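(* Let $x\ne0$, let $n,t\in\mathbb{N}$ with $1\le t\le n$, and let $\lambda\vdash n-t$. Then $$\operatorname{ind}_{n+1}\big(\mathscr{M}_{\mathbb{A}_n}(\lambda)\big)\cong\operatorname{res}_{n+1}\big(\mathscr{M}_{\mathbb{A}_{n+2}}(\lambda)\big)$$ as $\mathbb{A}_{n+1}$-modules, and there is an exact sequence of $\mathbb{A}_{n+1}$-modules $$0\longrightarrow\bigoplus_{\alpha\sqsubseteq\lambda}\mathscr{M}_{\mathbb{A}_{n+1}}(\alpha)\longrightarrow\operatorname{ind}_{n+1}\big(\mathscr{M}_{\mathbb{A}_n}(\lambda)\big)\longrightarrow\bigoplus_{\lambda\sqsubset\beta}\mathscr{M}_{\mathbb{A}_{n+1}}(\beta)\longrightarrow0.$$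
   Context: Let $K$ be a field, $x$ an element transcendental or algebraic over $K$, $F=K(x)$ of characteristic zero. $\mathscr{A}_n$ is the set of graphs on $\{1,\dots,n\}\cup\{1',\dots,n'\}$ (top row $1..n$, bottom row $1'..n'$) with all vertex degrees $0$ or $1$; degree-$0$ vertices carry loops; arcs within a row are horizontal, between rows vertical. Product: stack $\mathfrak a$ above $\mathfrak b$ identifying bottom vertex $i'$ of $\mathfrak a$ with top vertex $i$ of $\mathfrak b$; $\ell(\mathfrak a,\mathfrak b)$ = number of components lying entirely in the middle row; $G'(\mathfrak a,\mathfrak b)$ = diagram on the outer rows joining two vertices iff connected by a path; $\mathfrak a\mathfrak b=x^{\ell(\mathfrak a,\mathfrak b)}G'(\mathfrak a,\mathfrak b)$. This gives the algebra $\mathbb{A}_n$ with basis $\mathscr{A}_n$. $S_n$ = diagrams with $n$ vertical arcs; $S_{n-t}\subset S_n$ = permutations fixing $n-t+1,\dots,n$. $\epsilon_{n+1}\colon\mathbb{A}_n\to\mathbb{A}_{n+1}$ adds vertices $n+1,(n+1)'$ joined by a vertical arc; $\operatorname{res}_{n+1}$ denotes restriction of an $\mathbb{A}_{n+2}$-module to $\mathbb{A}_{n+1}$ along $\epsilon_{n+2}$, and $\operatorname{ind}_{n+1}(M)=\mathbb{A}_{n+1}\otimes_{\mathbb{A}_n}M$. $\mathbb{A}_n^m$ = span of diagrams with at most $m$ vertical arcs ($\mathbb{A}_n^{-1}=0$), $\mathbb{I}_n^m=\mathbb{A}_n^m/\mathbb{A}_n^{m-1}$. $\mathfrak u_{n,t}$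 = diagram with arcs $(i,i')$, $1\le i\le n-t$, other vertices isolated. For $\lambda\vdash n-t$ ($0\le t\le n$), Specht module $S^\lambda$ over $F$, and $x\ne0$: $\mathscr{M}_{\mathbb{A}_n}(\lambda)=\mathbb{I}_n^{n-t}\mathfrak u_{n,t}\otimes_{F[S_{n-t}]}S^\lambda$ with action $\mathfrak b\cdot(\mathfrak a\otimes v)=(\mathfrak b\mathfrak a)\otimes v$ (product in $\mathbb{I}_n^{n-t}$). $\alpha\sqsubset\lambda$: $\alpha$ obtained from $\lambda$ by removing one box; $\lambda\sqsubset\beta$: $\beta$ obtained from $\lambda$ by adding one box; $\alpha\sqsubseteq\lambda$: $\alpha\sqsubset\lambda$ or $\alpha=\lambda$. *)

theory Defs
  imports "HOL-Combinatorics.Permutations"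
begin

text \<open>A (left) module over a set of ring elements of type 'r, with scalars of type 'a:
  carrier, zero, addition, scalar multiplication, action.  For a right module the
  field mact r v is read as v.r.\<close>

record ('a, 'r, 'v) amod =
  mcarr :: "'v set"
  mzero :: 'v
  madd :: "'v \<Rightarrow> 'v \<Rightarrow> 'v"
  msmul :: "'a \<Rightarrow> 'v \<Rightarrow> 'v"
  mact :: "'r \<Rightarrow> 'v \<Rightarrow> 'v"

definition is_hom :: "'r set \<Rightarrow> ('a,'r,'v) amod \<Rightarrow> ('a,'r,'w) amod \<Rightarrow> ('v \<Rightarrow> 'w) \<Rightarrow> bool" where
  "is_hom R M N \<phi> \<longleftrightarrow>
     (\<forall>v\<in>mcarr M. \<phi> v \<in> mcarr N) \<and>
     (\<forall>u\<in>mcarr M. \<forall>v\<in>mcarr M. \<phi> (madd M u v) = madd N (\<phi> u) (\<phi> v)) \<and>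
     (\<forall>c. \<forall>v\<in>mcarr M. \<phi> (msmul M c v) = msmul N c (\<phi> v)) \<and>
     (\<forall>r\<in>R. \<forall>v\<in>mcarr M. \<phi> (mact M r v) = mact N r (\<phi> v))"

definition mod_iso :: "'r set \<Rightarrow> ('a,'r,'v) amod \<Rightarrow> ('a,'r,'w) amod \<Rightarrow> bool" where
  "mod_iso R M N \<longleftrightarrow> (\<exists>\<phi>. is_hom R M N \<phi> \<and> bij_betw \<phi> (mcarr M) (mcarr N))"

definition short_exact :: "'r set \<Rightarrow> ('a,'r,'u) amod \<Rightarrow> ('a,'r,'v) amod \<Rightarrow> ('a,'r,'w) amod
    \<Rightarrow> ('u \<Rightarrow> 'v) \<Rightarrow> ('v \<Rightarrow> 'w) \<Rightarrow> bool" where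
  "short_exact R A B C f g \<longleftrightarrow>
     is_hom R A B f \<and> is_hom R B C g \<and> inj_on f (mcarr A) \<and> g ` mcarr B = mcarr C \<and>
     f ` mcarr A = {b \<in> mcarr B. g b = mzero C}"

definition dsum :: "'i set \<Rightarrow> ('i \<Rightarrow> ('a,'r,'v) amod) \<Rightarrow> ('a,'r,'i \<Rightarrow> 'v) amod" where
  "dsum I M = \<lparr> mcarr = {f. (\<forall>i\<in>I. f i \<in> mcarr (M i)) \<and> (\<forall>i. i \<notin> I \<longrightarrow> f i = undefined)},
     mzero = (\<lambda>i. if i \<in> I then mzero (M i) else undefined),
     madd = (\<lambda>f g i. if i \<in> I then madd (M i) (f i) (g i) else undefined),
     msmul = (\<lambda>c f i. if i \<in> I then msmul (M i) c (f i) else undefined),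
     mact = (\<lambda>r f i. if i \<in> I then mact (M i) r (f i) else undefined) \<rparr>"

definition supp :: "('x \<Rightarrow> 'a::zero) \<Rightarrow> 'x set" where
  "supp f = {y. f y \<noteq> 0}"

definition freesp :: "'x set \<Rightarrow> ('x \<Rightarrow> 'a::zero) set" where
  "freesp X = {f. finite (supp f) \<and> supp f \<subseteq> X}"

definition dlt :: "'x \<Rightarrow> 'x \<Rightarrow> 'a::{zero,one}" where
  "dlt x = (\<lambda>y. if y = x then 1 else 0)"

definition lspan :: "('x \<Rightarrow> 'a::comm_ring_1) set \<Rightarrow> ('x \<Rightarrow> 'a) set" where
  "lspan S = {f. \<exists>T c. finite T \<and> T \<subseteq> S \<and> f = (\<lambda>y. \<Sum>v\<in>T. c v * v y)}"

text \<open>Relations defining M tensor_R N, M a right R-module, N a left R-module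
  (R given by a generating set of ring elements).\<close>
definition tens_rels :: "('a::comm_ring_1,'r,'m) amod \<Rightarrow> ('a,'r,'n) amod \<Rightarrow> 'r set \<Rightarrow> ('m \<times> 'n \<Rightarrow> 'a) set" where
  "tens_rels M N R =
     {(\<lambda>p. dlt (madd M m m', n) p - dlt (m, n) p - dlt (m', n) p) | m m' n.
         m \<in> mcarr M \<and> m' \<in> mcarr M \<and> n \<in> mcarr N}
   \<union> {(\<lambda>p. dlt (m, madd N n n') p - dlt (m, n) p - dlt (m, n') p) | m n n'.
         m \<in> mcarr M \<and> n \<in> mcarr N \<and> n' \<in> mcarr N}
   \<union> {(\<lambda>p. dlt (msmul M c m, n) p - c * dlt (m, n) p) | c m n. m \<in> mcarr M \<and> n \<in> mcarr N}
   \<union> {(\<lambda>p. dlt (m, msmul N c n) p - c * dlt (m, n) p) | c m n. m \<in> mcarr M \<and> n \<in> mcarr N}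
   \<union> {(\<lambda>p. dlt (mact M r m, n) p - dlt (m, mact N r n) p) | r m n.
         r \<in> R \<and> m \<in> mcarr M \<and> n \<in> mcarr N}"

definition cosetW :: "('x \<Rightarrow> 'a::ab_group_add) set \<Rightarrow> ('x \<Rightarrow> 'a) \<Rightarrow> ('x \<Rightarrow> 'a) set" where
  "cosetW W f = {g. (\<lambda>p. g p - f p) \<in> W}"

definition rep :: "'x set \<Rightarrow> 'x" where
  "rep X = (SOME f. f \<in> X)"

definition ften :: "('b \<Rightarrow> 'm \<Rightarrow> 'm) \<Rightarrow> 'b \<Rightarrow> ('m \<times> 'n \<Rightarrow> 'a::comm_ring_1) \<Rightarrow> ('m \<times> 'n \<Rightarrow> 'a)" where
  "ften L b f = (\<lambda>p. \<Sum>q\<in>supp f. if p = (L b (fst q), snd q) then f q else 0)"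

definition tensor :: "('a::comm_ring_1,'r,'m) amod \<Rightarrow> ('a,'r,'n) amod \<Rightarrow> 'r set \<Rightarrow> ('b \<Rightarrow> 'm \<Rightarrow> 'm)
    \<Rightarrow> ('a, 'b, ('m \<times> 'n \<Rightarrow> 'a) set) amod" where
  "tensor M N R L = (let W = lspan (tens_rels M N R) in
     \<lparr> mcarr = cosetW W ` freesp (mcarr M \<times> mcarr N),
       mzero = cosetW W (\<lambda>p. 0),
       madd = (\<lambda>X Y. cosetW W (\<lambda>p. rep X p + rep Y p)),
       msmul = (\<lambda>c X. cosetW W (\<lambda>p. c * rep X p)),
       mact = (\<lambda>b X. cosetW W (ften L b (rep X))) \<rparr>)"

datatype vtx = Top nat | Bot nat

type_synonym diag = "vtx set set"

definition verts :: "nat \<Rightarrow> vtx set" where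
  "verts n = Top ` {1..n} \<union> Bot ` {1..n}"

text \<open>Graphs on the 2n vertices with all degrees 0 or 1 (given by their edge sets;
  degree-0 vertices are the ones carrying loops).\<close>
definition Dg :: "nat \<Rightarrow> diag set" where
  "Dg n = {d. (\<forall>e\<in>d. \<exists>u v. u \<noteq> v \<and> e = {u, v} \<and> u \<in> verts n \<and> v \<in> verts n) \<and>
              (\<forall>e\<in>d. \<forall>e'\<in>d. e \<noteq> e' \<longrightarrow> e \<inter> e' = {})}"

definition nvert :: "diag \<Rightarrow> nat" where
  "nvert d = card {e \<in> d. \<exists>i j. e = {Top i, Bot j}}"

definition Dk :: "nat \<Rightarrow> nat \<Rightarrow> diag set" where
  "Dk n m = {d \<in> Dg n. nvert d = m}"

fun lft :: "nat \<Rightarrow> nat \<Rightarrow> vtx \<Rightarrow> nat \<times> nat" where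
  "lft r s (Top i) = (r, i)"
| "lft r s (Bot i) = (s, i)"

text \<open>Stacking a (rows 0,1) above b (rows 1,2).\<close>
definition gedges :: "diag \<Rightarrow> diag \<Rightarrow> (nat \<times> nat) set set" where
  "gedges a b = (\<lambda>e. lft 0 1 ` e) ` a \<union> (\<lambda>e. lft 1 2 ` e) ` b"

definition gconn :: "diag \<Rightarrow> diag \<Rightarrow> ((nat \<times> nat) \<times> (nat \<times> nat)) set" where
  "gconn a b = {(u, v). {u, v} \<in> gedges a b}\<^sup>*"

definition gverts :: "nat \<Rightarrow> (nat \<times> nat) set" where
  "gverts n = {0, 1, 2} \<times> {1..n}"

definition ell :: "nat \<Rightarrow> diag \<Rightarrow> diag \<Rightarrow> nat" where
  "ell n a b = card {C \<in> gverts n // gconn a b. C \<subseteq> {1} \<times> UNIV}"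

fun unl :: "nat \<times> nat \<Rightarrow> vtx" where
  "unl (r, i) = (if r = 0 then Top i else Bot i)"

definition outer :: "nat \<Rightarrow> (nat \<times> nat) set" where
  "outer n = {0, 2} \<times> {1..n}"

definition Gp :: "nat \<Rightarrow> diag \<Rightarrow> diag \<Rightarrow> diag" where
  "Gp n a b = {{unl u, unl v} | u v. u \<in> outer n \<and> v \<in> outer n \<and> u \<noteq> v \<and> (u, v) \<in> gconn a b}"

text \<open>Multiplication in A_n (elements: F-valued functions supported on Dg n).\<close>
definition amul :: "nat \<Rightarrow> 'a::field \<Rightarrow> (diag \<Rightarrow> 'a) \<Rightarrow> (diag \<Rightarrow> 'a) \<Rightarrow> (diag \<Rightarrow> 'a)" where
  "amul n x f g = (\<lambda>c. \<Sum>a\<in>Dg n. \<Sum>b\<in>Dg n. if Gp n a b = c then f a * g b * x ^ ell n a b else 0)"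

text \<open>The embedding eps_{k+1} : A_k -> A_{k+1} (add a vertical arc (k+1,(k+1)')).\<close>
definition eps :: "nat \<Rightarrow> (diag \<Rightarrow> 'a::zero) \<Rightarrow> (diag \<Rightarrow> 'a)" where
  "eps k f = (\<lambda>c. if c \<in> Dg (Suc k) \<and> {Top (Suc k), Bot (Suc k)} \<in> c
                   then f (c - {{Top (Suc k), Bot (Suc k)}}) else 0)"

text \<open>Multiplication in I_n^m = A_n^m / A_n^(m-1), realized on the basis of diagrams
  with exactly m vertical arcs.\<close>
definition imul :: "nat \<Rightarrow> nat \<Rightarrow> 'a::field \<Rightarrow> (diag \<Rightarrow> 'a) \<Rightarrow> (diag \<Rightarrow> 'a) \<Rightarrow> (diag \<Rightarrow> 'a)" where
  "imul n m x f g = (\<lambda>c. if c \<in> Dk n m then amul n x f g c else 0)"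

definition udiag :: "nat \<Rightarrow> nat \<Rightarrow> diag" where
  "udiag n t = {{Top i, Bot i} | i. 1 \<le> i \<and> i \<le> n - t}"

text \<open>Permutation diagram of sigma (in S_n): arcs (sigma i, i'); sigma |-> pd n sigma is
  multiplicative.\<close>
definition pd :: "nat \<Rightarrow> (nat \<Rightarrow> nat) \<Rightarrow> diag" where
  "pd n \<sigma> = {{Top (\<sigma> i), Bot i} | i. 1 \<le> i \<and> i \<le> n}"

definition is_partition :: "nat list \<Rightarrow> bool" where
  "is_partition l \<longleftrightarrow> sorted (rev l) \<and> (\<forall>k\<in>set l. 0 < k)"

definition cells :: "nat list \<Rightarrow> (nat \<times> nat) set" where
  "cells l = {(i, j). i < length l \<and> j < l ! i}"

definition tableau :: "nat list \<Rightarrow> (nat \<times> nat \<Rightarrow> nat) \<Rightarrow> bool" where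
  "tableau l T \<longleftrightarrow> bij_betw T (cells l) {1..sum_list l}"

text \<open>Tabloid {T}: records the row of each entry.\<close>
definition tabloid :: "nat list \<Rightarrow> (nat \<times> nat \<Rightarrow> nat) \<Rightarrow> nat \<Rightarrow> nat" where
  "tabloid l T = (\<lambda>k. if k \<in> T ` cells l then fst (THE c. c \<in> cells l \<and> T c = k) else 0)"

definition colgrp :: "nat list \<Rightarrow> (nat \<times> nat \<Rightarrow> nat) \<Rightarrow> (nat \<Rightarrow> nat) set" where
  "colgrp l T = {\<sigma>. \<sigma> permutes {1..sum_list l} \<and>
      (\<forall>c\<in>cells l. \<exists>c'\<in>cells l. T c' = \<sigma> (T c) \<and> snd c' = snd c)}"

definition polytab :: "nat list \<Rightarrow> (nat \<times> nat \<Rightarrow> nat) \<Rightarrow> ((nat \<Rightarrow> nat) \<Rightarrow> 'a::comm_ring_1)" where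
  "polytab l T = (\<lambda>s. \<Sum>\<sigma>\<in>colgrp l T. if s = tabloid l (\<sigma> \<circ> T) then of_int (sign \<sigma>) else 0)"

definition spechtmod :: "nat list \<Rightarrow> ('a::comm_ring_1, nat \<Rightarrow> nat, (nat \<Rightarrow> nat) \<Rightarrow> 'a) amod" where
  "spechtmod l = \<lparr> mcarr = lspan {polytab l T | T. tableau l T},
     mzero = (\<lambda>s. 0),
     madd = (\<lambda>u v s. u s + v s),
     msmul = (\<lambda>c u s. c * u s),
     mact = (\<lambda>\<sigma> u s. u (s \<circ> \<sigma>)) \<rparr>"

definition boxrem :: "nat list \<Rightarrow> nat list \<Rightarrow> bool" where
  "boxrem \<alpha> l \<longleftrightarrow> is_partition \<alpha> \<and> is_partition l \<and> (\<exists>c\<in>cells l. cells \<alpha> = cells l - {c})"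

definition boxrem_eq :: "nat list \<Rightarrow> nat list \<Rightarrow> bool" where
  "boxrem_eq \<alpha> l \<longleftrightarrow> boxrem \<alpha> l \<or> \<alpha> = l"

definition Ileft :: "nat \<Rightarrow> nat \<Rightarrow> 'a::field \<Rightarrow> ('a, nat \<Rightarrow> nat, diag \<Rightarrow> 'a) amod" where
  "Ileft n t x = \<lparr> mcarr = {imul n (n - t) x f (dlt (udiag n t)) | f. f \<in> freesp (Dk n (n - t))},
     mzero = (\<lambda>c. 0),
     madd = (\<lambda>f g c. f c + g c),
     msmul = (\<lambda>a f c. a * f c),
     mact = (\<lambda>\<sigma> f. imul n (n - t) x f (dlt (pd n \<sigma>))) \<rparr>"

definition Mmod :: "nat \<Rightarrow> 'a::field \<Rightarrow> nat list
    \<Rightarrow> ('a, diag \<Rightarrow> 'a, ((diag \<Rightarrow> 'a) \<times> ((nat \<Rightarrow> nat) \<Rightarrow> 'a) \<Rightarrow> 'a) set) amod" where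
  "Mmod n x l = tensor (Ileft n (n - sum_list l) x) (spechtmod l)
       {\<sigma>. \<sigma> permutes {1..sum_list l}} (\<lambda>b f. imul n (sum_list l) x b f)"

definition alg_right :: "nat \<Rightarrow> 'a::field \<Rightarrow> ('a, diag \<Rightarrow> 'a, diag \<Rightarrow> 'a) amod" where
  "alg_right n x = \<lparr> mcarr = freesp (Dg (Suc n)),
     mzero = (\<lambda>c. 0),
     madd = (\<lambda>f g c. f c + g c),
     msmul = (\<lambda>a f c. a * f c),
     mact = (\<lambda>r f. amul (Suc n) x f (eps n r)) \<rparr>"

definition indmod :: "nat \<Rightarrow> 'a::field \<Rightarrow> ('a, diag \<Rightarrow> 'a, 'v) amod
    \<Rightarrow> ('a, diag \<Rightarrow> 'a, ((diag \<Rightarrow> 'a) \<times> 'v \<Rightarrow> 'a) set) amod" where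
  "indmod n x M = tensor (alg_right n x) M (freesp (Dg n)) (\<lambda>b a. amul (Suc n) x b a)"

text \<open>res_{n+1}: restriction of an A_{n+2}-module to A_{n+1} along eps_{n+2}
  (resmod k restricts from A_{k+1} to A_k).\<close>
definition resmod :: "nat \<Rightarrow> ('a::zero, diag \<Rightarrow> 'a, 'v) amod \<Rightarrow> ('a, diag \<Rightarrow> 'a, 'v) amod" where
  "resmod k M = M\<lparr> mact := (\<lambda>b v. mact M (eps k b) v) \<rparr>"

end

theory Submission
  imports Defs "HOL-Library.Function_Algebras" "HOL.Vector_Spaces"
begin

text \<open>Call a diagram of \<open>m\<close> vertical arcs whose bottom ends are \<open>1', \<dots>, m'\<close> and whose other bottom vertices
  are isolated a half diagram. Since \<open>x \<noteq> 0\<close> and \<open>m!\<close> is invertible, the module of \<open>\<lambda>\<close> is the space of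
  \<open>S\<^sub>m\<close>-equivariant functions from half diagrams to the Specht module of \<open>\<lambda>\<close>. Bending the last bottom vertex
  of a diagram up to the top row turns a diagram of size \<open>n + 1\<close>, viewed modulo right multiplication by diagrams of size
  \<open>n\<close>, into a half diagram of size \<open>n + 2\<close>; this identifies induction with restriction.

  In a half diagram of size \<open>n + 2\<close> the last top vertex is isolated, or on a vertical arc, or on a horizontal arc.
  The functions that vanish on the diagrams of the third kind form a submodule. It splits by the first two kinds, which give
  \<open>\<lambda>\<close> itself and the restriction of its Specht module to \<open>S\<^sub>m\<^sub>-\<^sub>1\<close>. On the quotient, bending the horizontal arc down
  gives the Specht module induced to \<open>S\<^sub>m\<^sub>+\<^sub>1\<close>. The two branching rules come from describing the Specht module as
  the kernel of the operators that move one entry of a tabloid to the next row, filtering by the row of the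
  last point, and splitting the filtration by Maschke's theorem.\<close>


subsection \<open>Two-colourings of diagrams\<close>

text \<open>Products are defined through connectivity of a stacked graph, so every identity between
  products would need its own path chasing. Counting two-colourings compatible with the arcs turns a
  diagram into a 0/1 matrix and a closed component into a factor 2. Diagram and loop number can both
  be read off the matrix, so one matrix identity settles both. The tensor products are quotients of
  huge free spaces. They are reached only through an explicit map to functions and an explicit
  inverse modulo the relations, whose constants \<open>1/m!\<close> and powers of \<open>1/x\<close>
  come from averaging and from loops. Induction meets one real obstacle: a bent diagram may fail to
  be a half diagram, and then its tensor has to vanish. Moving a diagram that cuts one or two
  strands across the tensor sign shows this after division by \<open>x\<close>. Specht modules are
  spanned by polytabloids, which bounds the pieces of a filtration only from below. The kernel
  description bounds them from above, and an \<open>sl2\<close> argument removes the rows where no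
  box can be removed or added.\<close>

lemma alternating_walk_unique_end:
  fixes E :: "bool => 'v set set"
  assumes disj: "\<And>\<tau> e e'. e \<in> E \<tau> ==> e' \<in> E \<tau> ==> e ~= e' ==> e \<inter> e' = {}"
    and noloop: "\<And>\<tau> p. {p} \<notin> E \<tau>"
    and outer: "\<And>u \<tau>. u \<in> Out ==> u \<in> \<Union>(E \<tau>) ==> u \<notin> \<Union>(E (\<not> \<tau>))"
    and Ou: "u \<in> Out" "v \<in> Out" "w \<in> Out" and vw: "v ~= u" "w ~= u"
    and conn: "(u, v) \<in> {(p, q). {p, q} \<in> E True \<union> E False}\<^sup>*"
              "(u, w) \<in> {(p, q). {p, q} \<in> E True \<union> E False}\<^sup>*"
  shows "v = w"
proof -
  define R where "R = {(p, q). {p, q} \<in> E True \<union> E False}"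
  \<comment> \<open>A state is a vertex together with the colour of the last edge used, and the next
    edge must have the other colour. As each colour class is a matching, the walk is
    deterministic.\<close>
  define step where "step = {((p, \<tau>), (q, \<not> \<tau>)) | p q \<tau>. {p, q} \<in> E (\<not> \<tau>)}"
  have partner: "p = q" if "{c, p} \<in> E \<tau>" "{c, q} \<in> E \<tau>" for c p q \<tau>
  proof (cases "{c, p} = {c, q}")
    case True
    then show ?thesis by (auto simp: doubleton_eq_iff)
  next
    case False
    then show ?thesis using disj[OF that] by auto
  qed
  have sv: "single_valued step"
    unfolding single_valued_def step_def using partner by auto
  have R_E: "(p, q) \<in> R ==> \<exists>\<tau>. {p, q} \<in> E \<tau>" for p q
    unfolding R_def by auto
  have "u \<in> \<Union>(E True) \<or> u \<in> \<Union>(E False)"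
  proof -
    have "(u, v) \<in> R\<^sup>*" using conn(1) by (simp add: R_def)
    then obtain q where "(u, q) \<in> R" using vw(1) by (metis converse_rtranclE)
    then show ?thesis unfolding R_def by auto
  qed
  \<comment> \<open>\<open>b\<close> is the colour missing at \<open>u\<close>. The start pretends
    that \<open>u\<close> was entered along it, so the walk must leave by the only colour
    present.\<close>
  then obtain b where b: "u \<in> \<Union>(E (\<not> b))" by (metis (full_types))
  have b': "u \<notin> \<Union>(E b)" using outer[OF Ou(1) b] by simp
  \<comment> \<open>The walk misses nothing: an edge with the colour of the last step leads back to
    the previous state, which was already visited.\<close>
  have visited: "\<exists>\<tau>. ((u, b), (z, \<tau>)) \<in> step\<^sup>*" if "(u, z) \<in> R\<^sup>*" for z
    using that
  proof induction
    case base
    then show ?case by blast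
  next
    case (step y z)
    then obtain \<tau> where y: "((u, b), (y, \<tau>)) \<in> step\<^sup>*" by blast
    obtain \<rho> where \<rho>: "{y, z} \<in> E \<rho>" using R_E step.hyps by blast
    show ?case
    proof (cases "\<rho> = \<tau>")
      case False
      then have "\<rho> = (\<not> \<tau>)" by auto
      then have "((y, \<tau>), (z, \<not> \<tau>)) \<in> step" using \<rho> unfolding step_def by blast
      then show ?thesis using y by (meson rtrancl.rtrancl_into_rtrancl)
    next
      case True
      from y show ?thesis
      proof (cases rule: rtranclE)
        case base
        then show ?thesis using b' \<rho> True by auto
      next
        case (step s)
        then obtain p where s: "s = (p, \<not> \<tau>)" and e: "{p, y} \<in> E \<tau>"
          unfolding step_def by auto
        have "p = z" using partner[of y p \<tau> z] e \<rho> True by (simp add: insert_commute)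
        then show ?thesis using step s by blast
      qed
    qed
  qed
  \<comment> \<open>An outer vertex other than \<open>u\<close> carries only the colour by which it
    was entered, so it is a dead end, and a deterministic walk has at most one.\<close>
  have terminal: "\<exists>\<tau>. ((u, b), (z, \<tau>)) \<in> step\<^sup>* \<and> (\<forall>s. ((z, \<tau>), s) \<notin> step)"
    if z: "z \<in> Out" "z ~= u" "(u, z) \<in> R\<^sup>*" for z
  proof -
    obtain \<tau> where t: "((u, b), (z, \<tau>)) \<in> step\<^sup>*" using visited z(3) by blast
    have "z \<in> \<Union>(E \<tau>)"
      using t
    proof (cases rule: rtranclE)
      case base
      then show ?thesis using z by simp
    next
      case (step s)
      then show ?thesis unfolding step_def by auto
    qed
    then have "z \<notin> \<Union>(E (\<not> \<tau>))" using outer z by blast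
    then have "\<forall>s. ((z, \<tau>), s) \<notin> step" unfolding step_def by auto
    then show ?thesis using t by blast
  qed
  obtain \<tau> where t: "((u, b), (v, \<tau>)) \<in> step\<^sup>*" "\<forall>s. ((v, \<tau>), s) \<notin> step"
    using terminal[of v] Ou vw conn by (auto simp: R_def)
  obtain \<tau>' where t': "((u, b), (w, \<tau>')) \<in> step\<^sup>*" "\<forall>s. ((w, \<tau>'), s) \<notin> step"
    using terminal[of w] Ou vw conn by (auto simp: R_def)
  have "((v, \<tau>), (w, \<tau>')) \<in> step\<^sup>* \<or> ((w, \<tau>'), (v, \<tau>)) \<in> step\<^sup>*"
    using single_valued_confluent[OF sv t(1) t'(1)] .
  then show ?thesis using t(2) t'(2) by (metis converse_rtranclE prod.inject)
qed

lemma Dg_iff: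
  "d \<in> Dg n \<longleftrightarrow> (\<forall>e\<in>d. \<exists>u v. u ~= v \<and> e = {u, v} \<and> u \<in> verts n \<and> v \<in> verts n)
     \<and> (\<forall>e\<in>d. \<forall>e'\<in>d. e ~= e' --> e \<inter> e' = {})"
  unfolding Dg_def by simp

lemma Dg_edgeE:
  assumes "d \<in> Dg n" "e \<in> d"
  obtains u v where "e = {u, v}" "u ~= v" "u \<in> verts n" "v \<in> verts n"
proof -
  have "\<forall>e\<in>d. \<exists>u v. u ~= v \<and> e = {u, v} \<and> u \<in> verts n \<and> v \<in> verts n"
    using assms(1) unfolding Dg_iff by (rule conjunct1)
  from bspec[OF this assms(2)] show thesis using that by (elim exE conjE)
qed

lemma Dg_edgeD:
  assumes "d \<in> Dg n" "{u, v} \<in> d"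
  shows "u ~= v" "u \<in> verts n" "v \<in> verts n"
proof -
  obtain p q where "{u, v} = {p, q}" "p ~= q" "p \<in> verts n" "q \<in> verts n"
    using Dg_edgeE[OF assms] by metis
  then show "u ~= v" "u \<in> verts n" "v \<in> verts n" by (auto simp: doubleton_eq_iff)
qed

lemma Dg_disjoint: "d \<in> Dg n ==> e \<in> d ==> e' \<in> d ==> w \<in> e ==> w \<in> e' ==> e = e'"
  unfolding Dg_def by blast

lemma Dg_partner: "d \<in> Dg n ==> {u, v} \<in> d ==> {u, w} \<in> d ==> v = w"
  using Dg_disjoint[of d n "{u, v}" "{u, w}" u] by (auto simp: doubleton_eq_iff)

lemma DgI:
  assumes "\<And>e. e \<in> d ==> \<exists>u v. u ~= v \<and> e = {u, v} \<and> u \<in> verts n \<and> v \<in> verts n"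
    and "\<And>u v w. {u, v} \<in> d ==> {u, w} \<in> d ==> v = w"
  shows "d \<in> Dg n"
  unfolding Dg_iff
proof (intro conjI ballI impI)
  fix e e' assume e: "e \<in> d" "e' \<in> d" and ne: "e ~= e'"
  show "e \<inter> e' = {}"
  proof (rule ccontr)
    assume "e \<inter> e' ~= {}"
    then obtain w where w: "w \<in> e" "w \<in> e'" by blast
    obtain p where p: "e = {w, p}" using assms(1)[OF e(1)] w(1) by (metis insert_commute insertE singletonD)
    obtain q where q: "e' = {w, q}" using assms(1)[OF e(2)] w(2) by (metis insert_commute insertE singletonD)
    show False using assms(2)[of w p q] e ne unfolding p q by blast
  qed
qed (rule assms(1))

lemma finite_verts [simp]: "finite (verts n)"
  unfolding verts_def by simp

lemma finite_Dg [simp]: "finite (Dg n)"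
proof -
  have "Dg n <= Pow (Pow (verts n))" unfolding Dg_def by auto
  then show ?thesis by (rule finite_subset) simp
qed

lemma verts_iff [simp]:
  "Top i \<in> verts n \<longleftrightarrow> 1 <= i \<and> i <= n" "Bot i \<in> verts n \<longleftrightarrow> 1 <= i \<and> i <= n"
  unfolding verts_def by auto

lemma verts_mono: "n <= n' ==> verts n <= verts n'"
  unfolding verts_def by auto

lemma Dg_mono: "n <= n' ==> Dg n <= Dg n'"
proof
  fix d assume le: "n <= n'" and d: "d \<in> Dg n"
  show "d \<in> Dg n'"
  proof (rule DgI)
    fix e assume "e \<in> d"
    then obtain u v where "e = {u, v}" "u ~= v" "u \<in> verts n" "v \<in> verts n"
      by (rule Dg_edgeE[OF d])
    then show "\<exists>u v. u ~= v \<and> e = {u, v} \<and> u \<in> verts n' \<and> v \<in> verts n'"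
      using subsetD[OF verts_mono[OF le]] by metis
  qed (rule Dg_partner[OF d])
qed

definition vlab :: "nat set => nat set => vtx => bool" where
  "vlab A B v = (case v of Top i => i \<in> A | Bot i => i \<in> B)"

lemma vlab_simps [simp]: "vlab A B (Top i) \<longleftrightarrow> i \<in> A" "vlab A B (Bot i) \<longleftrightarrow> i \<in> B"
  by (auto simp: vlab_def)

definition dcompat :: "diag => nat set => nat set => bool" where
  "dcompat d A B \<longleftrightarrow> (\<forall>u v. {u, v} \<in> d --> vlab A B u = vlab A B v)"

lemma compat_empty [simp]: "dcompat d {} {}"
  unfolding dcompat_def vlab_def by (auto split: vtx.splits)

lemma compat_cong:
  assumes "d \<in> Dg n" "A \<inter> {1..n} = A' \<inter> {1..n}" "B \<inter> {1..n} = B' \<inter> {1..n}"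
  shows "dcompat d A B = dcompat d A' B'"
proof -
  have "vlab A B u = vlab A' B' u" if "u \<in> verts n" for u
    using assms that by (cases u) auto
  then show ?thesis unfolding dcompat_def using Dg_edgeD[OF assms(1)] by metis
qed

text \<open>Colouring exactly the component of \<open>u\<close> is compatible with \<open>d\<close>
  and separates \<open>u\<close> from every vertex that is not its partner. Hence the compatible
  colourings determine the diagram.\<close>

lemma edge_iff_compat:
  assumes d: "d \<in> Dg n" and uv: "u \<in> verts n" "v \<in> verts n" "u ~= v"
  shows "{u, v} \<in> d \<longleftrightarrow>
    (\<forall>A B. A <= {1..n} --> B <= {1..n} --> dcompat d A B --> vlab A B u = vlab A B v)"
proof
  assume "{u, v} \<in> d"
  then show "\<forall>A B. A <= {1..n} --> B <= {1..n} --> dcompat d A B --> vlab A B u = vlab A B v"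
    unfolding dcompat_def by blast
next
  assume all: "\<forall>A B. A <= {1..n} --> B <= {1..n} --> dcompat d A B --> vlab A B u = vlab A B v"
  define S where "S = {w. w = u \<or> {u, w} \<in> d}"
  define A where "A = {i. Top i \<in> S}"
  define B where "B = {i. Bot i \<in> S}"
  have lab: "vlab A B w \<longleftrightarrow> w \<in> S" for w by (cases w) (auto simp: A_def B_def)
  have sub: "S <= verts n" unfolding S_def using uv Dg_edgeD[OF d] by auto
  then have "A <= {1..n}" "B <= {1..n}" unfolding A_def B_def verts_def by auto
  moreover have "dcompat d A B"
    unfolding dcompat_def lab
  proof (intro allI impI)
    fix p q assume pq: "{p, q} \<in> d"
    then have qp: "{q, p} \<in> d" by (simp add: insert_commute)
    have "q \<in> S" if "p \<in> S" "{p, q} \<in> d" for p q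
      using that Dg_partner[OF d, of p q u] unfolding S_def by (auto simp: insert_commute)
    then show "p \<in> S \<longleftrightarrow> q \<in> S" using pq qp by blast
  qed
  ultimately have "v \<in> S" using all lab by (metis (mono_tags, lifting) S_def mem_Collect_eq)
  then show "{u, v} \<in> d" using uv unfolding S_def by auto
qed

lemma Dg_eqI:
  assumes "d \<in> Dg n" "d' \<in> Dg n"
    and "\<And>A B. A <= {1..n} ==> B <= {1..n} ==> dcompat d A B = dcompat d' A B"
  shows "d = d'"
proof -
  have "e \<in> d'" if h: "e \<in> d" "d \<in> Dg n" "d' \<in> Dg n"
    "\<And>A B. A <= {1..n} ==> B <= {1..n} ==> dcompat d A B = dcompat d' A B" for e d d'
  proof -
    obtain u v where e: "e = {u, v}" "u ~= v" "u \<in> verts n" "v \<in> verts n"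
      using Dg_edgeE[OF h(2,1)] by metis
    have "{u, v} \<in> d" using h(1) e(1) by simp
    then have "{u, v} \<in> d'"
      unfolding edge_iff_compat[OF h(2) e(3,4,2)] edge_iff_compat[OF h(3) e(3,4,2)]
      using h(4) by blast
    then show ?thesis using e(1) by simp
  qed
  then show ?thesis using assms by blast
qed

subsection \<open>The product of diagrams\<close>

lemma lft_inj: "r ~= s ==> inj (lft r s)"
proof (rule injI)
  fix u v assume "r ~= s" "lft r s u = lft r s v"
  then show "u = v" by (cases u; cases v) auto
qed

lemma gedges_cases:
  assumes a: "a \<in> Dg n" and b: "b \<in> Dg n" and e: "{p, q} \<in> gedges a b"
  shows "(\<exists>u v. p = lft 0 1 u \<and> q = lft 0 1 v \<and> {u, v} \<in> a) \<or>
         (\<exists>u v. p = lft 1 2 u \<and> q = lft 1 2 v \<and> {u, v} \<in> b)"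
proof -
  have *: "\<exists>u v. p = lft r s u \<and> q = lft r s v \<and> {u, v} \<in> d"
    if h: "{p, q} = lft r s ` e" "e \<in> d" "d \<in> Dg n" for r s e d
  proof -
    obtain u v where uv: "e = {u, v}" using Dg_edgeE[OF h(3,2)] by metis
    then have "{p, q} = {lft r s u, lft r s v}" using that by simp
    then have "p = lft r s u \<and> q = lft r s v \<or> p = lft r s v \<and> q = lft r s u"
      by (auto simp: doubleton_eq_iff)
    then show ?thesis using uv that(2) by (metis insert_commute)
  qed
  from e consider e' where "{p, q} = lft 0 1 ` e'" "e' \<in> a"
    | e' where "{p, q} = lft 1 2 ` e'" "e' \<in> b"
    unfolding gedges_def by auto
  then show ?thesis using *[OF _ _ a] *[OF _ _ b] by cases blast+
qed

lemma gedges_top: "{u, v} \<in> a ==> {lft 0 1 u, lft 0 1 v} \<in> gedges a b"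
  unfolding gedges_def by (metis (no_types, lifting) UnI1 image_empty image_eqI image_insert)

lemma gedges_bot: "{u, v} \<in> b ==> {lft 1 2 u, lft 1 2 v} \<in> gedges a b"
  unfolding gedges_def by (metis (no_types, lifting) UnI2 image_empty image_eqI image_insert)

lemma gconn_refl [simp]: "(u, u) \<in> gconn a b"
  unfolding gconn_def by simp

lemma gconn_sym: "(u, v) \<in> gconn a b ==> (v, u) \<in> gconn a b"
proof -
  have "sym {(u, v). {u, v} \<in> gedges a b}" by (auto simp: sym_def insert_commute)
  then have "sym (gconn a b)" unfolding gconn_def by (rule sym_rtrancl)
  then show "(u, v) \<in> gconn a b ==> (v, u) \<in> gconn a b" by (rule symD)
qed

lemma gconn_trans: "(u, v) \<in> gconn a b ==> (v, w) \<in> gconn a b ==> (u, w) \<in> gconn a b"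
  unfolding gconn_def by (rule rtrancl_trans)

lemma equiv_gconn: "equiv UNIV (gconn a b)"
proof -
  have r: "refl (gconn a b)" by (simp add: refl_on_def)
  have s: "sym (gconn a b)" by (rule symI) (rule gconn_sym)
  have t: "trans (gconn a b)" by (rule transI) (rule gconn_trans)
  show ?thesis unfolding equiv_def using r s t by simp
qed

lemma unl_inj: "u \<in> outer n ==> v \<in> outer n ==> unl u = unl v ==> u = v"
  unfolding outer_def by auto

text \<open>The arcs of \<open>a\<close> and those of \<open>b\<close> are the two colours of the
  walk: both can meet a vertex of the middle row, but an outer vertex belongs to only one of the two
  diagrams.\<close>

lemma gconn_outer_unique:
  assumes a: "a \<in> Dg n" and b: "b \<in> Dg n"
    and "u \<in> outer n" "v \<in> outer n" "w \<in> outer n" "v ~= u" "w ~= u"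
    and "(u, v) \<in> gconn a b" "(u, w) \<in> gconn a b"
  shows "v = w"
proof -
  define E where "E = (%\<tau>. if \<tau> then (%e. lft 0 1 ` e) ` a else (%e. lft 1 2 ` e) ` b)"
  have EU: "E True \<union> E False = gedges a b" unfolding E_def gedges_def by simp
  have conn: "(u, v) \<in> {(p, q). {p, q} \<in> E True \<union> E False}\<^sup>*"
             "(u, w) \<in> {(p, q). {p, q} \<in> E True \<union> E False}\<^sup>*"
    unfolding EU using assms(8,9) unfolding gconn_def .
  have disj: "lft r s ` e \<inter> lft r s ` e' = {}"
    if "d \<in> Dg n" "e \<in> d" "e' \<in> d" "lft r s ` e ~= lft r s ` e'" "r ~= s" for d e e' r s
  proof -
    have "e \<inter> e' = {}" using Dg_disjoint[OF that(1-3)] that(4) by blast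
    then show ?thesis using image_Int[OF lft_inj[OF that(5)], of e e'] by simp
  qed
  have nl: "{p} ~= lft r s ` e" if h: "d \<in> Dg n" "e \<in> d" "r ~= s" for d e r s p
  proof
    assume eq: "{p} = lft r s ` e"
    obtain u v where "e = {u, v}" "u ~= v" using Dg_edgeE[OF h(1,2)] by metis
    moreover from this have "lft r s u = p" "lft r s v = p" using eq by auto
    ultimately show False using injD[OF lft_inj[OF h(3)], of u v] by simp
  qed
  have l01: "fst (lft 0 1 u) \<in> {0, 1}" for u by (cases u) auto
  have l12: "fst (lft 1 2 u) \<in> {1, 2}" for u by (cases u) auto
  have ET: "fst z \<in> {0, 1}" if "z \<in> \<Union>(E True)" for z
    using that l01 unfolding E_def by (auto split: if_splits)
  have EF: "fst z \<in> {1, 2}" if "z \<in> \<Union>(E False)" for z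
    using that l12 unfolding E_def by (auto split: if_splits)
  show ?thesis
  proof (rule alternating_walk_unique_end[where E = E and Out = "outer n" and u = u])
    show "e \<inter> e' = {}" if h: "e \<in> E \<tau>" "e' \<in> E \<tau>" "e ~= e'" for \<tau> e e'
    proof (cases \<tau>)
      case True
      then obtain c c' where "e = lft 0 1 ` c" "e' = lft 0 1 ` c'" "c \<in> a" "c' \<in> a"
        using h unfolding E_def by auto
      then show ?thesis using disj[OF a, of c c' 0 1] that(3) by simp
    next
      case False
      then obtain c c' where "e = lft 1 2 ` c" "e' = lft 1 2 ` c'" "c \<in> b" "c' \<in> b"
        using h unfolding E_def by auto
      then show ?thesis using disj[OF b, of c c' 1 2] that(3) by simp
    qed
    show "{p} \<notin> E \<tau>" for \<tau> p using nl[OF a, of _ 0 1 p] nl[OF b, of _ 1 2 p] unfolding E_def by (cases \<tau>) auto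
    show "z \<notin> \<Union>(E (\<not> \<tau>))" if "z \<in> outer n" "z \<in> \<Union>(E \<tau>)" for z \<tau>
    proof
      assume "z \<in> \<Union>(E (\<not> \<tau>))"
      then have "z \<in> \<Union>(E True)" "z \<in> \<Union>(E False)" using that(2) by (cases \<tau>; simp)+
      then have "fst z = 1" using ET[of z] EF[of z] by auto
      then show False using that(1) by (auto simp: outer_def)
    qed
  qed (fact assms conn)+
qed

lemma Gp_edgeE:
  assumes "e \<in> Gp n a b"
  obtains u v where "e = {unl u, unl v}" "u \<in> outer n" "v \<in> outer n" "u ~= v" "(u, v) \<in> gconn a b"
proof -
  from assms have "\<exists>u v. e = {unl u, unl v} \<and> u \<in> outer n \<and> v \<in> outer n \<and> u ~= v \<and> (u, v) \<in> gconn a b"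
    unfolding Gp_def mem_Collect_eq .
  then show thesis using that by (elim exE conjE)
qed

lemma Gp_edge_iff:
  assumes "u \<in> outer n" "v \<in> outer n" "u ~= v"
  shows "{unl u, unl v} \<in> Gp n a b \<longleftrightarrow> (u, v) \<in> gconn a b"
proof
  assume "{unl u, unl v} \<in> Gp n a b"
  then obtain p q where pq: "{unl u, unl v} = {unl p, unl q}" "p \<in> outer n" "q \<in> outer n" "p ~= q" "(p, q) \<in> gconn a b"
    by (rule Gp_edgeE)
  from pq(1) have "u = p \<and> v = q \<or> u = q \<and> v = p"
    unfolding doubleton_eq_iff using unl_inj assms pq(2,3) by blast
  then show "(u, v) \<in> gconn a b" using pq(5) gconn_sym by blast
next
  assume "(u, v) \<in> gconn a b"
  then show "{unl u, unl v} \<in> Gp n a b" using assms unfolding Gp_def by blast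
qed

lemma unl_verts: "u \<in> outer n ==> unl u \<in> verts n"
  unfolding outer_def verts_def by auto

lemma Gp_Dg [simp]:
  assumes a: "a \<in> Dg n" and b: "b \<in> Dg n"
  shows "Gp n a b \<in> Dg n"
proof (rule DgI)
  fix e assume "e \<in> Gp n a b"
  then obtain u v where "e = {unl u, unl v}" "u \<in> outer n" "v \<in> outer n" "u ~= v" "(u, v) \<in> gconn a b"
    by (rule Gp_edgeE)
  then show "\<exists>u v. u ~= v \<and> e = {u, v} \<and> u \<in> verts n \<and> v \<in> verts n"
    using unl_inj unl_verts by blast
next
  fix u v w assume uv: "{u, v} \<in> Gp n a b" and uw: "{u, w} \<in> Gp n a b"
  have ex: "\<exists>p q. u = unl p \<and> v = unl q \<and> p \<in> outer n \<and> q \<in> outer n \<and> p ~= q \<and> (p, q) \<in> gconn a b"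
    if "{u, v} \<in> Gp n a b" for v
  proof -
    obtain p q where pq: "{u, v} = {unl p, unl q}" "p \<in> outer n" "q \<in> outer n" "p ~= q" "(p, q) \<in> gconn a b"
      using \<open>{u, v} \<in> Gp n a b\<close> by (rule Gp_edgeE)
    from pq(1) have "u = unl p \<and> v = unl q \<or> u = unl q \<and> v = unl p"
      unfolding doubleton_eq_iff .
    then show ?thesis using pq(2-5) gconn_sym[OF pq(5)] by blast
  qed
  obtain p q where pq: "u = unl p" "v = unl q" "p \<in> outer n" "q \<in> outer n" "p ~= q" "(p, q) \<in> gconn a b"
    using ex[OF uv] by blast
  obtain p' q' where pq': "u = unl p'" "w = unl q'" "p' \<in> outer n" "q' \<in> outer n" "p' ~= q'" "(p', q') \<in> gconn a b"
    using ex[OF uw] by blast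
  have "p = p'" using unl_inj pq pq' by metis
  then have "q = q'" using gconn_outer_unique[OF a b pq(3,4) pq'(4)] pq pq' by auto
  then show "v = w" using pq pq' by simp
qed

definition glab :: "nat set => nat set => nat set => nat \<times> nat => bool" where
  "glab A C B = (%(r, i). if r = 0 then i \<in> A else if r = 1 then i \<in> C else i \<in> B)"

lemma glab_lft [simp]: "glab A C B (lft 0 1 u) = vlab A C u" "glab A C B (lft 1 2 u) = vlab C B u"
  by (cases u; simp add: glab_def)+

text \<open>Two compatible colourings that agree on the middle row amount to one colouring of the
  stacked graph, constant on components. This links matrix products to connectivity.\<close>

lemma compat_iff_glab:
  assumes a: "a \<in> Dg n" and b: "b \<in> Dg n"
  shows "dcompat a A C \<and> dcompat b C B \<longleftrightarrow> (\<forall>u v. (u, v) \<in> gconn a b --> glab A C B u = glab A C B v)"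
proof
  assume co: "dcompat a A C \<and> dcompat b C B"
  show "\<forall>u v. (u, v) \<in> gconn a b --> glab A C B u = glab A C B v"
  proof (rule allI, rule allI, rule impI)
    fix u v assume "(u, v) \<in> gconn a b"
    then have "(u, v) \<in> {(u, v). {u, v} \<in> gedges a b}\<^sup>*" by (simp add: gconn_def)
    then show "glab A C B u = glab A C B v"
    proof induction
      case (step y z)
      then have "{y, z} \<in> gedges a b" by simp
      from gedges_cases[OF a b this] have "glab A C B y = glab A C B z"
        using co unfolding dcompat_def by (elim disjE exE conjE) (metis glab_lft)+
      then show ?case using step by simp
    qed simp
  qed
next
  assume all: "\<forall>u v. (u, v) \<in> gconn a b --> glab A C B u = glab A C B v"
  have conn: "glab A C B u = glab A C B v" if "{u, v} \<in> gedges a b" for u v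
    using that all unfolding gconn_def by blast
  have "vlab A C u = vlab A C v" if "{u, v} \<in> a" for u v
    using conn[OF gedges_top[OF that]] unfolding glab_lft .
  moreover have "vlab C B u = vlab C B v" if "{u, v} \<in> b" for u v
    using conn[OF gedges_bot[OF that]] unfolding glab_lft .
  ultimately show "dcompat a A C \<and> dcompat b C B"
    unfolding dcompat_def by blast
qed

lemma gedges_gverts:
  assumes a: "a \<in> Dg n" and b: "b \<in> Dg n" and "{p, q} \<in> gedges a b"
  shows "p \<in> gverts n" "q \<in> gverts n"
proof -
  have l: "lft 0 1 u \<in> gverts n" "lft 1 2 u \<in> gverts n" if "u \<in> verts n" for u
    using that by (cases u; auto simp: gverts_def)+
  have "p \<in> gverts n \<and> q \<in> gverts n"
    using gedges_cases[OF assms]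
  proof (elim disjE exE conjE)
    fix u v assume "p = lft 0 1 u" "q = lft 0 1 v" "{u, v} \<in> a"
    then show ?thesis using l(1)[OF Dg_edgeD(2)[OF a, of u v]] l(1)[OF Dg_edgeD(3)[OF a, of u v]] by simp
  next
    fix u v assume "p = lft 1 2 u" "q = lft 1 2 v" "{u, v} \<in> b"
    then show ?thesis using l(2)[OF Dg_edgeD(2)[OF b, of u v]] l(2)[OF Dg_edgeD(3)[OF b, of u v]] by simp
  qed
  then show "p \<in> gverts n" "q \<in> gverts n" by blast+
qed

lemma gconn_gverts:
  assumes a: "a \<in> Dg n" and b: "b \<in> Dg n" and "(u, v) \<in> gconn a b" "u \<in> gverts n"
  shows "v \<in> gverts n"
proof -
  have "(u, v) \<in> {(u, v). {u, v} \<in> gedges a b}\<^sup>*" using assms by (simp add: gconn_def)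
  then show ?thesis
    by induction (use assms gedges_gverts[OF a b] in auto)
qed

text \<open>A diagram is a matrix indexed by two-colourings of its rows; stacking is then matrix
  multiplication with loop parameter 2, which turns identities between products of diagrams
  into counting.\<close>

theorem card_middle_colourings:
  assumes a: "a \<in> Dg n" and b: "b \<in> Dg n" 
  shows "card {C. C <= {1..n} \<and> dcompat a A C \<and> dcompat b C B}
     = (if dcompat (Gp n a b) (A \<inter> {1..n}) (B \<inter> {1..n}) then 2 ^ ell n a b else 0)"
proof -
  define Ok where "Ok = {C. C <= {1..n} \<and> dcompat a A C \<and> dcompat b C B}"
  define K where "K = gconn a b"
  define Mid where "Mid = {Q \<in> gverts n // K. Q <= {1} \<times> UNIV}"
  have equivK: "equiv UNIV K" unfolding K_def by (rule equiv_gconn)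
  have labA: "glab A C B u = vlab (A \<inter> {1..n}) (B \<inter> {1..n}) (unl u)" if "u \<in> outer n" for u C
    using that unfolding outer_def glab_def by auto
  have Gpc: "dcompat (Gp n a b) (A \<inter> {1..n}) (B \<inter> {1..n}) \<longleftrightarrow>
      (\<forall>u v. u \<in> outer n --> v \<in> outer n --> (u, v) \<in> K --> glab A {} B u = glab A {} B v)"
    (is "?l \<longleftrightarrow> ?r")
  proof
    assume ?l
    then show ?r
      unfolding dcompat_def K_def using Gp_edge_iff labA by metis
  next
    assume r: ?r
    show ?l
      unfolding dcompat_def
    proof (intro allI impI)
      fix p q assume "{p, q} \<in> Gp n a b"
      then obtain u v where uv: "{p, q} = {unl u, unl v}" "u \<in> outer n" "v \<in> outer n" "u ~= v" "(u, v) \<in> K"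
        unfolding K_def by (rule Gp_edgeE)
      then have "vlab (A \<inter> {1..n}) (B \<inter> {1..n}) (unl u) = vlab (A \<inter> {1..n}) (B \<inter> {1..n}) (unl v)"
        using r labA by metis
      then show "vlab (A \<inter> {1..n}) (B \<inter> {1..n}) p = vlab (A \<inter> {1..n}) (B \<inter> {1..n}) q"
        using uv(1) by (metis doubleton_eq_iff)
    qed
  qed
  have outglab: "glab A C B u = glab A {} B u" if "u \<in> outer n" for u C
    using that labA by metis
  have OkD: "glab A C B u = glab A C B v" if "C \<in> Ok" "(u, v) \<in> K" for C u v
    using that compat_iff_glab[OF a b] unfolding Ok_def K_def by blast
  show ?thesis
  proof (cases "dcompat (Gp n a b) (A \<inter> {1..n}) (B \<inter> {1..n})")
    case False
    then obtain u v where "u \<in> outer n" "v \<in> outer n" "(u, v) \<in> K" "glab A {} B u ~= glab A {} B v"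
      using Gpc by blast
    then have "Ok = {}" using OkD outglab by blast
    then show ?thesis using False by (simp add: Ok_def)
  next
    case True
    note good = True[unfolded Gpc, rule_format]
    \<comment> \<open>On a component that reaches an outer row the middle colours are forced; on a
      component inside the middle row they are a free choice. \<open>F\<close> records the middle
      components chosen and \<open>G\<close> rebuilds the colouring, whence
      \<open>2 ^ ell n a b\<close>.\<close>
    define F where "F = (%C. {Q \<in> Mid. \<exists>i\<in>C. (1, i) \<in> Q})"
    define G where "G = (%S. {i\<in>{1..n}. K `` {(1, i)} \<in> S \<or> (\<exists>u\<in>outer n. ((1, i), u) \<in> K \<and> glab A {} B u)})"
    have Mid_class: "Q = K `` {z}" if h: "Q \<in> Mid" "z \<in> Q" for Q z
    proof -
      obtain y where "Q = K `` {y}" using h unfolding Mid_def quotient_def by auto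
      then show ?thesis using that(2) equiv_class_eq[OF equivK] by auto
    qed
    have Mid_not_outer: "u \<notin> outer n" if "Q \<in> Mid" "z \<in> Q" "(z, u) \<in> K" for Q z u
    proof -
      have "u \<in> Q" using Mid_class[OF that(1,2)] that(3) by auto
      then show ?thesis using that(1) unfolding Mid_def outer_def by auto
    qed
    have MidI: "K `` {z} \<in> Mid" if "z \<in> gverts n" "\<And>u. u \<in> outer n ==> (z, u) \<notin> K" for z
    proof -
      have "y \<in> {1} \<times> UNIV" if "y \<in> K `` {z}" for y
      proof -
        have "y \<in> gverts n" using gconn_gverts[OF a b] that \<open>z \<in> gverts n\<close> unfolding K_def by auto
        moreover have "y \<notin> outer n" using \<open>\<And>u. u \<in> outer n ==> (z, u) \<notin> K\<close>[of y] that by blast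
        ultimately show ?thesis unfolding gverts_def outer_def by auto
      qed
      then show ?thesis using that unfolding Mid_def quotient_def by auto
    qed
    have vm: "(1, i) \<in> gverts n" if "i \<in> {1..n}" for i using that by (auto simp: gverts_def)
    have Midi: "\<exists>i\<in>{1..n}. Q = K `` {(1, i)}" if h: "Q \<in> Mid" for Q
    proof -
      obtain y where y: "y \<in> gverts n" "Q = K `` {y}" using h unfolding Mid_def quotient_def by auto
      then have "y \<in> Q" by (simp add: K_def)
      then have "fst y = 1" using that unfolding Mid_def by auto
      then have "y = (1, snd y)" "snd y \<in> {1..n}" using y unfolding gverts_def by auto
      then show ?thesis using y by metis
    qed
    have GOk: "G S \<in> Ok" if "S <= Mid" for S
    proof -
      \<comment> \<open>\<open>g\<close> extends the middle colouring to all three rows as a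
        function of the component alone.\<close>
      define g where "g = (%z. K `` {z} \<in> S \<or> (\<exists>u\<in>outer n. (z, u) \<in> K \<and> glab A {} B u))"
      have gK: "g y = g z" if "(y, z) \<in> K" for y z
      proof -
        have "K `` {y} = K `` {z}" using equiv_class_eq[OF equivK that] .
        then show ?thesis unfolding g_def by (metis (no_types, lifting) Image_singleton_iff)
      qed
      have gl: "glab A (G S) B z = g z" if h: "z \<in> gverts n" for z
      proof (cases "z \<in> outer n")
        case True
        have "K `` {z} \<notin> S"
        proof
          assume "K `` {z} \<in> S"
          then have "K `` {z} \<in> Mid" using \<open>S <= Mid\<close> by blast
          moreover have "z \<in> K `` {z}" unfolding K_def by simp
          ultimately show False using Mid_not_outer[of "K `` {z}" z z] True by (simp add: K_def)
        qed
        moreover have "(\<exists>u\<in>outer n. (z, u) \<in> K \<and> glab A {} B u) = glab A {} B z"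
          using good[OF True] True by (metis K_def gconn_refl)
        ultimately show ?thesis using outglab[OF True] unfolding g_def by simp
      next
        case False
        then obtain i where "z = (1, i)" "i \<in> {1..n}" using h unfolding gverts_def outer_def by auto
        then show ?thesis unfolding g_def glab_def G_def by auto
      qed
      have "glab A (G S) B u = glab A (G S) B v" if uv: "(u, v) \<in> K" for u v
      proof (cases "u \<in> gverts n")
        case True
        then have "v \<in> gverts n" using gconn_gverts[OF a b] uv unfolding K_def by blast
        then show ?thesis using True gl gK uv by metis
      next
        case False
        have "u = v"
        proof (rule ccontr)
          assume "u ~= v"
          then obtain w where "{u, w} \<in> gedges a b"
            using uv unfolding K_def gconn_def by (metis (mono_tags, lifting) case_prodD converse_rtranclE mem_Collect_eq)
          then show False using gedges_gverts[OF a b] False by blast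
        qed
        then show ?thesis by simp
      qed
      then have "dcompat a A (G S) \<and> dcompat b (G S) B"
        using compat_iff_glab[OF a b, of A "G S" B] unfolding K_def by blast
      moreover have "G S <= {1..n}" unfolding G_def by auto
      ultimately show ?thesis unfolding Ok_def by blast
    qed
    have "bij_betw F Ok (Pow Mid)"
    proof (rule bij_betw_byWitness[where f' = G])
      show "\<forall>C\<in>Ok. G (F C) = C"
      proof
        fix C assume C: "C \<in> Ok"
        have Csub: "C <= {1..n}" using C unfolding Ok_def by blast
        have "i \<in> G (F C) \<longleftrightarrow> i \<in> C" if i: "i \<in> {1..n}" for i
        proof (cases "\<exists>u\<in>outer n. ((1, i), u) \<in> K")
          case True
          then obtain u where u: "u \<in> outer n" "((1, i), u) \<in> K" by blast
          have "K `` {(1, i)} \<notin> F C" using Mid_not_outer[of "K `` {(1, i)}" "(1, i)" u] u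
            unfolding F_def by (auto simp: K_def)
          then have "i \<in> G (F C) \<longleftrightarrow> (\<exists>u\<in>outer n. ((1, i), u) \<in> K \<and> glab A {} B u)"
            using i unfolding G_def by simp
          moreover have "glab A {} B v \<longleftrightarrow> i \<in> C" if "v \<in> outer n" "((1, i), v) \<in> K" for v
            using OkD[OF C that(2)] outglab[OF that(1), of C] by (simp add: glab_def)
          ultimately show ?thesis using u by blast
        next
          case False
          then have M: "K `` {(1, i)} \<in> Mid" using MidI vm[OF i] by blast
          have "(\<exists>j\<in>C. (1, j) \<in> K `` {(1, i)}) \<longleftrightarrow> i \<in> C"
          proof
            assume "\<exists>j\<in>C. (1, j) \<in> K `` {(1, i)}"
            then obtain j where "j \<in> C" "((1, i), (1, j)) \<in> K" by blast
            then show "i \<in> C" using OkD[OF C] by (fastforce simp: glab_def)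
          next
            assume "i \<in> C"
            then show "\<exists>j\<in>C. (1, j) \<in> K `` {(1, i)}" by (intro bexI[of _ i]) (simp_all add: K_def)
          qed
          then show ?thesis using False i M unfolding G_def F_def by auto
        qed
        moreover have "G (F C) <= {1..n}" unfolding G_def by auto
        ultimately show "G (F C) = C" using Csub by blast
      qed
      show "\<forall>S\<in>Pow Mid. F (G S) = S"
      proof
        fix S assume S: "S \<in> Pow Mid"
        have "Q \<in> F (G S) \<longleftrightarrow> Q \<in> S" if Q: "Q \<in> Mid" for Q
        proof
          assume "Q \<in> F (G S)"
          then obtain i where i: "i \<in> G S" "(1, i) \<in> Q" unfolding F_def by blast
          have "K `` {(1, i)} \<in> S" using i Mid_not_outer[OF Q i(2)] unfolding G_def by blast
          then show "Q \<in> S" using Mid_class[OF Q i(2)] by simp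
        next
          assume "Q \<in> S"
          obtain i where i: "i \<in> {1..n}" "Q = K `` {(1, i)}" using Midi[OF Q] by blast
          then have "i \<in> G S" using \<open>Q \<in> S\<close> unfolding G_def by auto
          moreover have "(1, i) \<in> Q" using i by (simp add: K_def)
          ultimately show "Q \<in> F (G S)" using Q unfolding F_def by blast
        qed
        moreover have "F (G S) <= Mid" unfolding F_def by auto
        ultimately show "F (G S) = S" using S by blast
      qed
      show "F ` Ok <= Pow Mid" unfolding F_def by auto
      show "G ` Pow Mid <= Ok" using GOk by auto
    qed
    then have "card Ok = card (Pow Mid)" by (rule bij_betw_same_card)
    also have "... = 2 ^ card Mid"
    proof (rule card_Pow)
      have "finite (gverts n // K)" unfolding quotient_def gverts_def by auto
      then show "finite Mid" unfolding Mid_def by simp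
    qed
    finally show ?thesis using True by (simp add: Ok_def ell_def Mid_def K_def)
  qed
qed

declare One_nat_def [simp del]

definition cmat :: "diag => nat set => nat set => nat" where
  "cmat d A B = of_bool (dcompat d A B)"

lemma cmat_empty [simp]: "cmat d {} {} = 1"
  by (simp add: cmat_def)

lemma cmat_cong:
  assumes "d \<in> Dg n" "A \<inter> {1..n} = A' \<inter> {1..n}" "B \<inter> {1..n} = B' \<inter> {1..n}"
  shows "cmat d A B = cmat d A' B'"
  using compat_cong[OF assms] by (simp add: cmat_def)

lemma cmat_mult:
  assumes a: "a \<in> Dg n" and b: "b \<in> Dg n" and AB: "A <= {1..n}" "B <= {1..n}"
  shows "(\<Sum>C\<in>Pow {1..n}. cmat a A C * cmat b C B) = 2 ^ ell n a b * cmat (Gp n a b) A B"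
proof -
  have "A \<inter> {1..n} = A" "B \<inter> {1..n} = B" using AB by auto
  then have "card {C. C <= {1..n} \<and> dcompat a A C \<and> dcompat b C B} = 2 ^ ell n a b * cmat (Gp n a b) A B"
    using card_middle_colourings[OF a b, of A B] by (simp add: cmat_def)
  moreover have "(\<Sum>C\<in>Pow {1..n}. cmat a A C * cmat b C B)
      = (\<Sum>C\<in>Pow {1..n}. if dcompat a A C \<and> dcompat b C B then 1 else 0)"
    by (intro sum.cong refl) (simp add: cmat_def)
  moreover have "... = card {C \<in> Pow {1..n}. dcompat a A C \<and> dcompat b C B}"
    by (subst sum.inter_filter[symmetric]) simp_all
  ultimately show ?thesis by simp
qed

text \<open>The entry at the two empty colourings is always 1, so the scalar \<open>2 ^ k\<close> is
  visible there. After cancelling it the matrices, and so the diagrams, agree.\<close>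

lemma cmat_scaled_eqD:
  assumes c: "c \<in> Dg n" "c' \<in> Dg n"
    and eq: "\<And>A B. A <= {1..n} ==> B <= {1..n} ==> 2 ^ k * cmat c A B = 2 ^ k' * cmat c' A B"
  shows "c = c' \<and> k = k'"
proof -
  have "(2::nat) ^ k = 2 ^ k'" using eq[of "{}" "{}"] by simp
  then have k: "k = k'" by simp
  have "c = c'"
  proof (rule Dg_eqI[OF c])
    fix A B assume "A <= {1..n}" "B <= {1..n}"
    then have "cmat c A B = cmat c' A B" using eq k by simp
    then show "dcompat c A B = dcompat c' A B" by (simp add: cmat_def of_bool_def split: if_splits)
  qed
  then show ?thesis using k by simp
qed

text \<open>The tool for nearly all product computations below: a guess for the product and for the
  loop number is confirmed by one matrix identity.\<close>

lemma Gp_ell_eqI: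
  assumes "a \<in> Dg n" "b \<in> Dg n" "c \<in> Dg n"
    and "\<And>A B. A <= {1..n} ==> B <= {1..n} ==>
           (\<Sum>C\<in>Pow {1..n}. cmat a A C * cmat b C B) = 2 ^ k * cmat c A B"
  shows "Gp n a b = c \<and> ell n a b = k"
  using assms cmat_mult[OF assms(1,2)] by (intro cmat_scaled_eqD) auto

text \<open>Associativity of matrix multiplication. Comparing the scalars gives the second claim,
  which makes \<open>x ^ ell\<close> consistent for every \<open>x\<close> and not only for the
  value 2 used in counting.\<close>

theorem Gp_assoc:
  assumes a: "a \<in> Dg n" and b: "b \<in> Dg n" and c: "c \<in> Dg n"
  shows "Gp n (Gp n a b) c = Gp n a (Gp n b c) \<and>
    ell n a b + ell n (Gp n a b) c = ell n b c + ell n a (Gp n b c)"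
proof (rule cmat_scaled_eqD)
  fix A B assume A: "A <= {1..n}" and B: "B <= {1..n}"
  have "2 ^ (ell n a b + ell n (Gp n a b) c) * cmat (Gp n (Gp n a b) c) A B
      = 2 ^ ell n a b * (\<Sum>D\<in>Pow {1..n}. cmat (Gp n a b) A D * cmat c D B)"
    using cmat_mult[OF Gp_Dg[OF a b] c A B] by (simp add: power_add)
  also have "... = (\<Sum>D\<in>Pow {1..n}. (\<Sum>C\<in>Pow {1..n}. cmat a A C * cmat b C D) * cmat c D B)"
    unfolding sum_distrib_left
    by (intro sum.cong refl) (use cmat_mult[OF a b A] in \<open>auto simp: mult.assoc\<close>)
  also have "... = (\<Sum>C\<in>Pow {1..n}. cmat a A C * (\<Sum>D\<in>Pow {1..n}. cmat b C D * cmat c D B))"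
    unfolding sum_distrib_left sum_distrib_right by (subst sum.swap) (simp add: mult.assoc)
  also have "... = 2 ^ ell n b c * (\<Sum>C\<in>Pow {1..n}. cmat a A C * cmat (Gp n b c) C B)"
  proof -
    have "(\<Sum>C\<in>Pow {1..n}. cmat a A C * (\<Sum>D\<in>Pow {1..n}. cmat b C D * cmat c D B))
        = (\<Sum>C\<in>Pow {1..n}. 2 ^ ell n b c * (cmat a A C * cmat (Gp n b c) C B))"
      by (rule sum.cong[OF refl]) (simp add: cmat_mult[OF b c _ B])
    then show ?thesis by (simp only: sum_distrib_left)
  qed
  also have "... = 2 ^ (ell n b c + ell n a (Gp n b c)) * cmat (Gp n a (Gp n b c)) A B"
    using cmat_mult[OF a Gp_Dg[OF b c] A B] by (simp add: power_add)
  finally show "2 ^ (ell n a b + ell n (Gp n a b) c) * cmat (Gp n (Gp n a b) c) A B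
      = 2 ^ (ell n b c + ell n a (Gp n b c)) * cmat (Gp n a (Gp n b c)) A B" .
qed (use assms in simp_all)

subsection \<open>Relabelling vertices\<close>

definition vmap :: "(vtx => vtx) => diag => diag" where
  "vmap f d = (%e. f ` e) ` d"

lemma vmap_vmap: "vmap f (vmap g d) = vmap (f \<circ> g) d"
  unfolding vmap_def by (simp add: image_image image_comp)

lemma vmap_edgeI: "{u, v} \<in> d ==> {f u, f v} \<in> vmap f d"
proof -
  assume "{u, v} \<in> d"
  then have "f ` {u, v} \<in> vmap f d" unfolding vmap_def by (rule imageI)
  then show ?thesis by simp
qed

lemma vmap_cong:
  assumes d: "d \<in> Dg n" and "\<And>v. v \<in> verts n ==> (\<exists>w. {v, w} \<in> d) ==> f v = g v"
  shows "vmap f d = vmap g d"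
proof -
  have "f ` e = g ` e" if e: "e \<in> d" for e
  proof -
    obtain u v where uv: "e = {u, v}" "u ~= v" "u \<in> verts n" "v \<in> verts n" by (rule Dg_edgeE[OF d e])
    then have h: "{u, v} \<in> d" "{v, u} \<in> d" using e by (simp_all add: insert_commute)
    have "\<exists>w. {u, w} \<in> d" "\<exists>w. {v, w} \<in> d" using h by (auto intro: exI)
    then have "f u = g u" "f v = g v" using assms(2) uv(3,4) by simp_all
    then show ?thesis using uv by simp
  qed
  then show ?thesis unfolding vmap_def by (rule image_cong[OF refl])
qed

lemma vmap_id:
  assumes d: "d \<in> Dg n" and "\<And>v. v \<in> verts n ==> (\<exists>w. {v, w} \<in> d) ==> f v = v"
  shows "vmap f d = d"
  using vmap_cong[OF d, of f id] assms(2) by (simp add: vmap_def)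

lemma vmap_edgeE:
  assumes d: "d \<in> Dg n" and e: "{u, v} \<in> vmap f d"
  obtains p q where "{p, q} \<in> d" "u = f p" "v = f q"
proof -
  obtain e' where e': "e' \<in> d" "{u, v} = f ` e'" using e unfolding vmap_def by auto
  obtain p q where pq: "e' = {p, q}" "p ~= q" "p \<in> verts n" "q \<in> verts n" by (rule Dg_edgeE[OF d e'(1)])
  have "{u, v} = {f p, f q}" using e' pq by simp
  then have "u = f p \<and> v = f q \<or> u = f q \<and> v = f p" unfolding doubleton_eq_iff .
  moreover have "{p, q} \<in> d" "{q, p} \<in> d" using e'(1) pq(1) by (simp_all add: insert_commute)
  ultimately show thesis using that by metis
qed

text \<open>Injectivity is required only on vertices that carry an arc: a used vertex may be sent
  onto an isolated one. Unbending relies on this.\<close>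

lemma vmap_Dg:
  assumes d: "d \<in> Dg n" and inj: "inj_on f {v \<in> verts n. \<exists>w. {v, w} \<in> d}"
    and sub: "\<And>v. v \<in> verts n ==> \<exists>w. {v, w} \<in> d ==> f v \<in> verts n'"
  shows "vmap f d \<in> Dg n'"
proof (rule DgI)
  fix e assume "e \<in> vmap f d"
  then obtain e' where e': "e' \<in> d" "e = f ` e'" unfolding vmap_def by auto
  obtain p q where pq: "e' = {p, q}" "p ~= q" "p \<in> verts n" "q \<in> verts n" by (rule Dg_edgeE[OF d e'(1)])
  have used: "\<exists>w. {p, w} \<in> d" "\<exists>w. {q, w} \<in> d" using e' pq insert_commute by metis+
  have "f p ~= f q" using pq used inj_onD[OF inj, of p q] by auto
  then have "f p ~= f q \<and> e = {f p, f q} \<and> f p \<in> verts n' \<and> f q \<in> verts n'"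
    using sub pq e' used by simp
  then show "\<exists>u v. u ~= v \<and> e = {u, v} \<and> u \<in> verts n' \<and> v \<in> verts n'" by blast
next
  fix u v w assume uv: "{u, v} \<in> vmap f d" and uw: "{u, w} \<in> vmap f d"
  obtain p q where pq: "{p, q} \<in> d" "u = f p" "v = f q" by (rule vmap_edgeE[OF d uv])
  obtain p' q' where pq': "{p', q'} \<in> d" "u = f p'" "w = f q'" by (rule vmap_edgeE[OF d uw])
  have "p = p'" using pq pq' Dg_edgeD[OF d pq(1)] Dg_edgeD[OF d pq'(1)] inj_onD[OF inj, of p p'] by auto
  then have "q = q'" using Dg_partner[OF d] pq pq' by blast
  then show "v = w" using pq pq' by simp
qed

lemma compat_vmap:
  assumes d: "d \<in> Dg n"
  shows "dcompat (vmap f d) A B \<longleftrightarrow> (\<forall>u v. {u, v} \<in> d --> vlab A B (f u) = vlab A B (f v))"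
proof
  assume "dcompat (vmap f d) A B"
  then show "\<forall>u v. {u, v} \<in> d --> vlab A B (f u) = vlab A B (f v)"
    unfolding dcompat_def using vmap_edgeI by blast
next
  assume r: "\<forall>u v. {u, v} \<in> d --> vlab A B (f u) = vlab A B (f v)"
  show "dcompat (vmap f d) A B"
    unfolding dcompat_def
  proof (rule allI, rule allI, rule impI)
    fix u v assume "{u, v} \<in> vmap f d"
    then show "vlab A B u = vlab A B v" by (rule vmap_edgeE[OF d]) (use r in simp)
  qed
qed

lemma compat_vmap_lab:
  assumes d: "d \<in> Dg n"
    and "\<And>v. v \<in> verts n ==> \<exists>w. {v, w} \<in> d ==> vlab A B (f v) = vlab A' B' v"
  shows "dcompat (vmap f d) A B \<longleftrightarrow> dcompat d A' B'"
proof -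
  have eq: "(vlab A B (f u) = vlab A B (f v)) = (vlab A' B' u = vlab A' B' v)" if uv: "{u, v} \<in> d" for u v
  proof -
    have vu: "{v, u} \<in> d" using uv by (simp add: insert_commute)
    have "\<exists>w. {u, w} \<in> d" "\<exists>w. {v, w} \<in> d" using uv vu by (auto intro: exI)
    then show ?thesis
      using assms(2) Dg_edgeD(2,3)[OF d uv] by simp
  qed
  show ?thesis unfolding compat_vmap[OF d] unfolding dcompat_def using eq by blast
qed

lemma compat_insert:
  "dcompat (insert {p, q} d) A B \<longleftrightarrow> dcompat d A B \<and> vlab A B p = vlab A B q"
  unfolding dcompat_def by (auto simp: doubleton_eq_iff)

lemma Dg_insert:
  assumes d: "d \<in> Dg n" and "p \<in> verts n" "q \<in> verts n" "p ~= q"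
    and iso: "\<And>v. {p, v} \<notin> d" "\<And>v. {q, v} \<notin> d"
  shows "insert {p, q} d \<in> Dg n"
proof (rule DgI)
  fix e assume "e \<in> insert {p, q} d"
  then show "\<exists>u v. u ~= v \<and> e = {u, v} \<and> u \<in> verts n \<and> v \<in> verts n"
  proof
    assume "e = {p, q}" then show ?thesis using assms by blast
  next
    assume "e \<in> d" then show ?thesis by (rule Dg_edgeE[OF d]) metis
  qed
next
  fix u v w assume "{u, v} \<in> insert {p, q} d" "{u, w} \<in> insert {p, q} d"
  then have "{u, v} \<in> d \<or> u = p \<and> v = q \<or> u = q \<and> v = p"
    "{u, w} \<in> d \<or> u = p \<and> w = q \<or> u = q \<and> w = p"
    by (simp_all add: doubleton_eq_iff) metis+
  then show "v = w" using iso Dg_partner[OF d, of u v w] assms(4) by metis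
qed

subsection \<open>Adding a strand, bending, permuting the bottom row\<close>

lemma sum_Pow_Suc:
  fixes f :: "nat set => nat"
  shows "(\<Sum>C\<in>Pow {1..Suc N}. f C) = (\<Sum>C\<in>Pow {1..N}. f C + f (insert (Suc N) C))"
proof -
  have e: "{1..Suc N} = insert (Suc N) {1..N}" by auto
  have inj: "inj_on (insert (Suc N)) (Pow {1..N})"
  proof (rule inj_onI)
    fix A B assume "A \<in> Pow {1..N}" "B \<in> Pow {1..N}" "insert (Suc N) A = insert (Suc N) B"
    moreover from this have "Suc N \<notin> A" "Suc N \<notin> B" by auto
    ultimately show "A = B" by (metis insert_ident)
  qed
  have "(\<Sum>C\<in>Pow {1..Suc N}. f C) = sum f (Pow {1..N}) + sum f (insert (Suc N) ` Pow {1..N})"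
    unfolding e Pow_insert by (rule sum.union_disjoint) auto
  also have "sum f (insert (Suc N) ` Pow {1..N}) = (\<Sum>C\<in>Pow {1..N}. f (insert (Suc N) C))"
    by (simp add: sum.reindex[OF inj])
  finally show ?thesis by (simp add: sum.distrib)
qed

text \<open>The image of a basis diagram under the embedding \<open>eps n\<close>.\<close>

definition hat :: "nat => diag => diag" where
  "hat n d = insert {Top (Suc n), Bot (Suc n)} d"

lemma Dg_vertex_gt:
  assumes "d \<in> Dg n" "n < i"
  shows "{Top i, v} \<notin> d" "{Bot i, v} \<notin> d"
  using Dg_edgeD(2)[OF assms(1), of "Top i" v] Dg_edgeD(2)[OF assms(1), of "Bot i" v] assms(2) by auto

lemma Dg_Suc: "d \<in> Dg n ==> d \<in> Dg (Suc n)"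
  using Dg_mono[of n "Suc n"] by auto

lemma hat_Dg [simp]: "d \<in> Dg n ==> hat n d \<in> Dg (Suc n)"
  unfolding hat_def by (rule Dg_insert) (auto simp: Dg_Suc Dg_vertex_gt)

lemma cmat_hat: "cmat (hat n d) A B = cmat d A B * of_bool (Suc n \<in> A \<longleftrightarrow> Suc n \<in> B)"
  by (simp add: cmat_def hat_def compat_insert)

lemma hat_sum:
  assumes b: "b \<in> Dg N"
  shows "(\<Sum>C\<in>Pow {1..Suc N}. cmat (hat N b) A C * f C)
    = (\<Sum>C\<in>Pow {1..N}. cmat b A C * f (if Suc N \<in> A then insert (Suc N) C else C))"
  unfolding sum_Pow_Suc
proof (rule sum.cong[OF refl])
  fix C assume C: "C \<in> Pow {1..N}"
  then have "Suc N \<notin> C" by auto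
  moreover have "cmat b A (insert (Suc N) C) = cmat b A C"
    by (rule cmat_cong[OF b]) auto
  ultimately show "cmat (hat N b) A C * f C + cmat (hat N b) A (insert (Suc N) C) * f (insert (Suc N) C)
      = cmat b A C * f (if Suc N \<in> A then insert (Suc N) C else C)"
    by (simp add: cmat_hat)
qed

text \<open>Common core of three computations: doing nothing, inserting an arc at the new top
  vertex, and bending an arc up to it. The strand of \<open>hat N b\<close> copies the colour of top
  vertex \<open>Suc N\<close> into the middle row. An operation on the lower factor that sees the
  top colouring only through that vertex therefore commutes with multiplication by
  \<open>hat N b\<close> and creates no further loop.\<close>

lemma Gp_hat_shift:
  assumes b: "b \<in> Dg N" and a: "a \<in> Dg N" and d: "d \<in> Dg (Suc N)" "d' \<in> Dg (Suc N)"
    and r: "\<And>A B. A <= {1..Suc N} ==> B <= {1..Suc N} ==> r A B <= {1..N}"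
    and q: "\<And>A A' B. (Suc N \<in> A \<longleftrightarrow> Suc N \<in> A') ==> r A B = r A' B \<and> q A B = (q A' B :: nat)"
    and dm: "\<And>A B. A <= {1..Suc N} ==> B <= {1..Suc N} ==> cmat d A B = cmat a A (r A B) * q A B"
    and dm': "\<And>A B. A <= {1..Suc N} ==> B <= {1..Suc N} ==> cmat d' A B = cmat (Gp N b a) A (r A B) * q A B"
  shows "Gp (Suc N) (hat N b) d = d' \<and> ell (Suc N) (hat N b) d = ell N b a"
proof (rule Gp_ell_eqI)
  fix A B assume A: "A <= {1..Suc N}" and B: "B <= {1..Suc N}"
  have "(\<Sum>C\<in>Pow {1..Suc N}. cmat (hat N b) A C * cmat d C B)
    = (\<Sum>C\<in>Pow {1..N}. cmat b A C * cmat d (if Suc N \<in> A then insert (Suc N) C else C) B)"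
    by (rule hat_sum[OF b])
  also have "... = (\<Sum>C\<in>Pow {1..N}. (cmat b (A \<inter> {1..N}) C * cmat a C (r A B)) * q A B)"
  proof (rule sum.cong[OF refl])
    fix C assume C: "C \<in> Pow {1..N}"
    define C' where "C' = (if Suc N \<in> A then insert (Suc N) C else C)"
    have C's: "C' <= {1..Suc N}" using C by (auto simp: C'_def)
    have "Suc N \<in> C' \<longleftrightarrow> Suc N \<in> A" using C by (auto simp: C'_def)
    then have "r C' B = r A B" "q C' B = q A B" using q by blast+
    moreover have "cmat a C' (r A B) = cmat a C (r A B)" by (rule cmat_cong[OF a]) (auto simp: C'_def)
    moreover have "cmat b A C = cmat b (A \<inter> {1..N}) C" by (rule cmat_cong[OF b]) auto
    ultimately show "cmat b A C * cmat d (if Suc N \<in> A then insert (Suc N) C else C) B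
        = (cmat b (A \<inter> {1..N}) C * cmat a C (r A B)) * q A B"
      using dm[OF C's B] by (simp add: C'_def)
  qed
  also have "... = (\<Sum>C\<in>Pow {1..N}. cmat b (A \<inter> {1..N}) C * cmat a C (r A B)) * q A B"
    by (simp add: sum_distrib_right)
  also have "... = 2 ^ ell N b a * cmat (Gp N b a) (A \<inter> {1..N}) (r A B) * q A B"
    using cmat_mult[OF b a, of "A \<inter> {1..N}" "r A B"] r[OF A B] by simp
  also have "cmat (Gp N b a) (A \<inter> {1..N}) (r A B) = cmat (Gp N b a) A (r A B)"
    by (rule cmat_cong[OF Gp_Dg[OF b a]]) auto
  finally show "(\<Sum>C\<in>Pow {1..Suc N}. cmat (hat N b) A C * cmat d C B) = 2 ^ ell N b a * cmat d' A B"
    using dm'[OF A B] by simp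
qed (simp_all add: b d)

text \<open>The middle vertex \<open>Suc N\<close> is isolated below but hangs on the strand from
  above, so it closes no loop.\<close>

lemma Gp_hat_low:
  assumes b: "b \<in> Dg N" and d: "d \<in> Dg N"
  shows "Gp (Suc N) (hat N b) d = Gp N b d \<and> ell (Suc N) (hat N b) d = ell N b d"
proof (rule Gp_hat_shift[OF b d, where r = "%A B. B \<inter> {1..N}" and q = "%A B. 1"])
  fix A B
  show "cmat d A B = cmat d A (B \<inter> {1..N}) * 1" using cmat_cong[OF d, of A A B "B \<inter> {1..N}"] by simp
  show "cmat (Gp N b d) A B = cmat (Gp N b d) A (B \<inter> {1..N}) * 1"
    using cmat_cong[OF Gp_Dg[OF b d], of A A B "B \<inter> {1..N}"] by simp
qed (use assms Dg_Suc in simp_all)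

text \<open>A vertex is isolated exactly when it alone can be coloured. In this form isolation
  passes through products.\<close>

lemma isolated_Bot_iff: 
  assumes d: "d \<in> Dg n"
  shows "(\<forall>v. {Bot i, v} \<notin> d) \<longleftrightarrow> dcompat d {} {i}"
proof
  assume iso: "\<forall>v. {Bot i, v} \<notin> d"
  show "dcompat d {} {i}"
    unfolding dcompat_def
  proof (rule allI, rule allI, rule impI)
    fix u v assume uv: "{u, v} \<in> d"
    have "u ~= Bot i" "v ~= Bot i" using iso uv by (metis insert_commute)+
    then have "\<not> vlab {} {i} u" "\<not> vlab {} {i} v" by (cases u; cases v; auto)+
    then show "vlab {} {i} u = vlab {} {i} v" by simp
  qed
next
  assume co: "dcompat d {} {i}"
  show "\<forall>v. {Bot i, v} \<notin> d"
  proof (rule allI, rule notI)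
    fix v assume v: "{Bot i, v} \<in> d"
    then have "vlab {} {i} v" using co unfolding dcompat_def by fastforce
    then have "v = Bot i" by (cases v) auto
    then show False using Dg_edgeD(1)[OF d v] by simp
  qed
qed

lemma compat_Gp:
  assumes a: "a \<in> Dg n" and b: "b \<in> Dg n" and sub: "A <= {1..n}" "B <= {1..n}" "C <= {1..n}"
    and co: "dcompat a A C" "dcompat b C B"
  shows "dcompat (Gp n a b) A B"
proof (rule ccontr)
  assume "\<not> dcompat (Gp n a b) A B"
  then have "(\<Sum>C\<in>Pow {1..n}. cmat a A C * cmat b C B) = 0"
    using cmat_mult[OF a b sub(1,2)] by (simp add: cmat_def)
  then have "cmat a A C * cmat b C B = 0" using sub(3) by (subst (asm) sum_eq_0_iff) auto
  then show False using co by (simp add: cmat_def)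
qed

lemma compat_GpD:
  assumes a: "a \<in> Dg n" and b: "b \<in> Dg n" and sub: "A <= {1..n}" "B <= {1..n}"
    and co: "dcompat (Gp n a b) A B"
  obtains C where "C <= {1..n}" "dcompat a A C" "dcompat b C B"
proof -
  have "(\<Sum>C\<in>Pow {1..n}. cmat a A C * cmat b C B) ~= 0"
    using cmat_mult[OF a b sub(1,2)] co by (simp add: cmat_def)
  then obtain C where "C \<in> Pow {1..n}" "cmat a A C * cmat b C B ~= 0" by (meson sum.not_neutral_contains_not_neutral)
  then show thesis using that[of C] by (simp add: cmat_def split: if_splits)
qed

lemma isolated_Bot_Gp:
  assumes a: "a \<in> Dg n" and b: "b \<in> Dg n" and iso: "\<And>v. {Bot i, v} \<notin> b"
  shows "{Bot i, v} \<notin> Gp n a b"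
proof (cases "i \<in> {1..n}")
  case True
  have "dcompat b {} {i}" using iso isolated_Bot_iff[OF b] by blast
  then have "dcompat (Gp n a b) {} {i}" using True by (intro compat_Gp[OF a b, of _ _ "{}"]) auto
  then show ?thesis using isolated_Bot_iff[OF Gp_Dg[OF a b]] by blast
next
  case False
  then have "Bot i \<notin> verts n" by simp
  then show ?thesis using Dg_edgeD(2)[OF Gp_Dg[OF a b], of "Bot i" v] by blast
qed

lemma Gp_hat_insert:
  assumes b: "b \<in> Dg N" and d: "d \<in> Dg N" and k: "k \<in> {1..N}" and iso: "\<And>v. {Bot k, v} \<notin> d"
  shows "Gp (Suc N) (hat N b) (insert {Top (Suc N), Bot k} d) = insert {Top (Suc N), Bot k} (Gp N b d)
     \<and> ell (Suc N) (hat N b) (insert {Top (Suc N), Bot k} d) = ell N b d"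
proof (rule Gp_hat_shift[OF b d, where r = "%A B. B \<inter> {1..N}" and q = "%A B. of_bool (Suc N \<in> A \<longleftrightarrow> k \<in> B)"])
  fix A B
  show "cmat (insert {Top (Suc N), Bot k} d) A B = cmat d A (B \<inter> {1..N}) * of_bool (Suc N \<in> A \<longleftrightarrow> k \<in> B)"
    using compat_cong[OF d, of A A B "B \<inter> {1..N}"] by (auto simp: cmat_def compat_insert)
  show "cmat (insert {Top (Suc N), Bot k} (Gp N b d)) A B
      = cmat (Gp N b d) A (B \<inter> {1..N}) * of_bool (Suc N \<in> A \<longleftrightarrow> k \<in> B)"
    using compat_cong[OF Gp_Dg[OF b d], of A A B "B \<inter> {1..N}"] by (auto simp: cmat_def compat_insert)
next
  show "insert {Top (Suc N), Bot k} d \<in> Dg (Suc N)"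
    using k iso by (intro Dg_insert Dg_Suc[OF d]) (auto simp: Dg_vertex_gt[OF d])
  show "insert {Top (Suc N), Bot k} (Gp N b d) \<in> Dg (Suc N)"
    using k isolated_Bot_Gp[OF b d iso]
    by (intro Dg_insert Dg_Suc[OF Gp_Dg[OF b d]]) (auto simp: Dg_vertex_gt[OF Gp_Dg[OF b d]])
qed auto

text \<open>Used in two ways: with \<open>p = Suc n\<close> it bends the last bottom vertex for the
  induced module, and with \<open>p = Suc m\<close> it turns the last vertical arc of a half diagram
  into a horizontal one.\<close>

definition bend :: "nat => nat => diag => diag" where
  "bend p q d = vmap (%v. if v = Bot p then Top q else v) d"

definition unbend :: "nat => nat => diag => diag" where
  "unbend p q d = vmap (%v. if v = Top q then Bot p else v) d"

lemma bend_Dg: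
  assumes d: "d \<in> Dg N"
  shows "bend p (Suc N) d \<in> Dg (Suc N)"
  unfolding bend_def
proof (rule vmap_Dg[OF d])
  show "inj_on (%v. if v = Bot p then Top (Suc N) else v) {v \<in> verts N. \<exists>w. {v, w} \<in> d}"
    by (auto simp: inj_on_def)
  fix v assume "v \<in> verts N"
  then show "(if v = Bot p then Top (Suc N) else v) \<in> verts (Suc N)"
    using verts_mono[of N "Suc N"] by auto
qed

lemma unbend_Dg:
  assumes d: "d \<in> Dg (Suc N)" and p: "p \<in> {1..N}" and iso: "\<And>v. {Bot p, v} \<notin> d" "\<And>v. {Bot (Suc N), v} \<notin> d"
  shows "unbend p (Suc N) d \<in> Dg N"
  unfolding unbend_def
proof (rule vmap_Dg[OF d])
  show "inj_on (%v. if v = Top (Suc N) then Bot p else v) {v \<in> verts (Suc N). \<exists>w. {v, w} \<in> d}"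
    using iso by (auto simp: inj_on_def)
  fix v assume v: "v \<in> verts (Suc N)" "\<exists>w. {v, w} \<in> d"
  then have "v ~= Bot (Suc N)" using iso by auto
  then show "(if v = Top (Suc N) then Bot p else v) \<in> verts N"
    using v p by (cases v) auto
qed

lemma bend_unbend:
  assumes d: "d \<in> Dg N" and iso: "\<And>v. {Bot p, v} \<notin> d"
  shows "bend p q (unbend p q d) = d"
  unfolding bend_def unbend_def vmap_vmap using iso by (intro vmap_id[OF d]) auto

lemma unbend_bend:
  assumes d: "d \<in> Dg N" and "N < q"
  shows "unbend p q (bend p q d) = d"
  unfolding bend_def unbend_def vmap_vmap using assms(2) by (intro vmap_id[OF d]) auto

lemma bend_isolated:
  assumes d: "d \<in> Dg N"
  shows "{Bot p, v} \<notin> bend p q d"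
proof
  assume "{Bot p, v} \<in> bend p q d"
  then show False unfolding bend_def by (rule vmap_edgeE[OF d]) (simp split: if_splits)
qed

lemma cmat_bend:
  assumes d: "d \<in> Dg N" and "N < q"
  shows "cmat (bend p q d) A B = cmat d A (if q \<in> A then insert p B else B - {p})"
proof -
  have "dcompat (bend p q d) A B \<longleftrightarrow> dcompat d A (if q \<in> A then insert p B else B - {p})"
    unfolding bend_def
  proof (rule compat_vmap_lab[OF d])
    fix v assume "v \<in> verts N"
    then show "vlab A B (if v = Bot p then Top q else v) = vlab A (if q \<in> A then insert p B else B - {p}) v"
      by (cases v) auto
  qed
  then show ?thesis by (simp add: cmat_def)
qed

lemma Gp_hat_bend:
  assumes b: "b \<in> Dg N" and a: "a \<in> Dg N" and p: "p \<in> {1..N}"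
  shows "Gp (Suc N) (hat N b) (bend p (Suc N) a) = bend p (Suc N) (Gp N b a)
     \<and> ell (Suc N) (hat N b) (bend p (Suc N) a) = ell N b a"
proof (rule Gp_hat_shift[OF b a, where q = "%A B. 1"
      and r = "%A B. (if Suc N \<in> A then insert p B else B - {p}) \<inter> {1..N}"])
  fix A B
  let ?r = "if Suc N \<in> A then insert p B else B - {p}"
  show "cmat (bend p (Suc N) a) A B = cmat a A (?r \<inter> {1..N}) * 1"
    using cmat_cong[OF a, of A A ?r "?r \<inter> {1..N}"] by (simp add: cmat_bend[OF a])
  show "cmat (bend p (Suc N) (Gp N b a)) A B = cmat (Gp N b a) A (?r \<inter> {1..N}) * 1"
    using cmat_cong[OF Gp_Dg[OF b a], of A A ?r "?r \<inter> {1..N}"] by (simp add: cmat_bend[OF Gp_Dg[OF b a]])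
qed (use assms bend_Dg in auto)

text \<open>Right multiplication by the embedded algebra of size \<open>n\<close> does not touch the
  bent vertex. The two extra loops are the middle vertices \<open>Suc n\<close> and
  \<open>Suc (Suc n)\<close>, isolated on both sides: the first has been bent away in the upper
  factor, the second never occurs there, and \<open>d\<close> uses neither.\<close>

lemma Gp_bend_low:
  assumes a: "a \<in> Dg (Suc n)" and d: "d \<in> Dg n"
  shows "Gp (Suc (Suc n)) (bend (Suc n) (Suc (Suc n)) a) d = bend (Suc n) (Suc (Suc n)) (Gp (Suc n) a (hat n d))
    \<and> ell (Suc (Suc n)) (bend (Suc n) (Suc (Suc n)) a) d = ell (Suc n) a (hat n d) + 2"
proof (rule Gp_ell_eqI)
  let ?q = "Suc (Suc n)" and ?p = "Suc n"
  fix A B assume A: "A <= {1..?q}" and B: "B <= {1..?q}"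
  define S where "S = (%C. if ?q \<in> A then insert ?p C else C - {?p})"
  have bS: "cmat (bend ?p ?q a) A C = cmat a A (S C)" for C
    unfolding S_def by (rule cmat_bend[OF a lessI])
  have ca: "cmat a A (S C) = cmat a (A \<inter> {1..?p}) (S C)" for C by (rule cmat_cong[OF a]) auto
  have drop: "cmat d (insert ?p C) B = cmat d C B" "cmat d (insert ?q C) B = cmat d C B"
    "cmat d (insert ?q (insert ?p C)) B = cmat d C B" for C
    by (rule cmat_cong[OF d]; auto)+
  have S': "cmat a A (S (insert ?p C)) = cmat a A (S C)" "cmat a A (S (insert ?q C)) = cmat a A (S C)" for C
    by (rule cmat_cong[OF a]; auto simp: S_def)+
  have "(\<Sum>C\<in>Pow {1..?q}. cmat (bend ?p ?q a) A C * cmat d C B)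
      = (\<Sum>C\<in>Pow {1..n}. 4 * (cmat a A (S C) * cmat d C B))"
    unfolding sum_Pow_Suc bS
    by (intro sum.cong refl) (simp add: drop S')
  also have "... = 4 * (\<Sum>C\<in>Pow {1..n}. cmat a A (S C) * cmat d C B)"
    by (simp add: sum_distrib_left)
  also have "(\<Sum>C\<in>Pow {1..n}. cmat a A (S C) * cmat d C B)
      = (\<Sum>C\<in>Pow {1..?p}. cmat a (A \<inter> {1..?p}) C * cmat (hat n d) C (S B \<inter> {1..?p}))"
    unfolding sum_Pow_Suc
  proof (rule sum.cong[OF refl])
    fix C assume "C \<in> Pow {1..n}"
    then have nC: "?p \<notin> C" by auto
    have "cmat d C (S B \<inter> {1..?p}) = cmat d C B" "cmat d (insert ?p C) (S B \<inter> {1..?p}) = cmat d C B"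
      by (rule cmat_cong[OF d]; auto simp: S_def)+
    moreover have "S C = (if ?q \<in> A then insert ?p C else C)" using nC by (auto simp: S_def)
    ultimately show "cmat a A (S C) * cmat d C B = cmat a (A \<inter> {1..?p}) C * cmat (hat n d) C (S B \<inter> {1..?p}) +
         cmat a (A \<inter> {1..?p}) (insert ?p C) * cmat (hat n d) (insert ?p C) (S B \<inter> {1..?p})"
      unfolding ca using nC by (simp add: cmat_hat S_def)
  qed
  also have "... = 2 ^ ell ?p a (hat n d) * cmat (Gp ?p a (hat n d)) (A \<inter> {1..?p}) (S B \<inter> {1..?p})"
    by (rule cmat_mult[OF a hat_Dg[OF d]]) auto
  also have "cmat (Gp ?p a (hat n d)) (A \<inter> {1..?p}) (S B \<inter> {1..?p}) = cmat (bend ?p ?q (Gp ?p a (hat n d))) A B"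
    unfolding cmat_bend[OF Gp_Dg[OF a hat_Dg[OF d]] lessI] S_def
    by (rule cmat_cong[OF Gp_Dg[OF a hat_Dg[OF d]]]) auto
  finally show "(\<Sum>C\<in>Pow {1..?q}. cmat (bend ?p ?q a) A C * cmat d C B)
      = 2 ^ (ell ?p a (hat n d) + 2) * cmat (bend ?p ?q (Gp ?p a (hat n d))) A B"
    by simp
qed (use assms bend_Dg Dg_Suc in simp_all)

text \<open>Right multiplication by the diagram of \<open>\<sigma>\<close>, done as a relabelling;
  the inverse is what makes it a right action (see \<open>rt_comp\<close> and
  \<open>Gp_pd\<close>).\<close>

definition rt :: "(nat => nat) => diag => diag" where
  "rt \<sigma> d = vmap (%v. case v of Top i => Top i | Bot i => Bot (inv \<sigma> i)) d"

lemma rt_Dg [simp]: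
  assumes \<sigma>: "\<sigma> permutes {1..m}" "m <= n" and d: "d \<in> Dg n"
  shows "rt \<sigma> d \<in> Dg n"
  unfolding rt_def
proof (rule vmap_Dg[OF d])
  have i: "inv \<sigma> permutes {1..m}" using \<sigma>(1) by (rule permutes_inv)
  then show "inj_on (%v. case v of Top i => Top i | Bot i => Bot (inv \<sigma> i)) {v \<in> verts n. \<exists>w. {v, w} \<in> d}"
    using permutes_inj[OF i] by (auto simp: inj_on_def inj_def split: vtx.splits)
  fix v assume "v \<in> verts n"
  moreover have "inv \<sigma> i \<in> {1..n}" if "i \<in> {1..n}" for i
    using permutes_in_image[OF permutes_subset[OF i, of "{1..n}"]] that \<sigma>(2) by auto
  ultimately show "(case v of Top i => Top i | Bot i => Bot (inv \<sigma> i)) \<in> verts n"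
    by (cases v) auto
qed

lemma cmat_rt:
  assumes \<sigma>: "\<sigma> permutes S" and d: "d \<in> Dg n"
  shows "cmat (rt \<sigma> d) A B = cmat d A (\<sigma> ` B)"
proof -
  have "dcompat (rt \<sigma> d) A B \<longleftrightarrow> dcompat d A (\<sigma> ` B)"
    unfolding rt_def
  proof (rule compat_vmap_lab[OF d])
    fix v
    have "inv \<sigma> i \<in> B \<longleftrightarrow> i \<in> \<sigma> ` B" for i
      using permutes_inverses[OF \<sigma>] by (metis image_iff)
    then show "vlab A B (case v of Top i => Top i | Bot i => Bot (inv \<sigma> i)) = vlab A (\<sigma> ` B) v"
      by (cases v) auto
  qed
  then show ?thesis by (simp add: cmat_def)
qed

lemma rt_comp:
  assumes "\<sigma> permutes S" "\<tau> permutes S"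
  shows "rt \<tau> (rt \<sigma> d) = rt (\<sigma> \<circ> \<tau>) d"
proof -
  have "inv (\<sigma> \<circ> \<tau>) = inv \<tau> \<circ> inv \<sigma>"
    by (rule o_inv_distrib) (use assms permutes_bij in blast)+
  then show ?thesis unfolding rt_def vmap_vmap by (auto simp: fun_eq_iff intro!: arg_cong[of _ _ "%f. vmap f d"] split: vtx.splits)
qed

lemma rt_id [simp]: "rt id d = d"
proof -
  have "inv id = (id :: nat => nat)" by (rule inv_unique_comp) simp_all
  then have "(%v. case v of Top i => Top i | Bot i => Bot (inv id i)) = (%v. v)"
    by (auto split: vtx.splits)
  then show ?thesis unfolding rt_def vmap_def by simp
qed

lemma rt_inv:
  assumes "\<sigma> permutes S"
  shows "rt \<sigma> (rt (inv \<sigma>) d) = d" "rt (inv \<sigma>) (rt \<sigma> d) = d"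
  using assms by (simp_all add: rt_comp[OF _ _] permutes_inv permutes_inv_o rt_comp[of _ S])

lemma rt_edge:
  assumes \<sigma>: "\<sigma> permutes S"
  shows "{Top j, Bot i} \<in> rt \<sigma> d \<longleftrightarrow> {Top j, Bot (\<sigma> i)} \<in> d"
    "{Top j, Top k} \<in> rt \<sigma> d \<longleftrightarrow> {Top j, Top k} \<in> d"
    "{Bot i, Bot l} \<in> rt \<sigma> d \<longleftrightarrow> {Bot (\<sigma> i), Bot (\<sigma> l)} \<in> d"
proof -
  let ?f = "%v. case v of Top i => Top i | Bot i => Bot (inv \<sigma> i)"
  have inj: "inj ?f"
    using permutes_inj[OF permutes_inv[OF \<sigma>]] by (auto simp: inj_def split: vtx.splits)
  have mem: "?f ` e \<in> rt \<sigma> d \<longleftrightarrow> e \<in> d" for e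
    unfolding rt_def vmap_def using inj_image_eq_iff[OF inj] by auto
  have "inv \<sigma> (\<sigma> i) = i" for i using permutes_inverses[OF \<sigma>] by simp
  then show "{Top j, Bot i} \<in> rt \<sigma> d \<longleftrightarrow> {Top j, Bot (\<sigma> i)} \<in> d"
    "{Top j, Top k} \<in> rt \<sigma> d \<longleftrightarrow> {Top j, Top k} \<in> d"
    "{Bot i, Bot l} \<in> rt \<sigma> d \<longleftrightarrow> {Bot (\<sigma> i), Bot (\<sigma> l)} \<in> d"
    using mem[of "{Top j, Bot (\<sigma> i)}"] mem[of "{Top j, Top k}"] mem[of "{Bot (\<sigma> i), Bot (\<sigma> l)}"] by simp_all
qed

lemma permutes_image_sub:
  assumes "\<sigma> permutes {1..m}" "m <= n" "B <= {1..n}"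
  shows "\<sigma> ` B <= {1..(n::nat)}"
  using permutes_image[OF permutes_subset[OF assms(1), of "{1..n}"]] assms(2,3) by auto

lemma Gp_rt:
  assumes \<sigma>: "\<sigma> permutes {1..m}" "m <= n" and a: "a \<in> Dg n" and d: "d \<in> Dg n"
  shows "Gp n a (rt \<sigma> d) = rt \<sigma> (Gp n a d) \<and> ell n a (rt \<sigma> d) = ell n a d"
proof (rule Gp_ell_eqI)
  fix A B assume A: "A <= {1..n}" and B: "B <= {1..n}"
  show "(\<Sum>C\<in>Pow {1..n}. cmat a A C * cmat (rt \<sigma> d) C B) = 2 ^ ell n a d * cmat (rt \<sigma> (Gp n a d)) A B"
    unfolding cmat_rt[OF \<sigma>(1) d] cmat_rt[OF \<sigma>(1) Gp_Dg[OF a d]]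
    by (rule cmat_mult[OF a d A permutes_image_sub[OF \<sigma> B]])
qed (use assms in simp_all)

lemma cmat_vertical_strands:
  "cmat {{Top (\<sigma> i), Bot i} | i. i \<in> I} C B = of_bool (\<forall>i\<in>I. \<sigma> i \<in> C \<longleftrightarrow> i \<in> B)"
proof -
  have "dcompat {{Top (\<sigma> i), Bot i} | i. i \<in> I} C B \<longleftrightarrow> (\<forall>i\<in>I. \<sigma> i \<in> C \<longleftrightarrow> i \<in> B)"
  proof
    assume l: "dcompat {{Top (\<sigma> i), Bot i} | i. i \<in> I} C B"
    show "\<forall>i\<in>I. \<sigma> i \<in> C \<longleftrightarrow> i \<in> B"
    proof
      fix i assume "i \<in> I"
      then have "{Top (\<sigma> i), Bot i} \<in> {{Top (\<sigma> i), Bot i} | i. i \<in> I}" by blast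
      then have "vlab C B (Top (\<sigma> i)) = vlab C B (Bot i)" using l unfolding dcompat_def by blast
      then show "\<sigma> i \<in> C \<longleftrightarrow> i \<in> B" by simp
    qed
  next
    assume r: "\<forall>i\<in>I. \<sigma> i \<in> C \<longleftrightarrow> i \<in> B"
    show "dcompat {{Top (\<sigma> i), Bot i} | i. i \<in> I} C B"
      unfolding dcompat_def
    proof (rule allI, rule allI, rule impI)
      fix u v assume "{u, v} \<in> {{Top (\<sigma> i), Bot i} | i. i \<in> I}"
      then obtain i where i: "i \<in> I" "{u, v} = {Top (\<sigma> i), Bot i}" by blast
      then have "u = Top (\<sigma> i) \<and> v = Bot i \<or> u = Bot i \<and> v = Top (\<sigma> i)" by (auto simp: doubleton_eq_iff)
      then show "vlab C B u = vlab C B v" using r i(1) by auto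
    qed
  qed
  then show ?thesis by (simp add: cmat_def)
qed

lemma vertical_strands_Dg:
  assumes "inj_on \<sigma> I" "\<And>i. i \<in> I ==> i \<in> {1..n} \<and> \<sigma> i \<in> {1..n}"
  shows "{{Top (\<sigma> i), Bot i} | i. i \<in> I} \<in> Dg n"
proof (rule DgI)
  fix e assume "e \<in> {{Top (\<sigma> i), Bot i} | i. i \<in> I}"
  then obtain i where i: "i \<in> I" "e = {Top (\<sigma> i), Bot i}" by blast
  then have "Top (\<sigma> i) ~= Bot i \<and> e = {Top (\<sigma> i), Bot i} \<and> Top (\<sigma> i) \<in> verts n \<and> Bot i \<in> verts n"
    using assms(2)[OF i(1)] by simp
  then show "\<exists>u v. u ~= v \<and> e = {u, v} \<and> u \<in> verts n \<and> v \<in> verts n" by blast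
next
  have *: "\<exists>i\<in>I. u = Top (\<sigma> i) \<and> v = Bot i \<or> u = Bot i \<and> v = Top (\<sigma> i)"
    if "{u, v} \<in> {{Top (\<sigma> i), Bot i} | i. i \<in> I}" for u v
    using that by (auto simp: doubleton_eq_iff)
  fix u v w assume "{u, v} \<in> {{Top (\<sigma> i), Bot i} | i. i \<in> I}" "{u, w} \<in> {{Top (\<sigma> i), Bot i} | i. i \<in> I}"
  from *[OF this(1)] *[OF this(2)] show "v = w" using inj_onD[OF assms(1)] by auto
qed

lemma pd_alt: "pd n \<sigma> = {{Top (\<sigma> i), Bot i} | i. i \<in> {1..n}}"
  unfolding pd_def by auto

lemma Gp_pd:
  assumes \<sigma>: "\<sigma> permutes {1..m}" "m <= n" and d: "d \<in> Dg n"
  shows "Gp n d (pd n \<sigma>) = rt \<sigma> d \<and> ell n d (pd n \<sigma>) = 0"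
proof (rule Gp_ell_eqI)
  have \<sigma>': "\<sigma> permutes {1..n}" using permutes_subset[OF \<sigma>(1)] \<sigma>(2) by auto
  have im: "\<sigma> i \<in> {1..n}" if "i \<in> {1..n}" for i using permutes_in_image[OF \<sigma>'] that by auto
  show "pd n \<sigma> \<in> Dg n" unfolding pd_alt
    by (rule vertical_strands_Dg) (use im permutes_inj_on[OF \<sigma>'] in auto)
  fix A B assume A: "A <= {1..n}" and B: "B <= {1..n}"
  have eq: "(\<forall>i\<in>{1..n}. \<sigma> i \<in> C \<longleftrightarrow> i \<in> B) \<longleftrightarrow> C = \<sigma> ` B" if C: "C <= {1..n}" for C
  proof
    assume r: "\<forall>i\<in>{1..n}. \<sigma> i \<in> C \<longleftrightarrow> i \<in> B"
    show "C = \<sigma> ` B"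
    proof
      show "C <= \<sigma> ` B"
      proof
        fix c assume "c \<in> C"
        then obtain i where "i \<in> {1..n}" "c = \<sigma> i" using C permutes_image[OF \<sigma>'] by blast
        then show "c \<in> \<sigma> ` B" using r \<open>c \<in> C\<close> by blast
      qed
      show "\<sigma> ` B <= C" using r B by blast
    qed
  next
    assume "C = \<sigma> ` B"
    then show "\<forall>i\<in>{1..n}. \<sigma> i \<in> C \<longleftrightarrow> i \<in> B" using permutes_inj[OF \<sigma>'] by (simp add: inj_image_mem_iff)
  qed
  have "(\<Sum>C\<in>Pow {1..n}. cmat d A C * cmat (pd n \<sigma>) C B) = (\<Sum>C\<in>Pow {1..n}. if C = \<sigma> ` B then cmat d A C else 0)"
    by (rule sum.cong[OF refl]) (simp only: pd_alt cmat_vertical_strands Pow_iff eq, simp)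
  also have "... = cmat d A (\<sigma> ` B)" using permutes_image_sub[OF \<sigma> B] by simp
  finally show "(\<Sum>C\<in>Pow {1..n}. cmat d A C * cmat (pd n \<sigma>) C B) = 2 ^ 0 * cmat (rt \<sigma> d) A B"
    by (simp add: cmat_rt[OF \<sigma>(1) d])
qed (use assms in simp_all)

lemma udiag_alt: "udiag n t = {{Top i, Bot i} | i. i \<in> {1..n - t}}"
  unfolding udiag_def by auto

lemma udiag_Dg [simp]: "n - t <= N ==> udiag n t \<in> Dg N"
  unfolding udiag_alt using vertical_strands_Dg[of "%i. i" "{1..n - t}" N] by auto

lemma cmat_udiag: "cmat (udiag n t) C B = of_bool (C \<inter> {1..n - t} = B \<inter> {1..n - t})"
proof -
  have "(\<forall>i\<in>{1..n - t}. i \<in> C \<longleftrightarrow> i \<in> B) \<longleftrightarrow> C \<inter> {1..n - t} = B \<inter> {1..n - t}" by auto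
  then show ?thesis unfolding udiag_alt cmat_vertical_strands by simp
qed

lemma cmat_isolated_cong:
  assumes d: "d \<in> Dg n" and iso: "\<And>i v. i \<notin> I ==> {Bot i, v} \<notin> d" and "B \<inter> I = B' \<inter> I"
  shows "cmat d A B = cmat d A B'"
proof -
  have "vlab A B u = vlab A B' u" if "{u, v} \<in> d" for u v
    using that iso assms(3) by (cases u) auto
  then have "vlab A B u = vlab A B' u \<and> vlab A B v = vlab A B' v" if "{u, v} \<in> d" for u v
    using that insert_commute by metis
  then show ?thesis unfolding cmat_def dcompat_def by simp
qed

text \<open>The last \<open>t\<close> middle vertices are isolated on both sides, and each closes
  one loop; on the other vertices \<open>udiag n t\<close> is the identity. Powers of
  \<open>x\<close> enter the cell modules here.\<close>

lemma Gp_udiag: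
  assumes t: "t <= n" and d: "d \<in> Dg n" and iso: "\<And>i v. n - t < i ==> {Bot i, v} \<notin> d"
  shows "Gp n d (udiag n t) = d \<and> ell n d (udiag n t) = t"
proof (rule Gp_ell_eqI)
  fix A B assume A: "A <= {1..n}" and B: "B <= {1..n}"
  let ?J = "{1..n - t}"
  have no0: "{Bot 0, v} \<notin> d" for v using Dg_edgeD(2)[OF d, of "Bot 0" v] by auto
  have iso': "{Bot i, v} \<notin> d" if "i \<notin> ?J" for i v
    using that iso[of i v] no0 by (cases "i = 0") auto
  have same: "cmat d A C = cmat d A B" if "C \<inter> ?J = B \<inter> ?J" for C
    by (rule cmat_isolated_cong[OF d iso' that])
  have "(\<Sum>C\<in>Pow {1..n}. cmat d A C * cmat (udiag n t) C B)
      = (\<Sum>C\<in>Pow {1..n}. if C \<inter> ?J = B \<inter> ?J then cmat d A B else 0)"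
  proof (rule sum.cong[OF refl])
    fix C
    show "cmat d A C * cmat (udiag n t) C B = (if C \<inter> ?J = B \<inter> ?J then cmat d A B else 0)"
    proof (cases "C \<inter> ?J = B \<inter> ?J")
      case True
      show ?thesis unfolding same[OF True] cmat_udiag if_P[OF True] using True by simp
    next
      case False
      then show ?thesis by (simp add: cmat_udiag)
    qed
  qed
  also have "... = card {C \<in> Pow {1..n}. C \<inter> ?J = B \<inter> ?J} * cmat d A B"
    by (subst sum.inter_filter[symmetric]) simp_all
  \<comment> \<open>The middle colouring is prescribed on \<open>?J\<close> and free on the
    remaining \<open>t\<close> vertices.\<close>
  also have "card {C \<in> Pow {1..n}. C \<inter> ?J = B \<inter> ?J} = card (Pow {n - t <.. n})"
  proof (rule bij_betw_same_card[of "%C. C \<inter> {n - t <.. n}"], rule bij_betw_byWitness[where f' = "%D. D \<union> (B \<inter> ?J)"])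
    show "\<forall>C\<in>{C \<in> Pow {1..n}. C \<inter> ?J = B \<inter> ?J}. C \<inter> {n - t<..n} \<union> B \<inter> ?J = C"
    proof
      fix C assume C: "C \<in> {C \<in> Pow {1..n}. C \<inter> ?J = B \<inter> ?J}"
      have "{1..n} = {n - t<..n} \<union> ?J" by auto
      then have "C = C \<inter> ({n - t<..n} \<union> ?J)" using C by auto
      also have "... = C \<inter> {n - t<..n} \<union> C \<inter> ?J" by (rule Int_Un_distrib)
      finally show "C \<inter> {n - t<..n} \<union> B \<inter> ?J = C" using C by simp
    qed
    show "\<forall>D\<in>Pow {n - t<..n}. (D \<union> B \<inter> ?J) \<inter> {n - t<..n} = D" by auto
    show "(%D. D \<union> B \<inter> ?J) ` Pow {n - t<..n} <= {C \<in> Pow {1..n}. C \<inter> ?J = B \<inter> ?J}" using B by auto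
  qed auto
  also have "... = 2 ^ t" using t by (simp add: card_Pow)
  finally show "(\<Sum>C\<in>Pow {1..n}. cmat d A C * cmat (udiag n t) C B) = 2 ^ t * cmat d A B" .
qed (use assms in simp_all)

subsection \<open>Linear spans and tensor relations\<close>

definition fsub :: "('x => 'a::comm_ring_1) set => bool" where
  "fsub V \<longleftrightarrow> (%s. 0) \<in> V \<and> (\<forall>u\<in>V. \<forall>v\<in>V. (%s. u s + v s) \<in> V) \<and> (\<forall>c. \<forall>v\<in>V. (%s. c * v s) \<in> V)"

lemma fsubD:
  assumes "fsub V"
  shows "(%s. 0) \<in> V" "u \<in> V ==> v \<in> V ==> (%s. u s + v s) \<in> V" "v \<in> V ==> (%s. c * v s) \<in> V"
  using assms unfolding fsub_def by blast+

lemma fsub_diff: "fsub V ==> u \<in> V ==> v \<in> V ==> (%s. u s - v s) \<in> V"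
  using fsubD(2)[of V u "%s. -1 * v s"] fsubD(3)[of V v "-1"] by simp

lemma fsub_sum: "fsub V ==> (\<And>i. i \<in> I ==> f i \<in> V) ==> (%s. \<Sum>i\<in>I. f i s) \<in> V"
  by (induction I rule: infinite_finite_induct) (auto intro: fsubD)

lemma fsub_lincomb: "fsub V ==> (\<And>i. i \<in> I ==> f i \<in> V) ==> (%s. \<Sum>i\<in>I. c i * f i s) \<in> V"
  using fsub_sum[of V I "%i s. c i * f i s"] fsubD(3) by blast

lemma fsub_lspan: "fsub (lspan S)"
  unfolding fsub_def
proof (intro conjI ballI allI)
  show "(%s. 0) \<in> lspan S" unfolding lspan_def by (auto intro!: exI[of _ "{}"])
next
  fix u v assume "u \<in> lspan S" "v \<in> lspan S"
  then obtain T c T' c' where T: "finite T" "T <= S" "u = (%y. \<Sum>v\<in>T. c v * v y)"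
    and T': "finite T'" "T' <= S" "v = (%y. \<Sum>v\<in>T'. c' v * v y)" unfolding lspan_def by auto
  define d where "d w = (if w \<in> T then c w else 0) + (if w \<in> T' then c' w else 0)" for w
  have "(\<Sum>w\<in>T \<union> T'. d w * w y) = u y + v y" for y
  proof -
    have "(\<Sum>w\<in>T \<union> T'. d w * w y) = (\<Sum>w\<in>T \<union> T'. if w \<in> T then c w * w y else 0)
        + (\<Sum>w\<in>T \<union> T'. if w \<in> T' then c' w * w y else 0)"
      unfolding sum.distrib[symmetric] by (rule sum.cong) (auto simp: d_def distrib_right)
    also have "... = u y + v y" using T T' by (simp add: sum.inter_restrict[symmetric] Int_absorb1 Int_absorb2)
    finally show ?thesis .
  qed
  then show "(%s. u s + v s) \<in> lspan S"
    unfolding lspan_def using T T' by (intro CollectI exI[of _ "T \<union> T'"] exI[of _ d]) auto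
next
  fix c v assume "v \<in> lspan S"
  then obtain T c' where T: "finite T" "T <= S" "v = (%y. \<Sum>v\<in>T. c' v * v y)" unfolding lspan_def by auto
  then show "(%s. c * v s) \<in> lspan S"
    unfolding lspan_def
    by (intro CollectI exI[of _ T] exI[of _ "%v. c * c' v"]) (auto simp: sum_distrib_left mult.assoc)
qed

lemma lspan_base: "v \<in> S ==> v \<in> lspan S"
  unfolding lspan_def by (intro CollectI exI[of _ "{v}"] exI[of _ "%_. 1"]) auto

lemma lspan_least: "fsub K ==> S <= K ==> lspan S <= K"
  unfolding lspan_def using fsub_lincomb[of K _ "%v. v"] by blast

text \<open>Congruence modulo \<open>W\<close>, so that elements of the free space can be compared
  without forming cosets.\<close>

definition teq :: "('x => 'a::comm_ring_1) set => ('x => 'a) => ('x => 'a) => bool" where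
  "teq W f g \<longleftrightarrow> (%p. f p - g p) \<in> W"

context
  fixes W :: "('x => 'a::comm_ring_1) set"
  assumes W: "fsub W"
begin

lemma teq_refl [simp]: "teq W f f"
  unfolding teq_def using fsubD(1)[OF W] by simp

lemma teq_sym: "teq W f g ==> teq W g f"
  unfolding teq_def using fsubD(3)[OF W, of "%p. f p - g p" "-1"] by simp

lemma teq_trans [trans]: "teq W f g ==> teq W g h ==> teq W f h"
  unfolding teq_def using fsubD(2)[OF W, of "%p. f p - g p" "%p. g p - h p"] by simp

lemma teq_add: "teq W f g ==> teq W f' g' ==> teq W (%p. f p + f' p) (%p. g p + g' p)"
  unfolding teq_def using fsubD(2)[OF W, of "%p. f p - g p" "%p. f' p - g' p"] by (simp add: algebra_simps)

lemma teq_scale: "teq W f g ==> teq W (%p. c * f p) (%p. c * g p)"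
  unfolding teq_def using fsubD(3)[OF W, of "%p. f p - g p" c] by (simp add: algebra_simps)

lemma teq_sum: "(\<And>i. i \<in> I ==> teq W (f i) (g i)) ==> teq W (%p. \<Sum>i\<in>I. c i * f i p) (%p. \<Sum>i\<in>I. c i * g i p)"
  unfolding teq_def using fsub_lincomb[OF W, of I "%i p. f i p - g i p" c]
  by (simp add: sum_subtractf algebra_simps)

lemma cosetW_eq_iff: "cosetW W f = cosetW W g \<longleftrightarrow> teq W f g"
proof
  assume "cosetW W f = cosetW W g"
  moreover have "f \<in> cosetW W f" unfolding cosetW_def using fsubD(1)[OF W] by simp
  ultimately show "teq W f g" unfolding cosetW_def teq_def by auto
next
  assume "teq W f g"
  then have "teq W h f \<longleftrightarrow> teq W h g" for h using teq_trans teq_sym by blast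
  then show "cosetW W f = cosetW W g" unfolding cosetW_def teq_def by blast
qed

lemma rep_cosetW: "teq W (rep (cosetW W f)) f"
proof -
  have "f \<in> cosetW W f" unfolding cosetW_def using fsubD(1)[OF W] by simp
  then have "rep (cosetW W f) \<in> cosetW W f" unfolding rep_def by (metis someI)
  then show ?thesis unfolding cosetW_def teq_def by simp
qed

end

text \<open>The linear extension of \<open>B\<close> to the free space on pairs, curried because the
  target consists of functions of two arguments.\<close>

definition lext :: "('m => 'n => 'y => 'z => 'a::comm_ring_1) => ('m \<times> 'n => 'a) => 'y => 'z => 'a" where
  "lext B f = (%y z. \<Sum>q\<in>supp f. f q * B (fst q) (snd q) y z)"

lemma lext_superset:
  assumes "finite T" "supp f <= T"
  shows "lext B f y z = (\<Sum>q\<in>T. f q * B (fst q) (snd q) y z)"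
  unfolding lext_def using assms by (intro sum.mono_neutral_left) (auto simp: supp_def)

lemma supp_add: "supp (%p. f p + g p :: 'a::comm_ring_1) <= supp f \<union> supp g"
  by (auto simp: supp_def)

lemma supp_scale: "supp (%p. c * f p :: 'a::comm_ring_1) <= supp f"
  by (auto simp: supp_def)

lemma lext_add:
  assumes "finite (supp f)" "finite (supp g)"
  shows "lext B (%p. f p + g p) = (%y z. lext B f y z + lext B g y z)"
proof (intro ext)
  fix y z
  let ?T = "supp f \<union> supp g"
  have T: "finite ?T" using assms by simp
  show "lext B (%p. f p + g p) y z = lext B f y z + lext B g y z"
    unfolding lext_superset[OF T supp_add] lext_superset[OF T Un_upper1] lext_superset[OF T Un_upper2]
    by (simp add: sum.distrib distrib_right)
qed

lemma lext_scale:
  assumes "finite (supp f)"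
  shows "lext B (%p. c * f p) = (%y z. c * lext B f y z)"
proof (intro ext)
  fix y z
  show "lext B (%p. c * f p) y z = c * lext B f y z"
    unfolding lext_superset[OF assms supp_scale] lext_superset[OF assms subset_refl]
    by (simp add: sum_distrib_left mult.assoc)
qed

lemma supp_dlt [simp]: "supp (dlt q :: 'x => 'a::comm_ring_1) = {q}"
  by (auto simp: supp_def dlt_def)

lemma lext_dlt [simp]: "lext B (dlt q) = B (fst q) (snd q)"
  by (simp add: lext_def) (simp add: dlt_def)

lemma lext_lincomb:
  fixes B :: "'m => 'n => 'y => 'z => 'a::comm_ring_1"
  assumes "finite I"
  shows "lext B (%p. \<Sum>i\<in>I. c i * dlt (g i) p) = (%y z. \<Sum>i\<in>I. c i * B (fst (g i)) (snd (g i)) y z)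
     \<and> finite (supp (%p. \<Sum>i\<in>I. c i * (dlt (g i) p :: 'a)))"
  using assms
proof induction
  case empty
  then show ?case by (simp add: lext_def supp_def)
next
  case (insert i I)
  have fi: "finite (supp (%p. c i * (dlt (g i) p :: 'a)))" using finite_subset[OF supp_scale[of "c i" "dlt (g i)"]] by simp
  have "lext B (%p. c i * dlt (g i) p + (\<Sum>i\<in>I. c i * dlt (g i) p))
      = (%y z. lext B (%p. c i * dlt (g i) p) y z + lext B (%p. \<Sum>i\<in>I. c i * dlt (g i) p) y z)"
    using insert fi by (intro lext_add) auto
  moreover have "finite (supp (%p. c i * dlt (g i) p + (\<Sum>i\<in>I. c i * (dlt (g i) p :: 'a))))"
    by (rule finite_subset[OF supp_add]) (use fi insert.IH in simp)
  ultimately show ?case using insert lext_scale[of "dlt (g i)" B "c i"] by simp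
qed

lemma fsub_freesp: "fsub (freesp X :: ('x => 'a::comm_ring_1) set)"
  unfolding fsub_def freesp_def
proof (intro conjI ballI allI)
  fix u v :: "'x => 'a" assume "u \<in> {f. finite (supp f) \<and> supp f <= X}" "v \<in> {f. finite (supp f) \<and> supp f <= X}"
  then show "(%s. u s + v s) \<in> {f. finite (supp f) \<and> supp f <= X}"
    using supp_add[of u v] finite_subset[OF supp_add[of u v]] by auto
next
  fix c and v :: "'x => 'a" assume "v \<in> {f. finite (supp f) \<and> supp f <= X}"
  then show "(%s. c * v s) \<in> {f. finite (supp f) \<and> supp f <= X}"
    using supp_scale[of c v] finite_subset[OF supp_scale[of c v]] by auto
qed (auto simp: supp_def)

lemma dlt_freesp [simp]: "dlt q \<in> (freesp X :: ('x => 'a::comm_ring_1) set) \<longleftrightarrow> q \<in> X"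
  unfolding freesp_def by simp

text \<open>A faithful linear model of \<open>N\<close>. A record of type \<open>amod\<close>
  carries operations without axioms, so linear combinations in it are verified through an injective
  map into functions.\<close>

definition fmod :: "('a::comm_ring_1, 'r, 'v) amod => ('v => 'x => 'a) => bool" where
  "fmod N \<Phi> \<longleftrightarrow> inj_on \<Phi> (mcarr N) \<and>
     (\<forall>u\<in>mcarr N. \<forall>v\<in>mcarr N. madd N u v \<in> mcarr N \<and> \<Phi> (madd N u v) = (%y. \<Phi> u y + \<Phi> v y)) \<and>
     (\<forall>c. \<forall>v\<in>mcarr N. msmul N c v \<in> mcarr N \<and> \<Phi> (msmul N c v) = (%y. c * \<Phi> v y))"

context
  fixes M :: "('a::comm_ring_1,'r,'m) amod" and N :: "('a,'r,'n) amod" and R :: "'r set" and W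
  assumes W_def: "W = lspan (tens_rels M N R)"
begin

lemma tens_W: "fsub W"
  unfolding W_def by (rule fsub_lspan)

lemma teq_addl: "m \<in> mcarr M ==> m' \<in> mcarr M ==> n \<in> mcarr N ==>
    teq W (dlt (madd M m m', n)) (%p. dlt (m, n) p + dlt (m', n) p)"
  unfolding teq_def W_def diff_diff_eq[symmetric] by (rule lspan_base) (unfold tens_rels_def, blast)

lemma teq_addr: "m \<in> mcarr M ==> n \<in> mcarr N ==> n' \<in> mcarr N ==>
    teq W (dlt (m, madd N n n')) (%p. dlt (m, n) p + dlt (m, n') p)"
  unfolding teq_def W_def diff_diff_eq[symmetric] by (rule lspan_base) (unfold tens_rels_def, blast)

lemma teq_scalel: "m \<in> mcarr M ==> n \<in> mcarr N ==> teq W (dlt (msmul M c m, n)) (%p. c * dlt (m, n) p)"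
  unfolding teq_def W_def by (rule lspan_base) (unfold tens_rels_def, blast)

lemma teq_scaler: "m \<in> mcarr M ==> n \<in> mcarr N ==> teq W (dlt (m, msmul N c n)) (%p. c * dlt (m, n) p)"
  unfolding teq_def W_def by (rule lspan_base) (unfold tens_rels_def, blast)

lemma teq_act: "r \<in> R ==> m \<in> mcarr M ==> n \<in> mcarr N ==> teq W (dlt (mact M r m, n)) (dlt (m, mact N r n))"
  unfolding teq_def W_def by (rule lspan_base) (unfold tens_rels_def, blast)

text \<open>The induction peels off one term by adding its negative to \<open>X\<close>. That adding
  the term back returns \<open>X\<close> follows from injectivity of the model, in place of module
  axioms.\<close>

lemma teq_lincomb_right:
  assumes "fmod N \<Phi>" "finite I" "m \<in> mcarr M" "\<And>i. i \<in> I ==> g i \<in> mcarr N" "X \<in> mcarr N"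
    and "\<Phi> X = (%y. \<Sum>i\<in>I. c i * \<Phi> (g i) y)"
  shows "teq W (dlt (m, X)) (%p. \<Sum>i\<in>I. c i * dlt (m, g i) p)"
  using assms(2,4-6)
proof (induction I arbitrary: X)
  case empty
  have "msmul N 0 X \<in> mcarr N" "\<Phi> (msmul N 0 X) = \<Phi> X" using assms(1) empty by (auto simp: fmod_def)
  then have "X = msmul N 0 X" using assms(1) empty unfolding fmod_def inj_on_def by metis
  then show ?case using teq_scaler[OF assms(3), of X 0] empty by simp
next
  case (insert i I)
  define Y where "Y = madd N X (msmul N (- c i) (g i))"
  have gi: "msmul N (- c i) (g i) \<in> mcarr N" "\<Phi> (msmul N (- c i) (g i)) = (%y. - c i * \<Phi> (g i) y)"
    "msmul N (c i) (g i) \<in> mcarr N" "\<Phi> (msmul N (c i) (g i)) = (%y. c i * \<Phi> (g i) y)"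
    using assms(1) insert.prems(1)[of i] unfolding fmod_def by auto
  have Y: "Y \<in> mcarr N" "\<Phi> Y = (%y. \<Phi> X y - c i * \<Phi> (g i) y)"
    using assms(1) insert.prems(2) gi unfolding Y_def fmod_def by auto
  have Z: "madd N Y (msmul N (c i) (g i)) \<in> mcarr N" "\<Phi> (madd N Y (msmul N (c i) (g i))) = \<Phi> X"
    using assms(1) Y gi unfolding fmod_def by auto
  then have X: "madd N Y (msmul N (c i) (g i)) = X"
    using assms(1) insert.prems(2) unfolding fmod_def inj_on_def by metis
  have "teq W (dlt (m, Y)) (%p. \<Sum>i\<in>I. c i * dlt (m, g i) p)"
    by (rule insert.IH) (use insert Y in \<open>auto simp: fun_eq_iff\<close>)
  then have "teq W (%p. dlt (m, Y) p + dlt (m, msmul N (c i) (g i)) p) (%p. (\<Sum>i\<in>I. c i * dlt (m, g i) p) + c i * dlt (m, g i) p)"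
    using teq_scaler[OF assms(3) insert.prems(1)[of i]] by (intro teq_add[OF tens_W]) auto
  with teq_addr[OF assms(3) Y(1) gi(3)] have "teq W (dlt (m, X)) (%p. (\<Sum>i\<in>I. c i * dlt (m, g i) p) + c i * dlt (m, g i) p)"
    unfolding X by (rule teq_trans[OF tens_W])
  then show ?case using insert by (simp add: add.commute)
qed

lemma teq_lincomb_left:
  assumes "fmod M \<Phi>" "finite I" "n \<in> mcarr N" "\<And>i. i \<in> I ==> g i \<in> mcarr M" "X \<in> mcarr M"
    and "\<Phi> X = (%y. \<Sum>i\<in>I. c i * \<Phi> (g i) y)"
  shows "teq W (dlt (X, n)) (%p. \<Sum>i\<in>I. c i * dlt (g i, n) p)"
  using assms(2,4-6)
proof (induction I arbitrary: X)
  case empty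
  have "msmul M 0 X \<in> mcarr M" "\<Phi> (msmul M 0 X) = \<Phi> X" using assms(1) empty by (auto simp: fmod_def)
  then have "X = msmul M 0 X" using assms(1) empty unfolding fmod_def inj_on_def by metis
  then show ?case using teq_scalel[of X n 0] empty assms(3) by simp
next
  case (insert i I)
  define Y where "Y = madd M X (msmul M (- c i) (g i))"
  have gi: "msmul M (- c i) (g i) \<in> mcarr M" "\<Phi> (msmul M (- c i) (g i)) = (%y. - c i * \<Phi> (g i) y)"
    "msmul M (c i) (g i) \<in> mcarr M" "\<Phi> (msmul M (c i) (g i)) = (%y. c i * \<Phi> (g i) y)"
    using assms(1) insert.prems(1)[of i] unfolding fmod_def by auto
  have Y: "Y \<in> mcarr M" "\<Phi> Y = (%y. \<Phi> X y - c i * \<Phi> (g i) y)"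
    using assms(1) insert.prems(2) gi unfolding Y_def fmod_def by auto
  have Z: "madd M Y (msmul M (c i) (g i)) \<in> mcarr M" "\<Phi> (madd M Y (msmul M (c i) (g i))) = \<Phi> X"
    using assms(1) Y gi unfolding fmod_def by auto
  then have X: "madd M Y (msmul M (c i) (g i)) = X"
    using assms(1) insert.prems(2) unfolding fmod_def inj_on_def by metis
  have "teq W (dlt (Y, n)) (%p. \<Sum>i\<in>I. c i * dlt (g i, n) p)"
    by (rule insert.IH) (use insert Y in \<open>auto simp: fun_eq_iff\<close>)
  then have "teq W (%p. dlt (Y, n) p + dlt (msmul M (c i) (g i), n) p) (%p. (\<Sum>i\<in>I. c i * dlt (g i, n) p) + c i * dlt (g i, n) p)"
    using teq_scalel[OF insert.prems(1)[of i] assms(3)] by (intro teq_add[OF tens_W]) auto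
  with teq_addl[OF Y(1) gi(3) assms(3)] have "teq W (dlt (X, n)) (%p. (\<Sum>i\<in>I. c i * dlt (g i, n) p) + c i * dlt (g i, n) p)"
    unfolding X by (rule teq_trans[OF tens_W])
  then show ?case using insert by (simp add: add.commute)
qed

end

definition mclosed :: "'r set => ('a,'r,'v) amod => bool" where
  "mclosed R M \<longleftrightarrow> mzero M \<in> mcarr M \<and> (\<forall>u\<in>mcarr M. \<forall>v\<in>mcarr M. madd M u v \<in> mcarr M) \<and>
     (\<forall>c. \<forall>v\<in>mcarr M. msmul M c v \<in> mcarr M) \<and> (\<forall>r\<in>R. \<forall>v\<in>mcarr M. mact M r v \<in> mcarr M)"

definition miso :: "'r set => ('a,'r,'v) amod => ('a,'r,'w) amod => ('v => 'w) => bool" where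
  "miso R M N \<phi> \<longleftrightarrow> is_hom R M N \<phi> \<and> bij_betw \<phi> (mcarr M) (mcarr N) \<and> \<phi> (mzero M) = mzero N \<and> mclosed R M"

text \<open>\<open>B\<close> induces a map out of the tensor product, and \<open>\<Psi>\<close> is an inverse to it that is only
  linear modulo the tensor relations.\<close>

lemma tensor_miso:
  fixes M :: "('a::comm_ring_1,'r,'m) amod" and N :: "('a,'r,'n) amod"
    and E :: "('a,'b,'y => 'z => 'a) amod" and B :: "'m => 'n => 'y => 'z => 'a"
  assumes Bin: "\<And>m n. m \<in> mcarr M ==> n \<in> mcarr N ==> B m n \<in> mcarr E"
    and B_addl: "\<And>m m' n. m \<in> mcarr M ==> m' \<in> mcarr M ==> n \<in> mcarr N ==>
        B (madd M m m') n = (%y z. B m n y z + B m' n y z)"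
    and B_addr: "\<And>m n n'. m \<in> mcarr M ==> n \<in> mcarr N ==> n' \<in> mcarr N ==>
        B m (madd N n n') = (%y z. B m n y z + B m n' y z)"
    and B_scalel: "\<And>c m n. m \<in> mcarr M ==> n \<in> mcarr N ==> B (msmul M c m) n = (%y z. c * B m n y z)"
    and B_scaler: "\<And>c m n. m \<in> mcarr M ==> n \<in> mcarr N ==> B m (msmul N c n) = (%y z. c * B m n y z)"
    and B_bal: "\<And>r m n. r \<in> R ==> m \<in> mcarr M ==> n \<in> mcarr N ==> B (mact M r m) n = B m (mact N r n)"
    and Eops: "mzero E = (%y z. 0)" "madd E = (%f g y z. f y z + g y z)" "msmul E = (%c f y z. c * f y z)"
    and Ecl: "mclosed R' E" and Mcl: "mclosed R M" and Ncl: "mclosed R N"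
    and Lcl: "\<And>b m. b \<in> R' ==> m \<in> mcarr M ==> L b m \<in> mcarr M"
    and Lact: "\<And>b m n. b \<in> R' ==> m \<in> mcarr M ==> n \<in> mcarr N ==> B (L b m) n = mact E b (B m n)"
    and actlin: "\<And>b c f g. b \<in> R' ==> f \<in> mcarr E ==> g \<in> mcarr E ==>
        mact E b (%y z. f y z + c * g y z) = (%y z. mact E b f y z + c * mact E b g y z)"
    and W_def: "W = lspan (tens_rels M N R)"
    and Psi: "\<And>m n. m \<in> mcarr M ==> n \<in> mcarr N ==> teq W (dlt (m, n)) (\<Psi> (B m n))"
    and Psi_lin: "\<And>c f g. f \<in> mcarr E ==> g \<in> mcarr E ==>
        teq W (\<Psi> (%y z. f y z + c * g y z)) (%p. \<Psi> f p + c * \<Psi> g p)"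
    and Psi_in: "\<And>f. f \<in> mcarr E ==> \<Psi> f \<in> freesp (mcarr M \<times> mcarr N)"
    and Psi_inv: "\<And>f. f \<in> mcarr E ==> lext B (\<Psi> f) = f"
  shows "miso R' (tensor M N R L) E (%X. lext B (rep X))"
proof -
  let ?F = "freesp (mcarr M \<times> mcarr N) :: ('m \<times> 'n => 'a) set"
  note W = fsub_lspan[of "tens_rels M N R", folded W_def]
  have T: "tensor M N R L = \<lparr> mcarr = cosetW W ` ?F, mzero = cosetW W (%p. 0),
       madd = (%X Y. cosetW W (%p. rep X p + rep Y p)), msmul = (%c X. cosetW W (%p. c * rep X p)),
       mact = (%b X. cosetW W (ften L b (rep X))) \<rparr>"
    unfolding tensor_def W_def Let_def ..
  have E0: "(%y z. 0) \<in> mcarr E" and Eadd: "\<And>f g. f \<in> mcarr E ==> g \<in> mcarr E ==> (%y z. f y z + g y z) \<in> mcarr E"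
    and Esc: "\<And>c f. f \<in> mcarr E ==> (%y z. c * f y z) \<in> mcarr E"
    and Eact: "\<And>b f. b \<in> R' ==> f \<in> mcarr E ==> mact E b f \<in> mcarr E"
    using Ecl unfolding mclosed_def Eops by blast+
  have fin: "finite (supp f)" if "f \<in> ?F" for f using that unfolding freesp_def by simp
  \<comment> \<open>The elements on which the linear extension of \<open>B\<close> vanishes. All
    tensor relations lie in \<open>K\<close>, so the extension descends to the quotient.\<close>
  define K where "K = {f \<in> ?F. lext B f = (%y z. 0)}"
  have fsubK: "fsub K"
    unfolding fsub_def K_def
  proof (intro conjI ballI allI)
    show "(%s. 0) \<in> {f \<in> ?F. lext B f = (%y z. 0)}"
      using fsubD(1)[OF fsub_freesp] by (simp add: lext_def supp_def)
  next
    fix u v assume "u \<in> {f \<in> ?F. lext B f = (%y z. 0)}" "v \<in> {f \<in> ?F. lext B f = (%y z. 0)}"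
    then show "(%s. u s + v s) \<in> {f \<in> ?F. lext B f = (%y z. 0)}"
      using fsubD(2)[OF fsub_freesp, of u "mcarr M \<times> mcarr N" v] fin lext_add[of u v B] by simp
  next
    fix c v assume "v \<in> {f \<in> ?F. lext B f = (%y z. 0)}"
    then show "(%s. c * v s) \<in> {f \<in> ?F. lext B f = (%y z. 0)}"
      using fsubD(3)[OF fsub_freesp, of v "mcarr M \<times> mcarr N" c] fin lext_scale[of v B c] by simp
  qed
  have d: "dlt (m, n) \<in> ?F" if "m \<in> mcarr M" "n \<in> mcarr N" for m n using that by simp
  have la: "lext B (%p. f p + c * g p) = (%y z. lext B f y z + c * lext B g y z)"
    if "f \<in> ?F" "g \<in> ?F" for f g c
    using lext_add[OF fin[OF that(1)] fin[OF fsubD(3)[OF fsub_freesp that(2), of c]], of B]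
    unfolding lext_scale[OF fin[OF that(2)]] .
  have lx2: "lext B (%p. f p - c * g p) = (%y z. lext B f y z - c * lext B g y z)"
    if "f \<in> ?F" "g \<in> ?F" for f g c
    using la[OF that, of "- c"] by simp
  have lx3: "lext B (%p. f p - g p - h p) = (%y z. lext B f y z - lext B g y z - lext B h y z)"
    if "f \<in> ?F" "g \<in> ?F" "h \<in> ?F" for f g h
    using lx2[OF fsub_diff[OF fsub_freesp that(1,2)] that(3), of 1] lx2[OF that(1,2), of 1] by simp
  have F3: "(%p. f p - g p - h p) \<in> ?F" if "f \<in> ?F" "g \<in> ?F" "h \<in> ?F" for f g h
    using that fsub_diff[OF fsub_freesp] by blast
  have F2: "(%p. f p - c * g p) \<in> ?F" if "f \<in> ?F" "g \<in> ?F" for f g c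
    using that fsub_diff[OF fsub_freesp] fsubD(3)[OF fsub_freesp] by blast
  have Mc: "madd M m m' \<in> mcarr M" "msmul M c m \<in> mcarr M" "r \<in> R ==> mact M r m \<in> mcarr M"
    if "m \<in> mcarr M" "m' \<in> mcarr M" for m m' c r using Mcl that unfolding mclosed_def by blast+
  have Nc: "madd N m m' \<in> mcarr N" "msmul N c m \<in> mcarr N" "r \<in> R ==> mact N r m \<in> mcarr N"
    if "m \<in> mcarr N" "m' \<in> mcarr N" for m m' c r using Ncl that unfolding mclosed_def by blast+
  have r1: "(%p. dlt (madd M m m', n) p - dlt (m, n) p - dlt (m', n) p) \<in> K"
    if "m \<in> mcarr M" "m' \<in> mcarr M" "n \<in> mcarr N" for m m' n
    using that Mc F3 lx3 d B_addl unfolding K_def by simp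
  have r2: "(%p. dlt (m, madd N n n') p - dlt (m, n) p - dlt (m, n') p) \<in> K"
    if "m \<in> mcarr M" "n \<in> mcarr N" "n' \<in> mcarr N" for m n n'
    using that Nc F3 lx3 d B_addr unfolding K_def by simp
  have r3: "(%p. dlt (msmul M c m, n) p - c * dlt (m, n) p) \<in> K"
    if "m \<in> mcarr M" "n \<in> mcarr N" for c m n
    using that Mc F2 lx2 d B_scalel unfolding K_def by simp
  have r4: "(%p. dlt (m, msmul N c n) p - c * dlt (m, n) p) \<in> K"
    if "m \<in> mcarr M" "n \<in> mcarr N" for c m n
    using that Nc F2 lx2 d B_scaler unfolding K_def by simp
  have r5: "(%p. dlt (mact M r m, n) p - dlt (m, mact N r n) p) \<in> K"
    if "r \<in> R" "m \<in> mcarr M" "n \<in> mcarr N" for r m n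
    using that Mc Nc F2[of "dlt (mact M r m, n)" "dlt (m, mact N r n)" 1]
      lx2[of "dlt (mact M r m, n)" "dlt (m, mact N r n)" 1] d B_bal unfolding K_def by simp
  have WK: "W <= K"
    unfolding W_def
  proof (rule lspan_least[OF fsubK], rule subsetI)
    fix f assume "f \<in> tens_rels M N R"
    then show "f \<in> K" unfolding tens_rels_def using r1 r2 r3 r4 r5 by blast
  qed
  have lext_teq: "lext B f = lext B g" if "teq W f g" "f \<in> ?F" "g \<in> ?F" for f g
  proof -
    have "(%p. f p - 1 * g p) \<in> K" using that(1) WK unfolding teq_def by auto
    then have "(%y z. lext B f y z - 1 * lext B g y z) = (%y z. 0)"
      using lx2[OF that(2,3), of 1] unfolding K_def by simp
    then show ?thesis by (simp add: fun_eq_iff)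
  qed
  have repF: "rep (cosetW W f) \<in> ?F" if "f \<in> ?F" for f
  proof -
    have "(%p. rep (cosetW W f) p - f p) \<in> ?F" using rep_cosetW[OF W, of f] WK unfolding teq_def K_def by blast
    from fsubD(2)[OF fsub_freesp this that] show ?thesis by simp
  qed
  have lrep: "lext B (rep (cosetW W f)) = lext B f" if "f \<in> ?F" for f
    using lext_teq[OF rep_cosetW[OF W] repF[OF that] that] .
  have lextE: "lext B f \<in> mcarr E" if "f \<in> ?F" for f
  proof -
    have sub: "finite (supp f)" "supp f <= mcarr M \<times> mcarr N" using that unfolding freesp_def by auto
    have "(%y z. \<Sum>q\<in>T. f q * B (fst q) (snd q) y z) \<in> mcarr E" if "finite T" "T <= mcarr M \<times> mcarr N" for T
      using that
    proof induction
      case (insert q T)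
      then have "B (fst q) (snd q) \<in> mcarr E" using Bin by auto
      then show ?case using insert Eadd[OF Esc[of "B (fst q) (snd q)" "f q"]] by simp
    qed (simp add: E0)
    then show ?thesis using sub unfolding lext_def by blast
  qed
  \<comment> \<open>Every element is congruent to \<open>\<Psi>\<close> of its image, by induction
    on the support. This gives injectivity without computing the kernel of the extension.\<close>
  have main: "teq W f (\<Psi> (lext B f))" if "f \<in> ?F" for f
  proof -
    have sub: "finite (supp f)" "supp f <= mcarr M \<times> mcarr N" using that unfolding freesp_def by auto
    have "\<forall>f. supp f <= T --> teq W f (\<Psi> (lext B f))" if "finite T" "T <= mcarr M \<times> mcarr N" for T
      using that
    proof induction
      case empty
      have "teq W (\<Psi> (%y z. 0 + (-1) * 0)) (%p. \<Psi> (%y z. 0) p + (-1) * \<Psi> (%y z. 0) p)"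
        using Psi_lin[OF E0 E0, of "-1"] .
      then have "teq W (%p. 0) (\<Psi> (%y z. 0))" using teq_sym[OF W] by simp
      moreover have "f = (%p. 0) \<and> lext B f = (%y z. 0)" if "supp f <= {}" for f
      proof
        show "f = (%p. 0)" using that by (auto simp: supp_def)
        show "lext B f = (%y z. 0)" using that by (simp add: lext_def)
      qed
      ultimately show ?case by metis
    next
      case (insert q T)
      show ?case
      proof (rule allI, rule impI)
        fix f :: "'m \<times> 'n => 'a" assume f: "supp f <= insert q T"
        define f' where "f' = f(q := 0)"
        have f'T: "supp f' <= T" using f unfolding f'_def supp_def by (auto split: if_splits)
        have f': "supp f' <= T" "supp f' <= mcarr M \<times> mcarr N" "finite (supp f')"
          using f'T insert.prems insert.hyps(1) finite_subset[OF f'T] by blast+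
        have f'F: "f' \<in> ?F" using f' by (simp add: freesp_def)
        have q: "q = (fst q, snd q)" "fst q \<in> mcarr M" "snd q \<in> mcarr N" using insert.prems by auto
        have fe: "f = (%p. f' p + f q * dlt q p)" unfolding f'_def dlt_def by auto
        have le: "lext B f = (%y z. lext B f' y z + f q * B (fst q) (snd q) y z)"
        proof -
          have "finite (supp (%p. f q * (dlt q p :: 'a)))" using finite_subset[OF supp_scale[of "f q" "dlt q"]] by simp
          then have "lext B (%p. f' p + f q * dlt q p) = (%y z. lext B f' y z + lext B (%p. f q * dlt q p) y z)"
            by (rule lext_add[OF f'(3)])
          then show ?thesis using lext_scale[of "dlt q" B "f q"] fe by simp
        qed
        have "teq W (%p. f' p + f q * dlt q p) (%p. \<Psi> (lext B f') p + f q * \<Psi> (B (fst q) (snd q)) p)"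
        proof (rule teq_add[OF W _ teq_scale[OF W]])
          show "teq W f' (\<Psi> (lext B f'))" using insert f' by simp
          show "teq W (dlt q) (\<Psi> (B (fst q) (snd q)))" using Psi[OF q(2,3)] by simp
        qed
        also have "teq W (%p. \<Psi> (lext B f') p + f q * \<Psi> (B (fst q) (snd q)) p)
            (\<Psi> (%y z. lext B f' y z + f q * B (fst q) (snd q) y z))"
          by (rule teq_sym[OF W Psi_lin[OF lextE[OF f'F] Bin[OF q(2,3)]]])
        finally (teq_trans[OF W]) show "teq W f (\<Psi> (lext B f))" using fe le by simp
      qed
    qed
    then show ?thesis using sub by blast
  qed
  have act0: "mact E b (%y z. 0) = (%y z. 0)" if "b \<in> R'" for b
    using actlin[OF that E0 E0, of "-1"] by (simp add: fun_eq_iff)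
  have actsum: "mact E b (%y z. \<Sum>i\<in>I. c i * f i y z) = (%y z. \<Sum>i\<in>I. c i * mact E b (f i) y z)
      \<and> (%y z. \<Sum>i\<in>I. c i * f i y z) \<in> mcarr E"
    if "b \<in> R'" "finite I" "\<And>i. i \<in> I ==> f i \<in> mcarr E" for b and I :: "('m \<times> 'n) set" and c f
    using that(2,3)
  proof induction
    case empty
    then show ?case using act0[OF that(1)] E0 by simp
  next
    case (insert i I)
    have 1: "mact E b (%y z. \<Sum>i\<in>I. c i * f i y z) = (%y z. \<Sum>i\<in>I. c i * mact E b (f i) y z)"
      "(%y z. \<Sum>i\<in>I. c i * f i y z) \<in> mcarr E" using insert by auto
    have 2: "f i \<in> mcarr E" using insert.prems by simp
    have "mact E b (%y z. (\<Sum>i\<in>I. c i * f i y z) + c i * f i y z)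
        = (%y z. (\<Sum>i\<in>I. c i * mact E b (f i) y z) + c i * mact E b (f i) y z)"
      using actlin[OF that(1) 1(2) 2, of "c i"] unfolding 1(1) .
    then show ?case using insert.hyps Eadd[OF Esc[OF 2, of "c i"] 1(2)] by (simp add: add.commute)
  qed
  have ftenF: "ften L b f \<in> ?F \<and> lext B (ften L b f) = mact E b (lext B f)" if b: "b \<in> R'" and f: "f \<in> ?F" for b f
  proof -
    have sub: "finite (supp f)" "supp f <= mcarr M \<times> mcarr N" using f unfolding freesp_def by auto
    define g where "g = (%q. (L b (fst q), snd q) :: 'm \<times> 'n)"
    have ft: "ften L b f = (%p. \<Sum>q\<in>supp f. f q * dlt (g q) p)"
      unfolding ften_def g_def dlt_def by (intro ext sum.cong) auto
    have gF: "dlt (g q) \<in> ?F" if "q \<in> supp f" for q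
    proof -
      have "q \<in> mcarr M \<times> mcarr N" using that sub by blast
      then show ?thesis using Lcl[OF b, of "fst q"] unfolding g_def by (simp add: mem_Times_iff)
    qed
    have BE: "B (fst q) (snd q) \<in> mcarr E" "B (fst (g q)) (snd (g q)) = mact E b (B (fst q) (snd q))" if "q \<in> supp f" for q
    proof -
      have "q \<in> mcarr M \<times> mcarr N" using that sub by blast
      then show "B (fst q) (snd q) \<in> mcarr E" "B (fst (g q)) (snd (g q)) = mact E b (B (fst q) (snd q))"
        using Bin Lact[OF b] by (auto simp: g_def mem_Times_iff)
    qed
    have "ften L b f \<in> ?F" unfolding ft by (rule fsub_lincomb[OF fsub_freesp gF])
    moreover have "lext B (ften L b f) = (%y z. \<Sum>q\<in>supp f. f q * mact E b (B (fst q) (snd q)) y z)"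
      unfolding ft using lext_lincomb[OF sub(1), of B f g] BE(2) by (auto simp: fun_eq_iff intro!: sum.cong)
    moreover have "... = mact E b (lext B f)"
      unfolding lext_def using actsum[OF b sub(1), of "%q. B (fst q) (snd q)" f] BE(1) by simp
    ultimately show ?thesis by simp
  qed
  have add: "(%p. rep (cosetW W f) p + rep (cosetW W g) p) \<in> ?F" if "f \<in> ?F" "g \<in> ?F" for f g
    using fsubD(2)[OF fsub_freesp repF[OF that(1)] repF[OF that(2)]] .
  have scale: "(%p. c * rep (cosetW W f) p) \<in> ?F" if "f \<in> ?F" for f c
    using fsubD(3)[OF fsub_freesp repF[OF that]] .
  have cl: "mclosed R' (tensor M N R L)"
    unfolding mclosed_def T
    using fsubD(1)[OF fsub_freesp, of "mcarr M \<times> mcarr N"] add scale ftenF[OF _ repF] by auto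
  have hom: "is_hom R' (tensor M N R L) E (%X. lext B (rep X))"
    unfolding is_hom_def T amod.simps
  proof (intro conjI ballI allI)
    fix X assume "X \<in> cosetW W ` ?F"
    then obtain f where f: "X = cosetW W f" "f \<in> ?F" by blast
    show "lext B (rep X) \<in> mcarr E" using f lextE repF by blast
    fix c
    show "lext B (rep (cosetW W (%p. c * rep X p))) = msmul E c (lext B (rep X))"
      unfolding f(1) lrep[OF scale[OF f(2)]] lext_scale[OF fin[OF repF[OF f(2)]]] Eops ..
  next
    fix X b assume "X \<in> cosetW W ` ?F" and b: "b \<in> R'"
    then obtain f where f: "X = cosetW W f" "f \<in> ?F" by blast
    show "lext B (rep (cosetW W (ften L b (rep X)))) = mact E b (lext B (rep X))"
      unfolding f(1) using lrep ftenF[OF b repF[OF f(2)]] by simp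
  next
    fix X Y assume "X \<in> cosetW W ` ?F" "Y \<in> cosetW W ` ?F"
    then obtain f g where f: "X = cosetW W f" "f \<in> ?F" and g: "Y = cosetW W g" "g \<in> ?F" by blast
    show "lext B (rep (cosetW W (%p. rep X p + rep Y p))) = madd E (lext B (rep X)) (lext B (rep Y))"
      unfolding f(1) g(1) lrep[OF add[OF f(2) g(2)]] lext_add[OF fin[OF repF[OF f(2)]] fin[OF repF[OF g(2)]]] Eops ..
  qed
  have bij: "bij_betw (%X. lext B (rep X)) (mcarr (tensor M N R L)) (mcarr E)"
    unfolding bij_betw_def T amod.simps
  proof
    show "inj_on (%X. lext B (rep X)) (cosetW W ` ?F)"
    proof (rule inj_onI)
      fix X Y assume "X \<in> cosetW W ` ?F" "Y \<in> cosetW W ` ?F" and eq: "lext B (rep X) = lext B (rep Y)"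
      then obtain f g where f: "X = cosetW W f" "f \<in> ?F" and g: "Y = cosetW W g" "g \<in> ?F" by blast
      have "lext B f = lext B g" using eq lrep f g by simp
      then have "teq W f g" using main[OF f(2)] main[OF g(2)] teq_trans[OF W] teq_sym[OF W] by metis
      then show "X = Y" unfolding f(1) g(1) cosetW_eq_iff[OF W] .
    qed
    show "(%X. lext B (rep X)) ` cosetW W ` ?F = mcarr E"
    proof
      show "(%X. lext B (rep X)) ` cosetW W ` ?F <= mcarr E" using lextE repF by blast
      show "mcarr E <= (%X. lext B (rep X)) ` cosetW W ` ?F"
      proof
        fix \<phi> assume "\<phi> \<in> mcarr E"
        then have "\<phi> = lext B (rep (cosetW W (\<Psi> \<phi>)))" "\<Psi> \<phi> \<in> ?F" using Psi_in Psi_inv lrep by simp_all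
        then show "\<phi> \<in> (%X. lext B (rep X)) ` cosetW W ` ?F" by blast
      qed
    qed
  qed
  have z: "lext B (rep (mzero (tensor M N R L))) = mzero E"
    unfolding T amod.simps Eops lrep[OF fsubD(1)[OF fsub_freesp]] by (simp add: lext_def supp_def)
  show ?thesis unfolding miso_def using hom bij z cl by blast
qed

subsection \<open>Half diagrams and equivariant functions on them\<close>

text \<open>These diagrams will be the basis of \<open>Ileft\<close>, where right multiplication by
  \<open>udiag\<close> has isolated all bottom vertices beyond \<open>m\<close>.\<close>

definition Hd :: "nat => nat => diag set" where
  "Hd n m = {d \<in> Dg n. (\<forall>i\<in>{1..m}. \<exists>j. {Top j, Bot i} \<in> d) \<and> (\<forall>i v. m < i --> {Bot i, v} \<notin> d)}"

lemma HdD: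
  assumes "d \<in> Hd n m"
  shows "d \<in> Dg n" "i \<in> {1..m} ==> \<exists>j. {Top j, Bot i} \<in> d" "m < i ==> {Bot i, v} \<notin> d"
  using assms unfolding Hd_def by simp_all

lemma HdI:
  assumes "d \<in> Dg n" "\<And>i. i \<in> {1..m} ==> \<exists>j. {Top j, Bot i} \<in> d" "\<And>i v. m < i ==> {Bot i, v} \<notin> d"
  shows "d \<in> Hd n m"
  using assms unfolding Hd_def by simp

lemma finite_Hd [simp]: "finite (Hd n m)"
  using finite_subset[OF _ finite_Dg[of n], of "Hd n m"] unfolding Hd_def by blast

lemma Hd_mono: "n <= n' ==> Hd n m <= Hd n' m"
  using Dg_mono[of n n'] unfolding Hd_def by blast

lemma rt_isolated:
  assumes \<sigma>: "\<sigma> permutes S" and iso: "\<And>w. {Bot (\<sigma> i), w} \<notin> d"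
  shows "{Bot i, v} \<notin> rt \<sigma> d"
proof (cases v)
  case (Top j)
  have "{Top j, Bot (\<sigma> i)} \<notin> d" using iso[of "Top j"] by (simp add: insert_commute)
  then show ?thesis using rt_edge(1)[OF \<sigma>, of j i d] Top by (simp add: insert_commute)
next
  case (Bot j)
  then show ?thesis using rt_edge(3)[OF \<sigma>, of i j d] iso by simp
qed

lemma Hd_rt:
  assumes \<sigma>: "\<sigma> permutes {1..m}" and m: "m <= n" and d: "d \<in> Hd n m"
  shows "rt \<sigma> d \<in> Hd n m"
proof (rule HdI)
  show "rt \<sigma> d \<in> Dg n" using rt_Dg[OF \<sigma> m HdD(1)[OF d]] .
next
  fix i assume "i \<in> {1..m}"
  then have "\<sigma> i \<in> {1..m}" using permutes_in_image[OF \<sigma>] by blast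
  then obtain j where "{Top j, Bot (\<sigma> i)} \<in> d" using HdD(2)[OF d] by blast
  then show "\<exists>j. {Top j, Bot i} \<in> rt \<sigma> d" using rt_edge(1)[OF \<sigma>] by blast
next
  fix i v assume i: "m < i"
  then have "\<sigma> i = i" using permutes_not_in[OF \<sigma>] by simp
  then show "{Bot i, v} \<notin> rt \<sigma> d" using rt_isolated[OF \<sigma>] HdD(3)[OF d i] by simp
qed

lemma Hd_rt_iff:
  assumes \<sigma>: "\<sigma> permutes {1..m}" and m: "m <= n"
  shows "rt \<sigma> d \<in> Hd n m \<longleftrightarrow> d \<in> Hd n m"
  using Hd_rt[OF \<sigma> m, of d] Hd_rt[OF permutes_inv[OF \<sigma>] m, of "rt \<sigma> d"] rt_inv(2)[OF \<sigma>, of d] by auto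

lemma rt_bij:
  assumes \<sigma>: "\<sigma> permutes {1..m}" and m: "m <= n"
  shows "bij_betw (rt \<sigma>) (Hd n m) (Hd n m)"
  by (rule bij_betw_byWitness[where f' = "rt (inv \<sigma>)"])
     (use Hd_rt[OF \<sigma> m] Hd_rt[OF permutes_inv[OF \<sigma>] m] rt_inv[OF \<sigma>] in auto)

text \<open>Bottom arcs of the lower factor survive in a product, and so do isolated bottom
  vertices, so a defect of \<open>d\<close> cannot be repaired from above. Dropping the products
  that leave \<open>Hd n m\<close> is therefore consistent.\<close>

lemma Gp_in_HdD:
  assumes a: "a \<in> Dg n" and d: "d \<in> Dg n" and iso: "\<And>i v. m < i ==> {Bot i, v} \<notin> d"
    and G: "Gp n a d \<in> Hd n m"
  shows "d \<in> Hd n m"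
proof (rule HdI[OF d _ iso])
  fix i assume i: "i \<in> {1..m}"
  obtain j where j: "{Top j, Bot i} \<in> Gp n a d" using HdD(2)[OF G i] by blast
  then have j': "{Bot i, Top j} \<in> Gp n a d" by (simp add: insert_commute)
  have in_n: "Bot i \<in> verts n" using Dg_edgeD(2)[OF Gp_Dg[OF a d] j'] .
  obtain w where w: "{Bot i, w} \<in> d" using isolated_Bot_Gp[OF a d, of i "Top j"] j' by blast
  show "\<exists>j. {Top j, Bot i} \<in> d"
  proof (cases w)
    case (Top k)
    then have "{Top k, Bot i} \<in> d" using w by (simp add: insert_commute)
    then show ?thesis by blast
  next
    case (Bot k)
    have "{Bot i, Bot k} \<in> Gp n a d"
    proof (subst edge_iff_compat[OF Gp_Dg[OF a d]])
      show "Bot i \<in> verts n" "Bot k \<in> verts n" "Bot i ~= Bot k"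
        using Dg_edgeD[OF d w] Bot by auto
      show "\<forall>A B. A <= {1..n} --> B <= {1..n} --> dcompat (Gp n a d) A B --> vlab A B (Bot i) = vlab A B (Bot k)"
      proof (rule allI, rule allI, rule impI, rule impI, rule impI)
        fix A B assume AB: "A <= {1..n}" "B <= {1..n}" and co: "dcompat (Gp n a d) A B"
        obtain C where "C <= {1..n}" "dcompat a A C" "dcompat d C B" by (rule compat_GpD[OF a d AB co])
        then have "vlab C B (Bot i) = vlab C B (Bot k)" using w Bot unfolding dcompat_def by blast
        then show "vlab A B (Bot i) = vlab A B (Bot k)" by simp
      qed
    qed
    then show ?thesis using Dg_partner[OF Gp_Dg[OF a d] j'] by blast
  qed
qed

text \<open>A vertical arc is determined by its bottom end, and only \<open>m\<close> bottom ends
  are available; having \<open>m\<close> vertical arcs means that all of them are used.\<close>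

lemma nvert_eq_iff:
  assumes d: "d \<in> Dg n" and iso: "\<And>i v. m < i ==> {Bot i, v} \<notin> d"
  shows "nvert d = m \<longleftrightarrow> d \<in> Hd n m"
proof -
  define Ev where "Ev = {e \<in> d. \<exists>i j. e = {Top i, Bot j}}"
  define T where "T = {j \<in> {1..m}. \<exists>i. {Top i, Bot j} \<in> d}"
  define g where "g e = (THE j. Bot j \<in> e)" for e
  have g: "g {Top i, Bot j} = j" for i j unfolding g_def by (rule the_equality) auto
  have "inj_on g Ev"
  proof (rule inj_onI)
    fix e e' assume e: "e \<in> Ev" "e' \<in> Ev" and eq: "g e = g e'"
    obtain i j where ij: "e = {Top i, Bot j}" "e \<in> d" using e unfolding Ev_def by blast
    obtain i' j' where ij': "e' = {Top i', Bot j'}" "e' \<in> d" using e unfolding Ev_def by blast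
    have "j = j'" using eq g ij ij' by simp
    then show "e = e'" using Dg_disjoint[OF d ij(2) ij'(2), of "Bot j"] ij(1) ij'(1) by simp
  qed
  moreover have "g ` Ev = T"
  proof
    show "g ` Ev <= T"
    proof
      fix j assume "j \<in> g ` Ev"
      then obtain i where i: "{Top i, Bot j} \<in> d" unfolding Ev_def using g by auto
      then have "{Bot j, Top i} \<in> d" by (simp add: insert_commute)
      then have "\<not> m < j" using iso by blast
      moreover have "1 <= j" using Dg_edgeD(3)[OF d i] by simp
      ultimately show "j \<in> T" using i unfolding T_def by auto
    qed
    show "T <= g ` Ev"
    proof
      fix j assume "j \<in> T"
      then obtain i where "{Top i, Bot j} \<in> d" unfolding T_def by blast
      then have "{Top i, Bot j} \<in> Ev" unfolding Ev_def by blast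
      then show "j \<in> g ` Ev" using g by (metis imageI)
    qed
  qed
  ultimately have "nvert d = card T" unfolding nvert_def Ev_def[symmetric] using card_image by metis
  moreover have "card T = m \<longleftrightarrow> T = {1..m}"
  proof -
    have sub: "T <= {1..m}" unfolding T_def by auto
    show ?thesis using card_subset_eq[OF _ sub] by auto
  qed
  moreover have "T = {1..m} \<longleftrightarrow> d \<in> Hd n m"
    using d iso unfolding T_def Hd_def by auto
  ultimately show ?thesis by simp
qed

lemma Dk_iff_Hd:
  assumes "d \<in> Dg n" "\<And>i v. m < i ==> {Bot i, v} \<notin> d"
  shows "d \<in> Dk n m \<longleftrightarrow> d \<in> Hd n m"
  using nvert_eq_iff[OF assms] assms(1) unfolding Dk_def by simp

lemma Hd_Dk: "d \<in> Hd n m ==> d \<in> Dk n m"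
  using Dk_iff_Hd[of d n m] HdD by blast

definition srep :: "nat => ((nat => nat) => 'a::comm_ring_1) set => bool" where
  "srep m V \<longleftrightarrow> fsub V \<and> (\<forall>\<sigma> v. \<sigma> permutes {1..m} --> v \<in> V --> (%s. v (s \<circ> \<sigma>)) \<in> V)"

text \<open>\<open>Ehd n m V\<close> models the tensor product of the span of \<open>Hd n m\<close> with \<open>V\<close> over the
  symmetric group: coinvariants are replaced by invariants.\<close>

definition Ehd :: "nat => nat => ((nat => nat) => 'a::comm_ring_1) set => (diag => (nat => nat) => 'a) set" where
  "Ehd n m V = {\<phi>. (\<forall>h. h \<notin> Hd n m --> \<phi> h = (%s. 0)) \<and> (\<forall>h\<in>Hd n m. \<phi> h \<in> V) \<and>
     (\<forall>\<sigma> h s. \<sigma> permutes {1..m} --> h \<in> Hd n m --> \<phi> (rt \<sigma> h) (s \<circ> \<sigma>) = \<phi> h s)}"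

text \<open>The value at \<open>c\<close> collects the values at all \<open>d\<close> whose product
  with \<open>a\<close> is \<open>c\<close>. Products outside \<open>Hd n m\<close> are dropped,
  which realises the quotient by diagrams with fewer vertical arcs.\<close>

definition dact :: "nat => nat => 'a::comm_ring_1 => diag => (diag => 'z => 'a) => diag => 'z => 'a" where
  "dact n m x a \<phi> = (%c s. if c \<in> Hd n m
      then \<Sum>d\<in>Hd n m. if Gp n a d = c then x ^ ell n a d * \<phi> d s else 0 else 0)"

definition hact :: "nat => nat => 'a::comm_ring_1 => (diag => 'a) => (diag => 'z => 'a) => diag => 'z => 'a" where
  "hact n m x b \<phi> = (%c s. \<Sum>a\<in>Dg n. b a * dact n m x a \<phi> c s)"

definition Emod :: "nat => nat => 'a::comm_ring_1 => ((nat => nat) => 'a) set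
    => ('a, diag => 'a, diag => (nat => nat) => 'a) amod" where
  "Emod n m x V = \<lparr> mcarr = Ehd n m V, mzero = (%h s. 0), madd = (%f g h s. f h s + g h s),
     msmul = (%c f h s. c * f h s), mact = hact n m x \<rparr>"

lemma EhdD:
  assumes "\<phi> \<in> Ehd n m V"
  shows "h \<notin> Hd n m ==> \<phi> h s = 0" "h \<in> Hd n m ==> \<phi> h \<in> V"
    "\<sigma> permutes {1..m} ==> h \<in> Hd n m ==> \<phi> (rt \<sigma> h) (s \<circ> \<sigma>) = \<phi> h s"
  using assms unfolding Ehd_def by auto

lemma EhdI:
  assumes "\<And>h s. h \<notin> Hd n m ==> \<phi> h s = 0" "\<And>h. h \<in> Hd n m ==> \<phi> h \<in> V"
    "\<And>\<sigma> h s. \<sigma> permutes {1..m} ==> h \<in> Hd n m ==> \<phi> (rt \<sigma> h) (s \<circ> \<sigma>) = \<phi> h s"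
  shows "\<phi> \<in> Ehd n m V"
  using assms unfolding Ehd_def by (auto simp: fun_eq_iff)

lemma Ehd_zero: "fsub V ==> (%h s. 0) \<in> Ehd n m V"
  by (rule EhdI) (auto intro: fsubD)

lemma Ehd_add: "fsub V ==> f \<in> Ehd n m V ==> g \<in> Ehd n m V ==> (%h s. f h s + g h s) \<in> Ehd n m V"
  by (rule EhdI) (auto simp: EhdD intro: fsubD)

lemma Ehd_scale: "fsub V ==> f \<in> Ehd n m V ==> (%h s. c * f h s) \<in> Ehd n m V"
  by (rule EhdI) (auto simp: EhdD intro: fsubD)

lemma Ehd_lincomb:
  assumes V: "fsub V" and "\<And>i. i \<in> I ==> f i \<in> Ehd n m V"
  shows "(%h s. \<Sum>i\<in>I. c i * f i h s) \<in> Ehd n m V"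
  using assms(2)
proof (induction I rule: infinite_finite_induct)
  case (insert i I)
  then show ?case using Ehd_add[OF V Ehd_scale[OF V, of "f i" n m "c i"]] by simp
qed (simp_all add: Ehd_zero[OF V])

lemma Ehd_mono:
  assumes V: "fsub V" and le: "m <= n" "n <= n'" and \<phi>: "\<phi> \<in> Ehd n m V"
  shows "\<phi> \<in> Ehd n' m V"
proof (rule EhdI)
  fix h s assume "h \<notin> Hd n' m"
  then show "\<phi> h s = 0" using EhdD(1)[OF \<phi>] Hd_mono[OF le(2)] by blast
next
  fix h assume "h \<in> Hd n' m"
  show "\<phi> h \<in> V"
  proof (cases "h \<in> Hd n m")
    case False
    then have "\<phi> h = (%s. 0)" using EhdD(1)[OF \<phi>] by blast
    then show ?thesis using fsubD(1)[OF V] by simp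
  qed (rule EhdD(2)[OF \<phi>])
next
  fix \<sigma> h s assume \<sigma>: "\<sigma> permutes {1..m}"
  show "\<phi> (rt \<sigma> h) (s \<circ> \<sigma>) = \<phi> h s"
    using EhdD(3)[OF \<phi> \<sigma>] EhdD(1)[OF \<phi>] Hd_rt_iff[OF \<sigma> le(1), of h] by (cases "h \<in> Hd n m") auto
qed

text \<open>Left multiplication commutes with relabelling the bottom row, so the defining sum can be
  reindexed by \<open>rt \<sigma>\<close>.\<close>

lemma dact_Ehd:
  assumes V: "fsub V" and m: "m <= n" and a: "a \<in> Dg n" and \<phi>: "\<phi> \<in> Ehd n m V"
  shows "dact n m x a \<phi> \<in> Ehd n m V"
proof (rule EhdI)
  fix h s assume "h \<notin> Hd n m"
  then show "dact n m x a \<phi> h s = 0" by (simp add: dact_def)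
next
  fix h assume h: "h \<in> Hd n m"
  have "(%s. \<Sum>d\<in>Hd n m. (if Gp n a d = h then x ^ ell n a d else 0) * \<phi> d s) \<in> V"
    by (rule fsub_lincomb[OF V EhdD(2)[OF \<phi>]])
  moreover have "(%s. \<Sum>d\<in>Hd n m. (if Gp n a d = h then x ^ ell n a d else 0) * \<phi> d s) = dact n m x a \<phi> h"
    using h by (auto simp: dact_def fun_eq_iff intro!: sum.cong)
  ultimately show "dact n m x a \<phi> h \<in> V" by simp
next
  fix \<sigma> h s assume \<sigma>: "\<sigma> permutes {1..m}" and h: "h \<in> Hd n m"
  have inj: "rt \<sigma> c = rt \<sigma> c' \<longleftrightarrow> c = c'" for c c' using rt_inv(2)[OF \<sigma>] by metis
  have "dact n m x a \<phi> (rt \<sigma> h) (s \<circ> \<sigma>)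
      = (\<Sum>d\<in>Hd n m. if Gp n a d = rt \<sigma> h then x ^ ell n a d * \<phi> d (s \<circ> \<sigma>) else 0)"
    using Hd_rt[OF \<sigma> m h] by (simp add: dact_def)
  also have "... = (\<Sum>d\<in>Hd n m. if Gp n a (rt \<sigma> d) = rt \<sigma> h then x ^ ell n a (rt \<sigma> d) * \<phi> (rt \<sigma> d) (s \<circ> \<sigma>) else 0)"
    by (rule sum.reindex_bij_betw[OF rt_bij[OF \<sigma> m], symmetric])
  also have "... = (\<Sum>d\<in>Hd n m. if Gp n a d = h then x ^ ell n a d * \<phi> d s else 0)"
    by (rule sum.cong[OF refl]) (simp add: Gp_rt[OF \<sigma> m a HdD(1)] inj EhdD(3)[OF \<phi> \<sigma>])
  also have "... = dact n m x a \<phi> h s" using h by (simp add: dact_def)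
  finally show "dact n m x a \<phi> (rt \<sigma> h) (s \<circ> \<sigma>) = dact n m x a \<phi> h s" .
qed

lemma hact_Ehd:
  assumes "fsub V" "m <= n" "\<phi> \<in> Ehd n m V"
  shows "hact n m x b \<phi> \<in> Ehd n m V"
  unfolding hact_def by (rule Ehd_lincomb[OF assms(1) dact_Ehd[OF assms(1,2) _ assms(3)]])

lemma dact_lincomb:
  "dact n m x a (%h s. \<Sum>i\<in>I. c i * f i h s) = (%h s. \<Sum>i\<in>I. c i * dact n m x a (f i) h s)"
proof (intro ext)
  fix h s
  show "dact n m x a (%h s. \<Sum>i\<in>I. c i * f i h s) h s = (\<Sum>i\<in>I. c i * dact n m x a (f i) h s)"
  proof (cases "h \<in> Hd n m")
    case True
    have "dact n m x a (%h s. \<Sum>i\<in>I. c i * f i h s) h s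
        = (\<Sum>d\<in>Hd n m. \<Sum>i\<in>I. c i * (if Gp n a d = h then x ^ ell n a d * f i d s else 0))"
      using True by (auto simp: dact_def sum_distrib_left mult_ac intro!: sum.cong)
    also have "... = (\<Sum>i\<in>I. \<Sum>d\<in>Hd n m. c i * (if Gp n a d = h then x ^ ell n a d * f i d s else 0))"
      by (rule sum.swap)
    finally show ?thesis using True by (simp add: dact_def sum_distrib_left)
  qed (simp add: dact_def)
qed

lemma dact_lin:
  "dact n m x a (%h s. f h s + c * g h s) = (%h s. dact n m x a f h s + c * dact n m x a g h s)"
  using dact_lincomb[where I = UNIV and c = "%b. if b then 1 else c" and f = "%b. if b then f else g"]
  by (simp add: UNIV_bool add.commute)

lemma hact_lin:
  "hact n m x b (%h s. f h s + c * g h s) = (%h s. hact n m x b f h s + c * hact n m x b g h s)"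
  unfolding hact_def dact_lin by (simp add: sum.distrib distrib_left sum_distrib_left mult_ac)

lemma Emod_mclosed:
  assumes "fsub V" "m <= n"
  shows "mclosed R (Emod n m x V)"
  unfolding mclosed_def Emod_def
  using Ehd_zero[OF assms(1)] Ehd_add[OF assms(1)] Ehd_scale[OF assms(1)] hact_Ehd[OF assms] by simp

text \<open>The powers of \<open>x\<close> match by the loop identity of \<open>Gp_assoc\<close>.
  The intermediate product may leave \<open>Hd n m\<close>, but then the final one is not
  \<open>c\<close> either, by \<open>Gp_in_HdD\<close>.\<close>

lemma dact_assoc:
  assumes a: "a \<in> Dg n" and b: "b \<in> Dg n"
  shows "dact n m x a (dact n m x b \<phi>) = (%c s. x ^ ell n a b * dact n m x (Gp n a b) \<phi> c s)"
proof (intro ext)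
  fix c s
  show "dact n m x a (dact n m x b \<phi>) c s = x ^ ell n a b * dact n m x (Gp n a b) \<phi> c s"
  proof (cases "c \<in> Hd n m")
    case c: True
    have "dact n m x a (dact n m x b \<phi>) c s
        = (\<Sum>e\<in>Hd n m. \<Sum>d\<in>Hd n m. if Gp n b d = e then (if Gp n a e = c then x ^ ell n a e * (x ^ ell n b d * \<phi> d s) else 0) else 0)"
    proof -
      have "(if Gp n a e = c then x ^ ell n a e * dact n m x b \<phi> e s else 0)
          = (\<Sum>d\<in>Hd n m. if Gp n b d = e then (if Gp n a e = c then x ^ ell n a e * (x ^ ell n b d * \<phi> d s) else 0) else 0)"
        if e: "e \<in> Hd n m" for e
      proof (cases "Gp n a e = c")
        case True
        have "x ^ ell n a e * dact n m x b \<phi> e s = (\<Sum>d\<in>Hd n m. x ^ ell n a e * (if Gp n b d = e then x ^ ell n b d * \<phi> d s else 0))"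
          using e by (simp add: dact_def sum_distrib_left)
        also have "... = (\<Sum>d\<in>Hd n m. if Gp n b d = e then x ^ ell n a e * (x ^ ell n b d * \<phi> d s) else 0)"
          by (rule sum.cong[OF refl]) simp
        finally show ?thesis unfolding if_P[OF True] .
      next
        case False
        show ?thesis unfolding if_not_P[OF False] by simp
      qed
      then have "(\<Sum>e\<in>Hd n m. if Gp n a e = c then x ^ ell n a e * dact n m x b \<phi> e s else 0)
          = (\<Sum>e\<in>Hd n m. \<Sum>d\<in>Hd n m. if Gp n b d = e then (if Gp n a e = c then x ^ ell n a e * (x ^ ell n b d * \<phi> d s) else 0) else 0)"
        by (rule sum.cong[OF refl])
      moreover have "dact n m x a (dact n m x b \<phi>) c s
          = (\<Sum>e\<in>Hd n m. if Gp n a e = c then x ^ ell n a e * dact n m x b \<phi> e s else 0)"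
        using c by (subst dact_def) simp
      ultimately show ?thesis by simp
    qed
    also have "... = (\<Sum>d\<in>Hd n m. \<Sum>e\<in>Hd n m. if Gp n b d = e then (if Gp n a e = c then x ^ ell n a e * (x ^ ell n b d * \<phi> d s) else 0) else 0)"
      by (rule sum.swap)
    also have "... = (\<Sum>d\<in>Hd n m. x ^ ell n a b * (if Gp n (Gp n a b) d = c then x ^ ell n (Gp n a b) d * \<phi> d s else 0))"
    proof (rule sum.cong[OF refl])
      fix d assume d: "d \<in> Hd n m"
      note dD = HdD(1)[OF d]
      have as: "Gp n (Gp n a b) d = Gp n a (Gp n b d)" "ell n a b + ell n (Gp n a b) d = ell n b d + ell n a (Gp n b d)"
        using Gp_assoc[OF a b dD] by auto
      have iso: "{Bot i, v} \<notin> Gp n b d" if "m < i" for i v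
        by (intro isolated_Bot_Gp[OF b dD] HdD(3)[OF d] that)
      have "Gp n a (Gp n b d) ~= c" if "Gp n b d \<notin> Hd n m"
        using Gp_in_HdD[OF a Gp_Dg[OF b dD] iso] c that by blast
      then have "(\<Sum>e\<in>Hd n m. if Gp n b d = e then (if Gp n a e = c then x ^ ell n a e * (x ^ ell n b d * \<phi> d s) else 0) else 0)
          = (if Gp n a (Gp n b d) = c then x ^ ell n a (Gp n b d) * (x ^ ell n b d * \<phi> d s) else 0)"
        by simp
      also have "... = x ^ ell n a b * (if Gp n (Gp n a b) d = c then x ^ ell n (Gp n a b) d * \<phi> d s else 0)"
      proof -
        have "x ^ ell n a (Gp n b d) * (x ^ ell n b d * \<phi> d s) = x ^ (ell n b d + ell n a (Gp n b d)) * \<phi> d s"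
          by (simp add: power_add mult_ac)
        also have "... = x ^ ell n a b * (x ^ ell n (Gp n a b) d * \<phi> d s)"
          unfolding as(2)[symmetric] by (simp add: power_add mult_ac)
        finally show ?thesis unfolding as(1) by simp
      qed
      finally show "(\<Sum>e\<in>Hd n m. if Gp n b d = e then (if Gp n a e = c then x ^ ell n a e * (x ^ ell n b d * \<phi> d s) else 0) else 0)
          = x ^ ell n a b * (if Gp n (Gp n a b) d = c then x ^ ell n (Gp n a b) d * \<phi> d s else 0)" .
    qed
    finally show ?thesis using c by (simp add: dact_def sum_distrib_left)
  qed (simp add: dact_def)
qed

subsection \<open>The cell modules\<close>

lemma amul_sum:
  fixes D :: "diag => 'a::field"
  shows "(\<Sum>c\<in>Dg N. amul N x f g c * D c) = (\<Sum>a\<in>Dg N. \<Sum>b\<in>Dg N. f a * g b * x ^ ell N a b * D (Gp N a b))"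
proof -
  have "(\<Sum>c\<in>Dg N. amul N x f g c * D c)
      = (\<Sum>c\<in>Dg N. \<Sum>a\<in>Dg N. \<Sum>b\<in>Dg N. if Gp N a b = c then f a * g b * x ^ ell N a b * D c else 0)"
    unfolding amul_def sum_distrib_right by (intro sum.cong refl) simp
  also have "... = (\<Sum>a\<in>Dg N. \<Sum>c\<in>Dg N. \<Sum>b\<in>Dg N. if Gp N a b = c then f a * g b * x ^ ell N a b * D c else 0)"
    by (rule sum.swap)
  also have "... = (\<Sum>a\<in>Dg N. \<Sum>b\<in>Dg N. \<Sum>c\<in>Dg N. if Gp N a b = c then f a * g b * x ^ ell N a b * D c else 0)"
    by (rule sum.cong[OF refl], rule sum.swap)
  also have "... = (\<Sum>a\<in>Dg N. \<Sum>b\<in>Dg N. f a * g b * x ^ ell N a b * D (Gp N a b))"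
    by (intro sum.cong refl) simp
  finally show ?thesis .
qed

lemma amul_freesp: "amul N x f g \<in> freesp (Dg N)"
proof -
  have "amul N x f g c = 0" if "c \<notin> Dg N" for c
    unfolding amul_def using that Gp_Dg by (intro sum.neutral ballI) auto
  then have "supp (amul N x f g) <= Dg N" unfolding supp_def by auto
  then show ?thesis unfolding freesp_def using finite_subset[OF _ finite_Dg] by blast
qed

lemma sum_dlt_right:
  fixes h :: "'x => 'a::comm_ring_1"
  assumes "finite X" "b \<in> X"
  shows "(\<Sum>a\<in>X. dlt b a * h a) = h b" "(\<Sum>a\<in>X. h a * dlt b a) = h b"
  using assms by (simp_all add: dlt_def if_distrib[of "%u. u * _"] if_distrib[of "%u. _ * u"] cong: if_cong)

lemma amul_dlt_right:
  assumes "b \<in> Dg N"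
  shows "amul N x f (dlt b) c = (\<Sum>a\<in>Dg N. if Gp N a b = c then f a * x ^ ell N a b else 0)"
  unfolding amul_def
proof (rule sum.cong[OF refl])
  fix a
  have "(\<Sum>b'\<in>Dg N. if Gp N a b' = c then f a * dlt b b' * x ^ ell N a b' else 0)
      = (\<Sum>b'\<in>Dg N. dlt b b' * (if Gp N a b' = c then f a * x ^ ell N a b' else 0))"
    by (rule sum.cong) (auto simp: mult_ac)
  then show "(\<Sum>b'\<in>Dg N. if Gp N a b' = c then f a * dlt b b' * x ^ ell N a b' else 0)
      = (if Gp N a b = c then f a * x ^ ell N a b else 0)"
    using assms by (simp add: sum_dlt_right)
qed

lemma freesp_zero: "f \<in> freesp X ==> c \<notin> X ==> f c = 0"
  unfolding freesp_def supp_def by blast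

lemma freespI: "finite X ==> (\<And>c. c \<notin> X ==> f c = 0) ==> f \<in> freesp X"
proof -
  assume "finite X" "\<And>c. c \<notin> X ==> f c = 0"
  then have "supp f <= X" unfolding supp_def by blast
  then show ?thesis unfolding freesp_def using finite_subset \<open>finite X\<close> by blast
qed

lemma udiag_Hd:
  assumes "n - t = m" "m <= N"
  shows "udiag n t \<in> Hd N m"
proof (rule HdI)
  show "udiag n t \<in> Dg N" using assms by simp
  show "\<exists>j. {Top j, Bot i} \<in> udiag n t" if "i \<in> {1..m}" for i
    using that assms unfolding udiag_alt by blast
  show "{Bot i, v} \<notin> udiag n t" if "m < i" for i v
  proof
    assume "{Bot i, v} \<in> udiag n t"
    then obtain j where "{Bot i, v} = {Top j, Bot j}" "j \<in> {1..m}" using assms unfolding udiag_alt by blast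
    then show False using that by (auto simp: doubleton_eq_iff)
  qed
qed

text \<open>Right multiplication by \<open>udiag\<close> lands in the span of half diagrams and
  rescales each of them by \<open>x ^ (n - m)\<close>; since \<open>x\<close> is invertible, nothing
  of that span is lost.\<close>

lemma Ileft_carr:
  fixes x :: "'a::field"
  assumes x: "x ~= 0" and m: "m <= n"
  shows "mcarr (Ileft n (n - m) x) = freesp (Hd n m)"
proof -
  define u where "u = udiag n (n - m)"
  have nm: "n - (n - m) = m" using m by simp
  have u: "u \<in> Hd n m" unfolding u_def by (rule udiag_Hd[OF nm m])
  note uD = HdD(1)[OF u]
  have "imul n m x f (dlt u) \<in> freesp (Hd n m)" for f
  proof (rule freespI)
    fix c assume c: "c \<notin> Hd n m"
    have "Gp n a u ~= c" if "a \<in> Dg n" "c \<in> Dk n m" for a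
    proof -
      have "{Bot i, v} \<notin> Gp n a u" if "m < i" for i v
        by (intro isolated_Bot_Gp[OF \<open>a \<in> Dg n\<close> uD] HdD(3)[OF u] that)
      from Dk_iff_Hd[OF Gp_Dg[OF that(1) uD] this] show ?thesis using that c by auto
    qed
    then show "imul n m x f (dlt u) c = 0" unfolding imul_def amul_dlt_right[OF uD] by (auto intro!: sum.neutral)
  qed simp
  moreover have "\<exists>f'\<in>freesp (Dk n m). f = imul n m x f' (dlt u)" if f: "f \<in> freesp (Hd n m)" for f
  proof (rule bexI)
    let ?f' = "%c. inverse (x ^ (n - m)) * f c"
    have "f \<in> freesp (Dk n m)" using f Hd_Dk unfolding freesp_def by blast
    then show "?f' \<in> freesp (Dk n m)" by (rule fsubD(3)[OF fsub_freesp])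
    show "f = imul n m x ?f' (dlt u)"
    proof
      fix c
      have "amul n x ?f' (dlt u) c = (\<Sum>a\<in>Hd n m. if a = c then f a else 0)"
      proof -
        have "amul n x ?f' (dlt u) c = (\<Sum>a\<in>Hd n m. if Gp n a u = c then ?f' a * x ^ ell n a u else 0)"
          unfolding amul_dlt_right[OF uD]
          by (rule sum.mono_neutral_right) (use freesp_zero[OF f] HdD(1) in auto)
        also have "... = (\<Sum>a\<in>Hd n m. if a = c then f a else 0)"
        proof (rule sum.cong[OF refl])
          fix a assume a: "a \<in> Hd n m"
          have "Gp n a u = a \<and> ell n a u = n - m"
            unfolding u_def by (rule Gp_udiag) (use HdD[OF a] nm in auto)
          then have g: "Gp n a u = a" and e: "ell n a u = n - m" by auto
          show "(if Gp n a u = c then ?f' a * x ^ ell n a u else 0) = (if a = c then f a else 0)"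
            unfolding g e using x by simp
        qed
        finally show ?thesis .
      qed
      then show "f c = imul n m x ?f' (dlt u) c"
        unfolding imul_def using freesp_zero[OF f] Hd_Dk by (cases "c \<in> Hd n m") auto
    qed
  qed
  ultimately show ?thesis unfolding Ileft_def nm u_def[symmetric] by auto
qed

lemma Ileft_act:
  assumes m: "m <= n" and \<sigma>: "\<sigma> permutes {1..m}" and f: "f \<in> freesp (Hd n m)"
  shows "mact (Ileft n (n - m) x) \<sigma> f = (%c. f (rt (inv \<sigma>) c))"
proof
  fix c
  have nm: "n - (n - m) = m" using m by simp
  have \<sigma>': "\<sigma> permutes {1..n}" using permutes_subset[OF \<sigma>] m by auto
  have pd: "pd n \<sigma> \<in> Dg n" unfolding pd_alt
    by (rule vertical_strands_Dg) (use permutes_inj_on[OF \<sigma>'] permutes_in_image[OF \<sigma>'] in auto)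
  have "amul n x f (dlt (pd n \<sigma>)) c = (\<Sum>a\<in>Hd n m. if Gp n a (pd n \<sigma>) = c then f a * x ^ ell n a (pd n \<sigma>) else 0)"
    unfolding amul_dlt_right[OF pd]
    by (rule sum.mono_neutral_right) (use freesp_zero[OF f] HdD(1) in auto)
  also have "... = (\<Sum>a\<in>Hd n m. if rt (inv \<sigma>) c = a then f a else 0)"
  proof (rule sum.cong[OF refl])
    fix a assume "a \<in> Hd n m"
    then have "Gp n a (pd n \<sigma>) = rt \<sigma> a \<and> ell n a (pd n \<sigma>) = 0" using Gp_pd[OF \<sigma> m HdD(1)] by blast
    moreover have "rt \<sigma> a = c \<longleftrightarrow> rt (inv \<sigma>) c = a" using rt_inv[OF \<sigma>] by metis
    ultimately show "(if Gp n a (pd n \<sigma>) = c then f a * x ^ ell n a (pd n \<sigma>) else 0) = (if rt (inv \<sigma>) c = a then f a else 0)"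
      by simp
  qed
  also have "... = f (rt (inv \<sigma>) c)" using freesp_zero[OF f] by (auto simp: sum.delta)
  finally have am: "amul n x f (dlt (pd n \<sigma>)) c = f (rt (inv \<sigma>) c)" .
  have "f (rt (inv \<sigma>) c) = 0" if "c \<notin> Dk n m"
    using that Hd_Dk Hd_rt_iff[OF permutes_inv[OF \<sigma>] m] freesp_zero[OF f] by blast
  then show "mact (Ileft n (n - m) x) \<sigma> f c = f (rt (inv \<sigma>) c)"
    unfolding Ileft_def nm by (simp add: imul_def am)
qed

text \<open>The dummy argument of type \<open>unit\<close> lets the one definition
  \<open>hact\<close> serve for scalar-valued functions as well.\<close>

lemma imul_Hd:
  assumes f: "f \<in> freesp (Hd n m)"
  shows "imul n m x b f = (%c. hact n m x b (%d (s::unit). f d) c ())"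
proof
  fix c
  have am: "amul n x b f c = (\<Sum>a\<in>Dg n. b a * (\<Sum>d\<in>Hd n m. if Gp n a d = c then x ^ ell n a d * f d else 0))"
    unfolding amul_def
  proof (rule sum.cong[OF refl])
    fix a
    have "(\<Sum>d\<in>Dg n. if Gp n a d = c then b a * f d * x ^ ell n a d else 0)
        = (\<Sum>d\<in>Hd n m. if Gp n a d = c then b a * f d * x ^ ell n a d else 0)"
      by (rule sum.mono_neutral_right) (use freesp_zero[OF f] HdD(1) in auto)
    also have "... = b a * (\<Sum>d\<in>Hd n m. if Gp n a d = c then x ^ ell n a d * f d else 0)"
      unfolding sum_distrib_left by (rule sum.cong) (auto simp: mult_ac)
    finally show "(\<Sum>d\<in>Dg n. if Gp n a d = c then b a * f d * x ^ ell n a d else 0)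
        = b a * (\<Sum>d\<in>Hd n m. if Gp n a d = c then x ^ ell n a d * f d else 0)" .
  qed
  show "imul n m x b f c = hact n m x b (%d s. f d) c ()"
  proof (cases "c \<in> Hd n m")
    case True
    then show ?thesis using Hd_Dk[OF True] by (simp add: imul_def am hact_def dact_def)
  next
    case False
    have "Gp n a d ~= c" if "a \<in> Dg n" "d \<in> Hd n m" "c \<in> Dk n m" for a d
    proof -
      have "{Bot i, v} \<notin> Gp n a d" if "m < i" for i v
        by (intro isolated_Bot_Gp[OF \<open>a \<in> Dg n\<close> HdD(1)[OF \<open>d \<in> Hd n m\<close>]] HdD(3)[OF \<open>d \<in> Hd n m\<close>] that)
      from Dk_iff_Hd[OF Gp_Dg[OF that(1) HdD(1)[OF that(2)]] this] show ?thesis using that(3) False by auto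
    qed
    then show ?thesis using False by (auto simp: imul_def am hact_def dact_def intro!: sum.neutral)
  qed
qed

definition perms :: "nat => (nat => nat) set" where
  "perms m = {\<sigma>. \<sigma> permutes {1..m}}"

lemma finite_perms [simp]: "finite (perms m)"
  unfolding perms_def by (rule finite_permutations) simp

lemma card_perms: "card (perms m) = fact m"
  unfolding perms_def by (rule card_permutations) auto

lemma perms_left: "\<tau> permutes {1..m} ==> bij_betw (%\<sigma>. \<tau> \<circ> \<sigma>) (perms m) (perms m)"
  by (rule bij_betw_byWitness[where f' = "%\<sigma>. inv \<tau> \<circ> \<sigma>"])
     (auto simp: perms_def permutes_compose permutes_inv o_assoc permutes_inv_o)

lemma perms_right: "\<tau> permutes {1..m} ==> bij_betw (%\<sigma>. \<sigma> \<circ> \<tau>) (perms m) (perms m)"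
  by (rule bij_betw_byWitness[where f' = "%\<sigma>. \<sigma> \<circ> inv \<tau>"])
     (auto simp: perms_def permutes_compose permutes_inv o_assoc[symmetric] permutes_inv_o)

text \<open>The function that represents the tensor of \<open>f\<close> and \<open>v\<close>.
  Summing over the whole group makes it both equivariant in \<open>c\<close> and balanced in
  \<open>f\<close> and \<open>v\<close>.\<close>

definition Bten :: "nat => nat => (diag => 'a::comm_ring_1) => ((nat => nat) => 'a) => diag => (nat => nat) => 'a" where
  "Bten n m f v = (%c s. if c \<in> Hd n m then \<Sum>\<sigma>\<in>perms m. f (rt \<sigma> c) * v (s \<circ> \<sigma>) else 0)"

lemma Bten_Ehd:
  assumes V: "srep m V" and v: "v \<in> V" and m: "m <= n"
  shows "Bten n m f v \<in> Ehd n m V"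
proof (rule EhdI)
  fix h assume h: "h \<in> Hd n m"
  have "(%s. \<Sum>\<sigma>\<in>perms m. f (rt \<sigma> h) * v (s \<circ> \<sigma>)) \<in> V"
    by (rule fsub_lincomb) (use V v in \<open>auto simp: srep_def perms_def\<close>)
  then show "Bten n m f v h \<in> V" using h by (simp add: Bten_def)
next
  fix \<tau> h s assume \<tau>: "\<tau> permutes {1..m}" and h: "h \<in> Hd n m"
  have "Bten n m f v (rt \<tau> h) (s \<circ> \<tau>) = (\<Sum>\<sigma>\<in>perms m. f (rt \<sigma> (rt \<tau> h)) * v (s \<circ> \<tau> \<circ> \<sigma>))"
    using Hd_rt[OF \<tau> m h] by (simp add: Bten_def)
  also have "... = (\<Sum>\<sigma>\<in>perms m. f (rt (\<tau> \<circ> \<sigma>) h) * v (s \<circ> (\<tau> \<circ> \<sigma>)))"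
    by (rule sum.cong[OF refl]) (simp add: rt_comp[OF \<tau>] perms_def o_assoc)
  also have "... = (\<Sum>\<sigma>\<in>perms m. f (rt \<sigma> h) * v (s \<circ> \<sigma>))"
    by (rule sum.reindex_bij_betw[OF perms_left[OF \<tau>]])
  finally show "Bten n m f v (rt \<tau> h) (s \<circ> \<tau>) = Bten n m f v h s" using h by (simp add: Bten_def)
qed (simp add: Bten_def)

lemma Mmod_miso:
  fixes x :: "'a::field_char_0"
  assumes x: "x ~= 0" and l: "sum_list l = m" "m <= n" and V: "srep m (mcarr (spechtmod l) :: ((nat => nat) => 'a) set)"
  shows "\<exists>\<Phi>. miso (freesp (Dg n)) (Mmod n x l) (Emod n m x (mcarr (spechtmod l))) \<Phi>"
proof -
  define M where "M = Ileft n (n - m) x"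
  define N where "N = (spechtmod l :: ('a, _, _) amod)"
  define S where "S = perms m"
  define W where "W = lspan (tens_rels M N S)"
  \<comment> \<open>The diagrams \<open>h\<close> and \<open>rt \<sigma> h\<close> contribute the
    same tensor, so every tensor is counted \<open>m!\<close> times.\<close>
  define \<Psi> where "\<Psi> \<phi> = (%p. \<Sum>h\<in>Hd n m. (inverse (fact m) :: 'a) * dlt (dlt h :: diag => 'a, \<phi> h) p)"
    for \<phi> :: "diag => (nat => nat) => 'a"
  have Mc: "mcarr M = freesp (Hd n m)" unfolding M_def by (rule Ileft_carr[OF x l(2)])
  have Mact: "mact M \<sigma> f = (%c. f (rt (inv \<sigma>) c))" if "\<sigma> \<in> S" "f \<in> mcarr M" for \<sigma> f
    using Ileft_act[OF l(2)] that unfolding Mc unfolding M_def S_def perms_def by simp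
  have Mops: "madd M = (%f g c. f c + g c)" "msmul M = (%a f c. a * f c)" "mzero M = (%c. 0)"
    unfolding M_def Ileft_def by simp_all
  have Nops: "madd N = (%u v s. u s + v s)" "msmul N = (%c u s. c * u s)" "mzero N = (%s. 0)"
    "mact N = (%\<sigma> u s. u (s \<circ> \<sigma>))" unfolding N_def spechtmod_def by simp_all
  have V': "srep m (mcarr N)" using V unfolding N_def .
  then have fV: "fsub (mcarr N)" unfolding srep_def by simp
  have fM: "fsub (mcarr M)" unfolding Mc by (rule fsub_freesp)
  have cM: "mclosed S M" unfolding mclosed_def Mops
  proof (intro conjI ballI allI)
    fix \<sigma> f assume s: "\<sigma> \<in> S" and f: "f \<in> mcarr M"
    have p: "\<sigma> permutes {1..m}" using s unfolding S_def perms_def by simp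
    show "mact M \<sigma> f \<in> mcarr M" unfolding Mact[OF s f] unfolding Mc
      by (rule freespI) (simp_all add: freesp_zero[OF f[unfolded Mc]] Hd_rt_iff[OF permutes_inv[OF p] l(2)])
  qed (use fM in \<open>auto intro: fsubD\<close>)
  have cN: "mclosed S N" unfolding mclosed_def Nops using fsubD[OF fV] V' unfolding srep_def S_def perms_def by simp
  have fmM: "fmod M (%f. f)" unfolding fmod_def Mops using fsubD[OF fM] by simp
  have fmN: "fmod N (%f. f)" unfolding fmod_def Nops using fsubD[OF fV] by simp
  have fact0: "(fact m :: 'a) ~= 0" by simp
  have W: "fsub W" unfolding W_def by (rule fsub_lspan)
  have "Mmod n x l = tensor M N S (imul n m x)"
    unfolding Mmod_def M_def N_def S_def perms_def l(1) ..
  moreover have "miso (freesp (Dg n)) (tensor M N S (imul n m x)) (Emod n m x (mcarr N)) (%X. lext (Bten n m) (rep X))"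
  proof (rule tensor_miso[OF _ _ _ _ _ _ _ _ _ _ cM cN _ _ _ W_def, where \<Psi> = \<Psi>])
    show "Bten n m f v \<in> mcarr (Emod n m x (mcarr N))" if "f \<in> mcarr M" "v \<in> mcarr N" for f v
      using Bten_Ehd[OF V' that(2) l(2)] by (simp add: Emod_def)
    show "Bten n m (madd M f f') v = (%y z. Bten n m f v y z + Bten n m f' v y z)" for f f' v
      by (auto simp: Bten_def Mops fun_eq_iff sum.distrib distrib_right)
    show "Bten n m f (madd N v v') = (%y z. Bten n m f v y z + Bten n m f v' y z)" for f v v'
      by (auto simp: Bten_def Nops fun_eq_iff sum.distrib distrib_left)
    show "Bten n m (msmul M c f) v = (%y z. c * Bten n m f v y z)" for c f v
      by (auto simp: Bten_def Mops fun_eq_iff sum_distrib_left mult_ac)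
    show "Bten n m f (msmul N c v) = (%y z. c * Bten n m f v y z)" for c f v
      by (auto simp: Bten_def Nops fun_eq_iff sum_distrib_left mult_ac)
    show "Bten n m (mact M \<tau> f) v = Bten n m f (mact N \<tau> v)" if \<tau>: "\<tau> \<in> S" and f: "f \<in> mcarr M" for \<tau> f v
    proof (intro ext)
      fix c s
      have p: "\<tau> permutes {1..m}" using \<tau> unfolding S_def perms_def by simp
      have "(\<Sum>\<sigma>\<in>perms m. f (rt (inv \<tau>) (rt \<sigma> c)) * v (s \<circ> \<sigma>))
          = (\<Sum>\<sigma>\<in>perms m. f (rt (inv \<tau>) (rt (\<sigma> \<circ> \<tau>) c)) * v (s \<circ> (\<sigma> \<circ> \<tau>)))"
        by (rule sum.reindex_bij_betw[OF perms_right[OF p], symmetric])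
      also have "... = (\<Sum>\<sigma>\<in>perms m. f (rt \<sigma> c) * v (s \<circ> \<sigma> \<circ> \<tau>))"
      proof (rule sum.cong[OF refl])
        fix \<sigma> assume "\<sigma> \<in> perms m"
        then have q: "\<sigma> permutes {1..m}" by (simp add: perms_def)
        show "f (rt (inv \<tau>) (rt (\<sigma> \<circ> \<tau>) c)) * v (s \<circ> (\<sigma> \<circ> \<tau>)) = f (rt \<sigma> c) * v (s \<circ> \<sigma> \<circ> \<tau>)"
          unfolding rt_comp[OF q p, symmetric] rt_inv[OF p] by (simp add: o_assoc)
      qed
      finally show "Bten n m (mact M \<tau> f) v c s = Bten n m f (mact N \<tau> v) c s"
        unfolding Mact[OF \<tau> f] by (simp add: Bten_def Nops)
    qed
    show "mzero (Emod n m x (mcarr N)) = (%y z. 0)" "madd (Emod n m x (mcarr N)) = (%f g y z. f y z + g y z)"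
      "msmul (Emod n m x (mcarr N)) = (%c f y z. c * f y z)" by (simp_all add: Emod_def)
    show "mclosed (freesp (Dg n)) (Emod n m x (mcarr N))" by (rule Emod_mclosed[OF fV l(2)])
    show "imul n m x b f \<in> mcarr M" if "f \<in> mcarr M" for b f
      unfolding Mc using that imul_Hd[of f n m x b] unfolding Mc by (intro freespI) (auto simp: hact_def dact_def)
    show "Bten n m (imul n m x b f) v = mact (Emod n m x (mcarr N)) b (Bten n m f v)"
      if f: "f \<in> mcarr M" for b f v
    proof (intro ext)
      fix c s
      show "Bten n m (imul n m x b f) v c s = mact (Emod n m x (mcarr N)) b (Bten n m f v) c s"
      proof (cases "c \<in> Hd n m")
        case c: True
        have "Bten n m (imul n m x b f) v c s
           = (\<Sum>\<sigma>\<in>perms m. \<Sum>a\<in>Dg n. b a * (dact n m x a (%d s. f d) (rt \<sigma> c) () * v (s \<circ> \<sigma>)))"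
          using c f unfolding Mc by (simp add: Bten_def imul_Hd hact_def sum_distrib_right mult.assoc)
        also have "... = (\<Sum>a\<in>Dg n. b a * (\<Sum>\<sigma>\<in>perms m. dact n m x a (%d s. f d) (rt \<sigma> c) () * v (s \<circ> \<sigma>)))"
          unfolding sum_distrib_left by (rule sum.swap)
        also have "... = (\<Sum>a\<in>Dg n. b a * dact n m x a (Bten n m f v) c s)"
        proof (rule sum.cong[OF refl], rule arg_cong[where f = "%y. _ * y"])
          fix a assume a: "a \<in> Dg n"
          have "dact n m x a (%d s. f d) (rt \<sigma> c) () = (\<Sum>d\<in>Hd n m. if Gp n a d = c then x ^ ell n a d * f (rt \<sigma> d) else 0)"
            if "\<sigma> \<in> perms m" for \<sigma>
          proof -
            have \<sigma>: "\<sigma> permutes {1..m}" using that by (simp add: perms_def)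
            have inj: "rt \<sigma> c = rt \<sigma> c' \<longleftrightarrow> c = c'" for c c' using rt_inv(2)[OF \<sigma>] by metis
            have "dact n m x a (%d s. f d) (rt \<sigma> c) () = (\<Sum>d\<in>Hd n m. if Gp n a d = rt \<sigma> c then x ^ ell n a d * f d else 0)"
              using Hd_rt[OF \<sigma> l(2) c] by (simp add: dact_def)
            also have "... = (\<Sum>d\<in>Hd n m. if Gp n a (rt \<sigma> d) = rt \<sigma> c then x ^ ell n a (rt \<sigma> d) * f (rt \<sigma> d) else 0)"
              by (rule sum.reindex_bij_betw[OF rt_bij[OF \<sigma> l(2)], symmetric])
            also have "... = (\<Sum>d\<in>Hd n m. if Gp n a d = c then x ^ ell n a d * f (rt \<sigma> d) else 0)"
              by (rule sum.cong[OF refl]) (simp add: Gp_rt[OF \<sigma> l(2) a HdD(1)] inj)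
            finally show ?thesis .
          qed
          then have "(\<Sum>\<sigma>\<in>perms m. dact n m x a (%d s. f d) (rt \<sigma> c) () * v (s \<circ> \<sigma>))
            = (\<Sum>\<sigma>\<in>perms m. \<Sum>d\<in>Hd n m. (if Gp n a d = c then x ^ ell n a d * f (rt \<sigma> d) else 0) * v (s \<circ> \<sigma>))"
            by (simp add: sum_distrib_right)
          also have "... = (\<Sum>d\<in>Hd n m. \<Sum>\<sigma>\<in>perms m. (if Gp n a d = c then x ^ ell n a d * f (rt \<sigma> d) else 0) * v (s \<circ> \<sigma>))"
            by (rule sum.swap)
          also have "... = (\<Sum>d\<in>Hd n m. if Gp n a d = c then x ^ ell n a d * Bten n m f v d s else 0)"
            by (rule sum.cong[OF refl]) (simp add: Bten_def sum_distrib_left mult.assoc)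
          finally show "(\<Sum>\<sigma>\<in>perms m. dact n m x a (%d s. f d) (rt \<sigma> c) () * v (s \<circ> \<sigma>)) = dact n m x a (Bten n m f v) c s"
            using c by (simp add: dact_def)
        qed
        finally show ?thesis by (simp add: Emod_def hact_def)
      qed (simp add: Bten_def Emod_def hact_def dact_def)
    qed
    show "mact (Emod n m x (mcarr N)) b (%y z. f y z + c * g y z)
        = (%y z. mact (Emod n m x (mcarr N)) b f y z + c * mact (Emod n m x (mcarr N)) b g y z)" for b c f g
      by (simp add: Emod_def hact_lin)
    show "teq W (dlt (f, v)) (\<Psi> (Bten n m f v))" if f: "f \<in> mcarr M" and v: "v \<in> mcarr N" for f v
    proof -
      have vs: "(%s. v (s \<circ> \<sigma>)) \<in> mcarr N" if "\<sigma> \<in> perms m" for \<sigma>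
        using V' v that unfolding srep_def perms_def by blast
      have dM: "dlt h \<in> mcarr M" if "h \<in> Hd n m" for h unfolding Mc using that by simp
      \<comment> \<open>Group elements are moved across the tensor sign until all terms share the
        second factor \<open>v\<close>.\<close>
      have 1: "teq W (dlt (dlt h, Bten n m f v h)) (%p. \<Sum>\<sigma>\<in>perms m. f (rt \<sigma> h) * dlt (dlt (rt \<sigma> h), v) p)"
        if h: "h \<in> Hd n m" for h
      proof -
        have "teq W (dlt (dlt h, Bten n m f v h)) (%p. \<Sum>\<sigma>\<in>perms m. f (rt \<sigma> h) * dlt (dlt h, %s. v (s \<circ> \<sigma>)) p)"
        proof (rule teq_lincomb_right[OF W_def fmN])
          have "Bten n m f v \<in> Ehd n m (mcarr N)" by (rule Bten_Ehd[OF V' v l(2)])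
          then show "Bten n m f v h \<in> mcarr N" using EhdD(2) h by blast
        qed (use h dM vs in \<open>auto simp: Bten_def\<close>)
        also have "teq W (%p. \<Sum>\<sigma>\<in>perms m. f (rt \<sigma> h) * dlt (dlt h, %s. v (s \<circ> \<sigma>)) p)
            (%p. \<Sum>\<sigma>\<in>perms m. f (rt \<sigma> h) * dlt (dlt (rt \<sigma> h), v) p)"
        proof (rule teq_sum[OF W])
          fix \<sigma> assume s: "\<sigma> \<in> perms m"
          have p: "\<sigma> permutes {1..m}" using s by (simp add: perms_def)
          have "mact M \<sigma> (dlt h) = dlt (rt \<sigma> h)"
            using Mact[of \<sigma> "dlt h"] dM[OF h] s rt_inv[OF p] unfolding S_def by (auto simp: dlt_def fun_eq_iff)
          then have "teq W (dlt (dlt (rt \<sigma> h), v)) (dlt (dlt h, %s. v (s \<circ> \<sigma>)))"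
            using teq_act[OF W_def, of \<sigma> "dlt h" v] s dM[OF h] v unfolding S_def by (simp add: Nops)
          then show "teq W (dlt (dlt h, %s. v (s \<circ> \<sigma>))) (dlt (dlt (rt \<sigma> h), v))" by (rule teq_sym[OF W])
        qed
        finally (teq_trans[OF W]) show ?thesis .
      qed
      have 2: "teq W (dlt (f, v)) (%p. \<Sum>h\<in>Hd n m. f h * dlt (dlt h, v) p)"
      proof (rule teq_lincomb_left[OF W_def fmM])
        show "f = (%y. \<Sum>h\<in>Hd n m. f h * dlt h y)"
        proof
          fix y
          have "(\<Sum>h\<in>Hd n m. f h * dlt h y) = (\<Sum>h\<in>Hd n m. if y = h then f h else 0)"
            by (rule sum.cong) (auto simp: dlt_def)
          then show "f y = (\<Sum>h\<in>Hd n m. f h * dlt h y)" using freesp_zero f unfolding Mc by (auto simp: sum.delta)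
        qed
      qed (use f v dM in auto)
      have "(\<Sum>h\<in>Hd n m. inverse (fact m) * (\<Sum>\<sigma>\<in>perms m. f (rt \<sigma> h) * dlt (dlt (rt \<sigma> h), v) p))
          = (\<Sum>h\<in>Hd n m. f h * dlt (dlt h, v) p)" for p
      proof -
        have "(\<Sum>h\<in>Hd n m. \<Sum>\<sigma>\<in>perms m. f (rt \<sigma> h) * dlt (dlt (rt \<sigma> h), v) p)
            = (\<Sum>\<sigma>\<in>perms m. \<Sum>h\<in>Hd n m. f (rt \<sigma> h) * dlt (dlt (rt \<sigma> h), v) p)" by (rule sum.swap)
        also have "... = (\<Sum>\<sigma>\<in>perms m. \<Sum>h\<in>Hd n m. f h * dlt (dlt h, v) p)"
          by (intro sum.cong refl sum.reindex_bij_betw[OF rt_bij[OF _ l(2)]]) (simp add: perms_def)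
        also have "... = fact m * (\<Sum>h\<in>Hd n m. f h * dlt (dlt h, v) p)" by (simp add: card_perms)
        finally show ?thesis unfolding sum_distrib_left[symmetric] by simp
      qed
      then have 3: "(%p. \<Sum>h\<in>Hd n m. inverse (fact m) * (\<Sum>\<sigma>\<in>perms m. f (rt \<sigma> h) * dlt (dlt (rt \<sigma> h), v) p))
          = (%p. \<Sum>h\<in>Hd n m. f h * dlt (dlt h, v) p)" by blast
      have "teq W (\<Psi> (Bten n m f v)) (%p. \<Sum>h\<in>Hd n m. inverse (fact m) * (\<Sum>\<sigma>\<in>perms m. f (rt \<sigma> h) * dlt (dlt (rt \<sigma> h), v) p))"
        unfolding \<Psi>_def by (rule teq_sum[OF W 1])
      then show ?thesis unfolding 3 using 2 teq_trans[OF W] teq_sym[OF W] by blast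
    qed
    show "teq W (\<Psi> (%y z. f y z + c * g y z)) (%p. \<Psi> f p + c * \<Psi> g p)"
      if fg: "f \<in> mcarr (Emod n m x (mcarr N))" "g \<in> mcarr (Emod n m x (mcarr N))" for c f g
    proof -
      have "teq W (\<Psi> (%y z. f y z + c * g y z)) (%p. \<Sum>h\<in>Hd n m. inverse (fact m) * (dlt (dlt h, f h) p + c * dlt (dlt h, g h) p))"
        unfolding \<Psi>_def
      proof (rule teq_sum[OF W])
        fix h assume h: "h \<in> Hd n m"
        have fh: "f h \<in> mcarr N" "g h \<in> mcarr N" using fg EhdD(2) h by (auto simp: Emod_def)
        have dh: "dlt h \<in> mcarr M" unfolding Mc using h by simp
        have cg: "(%s. c * g h s) \<in> mcarr N" using fsubD(3)[OF fV fh(2)] .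
        have "teq W (dlt (dlt h, %s. f h s + c * g h s)) (%p. dlt (dlt h, f h) p + dlt (dlt h, %s. c * g h s) p)"
          using teq_addr[OF W_def dh fh(1) cg] by (simp add: Nops)
        also have "teq W (%p. dlt (dlt h, f h) p + dlt (dlt h, %s. c * g h s) p) (%p. dlt (dlt h, f h) p + c * dlt (dlt h, g h) p)"
          using teq_scaler[OF W_def dh fh(2), of c] by (intro teq_add[OF W] teq_refl[OF W]) (simp add: Nops)
        finally (teq_trans[OF W]) show "teq W (dlt (dlt h, %s. f h s + c * g h s)) (%p. dlt (dlt h, f h) p + c * dlt (dlt h, g h) p)" .
      qed
      moreover have "(%p. \<Sum>h\<in>Hd n m. inverse (fact m) * (dlt (dlt h, f h) p + c * dlt (dlt h, g h) p)) = (%p. \<Psi> f p + c * \<Psi> g p)"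
        unfolding \<Psi>_def by (simp add: sum.distrib sum_distrib_left distrib_left mult_ac)
      ultimately show ?thesis by simp
    qed
    show "\<Psi> \<phi> \<in> freesp (mcarr M \<times> mcarr N)" if "\<phi> \<in> mcarr (Emod n m x (mcarr N))" for \<phi>
      unfolding \<Psi>_def
      by (rule fsub_lincomb[OF fsub_freesp]) (use that EhdD(2) in \<open>auto simp: Mc Emod_def\<close>)
    show "lext (Bten n m) (\<Psi> \<phi>) = \<phi>" if phi: "\<phi> \<in> mcarr (Emod n m x (mcarr N))" for \<phi>
    proof (intro ext)
      fix c s
      have \<phi>: "\<phi> \<in> Ehd n m (mcarr N)" using phi by (simp add: Emod_def)
      have "lext (Bten n m) (\<Psi> \<phi>) c s = (\<Sum>h\<in>Hd n m. inverse (fact m) * Bten n m (dlt h) (\<phi> h) c s)"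
        unfolding \<Psi>_def using lext_lincomb[of "Hd n m" "Bten n m" "%_. inverse (fact m)" "%h. (dlt h, \<phi> h)"] by simp
      also have "... = \<phi> c s"
      proof (cases "c \<in> Hd n m")
        case c: True
        have "(\<Sum>h\<in>Hd n m. Bten n m (dlt h) (\<phi> h) c s) = (\<Sum>h\<in>Hd n m. \<Sum>\<sigma>\<in>perms m. dlt h (rt \<sigma> c) * \<phi> h (s \<circ> \<sigma>))"
          using c by (simp add: Bten_def)
        also have "... = (\<Sum>\<sigma>\<in>perms m. \<Sum>h\<in>Hd n m. dlt h (rt \<sigma> c) * \<phi> h (s \<circ> \<sigma>))" by (rule sum.swap)
        also have "... = (\<Sum>\<sigma>\<in>perms m. \<phi> c s)"
        proof (rule sum.cong[OF refl])
          fix \<sigma> assume "\<sigma> \<in> perms m"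
          then have \<sigma>: "\<sigma> permutes {1..m}" by (simp add: perms_def)
          have "(\<Sum>h\<in>Hd n m. dlt h (rt \<sigma> c) * \<phi> h (s \<circ> \<sigma>)) = (\<Sum>h\<in>Hd n m. if rt \<sigma> c = h then \<phi> h (s \<circ> \<sigma>) else 0)"
            by (rule sum.cong) (auto simp: dlt_def)
          also have "... = \<phi> (rt \<sigma> c) (s \<circ> \<sigma>)" using Hd_rt[OF \<sigma> l(2) c] by simp
          finally show "(\<Sum>h\<in>Hd n m. dlt h (rt \<sigma> c) * \<phi> h (s \<circ> \<sigma>)) = \<phi> c s" using EhdD(3)[OF \<phi> \<sigma> c] by simp
        qed
        also have "... = fact m * \<phi> c s" by (simp add: card_perms)
        finally show ?thesis unfolding sum_distrib_left[symmetric] by simp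
      qed (simp add: Bten_def EhdD(1)[OF \<phi>])
      finally show "lext (Bten n m) (\<Psi> \<phi>) c s = \<phi> c s" .
    qed
  qed
  ultimately show ?thesis unfolding N_def by metis
qed

subsection \<open>Induction is restriction\<close>

lemma dact_scale: "dact n m x a (%h s. c * f h s) = (%h s. c * dact n m x a f h s)"
  using dact_lincomb[where I = "{()}" and c = "%_. c" and f = "%_. f"] by simp

text \<open>In the larger algebra the middle vertex \<open>Suc n\<close> is isolated on both sides
  and closes one loop.\<close>

lemma Gp_low:
  assumes r: "r \<in> Dg n" and d: "d \<in> Dg n"
  shows "Gp (Suc n) r d = Gp n r d \<and> ell (Suc n) r d = Suc (ell n r d)"
proof (rule Gp_ell_eqI)
  fix A B :: "nat set"
  have "(\<Sum>C\<in>Pow {1..Suc n}. cmat r A C * cmat d C B) = (\<Sum>C\<in>Pow {1..n}. 2 * (cmat r (A \<inter> {1..n}) C * cmat d C (B \<inter> {1..n})))"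
    unfolding sum_Pow_Suc
  proof (rule sum.cong[OF refl])
    fix C
    have "cmat r A C = cmat r (A \<inter> {1..n}) C" "cmat r A (insert (Suc n) C) = cmat r (A \<inter> {1..n}) C"
      by (rule cmat_cong[OF r]; auto)+
    moreover have "cmat d C B = cmat d C (B \<inter> {1..n})" "cmat d (insert (Suc n) C) B = cmat d C (B \<inter> {1..n})"
      by (rule cmat_cong[OF d]; auto)+
    ultimately show "cmat r A C * cmat d C B + cmat r A (insert (Suc n) C) * cmat d (insert (Suc n) C) B
        = 2 * (cmat r (A \<inter> {1..n}) C * cmat d C (B \<inter> {1..n}))" by simp
  qed
  also have "... = 2 * (2 ^ ell n r d * cmat (Gp n r d) (A \<inter> {1..n}) (B \<inter> {1..n}))"
    unfolding sum_distrib_left[symmetric] using cmat_mult[OF r d, of "A \<inter> {1..n}" "B \<inter> {1..n}"] by simp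
  also have "cmat (Gp n r d) (A \<inter> {1..n}) (B \<inter> {1..n}) = cmat (Gp n r d) A B"
    by (rule cmat_cong[OF Gp_Dg[OF r d]]) auto
  finally show "(\<Sum>C\<in>Pow {1..Suc n}. cmat r A C * cmat d C B) = 2 ^ Suc (ell n r d) * cmat (Gp n r d) A B" by simp
qed (use assms Dg_Suc in simp_all)

lemma dact_low:
  fixes x :: "'a::comm_ring_1"
  assumes a: "a \<in> Dg n" and \<phi>: "\<And>h s. h \<notin> Hd n m ==> \<phi> h s = 0"
  shows "dact (Suc n) m x a \<phi> = (%c s. x * dact n m x a \<phi> c s)"
proof (intro ext)
  fix c s
  have sub: "Hd n m <= Hd (Suc n) m" by (rule Hd_mono) simp
  show "dact (Suc n) m x a \<phi> c s = x * dact n m x a \<phi> c s"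
  proof (cases "c \<in> Hd (Suc n) m")
    case c: True
    have "dact (Suc n) m x a \<phi> c s = (\<Sum>d\<in>Hd n m. if Gp (Suc n) a d = c then x ^ ell (Suc n) a d * \<phi> d s else 0)"
      using c sub \<phi> unfolding dact_def by (simp, intro sum.mono_neutral_right) auto
    also have "... = (\<Sum>d\<in>Hd n m. x * (if Gp n a d = c then x ^ ell n a d * \<phi> d s else 0))"
      by (rule sum.cong[OF refl]) (simp add: Gp_low[OF a HdD(1)])
    also have "... = x * dact n m x a \<phi> c s"
    proof (cases "c \<in> Hd n m")
      case False
      have "Gp n a d ~= c" if "d \<in> Hd n m" for d
      proof
        assume "Gp n a d = c"
        then have "c \<in> Dg n" using Gp_Dg[OF a HdD(1)[OF that]] by simp
        then have "c \<in> Hd n m" using c unfolding Hd_def by blast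
        then show False using False by blast
      qed
      then show ?thesis using False by (simp add: dact_def)
    qed (simp add: dact_def sum_distrib_left)
    finally show ?thesis .
  next
    case False
    then show ?thesis using sub by (auto simp: dact_def)
  qed
qed

section \<open>The embedding \<open>eps\<close> on basis diagrams\<close>

lemma hat_inj: "a \<in> Dg k ==> hat k a - {{Top (Suc k), Bot (Suc k)}} = a"
  using Dg_vertex_gt(1)[of a k "Suc k" "Bot (Suc k)"] unfolding hat_def by auto

lemma unhat:
  assumes c: "c \<in> Dg (Suc k)" and e: "{Top (Suc k), Bot (Suc k)} \<in> c"
  shows "c - {{Top (Suc k), Bot (Suc k)}} \<in> Dg k"
proof (rule DgI)
  let ?e = "{Top (Suc k), Bot (Suc k)}"
  fix f assume f: "f \<in> c - {?e}"
  then have fc: "f \<in> c" and ne: "f ~= ?e" by auto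
  obtain u v where uv: "f = {u, v}" "u ~= v" "u \<in> verts (Suc k)" "v \<in> verts (Suc k)" by (rule Dg_edgeE[OF c fc])
  have no: "Top (Suc k) \<notin> f" "Bot (Suc k) \<notin> f" using Dg_disjoint[OF c fc e] ne by blast+
  have "w \<in> verts k" if "w \<in> f" "w \<in> verts (Suc k)" for w
    using that no by (cases w) (auto simp: le_Suc_eq)
  then show "\<exists>u v. u ~= v \<and> f = {u, v} \<and> u \<in> verts k \<and> v \<in> verts k" using uv by blast
next
  fix u v w assume "{u, v} \<in> c - {{Top (Suc k), Bot (Suc k)}}" "{u, w} \<in> c - {{Top (Suc k), Bot (Suc k)}}"
  then show "v = w" using Dg_partner[OF c] by blast
qed

text \<open>\<open>eps k f\<close> only lives on diagrams with the last strand, and these are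
  exactly the diagrams \<open>hat k a\<close>.\<close>

lemma eps_sum:
  fixes f :: "diag => 'a::comm_ring_1"
  shows "(\<Sum>c\<in>Dg (Suc k). eps k f c * g c) = (\<Sum>a\<in>Dg k. f a * g (hat k a))"
proof -
  let ?e = "{Top (Suc k), Bot (Suc k)}"
  have "(\<Sum>c\<in>Dg (Suc k). eps k f c * g c) = (\<Sum>c\<in>{c \<in> Dg (Suc k). ?e \<in> c}. f (c - {?e}) * g c)"
    unfolding eps_def by (rule sum.mono_neutral_cong_right) auto
  also have "... = (\<Sum>a\<in>Dg k. f (hat k a - {?e}) * g (hat k a))"
  proof (rule sum.reindex_bij_betw[symmetric], rule bij_betw_byWitness[where f' = "%c. c - {?e}"])
    show "\<forall>a\<in>Dg k. hat k a - {?e} = a" using hat_inj by blast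
    show "\<forall>c\<in>{c \<in> Dg (Suc k). ?e \<in> c}. hat k (c - {?e}) = c" unfolding hat_def by blast
    show "hat k ` Dg k <= {c \<in> Dg (Suc k). ?e \<in> c}" using hat_Dg unfolding hat_def by blast
    show "(%c. c - {?e}) ` {c \<in> Dg (Suc k). ?e \<in> c} <= Dg k" using unhat by blast
  qed
  also have "... = (\<Sum>a\<in>Dg k. f a * g (hat k a))" by (rule sum.cong[OF refl]) (simp add: hat_inj)
  finally show ?thesis .
qed

lemma eps_freesp: "eps k f \<in> freesp (Dg (Suc k))"
  by (rule freespI) (auto simp: eps_def)

lemma eps_dlt:
  assumes d: "d \<in> Dg k"
  shows "eps k (dlt d) = (dlt (hat k d) :: diag => 'a::comm_ring_1)"
proof
  fix c
  let ?e = "{Top (Suc k), Bot (Suc k)}"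
  show "eps k (dlt d) c = (dlt (hat k d) c :: 'a)"
  proof (cases "c = hat k d")
    case True
    then have "c \<in> Dg (Suc k)" "?e \<in> c" "c - {?e} = d" using hat_Dg[OF d] hat_inj[OF d] by (auto simp: hat_def)
    then show ?thesis using True by (simp add: eps_def dlt_def)
  next
    case False
    have "c - {?e} ~= d" if "?e \<in> c" using that False unfolding hat_def by blast
    then show ?thesis using False by (simp add: eps_def dlt_def)
  qed
qed

lemma hact_dlt: "d \<in> Dg n ==> hact n m x (dlt d) \<phi> = dact n m x d \<phi>"
  unfolding hact_def by (intro ext) (simp add: sum_dlt_right)

lemma hact_eps: "hact (Suc k) m x (eps k b) \<phi> = (%c s. \<Sum>a\<in>Dg k. b a * dact (Suc k) m x (hat k a) \<phi> c s)"
  unfolding hact_def eps_sum ..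

lemma amul_dlt_dlt:
  assumes "a \<in> Dg N" "b \<in> Dg N"
  shows "amul N x (dlt a) (dlt b) = (%c. x ^ ell N a b * dlt (Gp N a b) c)"
proof
  fix c
  have "amul N x (dlt a) (dlt b) c = (\<Sum>a'\<in>Dg N. dlt a a' * (if Gp N a' b = c then x ^ ell N a' b else 0))"
    unfolding amul_dlt_right[OF assms(2)] by (rule sum.cong) auto
  then show "amul N x (dlt a) (dlt b) c = x ^ ell N a b * dlt (Gp N a b) c"
    using assms by (simp add: sum_dlt_right) (auto simp: dlt_def)
qed

text \<open>A test element for defects at the bottom vertices \<open>i\<close> and \<open>j\<close>.
  From the right it reproduces, up to the factor \<open>x\<close>, every diagram in which they are
  joined (or isolated, if \<open>i = j\<close>); from the left it kills the generators
  \<open>eta\<close>, whose strands at \<open>i\<close> and \<open>j\<close> it cuts.\<close>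

definition cutd :: "nat => nat => nat => diag" where
  "cutd n i j = (let D = {{Top k, Bot k} | k. k \<in> {1..n} - {i, j}} in if i = j then D else insert {Bot i, Bot j} D)"

lemma cmat_cutd: "cmat (cutd n i j) C B = of_bool ((\<forall>k\<in>{1..n} - {i, j}. k \<in> C \<longleftrightarrow> k \<in> B) \<and> (i \<in> B \<longleftrightarrow> j \<in> B))"
proof -
  have "dcompat {{Top k, Bot k} | k. k \<in> {1..n} - {i, j}} C B \<longleftrightarrow> (\<forall>k\<in>{1..n} - {i, j}. k \<in> C \<longleftrightarrow> k \<in> B)"
    using cmat_vertical_strands[of "%k. k" "{1..n} - {i, j}" C B] by (simp only: cmat_def of_bool_eq_iff)
  then show ?thesis unfolding cutd_def Let_def cmat_def by (cases "i = j") (simp_all only: compat_insert if_True if_False vlab_simps simp_thms)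
qed

lemma cutd_Dg:
  assumes "i \<in> {1..n}" "j \<in> {1..n}"
  shows "cutd n i j \<in> Dg n"
proof -
  let ?D = "{{Top k, Bot k} | k. k \<in> {1..n} - {i, j}}"
  have D: "?D \<in> Dg n" using vertical_strands_Dg[of "%k. k" "{1..n} - {i, j}" n] by auto
  have iso: "{Bot k, v} \<notin> ?D" if "k \<in> {i, j}" for k v
  proof
    assume "{Bot k, v} \<in> ?D"
    then obtain l where "{Bot k, v} = {Top l, Bot l}" "l \<in> {1..n} - {i, j}" by blast
    then show False using that by (auto simp: doubleton_eq_iff)
  qed
  show ?thesis unfolding cutd_def Let_def using D assms by (auto intro!: Dg_insert iso)
qed

lemma hat_cutd:
  assumes "i \<in> {1..n}" "j \<in> {1..n}"
  shows "hat n (cutd n i j) = cutd (Suc n) i j"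
proof (rule Dg_eqI[OF hat_Dg[OF cutd_Dg[OF assms]] cutd_Dg])
  show "i \<in> {1..Suc n}" "j \<in> {1..Suc n}" using assms by auto
  have e: "{1..Suc n} - {i, j} = insert (Suc n) ({1..n} - {i, j})" using assms by auto
  fix A B
  have "cmat (hat n (cutd n i j)) A B = cmat (cutd (Suc n) i j) A B"
    unfolding cmat_hat cmat_cutd e by auto
  then show "dcompat (hat n (cutd n i j)) A B = dcompat (cutd (Suc n) i j) A B" by (simp only: cmat_def of_bool_eq_iff)
qed

text \<open>The defect of \<open>a\<close> together with the isolated top vertices of
  \<open>cutd\<close> forms one closed component, and the bottom row of \<open>cutd\<close> restores
  the same defect.\<close>

lemma Gp_cutd:
  assumes a: "a \<in> Dg N" and ij: "i \<in> {1..N}" "j \<in> {1..N}"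
    and h: "i = j \<and> (\<forall>v. {Bot i, v} \<notin> a) \<or> {Bot i, Bot j} \<in> a"
  shows "Gp N a (cutd N i j) = a \<and> ell N a (cutd N i j) = 1"
proof (rule Gp_ell_eqI[OF a cutd_Dg[OF ij] a])
  fix A B assume A: "A <= {1..N}" and B: "B <= {1..N}"
  have key: "cmat a A C = cmat a A B" if C: "\<forall>k\<in>{1..N} - {i, j}. k \<in> C \<longleftrightarrow> k \<in> B" "i \<in> C \<longleftrightarrow> j \<in> C" "i \<in> B \<longleftrightarrow> j \<in> B" for C
  proof -
    have "(vlab A C u = vlab A C v) = (vlab A B u = vlab A B v)" if uv: "{u, v} \<in> a" for u v
    proof (cases "u \<in> {Bot i, Bot j} \<or> v \<in> {Bot i, Bot j}")
      case True
      then have ne: "{Bot i, Bot j} \<in> a"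
        using h uv by (auto simp: insert_commute)
      then have "{u, v} = {Bot i, Bot j}"
        using True Dg_disjoint[OF a uv ne] by blast
      then have "u = Bot i \<and> v = Bot j \<or> u = Bot j \<and> v = Bot i" unfolding doubleton_eq_iff .
      then show ?thesis using C by auto
    next
      case False
      have "vlab A C w = vlab A B w" if "w \<in> verts N" "w ~= Bot i" "w ~= Bot j" for w
        using that C(1) by (cases w) auto
      then show ?thesis using False Dg_edgeD(2,3)[OF a uv] by auto
    qed
    then show ?thesis unfolding cmat_def dcompat_def by (metis (no_types, lifting))
  qed
  have neq: "cmat a A C = 0" if "(i \<in> C) ~= (j \<in> C)" for C
  proof -
    have "{Bot i, Bot j} \<in> a" using h that by auto
    then have "\<not> dcompat a A C" using that unfolding dcompat_def by (metis vlab_simps(2))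
    then show ?thesis by (simp add: cmat_def)
  qed
  show "(\<Sum>C\<in>Pow {1..N}. cmat a A C * cmat (cutd N i j) C B) = 2 ^ 1 * cmat a A B"
  proof (cases "i \<in> B \<longleftrightarrow> j \<in> B")
    case True
    \<comment> \<open>Away from \<open>i\<close> and \<open>j\<close> the middle colouring is
      prescribed by \<open>B\<close>; at \<open>i\<close> and \<open>j\<close> the colours agree but
      are otherwise free, which leaves exactly these two.\<close>
    let ?X = "{B - {i, j}, B \<union> {i, j}}"
    have X: "?X <= Pow {1..N}" using B ij by auto
    have ne: "B - {i, j} ~= B \<union> {i, j}" by blast
    have "(\<Sum>C\<in>Pow {1..N}. cmat a A C * cmat (cutd N i j) C B) = (\<Sum>C\<in>?X. cmat a A B)"
    proof (rule sum.mono_neutral_cong_right)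
      show "\<forall>C\<in>Pow {1..N} - ?X. cmat a A C * cmat (cutd N i j) C B = 0"
      proof
        fix C assume C: "C \<in> Pow {1..N} - ?X"
        show "cmat a A C * cmat (cutd N i j) C B = 0"
        proof (rule ccontr)
          assume "cmat a A C * cmat (cutd N i j) C B ~= 0"
          then have a0: "cmat a A C ~= 0" and w0: "cmat (cutd N i j) C B ~= 0" by auto
          have 1: "i \<in> C \<longleftrightarrow> j \<in> C" using neq[of C] a0 by blast
          have 2: "\<forall>k\<in>{1..N} - {i, j}. k \<in> C \<longleftrightarrow> k \<in> B"
            using w0 unfolding cmat_cutd of_bool_eq_0_iff by blast
          have Cs: "C <= {1..N}" using C by blast
          have "C - {i, j} = B - {i, j}" using 2 Cs B by blast
          moreover have "C = (C - {i, j}) \<union> (if i \<in> C then {i, j} else {})" using 1 by auto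
          moreover have "B \<union> {i, j} = (B - {i, j}) \<union> {i, j}" by blast
          ultimately have "C = B - {i, j} \<or> C = B \<union> {i, j}" by (metis Un_empty_right)
          then show False using C by blast
        qed
      qed
      fix C assume C: "C \<in> ?X"
      have "cmat (cutd N i j) C B = 1" using C True unfolding cmat_cutd by auto
      moreover have "cmat a A C = cmat a A B" by (rule key) (use C True in auto)
      ultimately show "cmat a A C * cmat (cutd N i j) C B = cmat a A B" by simp
    qed (use X in auto)
    also have "... = 2 * cmat a A B" using ne by simp
    finally show ?thesis by simp
  next
    case False
    then show ?thesis using neq[OF False] by (simp add: cmat_cutd)
  qed
qed

abbreviation ud :: "nat => diag" where
  "ud m \<equiv> udiag m 0"

lemma ud_eq: "m <= N ==> ud m = udiag N (N - m)"
  unfolding udiag_alt by simp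

lemma ud_Hd: "m <= N ==> ud m \<in> Hd N m"
  using udiag_Hd[of m 0 m N] by simp

lemma Gp_ud:
  assumes "m <= N" "h \<in> Hd N m"
  shows "Gp N h (ud m) = h \<and> ell N h (ud m) = N - m"
  unfolding ud_eq[OF assms(1)] using HdD[OF assms(2)] assms(1) by (intro Gp_udiag) auto

text \<open>The generator attached to \<open>v\<close>, the image of the tensor of the half diagram
  \<open>ud m\<close> with \<open>v\<close>. As a function it does not depend on \<open>n\<close>
  (see \<open>eta_mono\<close>), so it can be used in sizes \<open>n\<close> and
  \<open>n + 2\<close> alike.\<close>

abbreviation eta :: "nat => nat => ((nat => nat) => 'a::comm_ring_1) => diag => (nat => nat) => 'a" where
  "eta n m v \<equiv> Bten n m (dlt (ud m)) v"

lemma eta_mono: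
  assumes "m <= n" "n <= N"
  shows "eta N m v = eta n m v"
proof (intro ext)
  fix c s
  have "dlt (ud m) (rt \<sigma> c) * v (s \<circ> \<sigma>) = 0" if "c \<notin> Hd n m" "\<sigma> \<in> perms m" for \<sigma>
  proof -
    have "rt \<sigma> c ~= ud m" using that ud_Hd[OF assms(1)] Hd_rt_iff[OF _ assms(1), of \<sigma> c] unfolding perms_def by auto
    then show ?thesis by (simp add: dlt_def)
  qed
  then show "eta N m v c s = eta n m v c s"
    using Hd_mono[OF assms(2), of m] unfolding Bten_def by (auto intro!: sum.neutral)
qed

lemma dact_eta:
  assumes m: "m <= N" and h: "h \<in> Hd N m"
  shows "dact N m x h (eta N m v) c s = (if c \<in> Hd N m
     then \<Sum>\<sigma>\<in>perms m. if rt \<sigma> c = h then x ^ (N - m) * v (s \<circ> \<sigma>) else 0 else 0)"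
proof (cases "c \<in> Hd N m")
  case c: True
  have "dact N m x h (eta N m v) c s
      = (\<Sum>d\<in>Hd N m. \<Sum>\<sigma>\<in>perms m. if Gp N h d = c then x ^ ell N h d * (dlt (ud m) (rt \<sigma> d) * v (s \<circ> \<sigma>)) else 0)"
    using c unfolding dact_def by (simp, intro sum.cong refl) (auto simp: Bten_def sum_distrib_left)
  also have "... = (\<Sum>\<sigma>\<in>perms m. \<Sum>d\<in>Hd N m. if Gp N h d = c then x ^ ell N h d * (dlt (ud m) (rt \<sigma> d) * v (s \<circ> \<sigma>)) else 0)"
    by (rule sum.swap)
  also have "... = (\<Sum>\<sigma>\<in>perms m. if rt \<sigma> c = h then x ^ (N - m) * v (s \<circ> \<sigma>) else 0)"
  proof (rule sum.cong[OF refl])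
    fix \<sigma> assume "\<sigma> \<in> perms m"
    then have \<sigma>: "\<sigma> permutes {1..m}" by (simp add: perms_def)
    define d0 where "d0 = rt (inv \<sigma>) (ud m)"
    have d0: "d0 \<in> Hd N m" unfolding d0_def by (rule Hd_rt[OF permutes_inv[OF \<sigma>] m ud_Hd[OF m]])
    have iff: "rt \<sigma> d = ud m \<longleftrightarrow> d = d0" for d unfolding d0_def using rt_inv[OF \<sigma>] by metis
    have G: "Gp N h d0 = rt (inv \<sigma>) h" "ell N h d0 = N - m"
      using Gp_rt[OF permutes_inv[OF \<sigma>] m HdD(1)[OF h] HdD(1)[OF ud_Hd[OF m]]] Gp_ud[OF m h] unfolding d0_def by auto
    have "(\<Sum>d\<in>Hd N m. if Gp N h d = c then x ^ ell N h d * (dlt (ud m) (rt \<sigma> d) * v (s \<circ> \<sigma>)) else 0)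
        = (\<Sum>d\<in>Hd N m. if d0 = d then (if Gp N h d = c then x ^ ell N h d * v (s \<circ> \<sigma>) else 0) else 0)"
      by (rule sum.cong[OF refl]) (auto simp: dlt_def iff)
    also have "... = (if rt (inv \<sigma>) h = c then x ^ (N - m) * v (s \<circ> \<sigma>) else 0)"
      using d0 G by simp
    also have "... = (if rt \<sigma> c = h then x ^ (N - m) * v (s \<circ> \<sigma>) else 0)"
      using rt_inv[OF \<sigma>] by metis
    finally show "(\<Sum>d\<in>Hd N m. if Gp N h d = c then x ^ ell N h d * (dlt (ud m) (rt \<sigma> d) * v (s \<circ> \<sigma>)) else 0)
        = (if rt \<sigma> c = h then x ^ (N - m) * v (s \<circ> \<sigma>) else 0)" .
  qed
  finally show ?thesis using c by simp
qed (simp add: dact_def)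

text \<open>Every equivariant function is recovered by letting half diagrams act on generators. The
  factor consists of the \<open>N - m\<close> loops produced by \<open>ud m\<close> and of the
  \<open>m!\<close> permutations.\<close>

lemma sum_dact_eta:
  fixes x :: "'a::field_char_0"
  assumes m: "m <= N" and \<phi>: "\<phi> \<in> Ehd N m V"
  shows "(\<Sum>h\<in>Hd N m. dact N m x h (eta N m (\<phi> h)) c s) = x ^ (N - m) * fact m * \<phi> c s"
proof (cases "c \<in> Hd N m")
  case c: True
  have "(\<Sum>h\<in>Hd N m. dact N m x h (eta N m (\<phi> h)) c s)
      = (\<Sum>h\<in>Hd N m. \<Sum>\<sigma>\<in>perms m. if rt \<sigma> c = h then x ^ (N - m) * \<phi> h (s \<circ> \<sigma>) else 0)"
    by (rule sum.cong[OF refl]) (simp add: dact_eta[OF m] c)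
  also have "... = (\<Sum>\<sigma>\<in>perms m. \<Sum>h\<in>Hd N m. if rt \<sigma> c = h then x ^ (N - m) * \<phi> h (s \<circ> \<sigma>) else 0)"
    by (rule sum.swap)
  also have "... = (\<Sum>\<sigma>\<in>perms m. x ^ (N - m) * \<phi> c s)"
  proof (rule sum.cong[OF refl])
    fix \<sigma> assume "\<sigma> \<in> perms m"
    then have \<sigma>: "\<sigma> permutes {1..m}" by (simp add: perms_def)
    show "(\<Sum>h\<in>Hd N m. if rt \<sigma> c = h then x ^ (N - m) * \<phi> h (s \<circ> \<sigma>) else 0) = x ^ (N - m) * \<phi> c s"
      using Hd_rt[OF \<sigma> m c] EhdD(3)[OF \<phi> \<sigma> c] by simp
  qed
  finally show ?thesis by (simp add: card_perms)
qed (simp add: dact_def EhdD(1)[OF \<phi>])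

text \<open>After cutting, no product keeps all \<open>m\<close> vertical arcs. In terms of colours:
  the bottom ends of the strands at \<open>i\<close> and \<open>j\<close> can be coloured with the
  whole top row left uncoloured, which a vertical arc at such an end forbids.\<close>

lemma dact_cutd_eta:
  assumes m: "m <= n" and ij: "i \<in> {1..m}" "j \<in> {1..m}"
  shows "dact n m x (cutd n i j) (eta n m v) = (%c s. 0)"
proof (intro ext)
  fix c s
  have ijn: "i \<in> {1..n}" "j \<in> {1..n}" using ij m by auto
  note w = cutd_Dg[OF ijn]
  have zero: "x ^ ell n (cutd n i j) d * eta n m v d s = 0" if c: "c \<in> Hd n m" and d: "d \<in> Hd n m" and G: "Gp n (cutd n i j) d = c" for d
  proof -
    have "rt \<sigma> d ~= ud m" if s: "\<sigma> \<in> perms m" for \<sigma>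
    proof
      assume r: "rt \<sigma> d = ud m"
      have \<sigma>: "\<sigma> permutes {1..m}" using s by (simp add: perms_def)
      note \<sigma>' = permutes_inv[OF \<sigma>]
      have dd: "d = rt (inv \<sigma>) (ud m)" using r rt_inv[OF \<sigma>] by metis
      define B where "B = \<sigma> ` {i, j}"
      have B: "B <= {1..n}" "inv \<sigma> ` B = {i, j}"
        using permutes_image_sub[OF \<sigma> m, of "{i, j}"] ijn permutes_inverses[OF \<sigma>] unfolding B_def by auto
      have "cmat d {i, j} B = 1"
        unfolding dd cmat_rt[OF \<sigma>' HdD(1)[OF ud_Hd[OF m]]] B(2) cmat_udiag by simp
      then have 1: "dcompat d {i, j} B" by (simp add: cmat_def split: if_splits)
      have "cmat (cutd n i j) {} {i, j} = 1" unfolding cmat_cutd by simp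
      then have 2: "dcompat (cutd n i j) {} {i, j}" by (simp add: cmat_def split: if_splits)
      have "dcompat c {} B" unfolding G[symmetric]
        by (rule compat_Gp[OF w HdD(1)[OF d] _ B(1) _ 2 1]) (use ijn in auto)
      moreover have "\<sigma> i \<in> {1..m}" using permutes_in_image[OF \<sigma>] ij by blast
      then obtain k where "{Top k, Bot (\<sigma> i)} \<in> c" using HdD(2)[OF c] by blast
      ultimately have "vlab {} B (Top k) = vlab {} B (Bot (\<sigma> i))" unfolding dcompat_def by blast
      then show False unfolding B_def by simp
    qed
    then have "eta n m v d s = 0" unfolding Bten_def by (auto simp: dlt_def intro!: sum.neutral)
    then show ?thesis by simp
  qed
  show "dact n m x (cutd n i j) (eta n m v) c s = 0"
  proof (cases "c \<in> Hd n m")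
    case True
    have "(\<Sum>d\<in>Hd n m. if Gp n (cutd n i j) d = c then x ^ ell n (cutd n i j) d * eta n m v d s else 0) = 0"
    proof (rule sum.neutral, rule ballI)
      fix d assume "d \<in> Hd n m"
      then show "(if Gp n (cutd n i j) d = c then x ^ ell n (cutd n i j) d * eta n m v d s else 0) = 0"
        using zero[OF True] by auto
    qed
    then show ?thesis unfolding dact_def by simp
  qed (simp add: dact_def)
qed

lemma Bten_lincomb_right:
  "Bten n m f (%s. \<Sum>i\<in>I. c i * g i s) = (%h s. \<Sum>i\<in>I. c i * Bten n m f (g i) h s)"
proof (intro ext)
  fix h s
  show "Bten n m f (%s. \<Sum>i\<in>I. c i * g i s) h s = (\<Sum>i\<in>I. c i * Bten n m f (g i) h s)"
  proof (cases "h \<in> Hd n m")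
    case True
    have "Bten n m f (%s. \<Sum>i\<in>I. c i * g i s) h s = (\<Sum>\<sigma>\<in>perms m. \<Sum>i\<in>I. c i * (f (rt \<sigma> h) * g i (s \<circ> \<sigma>)))"
      using True by (simp add: Bten_def sum_distrib_left mult_ac)
    also have "... = (\<Sum>i\<in>I. \<Sum>\<sigma>\<in>perms m. c i * (f (rt \<sigma> h) * g i (s \<circ> \<sigma>)))" by (rule sum.swap)
    finally show ?thesis using True by (simp add: Bten_def sum_distrib_left)
  qed (simp add: Bten_def)
qed

text \<open>Bending changes only the arc at bottom \<open>Suc n\<close>, so the failure is visible
  in \<open>a\<close> and can be treated by \<open>cutd\<close>. An arc from one of the first
  \<open>m\<close> bottom vertices to bottom \<open>Suc n\<close> is no failure, since bending makes
  it vertical.\<close>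

lemma bend_not_HdE:
  assumes a: "a \<in> Dg (Suc n)" and m: "m <= n" and iso: "\<And>i v. m < i ==> {Bot i, v} \<notin> bend (Suc n) (Suc (Suc n)) a"
    and nH: "bend (Suc n) (Suc (Suc n)) a \<notin> Hd (Suc (Suc n)) m"
  obtains i j where "i \<in> {1..m}" "j \<in> {1..m}" "i = j \<and> (\<forall>v. {Bot i, v} \<notin> a) \<or> {Bot i, Bot j} \<in> a"
proof -
  let ?b = "bend (Suc n) (Suc (Suc n)) a"
  let ?f = "%v. if v = Bot (Suc n) then Top (Suc (Suc n)) else v"
  have "\<exists>i\<in>{1..m}. \<forall>j. {Top j, Bot i} \<notin> ?b"
    using nH bend_Dg[OF a] iso unfolding Hd_def by blast
  then obtain i where i: "i \<in> {1..m}" "\<And>j. {Top j, Bot i} \<notin> ?b" by blast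
  have fi: "?f (Bot i) = Bot i" using i m by auto
  have edge: "{?f u, ?f v} \<in> ?b" if "{u, v} \<in> a" for u v unfolding bend_def by (rule vmap_edgeI[OF that])
  show thesis
  proof (cases "\<forall>v. {Bot i, v} \<notin> a")
    case True
    then show thesis using that[of i i] i by blast
  next
    case False
    then obtain v where v: "{Bot i, v} \<in> a" by blast
    have e: "{Bot i, ?f v} \<in> ?b" using edge[OF v] unfolding fi .
    show thesis
    proof (cases v)
      case (Top k)
      then show thesis using e i(2)[of k] by (simp add: insert_commute)
    next
      case (Bot k)
      have "k ~= Suc n" using e i(2)[of "Suc (Suc n)"] Bot by (auto simp: insert_commute)
      then have "{Bot k, Bot i} \<in> ?b" using e Bot by (simp add: insert_commute)
      then have "\<not> m < k" using iso by blast
      moreover have "1 <= k" using Dg_edgeD(3)[OF a v] Bot by simp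
      ultimately show thesis using that[of i k] i v Bot by auto
    qed
  qed
qed

text \<open>The tensor of a diagram \<open>a\<close> with \<open>X\<close> goes to the bent diagram
  acting on the function of \<open>X\<close>, both viewed in size \<open>n + 2\<close>. This is
  balanced because bending leaves the first \<open>n\<close> bottom vertices alone. It is bijective
  because unbending inverts it on half diagrams, while all other bent diagrams come from zero
  tensors.\<close>

lemma indmod_miso:
  fixes x :: "'a::field_char_0" and N :: "('a, diag => 'a, 'v) amod"
  assumes x: "x ~= 0" and m: "m <= n" and V: "srep m V" and Phi: "miso (freesp (Dg n)) N (Emod n m x V) \<Phi>"
  shows "\<exists>\<Phi>'. miso (freesp (Dg (Suc n))) (indmod n x N) (resmod (Suc n) (Emod (Suc (Suc n)) m x V)) \<Phi>'"
proof -
  define n1 where "n1 = Suc n"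
  define n2 where "n2 = Suc (Suc n)"
  define M where "M = alg_right n x"
  define R where "R = (freesp (Dg n) :: (diag => 'a) set)"
  define E where "E = resmod (Suc n) (Emod (Suc (Suc n)) m x V)"
  define bd where "bd = bend n1 n2"
  define G where "G a d = Gp n1 a (hat n d)" for a d
  define L where "L a d = ell n1 a (hat n d)" for a d
  define B where "B a X = (%c s. \<Sum>a0\<in>Dg n1. a a0 * dact n2 m x (bd a0) (\<Phi> X) c s)" for a X
  define \<xi> where "\<xi> v = inv_into (mcarr N) \<Phi> (eta n m v)" for v
  define \<kappa> where "\<kappa> = inverse (x ^ (n2 - m) * fact m)"
  define \<kappa>' where "\<kappa>' = inverse (x ^ (n - m) * fact m)"
  define \<Psi> where "\<Psi> \<phi> = (%p. \<Sum>h\<in>Hd n2 m. \<kappa> * dlt (dlt (unbend n1 n2 h) :: diag => 'a, \<xi> (\<phi> h)) p)"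
    for \<phi> :: "diag => (nat => nat) => 'a"
  define W where "W = lspan (tens_rels M N R)"
  have W: "fsub W" unfolding W_def by (rule fsub_lspan)
  have fV: "fsub V" using V unfolding srep_def by simp
  have n12: "n1 = Suc n" "n2 = Suc n1" unfolding n1_def n2_def by simp_all
  have m2: "m <= n2" using m n12 by simp
  have E_s: "mcarr E = Ehd n2 m V" "mact E = (%b. hact n2 m x (eps n1 b))" "mzero E = (%y z. 0)"
    "madd E = (%f g y z. f y z + g y z)" "msmul E = (%c f y z. c * f y z)"
    unfolding E_def resmod_def Emod_def n1_def n2_def by simp_all
  have M_s: "mcarr M = freesp (Dg n1)" "mact M = (%r f. amul n1 x f (eps n r))" "mzero M = (%c. 0)"
    "madd M = (%f g c. f c + g c)" "msmul M = (%a f c. a * f c)"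
    unfolding M_def alg_right_def n1_def by simp_all
  have fM: "fsub (mcarr M)" unfolding M_s by (rule fsub_freesp)
  have hom: "is_hom R N (Emod n m x V) \<Phi>" and bij: "bij_betw \<Phi> (mcarr N) (Ehd n m V)"
    and cN: "mclosed R N" using Phi unfolding miso_def R_def by (auto simp: Emod_def)
  have PhiE: "\<Phi> X \<in> Ehd n m V" if "X \<in> mcarr N" for X using bij that unfolding bij_betw_def by blast
  have PhiE2: "\<Phi> X \<in> Ehd n2 m V" if "X \<in> mcarr N" for X
    using Ehd_mono[OF fV m _ PhiE[OF that]] n12 by simp
  have Phi0: "\<Phi> X h s = 0" if "X \<in> mcarr N" "h \<notin> Hd n m" for X h s using EhdD(1)[OF PhiE] that by blast
  have inj: "X = Y" if "X \<in> mcarr N" "Y \<in> mcarr N" "\<Phi> X = \<Phi> Y" for X Y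
    using bij that unfolding bij_betw_def inj_on_def by blast
  have Nadd: "madd N X Y \<in> mcarr N" "\<Phi> (madd N X Y) = (%h s. \<Phi> X h s + \<Phi> Y h s)" if "X \<in> mcarr N" "Y \<in> mcarr N" for X Y
    using cN hom that unfolding mclosed_def is_hom_def by (auto simp: Emod_def)
  have Nsc: "msmul N c X \<in> mcarr N" "\<Phi> (msmul N c X) = (%h s. c * \<Phi> X h s)" if "X \<in> mcarr N" for X c
    using cN hom that unfolding mclosed_def is_hom_def by (auto simp: Emod_def)
  have Nact: "mact N r X \<in> mcarr N" "\<Phi> (mact N r X) = hact n m x r (\<Phi> X)" if "X \<in> mcarr N" "r \<in> R" for X r
    using cN hom that unfolding mclosed_def is_hom_def by (auto simp: Emod_def)
  have fmM: "fmod M (%f. f)" unfolding fmod_def M_s(4,5) using fsubD[OF fM] by simp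
  have fmN: "fmod N (%X q. \<Phi> X (fst q) (snd q))"
    unfolding fmod_def
  proof (intro conjI ballI allI)
    show "inj_on (%X q. \<Phi> X (fst q) (snd q)) (mcarr N)"
    proof (rule inj_onI)
      fix X Y assume X: "X \<in> mcarr N" "Y \<in> mcarr N" and eq: "(%q. \<Phi> X (fst q) (snd q)) = (%q. \<Phi> Y (fst q) (snd q))"
      have "\<Phi> X = \<Phi> Y"
      proof (intro ext)
        fix h s show "\<Phi> X h s = \<Phi> Y h s" using fun_cong[OF eq, of "(h, s)"] by simp
      qed
      then show "X = Y" by (rule inj[OF X])
    qed
  qed (simp_all add: Nadd Nsc)
  have xi: "\<xi> v \<in> mcarr N" "\<Phi> (\<xi> v) = eta n m v" if "v \<in> V" for v
  proof -
    have "eta n m v \<in> \<Phi> ` mcarr N" using Bten_Ehd[OF V that m] bij unfolding bij_betw_def by blast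
    then show "\<xi> v \<in> mcarr N" "\<Phi> (\<xi> v) = eta n m v" unfolding \<xi>_def by (rule inv_into_into, rule f_inv_into_f)
  qed
  have bdD: "bd a \<in> Dg n2" if "a \<in> Dg n1" for a unfolding bd_def n12 using bend_Dg that n12 by blast
  have GD: "G a d \<in> Dg n1" if "a \<in> Dg n1" "d \<in> Dg n" for a d
    unfolding G_def using Gp_Dg[OF that(1)[unfolded n12] hat_Dg[OF that(2)]] n12 by simp
  have Gbd: "Gp n2 (bd a) d = bd (G a d)" "ell n2 (bd a) d = L a d + 2" if "a \<in> Dg n1" "d \<in> Dg n" for a d
    using Gp_bend_low[OF that(1)[unfolded n12] that(2)] unfolding bd_def G_def L_def n12 by auto
  have Hsub: "Hd n m <= Hd n2 m" by (rule Hd_mono) (simp add: n12)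
  have dact_bd: "dact n2 m x (bd a) \<phi> h s
      = (if h \<in> Hd n2 m then \<Sum>d\<in>Hd n m. (if bd (G a d) = h then x ^ (L a d + 2) else 0) * \<phi> d s else 0)"
    if a: "a \<in> Dg n1" and \<phi>: "\<And>h s. h \<notin> Hd n m ==> \<phi> h s = 0"
    for a h s and \<phi> :: "diag => (nat => nat) => 'a"
  proof -
    have "(\<Sum>d\<in>Hd n2 m. if Gp n2 (bd a) d = h then x ^ ell n2 (bd a) d * \<phi> d s else 0)
       = (\<Sum>d\<in>Hd n m. if Gp n2 (bd a) d = h then x ^ ell n2 (bd a) d * \<phi> d s else 0)"
      by (rule sum.mono_neutral_right) (use Hsub \<phi> in auto)
    also have "... = (\<Sum>d\<in>Hd n m. (if bd (G a d) = h then x ^ (L a d + 2) else 0) * \<phi> d s)"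
      by (rule sum.cong[OF refl]) (simp add: Gbd[OF a HdD(1)])
    finally show ?thesis by (simp add: dact_def)
  qed
  have dact2: "dact n2 m x r \<phi> = (%c s. x ^ 2 * dact n m x r \<phi> c s)"
    if r: "r \<in> Dg n" and \<phi>: "\<And>h s. h \<notin> Hd n m ==> \<phi> h s = 0" for r and \<phi> :: "diag => (nat => nat) => 'a"
  proof -
    have "\<phi> h s = 0" if "h \<notin> Hd n1 m" for h s using \<phi> that Hd_mono[of n n1 m] n12 by auto
    then have "dact n2 m x r \<phi> = (%c s. x * dact n1 m x r \<phi> c s)"
      unfolding n12(2) by (intro dact_low) (use r Dg_Suc n12 in auto)
    moreover have "dact n1 m x r \<phi> = (%c s. x * dact n m x r \<phi> c s)"
      unfolding n12(1) by (rule dact_low[OF r \<phi>])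
    ultimately show ?thesis by (simp add: power2_eq_square mult.assoc)
  qed
  have bal: "x ^ L a r * dact n2 m x (bd (G a r)) (\<Phi> X) c s = dact n2 m x (bd a) (dact n m x r (\<Phi> X)) c s"
    if a: "a \<in> Dg n1" and r: "r \<in> Dg n" and X: "X \<in> mcarr N" for a r X c s
  proof -
    have rn2: "r \<in> Dg n2" using Dg_mono[of n n2] r n12 by auto
    have "x ^ 2 * dact n2 m x (bd a) (dact n m x r (\<Phi> X)) c s
        = dact n2 m x (bd a) (%c s. x ^ 2 * dact n m x r (\<Phi> X) c s) c s"
      unfolding dact_scale ..
    also have "... = dact n2 m x (bd a) (dact n2 m x r (\<Phi> X)) c s"
      using dact2[OF r Phi0[OF X]] by simp
    also have "... = x ^ 2 * (x ^ L a r * dact n2 m x (bd (G a r)) (\<Phi> X) c s)"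
      unfolding dact_assoc[OF bdD[OF a] rn2] Gbd[OF a r] by (simp add: power_add power2_eq_square mult_ac)
    finally show ?thesis using x by simp
  qed
  have kinv: "\<kappa> * (x ^ (n2 - m) * fact m * y) = y" "\<kappa>' * (x ^ (n - m) * fact m * y) = y" for y
    using x unfolding \<kappa>_def \<kappa>'_def by (simp_all add: field_simps)
  have kx: "\<kappa> * x ^ (k + 2) = \<kappa>' * x ^ k" for k
  proof -
    have "n2 - m = (n - m) + 2" using m n12 by simp
    then show ?thesis using x unfolding \<kappa>_def \<kappa>'_def by (simp add: power_add field_simps)
  qed
  \<comment> \<open>With \<open>w\<close> the cut diagram at the defect, \<open>x\<close> times this
    tensor equals the tensor of \<open>G a d\<close> times \<open>w\<close> with
    \<open>\<xi> v\<close>; moving \<open>w\<close> to the second factor kills it.\<close>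
  have vanish: "teq W (dlt (dlt (G a d), \<xi> v)) (%p. 0)"
    if a: "a \<in> Dg n1" and d: "d \<in> Hd n m" and v: "v \<in> V" and nH: "bd (G a d) \<notin> Hd n2 m" for a d v
  proof -
    note dD = HdD(1)[OF d]
    have dn2: "d \<in> Dg n2" using Dg_mono[of n n2] dD n12 by auto
    have iso: "{Bot i, w} \<notin> bd (G a d)" if "m < i" for i w
      unfolding Gbd[OF a dD, symmetric] by (intro isolated_Bot_Gp[OF bdD[OF a] dn2] HdD(3)[OF d] that)
    obtain i j where ij: "i \<in> {1..m}" "j \<in> {1..m}" "i = j \<and> (\<forall>w. {Bot i, w} \<notin> G a d) \<or> {Bot i, Bot j} \<in> G a d"
      by (rule bend_not_HdE[OF GD[OF a dD, unfolded n12] m iso[unfolded bd_def n12] nH[unfolded bd_def n12]])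
    have ijn: "i \<in> {1..n}" "j \<in> {1..n}" "i \<in> {1..n1}" "j \<in> {1..n1}" using ij m n12 by auto
    define w where "w = cutd n i j"
    have wD: "w \<in> Dg n" unfolding w_def by (rule cutd_Dg[OF ijn(1,2)])
    then have wR: "dlt w \<in> R" unfolding R_def by simp
    have gM: "dlt (G a d) \<in> mcarr M" unfolding M_s using GD[OF a dD] by simp
    have "hat n w = cutd n1 i j" unfolding w_def n12 by (rule hat_cutd[OF ijn(1,2)])
    then have "mact M (dlt w) (dlt (G a d)) = msmul M x (dlt (G a d))"
      using Gp_cutd[OF GD[OF a dD] ijn(3,4) ij(3)] amul_dlt_dlt[OF GD[OF a dD] cutd_Dg[OF ijn(3,4)], of x]
      unfolding M_s eps_dlt[OF wD] by simp
    then have "teq W (dlt (msmul M x (dlt (G a d)), \<xi> v)) (dlt (dlt (G a d), mact N (dlt w) (\<xi> v)))"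
      using teq_act[OF W_def wR gM xi(1)[OF v]] by simp
    also have "mact N (dlt w) (\<xi> v) = msmul N 0 (\<xi> v)"
    proof (rule inj)
      show "mact N (dlt w) (\<xi> v) \<in> mcarr N" "msmul N 0 (\<xi> v) \<in> mcarr N"
        using Nact(1)[OF xi(1)[OF v] wR] Nsc(1)[OF xi(1)[OF v]] .
      have "\<Phi> (mact N (dlt w) (\<xi> v)) = (%c s. 0)"
        unfolding Nact(2)[OF xi(1)[OF v] wR] xi(2)[OF v] hact_dlt[OF wD] unfolding w_def by (rule dact_cutd_eta[OF m ij(1,2)])
      then show "\<Phi> (mact N (dlt w) (\<xi> v)) = \<Phi> (msmul N 0 (\<xi> v))" unfolding Nsc(2)[OF xi(1)[OF v]] by simp
    qed
    also have "teq W (dlt (dlt (G a d), msmul N 0 (\<xi> v))) (%p. 0 * dlt (dlt (G a d), \<xi> v) p)"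
      by (rule teq_scaler[OF W_def gM xi(1)[OF v]])
    finally (teq_trans[OF W]) have "teq W (dlt (msmul M x (dlt (G a d)), \<xi> v)) (%p. 0)" by simp
    with teq_sym[OF W teq_scalel[OF W_def gM xi(1)[OF v], of x]]
    have "teq W (%p. x * dlt (dlt (G a d), \<xi> v) p) (%p. 0)" by (rule teq_trans[OF W])
    from teq_scale[OF W this, of "inverse x"] show ?thesis using x by (simp add: mult.assoc[symmetric])
  qed
  have BE: "B a X \<in> Ehd n2 m V" if "X \<in> mcarr N" for a X
    unfolding B_def by (rule Ehd_lincomb[OF fV dact_Ehd[OF fV m2 bdD PhiE2[OF that]]])
  have fin: "finite (Dg n1 \<times> Hd n m)" by simp
  have "indmod n x N = tensor M N R (amul n1 x)" unfolding indmod_def M_def R_def n1_def ..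
  moreover have "miso (freesp (Dg n1)) (tensor M N R (amul n1 x)) E (%X. lext B (rep X))"
  proof (rule tensor_miso[OF _ _ _ _ _ _ _ _ _ _ _ cN _ _ _ W_def, where \<Psi> = \<Psi>])
    show "B a X \<in> mcarr E" if "X \<in> mcarr N" for a X unfolding E_s by (rule BE[OF that])
    show "B (madd M a a') X = (%y z. B a X y z + B a' X y z)" for a a' X
      unfolding B_def M_s by (simp add: sum.distrib distrib_right)
    show "B (msmul M c a) X = (%y z. c * B a X y z)" for c a X
      unfolding B_def M_s by (simp add: sum_distrib_left mult_ac)
    show "B a (madd N X Y) = (%y z. B a X y z + B a Y y z)" if "X \<in> mcarr N" "Y \<in> mcarr N" for a X Y
      unfolding B_def Nadd(2)[OF that] using dact_lin[of n2 m x _ "\<Phi> X" 1 "\<Phi> Y"]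
      by (simp add: sum.distrib distrib_left)
    show "B a (msmul N c X) = (%y z. c * B a X y z)" if "X \<in> mcarr N" for a c X
      unfolding B_def Nsc(2)[OF that] dact_scale by (simp add: sum_distrib_left mult_ac)
    show "B (mact M r a) X = B a (mact N r X)" if r: "r \<in> R" and X: "X \<in> mcarr N" for r a X
    proof (intro ext)
      fix c s
      have "B (mact M r a) X c s = (\<Sum>a0\<in>Dg n1. \<Sum>b\<in>Dg n1. a a0 * eps n r b * x ^ ell n1 a0 b * dact n2 m x (bd (Gp n1 a0 b)) (\<Phi> X) c s)"
        unfolding B_def M_s amul_sum ..
      also have "... = (\<Sum>a0\<in>Dg n1. \<Sum>b\<in>Dg n1. eps n r b * (a a0 * x ^ ell n1 a0 b * dact n2 m x (bd (Gp n1 a0 b)) (\<Phi> X) c s))"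
        by (simp add: mult_ac)
      also have "... = (\<Sum>a0\<in>Dg n1. \<Sum>r0\<in>Dg n. r r0 * (a a0 * x ^ L a0 r0 * dact n2 m x (bd (G a0 r0)) (\<Phi> X) c s))"
        unfolding n12(1) eps_sum unfolding L_def G_def n12(1) ..
      also have "... = (\<Sum>a0\<in>Dg n1. a a0 * (\<Sum>r0\<in>Dg n. r r0 * dact n2 m x (bd a0) (dact n m x r0 (\<Phi> X)) c s))"
        unfolding sum_distrib_left
      proof (intro sum.cong refl)
        fix a0 r0 assume "a0 \<in> Dg n1" "r0 \<in> Dg n"
        from bal[OF this X, of c s, symmetric]
        show "r r0 * (a a0 * x ^ L a0 r0 * dact n2 m x (bd (G a0 r0)) (\<Phi> X) c s)
            = a a0 * (r r0 * dact n2 m x (bd a0) (dact n m x r0 (\<Phi> X)) c s)" by (simp add: mult_ac)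
      qed
      also have "... = B a (mact N r X) c s"
        unfolding B_def Nact(2)[OF X r] unfolding hact_def dact_lincomb ..
      finally show "B (mact M r a) X c s = B a (mact N r X) c s" .
    qed
    show "mzero E = (%y z. 0)" "madd E = (%f g y z. f y z + g y z)" "msmul E = (%c f y z. c * f y z)"
      by (fact E_s)+
    show "mclosed (freesp (Dg n1)) E"
      unfolding mclosed_def E_s using Ehd_zero[OF fV] Ehd_add[OF fV] Ehd_scale[OF fV] hact_Ehd[OF fV m2] by simp
    show "mclosed R M" unfolding mclosed_def using fsubD[OF fM] unfolding M_s by (simp add: amul_freesp)
    show "amul n1 x b a \<in> mcarr M" for b a unfolding M_s by (rule amul_freesp)
    show "B (amul n1 x b a) X = mact E b (B a X)" for b a X
    proof (intro ext)
      fix c s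
      have "B (amul n1 x b a) X c s = (\<Sum>b0\<in>Dg n1. \<Sum>a0\<in>Dg n1. b b0 * a a0 * x ^ ell n1 b0 a0 * dact n2 m x (bd (Gp n1 b0 a0)) (\<Phi> X) c s)"
        unfolding B_def amul_sum ..
      also have "... = (\<Sum>b0\<in>Dg n1. b b0 * (\<Sum>a0\<in>Dg n1. a a0 * dact n2 m x (hat n1 b0) (dact n2 m x (bd a0) (\<Phi> X)) c s))"
        unfolding sum_distrib_left
      proof (intro sum.cong refl)
        fix b0 a0 assume b0: "b0 \<in> Dg n1" and a0: "a0 \<in> Dg n1"
        have hb: "hat n1 b0 \<in> Dg n2" unfolding n12(2) by (rule hat_Dg[OF b0])
        have "Gp n2 (hat n1 b0) (bd a0) = bd (Gp n1 b0 a0) \<and> ell n2 (hat n1 b0) (bd a0) = ell n1 b0 a0"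
          unfolding bd_def n12(2) by (rule Gp_hat_bend[OF b0 a0]) (simp add: n12)
        then show "b b0 * a a0 * x ^ ell n1 b0 a0 * dact n2 m x (bd (Gp n1 b0 a0)) (\<Phi> X) c s
            = b b0 * (a a0 * dact n2 m x (hat n1 b0) (dact n2 m x (bd a0) (\<Phi> X)) c s)"
          unfolding dact_assoc[OF hb bdD[OF a0]] by (simp add: mult_ac)
      qed
      also have "... = mact E b (B a X) c s"
        unfolding E_s unfolding n12(2) hact_eps unfolding B_def n12(2) dact_lincomb ..
      finally show "B (amul n1 x b a) X c s = mact E b (B a X) c s" .
    qed
    show "mact E b (%y z. f y z + c * g y z) = (%y z. mact E b f y z + c * mact E b g y z)" for b c f g
      unfolding E_s by (rule hact_lin)
    show "teq W (\<Psi> (%y z. f y z + c * g y z)) (%p. \<Psi> f p + c * \<Psi> g p)"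
      if fg: "f \<in> mcarr E" "g \<in> mcarr E" for c f g
    proof -
      have "teq W (\<Psi> (%y z. f y z + c * g y z))
          (%p. \<Sum>h\<in>Hd n2 m. \<kappa> * (\<Sum>b\<in>UNIV. (if b then 1 else c) * dlt (dlt (unbend n1 n2 h), if b then \<xi> (f h) else \<xi> (g h)) p))"
        unfolding \<Psi>_def
      proof (rule teq_sum[OF W])
        fix h assume h: "h \<in> Hd n2 m"
        have fh: "f h \<in> V" "g h \<in> V" using fg EhdD(2) h unfolding E_s by blast+
        have fgh: "(%s. f h s + c * g h s) \<in> V" using fsubD(2)[OF fV fh(1) fsubD(3)[OF fV fh(2)]] .
        have uh: "unbend n1 n2 h \<in> Dg n1" unfolding n12(2)
          by (rule unbend_Dg) (use HdD[OF h] m n12 in auto)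
        show "teq W (dlt (dlt (unbend n1 n2 h), \<xi> (%s. f h s + c * g h s)))
           (%p. \<Sum>b\<in>UNIV. (if b then 1 else c) * dlt (dlt (unbend n1 n2 h), if b then \<xi> (f h) else \<xi> (g h)) p)"
        proof (rule teq_lincomb_right[OF W_def fmN])
          show "dlt (unbend n1 n2 h) \<in> mcarr M" unfolding M_s using uh by simp
          show "(if b then \<xi> (f h) else \<xi> (g h)) \<in> mcarr N" for b using xi(1) fh by simp
          show "\<xi> (%s. f h s + c * g h s) \<in> mcarr N" by (rule xi(1)[OF fgh])
          have "eta n m (%s. \<Sum>b\<in>UNIV. (if b then 1 else c) * (if b then f h else g h) s)
              = (%y z. \<Sum>b\<in>UNIV. (if b then 1 else c) * eta n m (if b then f h else g h) y z)"
            by (rule Bten_lincomb_right)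
          then show "(%q. \<Phi> (\<xi> (%s. f h s + c * g h s)) (fst q) (snd q))
              = (%y. \<Sum>b\<in>UNIV. (if b then 1 else c) * \<Phi> (if b then \<xi> (f h) else \<xi> (g h)) (fst y) (snd y))"
            by (simp add: xi(2)[OF fgh] xi(2)[OF fh(1)] xi(2)[OF fh(2)] UNIV_bool add.commute)
        qed simp
      qed
      moreover have "(%p. \<Sum>h\<in>Hd n2 m. \<kappa> * (\<Sum>b\<in>UNIV. (if b then 1 else c) * dlt (dlt (unbend n1 n2 h), if b then \<xi> (f h) else \<xi> (g h)) p))
          = (%p. \<Psi> f p + c * \<Psi> g p)"
        unfolding \<Psi>_def by (simp add: UNIV_bool sum.distrib sum_distrib_left distrib_left mult_ac add.commute)
      ultimately show ?thesis by simp
    qed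
    show "\<Psi> \<phi> \<in> freesp (mcarr M \<times> mcarr N)" if "\<phi> \<in> mcarr E" for \<phi>
      unfolding \<Psi>_def
    proof (rule fsub_lincomb[OF fsub_freesp])
      fix h assume h: "h \<in> Hd n2 m"
      have "\<xi> (\<phi> h) \<in> mcarr N" using xi(1) EhdD(2) that h unfolding E_s by blast
      moreover have "unbend n1 n2 h \<in> Dg n1" unfolding n12(2)
        by (rule unbend_Dg) (use HdD[OF h] m n12 in auto)
      ultimately show "(dlt (dlt (unbend n1 n2 h), \<xi> (\<phi> h)) :: _ => 'a) \<in> freesp (mcarr M \<times> mcarr N)" unfolding M_s by simp
    qed
    show "lext B (\<Psi> \<phi>) = \<phi>" if phi: "\<phi> \<in> mcarr E" for \<phi>
    proof (intro ext)
      fix c s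
      have \<phi>: "\<phi> \<in> Ehd n2 m V" using phi unfolding E_s .
      have "lext B (\<Psi> \<phi>) c s = (\<Sum>h\<in>Hd n2 m. \<kappa> * B (dlt (unbend n1 n2 h)) (\<xi> (\<phi> h)) c s)"
        unfolding \<Psi>_def using lext_lincomb[of "Hd n2 m" B "%_. \<kappa>" "%h. (dlt (unbend n1 n2 h), \<xi> (\<phi> h))"] by simp
      also have "... = (\<Sum>h\<in>Hd n2 m. \<kappa> * dact n2 m x h (eta n2 m (\<phi> h)) c s)"
      proof (rule sum.cong[OF refl])
        fix h assume h: "h \<in> Hd n2 m"
        have u: "unbend n1 n2 h \<in> Dg n1" unfolding n12(2)
          by (rule unbend_Dg) (use HdD[OF h] m n12 in auto)
        have bu: "bd (unbend n1 n2 h) = h" unfolding bd_def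
          by (rule bend_unbend[OF HdD(1)[OF h] HdD(3)[OF h]]) (use m n12 in simp)
        have "B (dlt (unbend n1 n2 h)) (\<xi> (\<phi> h)) c s = dact n2 m x h (\<Phi> (\<xi> (\<phi> h))) c s"
          unfolding B_def sum_dlt_right(1)[OF finite_Dg u] bu ..
        moreover have "\<Phi> (\<xi> (\<phi> h)) = eta n2 m (\<phi> h)"
          using xi(2)[OF EhdD(2)[OF \<phi> h]] eta_mono[OF m, of n2 "\<phi> h"] n12 by simp
        ultimately show "\<kappa> * B (dlt (unbend n1 n2 h)) (\<xi> (\<phi> h)) c s = \<kappa> * dact n2 m x h (eta n2 m (\<phi> h)) c s" by simp
      qed
      also have "... = \<phi> c s"
        unfolding sum_distrib_left[symmetric] sum_dact_eta[OF m2 \<phi>] kinv ..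
      finally show "lext B (\<Psi> \<phi>) c s = \<phi> c s" .
    qed
    show "teq W (dlt (a, X)) (\<Psi> (B a X))" if a: "a \<in> mcarr M" and X: "X \<in> mcarr N" for a X
    proof -
      \<comment> \<open>The second factor is expanded into diagrams acting on generators, and these
        diagrams are moved into the first factor. What remains are tensors of basis diagrams with
        generators; \<open>vanish\<close> removes those whose bend is no half diagram.\<close>
      define \<phi> where "\<phi> = \<Phi> X"
      have \<phi>: "\<phi> \<in> Ehd n m V" unfolding \<phi>_def by (rule PhiE[OF X])
      have \<phi>V: "\<phi> d \<in> V" if "d \<in> Hd n m" for d using EhdD(2)[OF \<phi> that] .
      define cf where "cf a0 d = (if bd (G a0 d) \<in> Hd n2 m then \<kappa>' * x ^ L a0 d else 0)" for a0 d
      have dM: "dlt a0 \<in> mcarr M" if "a0 \<in> Dg n1" for a0 unfolding M_s using that by simp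
      have dR: "dlt d \<in> R" if "d \<in> Hd n m" for d unfolding R_def using HdD(1)[OF that] by simp
      have l1: "teq W (dlt (a, X)) (%p. \<Sum>a0\<in>Dg n1. a a0 * dlt (dlt a0, X) p)"
      proof (rule teq_lincomb_left[OF W_def fmM])
        show "a = (%y. \<Sum>a0\<in>Dg n1. a a0 * dlt a0 y)"
        proof
          fix y
          have "(\<Sum>h\<in>Dg n1. a h * dlt h y) = (\<Sum>h\<in>Dg n1. if y = h then a h else 0)"
            by (rule sum.cong) (auto simp: dlt_def)
          then show "a y = (\<Sum>h\<in>Dg n1. a h * dlt h y)" using freesp_zero a unfolding M_s by (auto simp: sum.delta)
        qed
      qed (use a X dM in auto)
      have l2: "teq W (dlt (dlt a0, X)) (%p. \<Sum>d\<in>Hd n m. \<kappa>' * dlt (dlt a0, mact N (dlt d) (\<xi> (\<phi> d))) p)"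
        if a0: "a0 \<in> Dg n1" for a0
      proof (rule teq_lincomb_right[OF W_def fmN])
        have "\<Phi> X h s = (\<Sum>d\<in>Hd n m. \<kappa>' * \<Phi> (mact N (dlt d) (\<xi> (\<phi> d))) h s)" for h s
        proof -
          have "(\<Sum>d\<in>Hd n m. \<kappa>' * \<Phi> (mact N (dlt d) (\<xi> (\<phi> d))) h s) = (\<Sum>d\<in>Hd n m. \<kappa>' * dact n m x d (eta n m (\<phi> d)) h s)"
            by (rule sum.cong[OF refl]) (simp add: Nact(2)[OF xi(1)[OF \<phi>V] dR] xi(2)[OF \<phi>V] hact_dlt[OF HdD(1)])
          also have "... = \<phi> h s"
            unfolding sum_distrib_left[symmetric] sum_dact_eta[OF m \<phi>] kinv ..
          finally show ?thesis unfolding \<phi>_def by simp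
        qed
        then show "(%q. \<Phi> X (fst q) (snd q)) = (%y. \<Sum>d\<in>Hd n m. \<kappa>' * \<Phi> (mact N (dlt d) (\<xi> (\<phi> d))) (fst y) (snd y))"
          by simp
      qed (use dM[OF a0] X Nact(1)[OF xi(1)[OF \<phi>V] dR] in auto)
      have l3: "teq W (%p. \<kappa>' * dlt (dlt a0, mact N (dlt d) (\<xi> (\<phi> d))) p) (%p. cf a0 d * dlt (dlt (G a0 d), \<xi> (\<phi> d)) p)"
        if a0: "a0 \<in> Dg n1" and d: "d \<in> Hd n m" for a0 d
      proof -
        note dD = HdD(1)[OF d]
        note X = xi(1)[OF \<phi>V[OF d]]
        have g: "dlt (G a0 d) \<in> mcarr M" by (rule dM[OF GD[OF a0 dD]])
        have hd: "hat n d \<in> Dg n1" unfolding n12 by (rule hat_Dg[OF dD])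
        have "mact M (dlt d) (dlt a0) = msmul M (x ^ L a0 d) (dlt (G a0 d))"
          unfolding M_s eps_dlt[OF dD] amul_dlt_dlt[OF a0 hd] G_def L_def ..
        then have "teq W (dlt (dlt a0, mact N (dlt d) (\<xi> (\<phi> d)))) (dlt (msmul M (x ^ L a0 d) (dlt (G a0 d)), \<xi> (\<phi> d)))"
          using teq_sym[OF W teq_act[OF W_def dR[OF d] dM[OF a0] X]] by simp
        also have "teq W (dlt (msmul M (x ^ L a0 d) (dlt (G a0 d)), \<xi> (\<phi> d))) (%p. x ^ L a0 d * dlt (dlt (G a0 d), \<xi> (\<phi> d)) p)"
          by (rule teq_scalel[OF W_def g X])
        finally (teq_trans[OF W]) have t: "teq W (dlt (dlt a0, mact N (dlt d) (\<xi> (\<phi> d)))) (%p. x ^ L a0 d * dlt (dlt (G a0 d), \<xi> (\<phi> d)) p)" .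
        show ?thesis
        proof (cases "bd (G a0 d) \<in> Hd n2 m")
          case True
          then show ?thesis using teq_scale[OF W t, of \<kappa>'] by (simp add: cf_def mult.assoc)
        next
          case False
          have "teq W (%p. x ^ L a0 d * dlt (dlt (G a0 d), \<xi> (\<phi> d)) p) (%p. x ^ L a0 d * 0)"
            by (rule teq_scale[OF W vanish[OF a0 d \<phi>V[OF d] False]])
          then show ?thesis using teq_scale[OF W teq_trans[OF W t], of _ \<kappa>'] False by (fastforce simp: cf_def)
        qed
      qed
      have l4: "teq W (dlt (dlt a0, X)) (%p. \<Sum>d\<in>Hd n m. cf a0 d * dlt (dlt (G a0 d), \<xi> (\<phi> d)) p)"
        if a0: "a0 \<in> Dg n1" for a0
      proof -
        have "teq W (%p. \<Sum>d\<in>Hd n m. 1 * (\<kappa>' * dlt (dlt a0, mact N (dlt d) (\<xi> (\<phi> d))) p))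
            (%p. \<Sum>d\<in>Hd n m. 1 * (cf a0 d * dlt (dlt (G a0 d), \<xi> (\<phi> d)) p))"
          by (rule teq_sum[OF W l3[OF a0]])
        then show ?thesis using teq_trans[OF W l2[OF a0]] by simp
      qed
      have L: "teq W (dlt (a, X)) (%p. \<Sum>a0\<in>Dg n1. a a0 * (\<Sum>d\<in>Hd n m. cf a0 d * dlt (dlt (G a0 d), \<xi> (\<phi> d)) p))"
        by (rule teq_trans[OF W l1 teq_sum[OF W l4]])
      define co where "co h q = a (fst q) * (if bd (G (fst q) (snd q)) = h then x ^ (L (fst q) (snd q) + 2) else 0)" for h q
      have r1: "teq W (dlt (dlt (unbend n1 n2 h), \<xi> (B a X h)))
          (%p. \<Sum>q\<in>Dg n1 \<times> Hd n m. co h q * dlt (dlt (unbend n1 n2 h), \<xi> (\<phi> (snd q))) p)" if h: "h \<in> Hd n2 m" for h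
      proof (rule teq_lincomb_right[OF W_def fmN fin])
        show "dlt (unbend n1 n2 h) \<in> mcarr M"
          unfolding M_s n12(2) using unbend_Dg[of h n1 n1] HdD[OF h] m n12 by simp
        have BV: "B a X h \<in> V" using EhdD(2)[OF BE[OF X] h] .
        show "\<xi> (B a X h) \<in> mcarr N" by (rule xi(1)[OF BV])
        show "\<xi> (\<phi> (snd q)) \<in> mcarr N" if "q \<in> Dg n1 \<times> Hd n m" for q using xi(1)[OF \<phi>V] that by auto
        have "B a X h s = (\<Sum>q\<in>Dg n1 \<times> Hd n m. co h q * \<phi> (snd q) s)" for s
        proof -
          have "B a X h s = (\<Sum>a0\<in>Dg n1. \<Sum>d\<in>Hd n m. co h (a0, d) * \<phi> d s)"
            unfolding B_def
          proof (rule sum.cong[OF refl])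
            fix a0 assume a0: "a0 \<in> Dg n1"
            show "a a0 * dact n2 m x (bd a0) (\<Phi> X) h s = (\<Sum>d\<in>Hd n m. co h (a0, d) * \<phi> d s)"
              using dact_bd[where a = a0 and \<phi> = "\<Phi> X" and h = h and s = s, OF a0 Phi0[OF X]] h unfolding \<phi>_def co_def fst_conv snd_conv by (simp add: sum_distrib_left mult.assoc)
          qed
          also have "... = (\<Sum>q\<in>Dg n1 \<times> Hd n m. co h q * \<phi> (snd q) s)"
            unfolding sum.cartesian_product by (rule sum.cong) auto
          finally show ?thesis .
        qed
        then have "B a X h = (%s. \<Sum>q\<in>Dg n1 \<times> Hd n m. co h q * \<phi> (snd q) s)" by blast
        then have "eta n m (B a X h) = (%y z. \<Sum>q\<in>Dg n1 \<times> Hd n m. co h q * eta n m (\<phi> (snd q)) y z)"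
          by (simp only: Bten_lincomb_right)
        then show "(%q. \<Phi> (\<xi> (B a X h)) (fst q) (snd q))
            = (%y. \<Sum>q\<in>Dg n1 \<times> Hd n m. co h q * \<Phi> (\<xi> (\<phi> (snd q))) (fst y) (snd y))"
          unfolding xi(2)[OF BV] by (auto simp: xi(2)[OF \<phi>V] intro!: sum.cong)
      qed
      have "teq W (\<Psi> (B a X)) (%p. \<Sum>h\<in>Hd n2 m. \<kappa> * (\<Sum>q\<in>Dg n1 \<times> Hd n m. co h q * dlt (dlt (unbend n1 n2 h), \<xi> (\<phi> (snd q))) p))"
        unfolding \<Psi>_def by (rule teq_sum[OF W r1])
      moreover have "(\<Sum>h\<in>Hd n2 m. \<kappa> * (\<Sum>q\<in>Dg n1 \<times> Hd n m. co h q * dlt (dlt (unbend n1 n2 h), \<xi> (\<phi> (snd q))) p))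
          = (\<Sum>a0\<in>Dg n1. a a0 * (\<Sum>d\<in>Hd n m. cf a0 d * dlt (dlt (G a0 d), \<xi> (\<phi> d)) p))" for p :: "(diag => 'a) \<times> 'v"
      proof -
        have "(\<Sum>h\<in>Hd n2 m. \<kappa> * (\<Sum>q\<in>Dg n1 \<times> Hd n m. co h q * dlt (dlt (unbend n1 n2 h), \<xi> (\<phi> (snd q))) p))
           = (\<Sum>q\<in>Dg n1 \<times> Hd n m. \<Sum>h\<in>Hd n2 m. \<kappa> * (co h q * dlt (dlt (unbend n1 n2 h), \<xi> (\<phi> (snd q))) p))"
          unfolding sum_distrib_left by (rule sum.swap)
        also have "... = (\<Sum>q\<in>Dg n1 \<times> Hd n m. a (fst q) * (cf (fst q) (snd q) * dlt (dlt (G (fst q) (snd q)), \<xi> (\<phi> (snd q))) p))"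
        proof (rule sum.cong[OF refl])
          fix q assume q: "q \<in> Dg n1 \<times> Hd n m"
          let ?g = "G (fst q) (snd q)"
          have gD: "?g \<in> Dg n1" using GD[of "fst q" "snd q"] q HdD(1) by auto
          have ub: "unbend n1 n2 (bd ?g) = ?g" unfolding bd_def by (rule unbend_bend[OF gD]) (simp add: n12)
          have "(\<Sum>h\<in>Hd n2 m. \<kappa> * (co h q * dlt (dlt (unbend n1 n2 h), \<xi> (\<phi> (snd q))) p))
            = (\<Sum>h\<in>Hd n2 m. if bd ?g = h then \<kappa> * (a (fst q) * x ^ (L (fst q) (snd q) + 2) * dlt (dlt (unbend n1 n2 h), \<xi> (\<phi> (snd q))) p) else 0)"
            by (rule sum.cong[OF refl]) (simp add: co_def)
          also have "... = (if bd ?g \<in> Hd n2 m then \<kappa> * (a (fst q) * x ^ (L (fst q) (snd q) + 2) * dlt (dlt ?g, \<xi> (\<phi> (snd q))) p) else 0)"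
            by (simp add: ub)
          also have "... = a (fst q) * (cf (fst q) (snd q) * dlt (dlt ?g, \<xi> (\<phi> (snd q))) p)"
          proof -
            have "\<kappa> * (a (fst q) * x ^ (L (fst q) (snd q) + 2) * y) = a (fst q) * ((\<kappa> * x ^ (L (fst q) (snd q) + 2)) * y)" for y
              by (simp only: mult_ac)
            then show ?thesis unfolding kx cf_def by simp
          qed
          finally show "(\<Sum>h\<in>Hd n2 m. \<kappa> * (co h q * dlt (dlt (unbend n1 n2 h), \<xi> (\<phi> (snd q))) p))
              = a (fst q) * (cf (fst q) (snd q) * dlt (dlt ?g, \<xi> (\<phi> (snd q))) p)" .
        qed
        also have "... = (\<Sum>a0\<in>Dg n1. \<Sum>d\<in>Hd n m. a a0 * (cf a0 d * dlt (dlt (G a0 d), \<xi> (\<phi> d)) p))"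
          unfolding sum.cartesian_product by (rule sum.cong) auto
        finally show ?thesis by (simp add: sum_distrib_left)
      qed
      ultimately have "teq W (\<Psi> (B a X)) (%p. \<Sum>a0\<in>Dg n1. a a0 * (\<Sum>d\<in>Hd n m. cf a0 d * dlt (dlt (G a0 d), \<xi> (\<phi> d)) p))" by simp
      then show ?thesis using teq_trans[OF W L] teq_sym[OF W] by blast
    qed
  qed
  ultimately show ?thesis unfolding E_def n1_def by metis
qed

subsection \<open>Functions on tabloids and raising operators\<close>

definition cnt :: "nat => (nat => nat) => nat => nat" where
  "cnt m s r = card {k \<in> {1..m}. s k = r}"

text \<open>A tabloid assigns to each point its row. The value 0 off \<open>{1..m}\<close> only
  serves to make it a unique function, although 0 is also the index of the first row.\<close>

definition Tab :: "nat => (nat => nat) => (nat => nat) set" where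
  "Tab m c = {s. (\<forall>k. k \<notin> {1..m} --> s k = 0) \<and> (\<forall>r. cnt m s r = c r)}"

definition Fsp :: "nat => (nat => nat) => ((nat => nat) => 'a::comm_ring_1) set" where
  "Fsp m c = {v. \<forall>s. s \<notin> Tab m c --> v s = 0}"

text \<open>On a basis tabloid this moves one point from row \<open>q\<close> to row
  \<open>p\<close> (see \<open>mv_dlt\<close>); on functions the move appears reversed. These
  operators satisfy the \<open>gl\<close> relations on rows and commute with the symmetric
  group.\<close>

definition mv :: "nat => nat => nat => ((nat => nat) => 'a::comm_ring_1) => (nat => nat) => 'a" where
  "mv m p q v = (%s. \<Sum>k\<in>{k \<in> {1..m}. s k = p}. v (s(k := q)))"

text \<open>Highest weight vectors of weight \<open>c\<close>. For a partition this will be the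
  Specht module, by James's kernel intersection theorem (\<open>HW_eq_sp\<close>).\<close>

definition HW :: "nat => (nat => nat) => ((nat => nat) => 'a::comm_ring_1) set" where
  "HW m c = {v \<in> Fsp m c. \<forall>r. mv m r (Suc r) v = (%s. 0)}"

lemma FspD: "v \<in> Fsp m c ==> v s ~= 0 ==> s \<in> Tab m c"
  unfolding Fsp_def by blast

lemma FspI: "(\<And>s. v s ~= 0 ==> s \<in> Tab m c) ==> v \<in> Fsp m c"
  unfolding Fsp_def by blast

lemma fsub_Fsp: "fsub (Fsp m c)"
  unfolding fsub_def Fsp_def by auto

lemma mv_lin: "mv m p q (%s. u s + c * v s) = (%s. mv m p q u s + c * mv m p q v s)"
  unfolding mv_def by (simp add: sum.distrib sum_distrib_left)

lemma mv_zero [simp]: "mv m p q (%s. 0) = (%s. 0)"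
  unfolding mv_def by simp

lemma mv_scale: "mv m p q (%s. c * v s) = (%s. c * mv m p q v s)"
  using mv_lin[where u = "%s. 0" and c = c and v = v] by simp

lemma mv_lincomb: "mv m p q (%s. \<Sum>i\<in>I. c i * f i s) = (%s. \<Sum>i\<in>I. c i * mv m p q (f i) s)"
proof (induction I rule: infinite_finite_induct)
  case (insert i I)
  have "mv m p q (%s. (\<Sum>i\<in>I. c i * f i s) + c i * f i s) = (%s. (\<Sum>i\<in>I. c i * mv m p q (f i) s) + c i * mv m p q (f i) s)"
    unfolding mv_lin insert.IH ..
  then show ?case using insert by (simp add: add.commute)
qed simp_all

lemma fsub_HW: "fsub (HW m c)"
proof -
  have a: "mv m p q (%s. u s + v s) = (%s. mv m p q u s + mv m p q v s)" for p q and u v :: "(nat => nat) => 'a"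
    using mv_lin[where u = u and c = 1 and v = v] by simp
  have b: "mv m p q (%s. c * v s) = (%s. c * mv m p q v s)" for p q c and v :: "(nat => nat) => 'a"
    using mv_lin[where u = "%s. 0" and c = c and v = v] by simp
  show ?thesis unfolding fsub_def HW_def using fsubD[OF fsub_Fsp[where 'a = 'a and m = m and c = c]] by (simp add: a b)
qed

lemma cnt_update:
  assumes k: "k \<in> {1..m}" and p: "s k = p" and "p ~= q"
  shows "cnt m s p = Suc (cnt m (s(k := q)) p)" "cnt m (s(k := q)) q = Suc (cnt m s q)"
    "r ~= p ==> r ~= q ==> cnt m (s(k := q)) r = cnt m s r"
proof -
  have "{j \<in> {1..m}. s j = p} = insert k {j \<in> {1..m}. (s(k := q)) j = p}" using assms by auto
  then show "cnt m s p = Suc (cnt m (s(k := q)) p)" unfolding cnt_def using assms by simp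
  have "{j \<in> {1..m}. (s(k := q)) j = q} = insert k {j \<in> {1..m}. s j = q}" using assms by auto
  then show "cnt m (s(k := q)) q = Suc (cnt m s q)" unfolding cnt_def using assms by simp
  assume "r ~= p" "r ~= q"
  then have "{j \<in> {1..m}. (s(k := q)) j = r} = {j \<in> {1..m}. s j = r}" using assms by auto
  then show "cnt m (s(k := q)) r = cnt m s r" unfolding cnt_def by simp
qed

lemma mv_nonzeroE:
  assumes "mv m p q v s ~= 0"
  obtains k where "k \<in> {1..m}" "s k = p" "v (s(k := q)) ~= 0"
proof -
  obtain k where "k \<in> {k \<in> {1..m}. s k = p}" "v (s(k := q)) ~= 0"
    using assms unfolding mv_def by (rule sum.not_neutral_contains_not_neutral)
  then show thesis using that by blast
qed

lemma Tab_update: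
  assumes T: "s(k := q) \<in> Tab m c" and k: "k \<in> {1..m}" and pq: "p ~= q" "s k = p"
  shows "0 < c q" "s \<in> Tab m (c(p := Suc (c p), q := c q - 1))"
proof -
  have z: "s j = 0" if j: "j \<notin> {1..m}" for j
  proof -
    have "(s(k := q)) j = 0" using T j unfolding Tab_def mem_Collect_eq by blast
    then show ?thesis using k j by (cases "j = k") auto
  qed
  have c: "cnt m (s(k := q)) r = c r" for r using T unfolding Tab_def by blast
  note u = cnt_update[of k m s p q, OF k pq(2) pq(1)]
  show "0 < c q" using u(2) c[of q] by simp
  have "cnt m s r = (c(p := Suc (c p), q := c q - 1)) r" for r
    using u(1) u(2) u(3)[of r] c[of p] c[of q] c[of r] pq(1) by (cases "r = p"; cases "r = q") auto
  then show "s \<in> Tab m (c(p := Suc (c p), q := c q - 1))" unfolding Tab_def using z by blast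
qed

lemma mv_Fsp:
  assumes v: "v \<in> Fsp m c" and pq: "p ~= q"
  shows "mv m p q v \<in> Fsp m (c(p := Suc (c p), q := c q - 1))" "c q = 0 ==> mv m p q v = (%s. 0)"
proof -
  have *: "0 < c q \<and> s \<in> Tab m (c(p := Suc (c p), q := c q - 1))" if "mv m p q v s ~= 0" for s
  proof -
    from that obtain k where k: "k \<in> {1..m}" "s k = p" "v (s(k := q)) ~= 0" by (rule mv_nonzeroE)
    note T = FspD[of v m c "s(k := q)", OF v k(3)]
    show ?thesis by (intro conjI Tab_update[of s k q m c p, OF T k(1) pq k(2)])
  qed
  show "mv m p q v \<in> Fsp m (c(p := Suc (c p), q := c q - 1))" by (rule FspI) (use * in blast)
  show "c q = 0 ==> mv m p q v = (%s. 0)" using * by (auto simp: fun_eq_iff)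
qed

lemma mv_self: "mv m p p v s = of_nat (cnt m s p) * v s"
proof -
  have "mv m p p v s = (\<Sum>k\<in>{k \<in> {1..m}. s k = p}. v s)"
    unfolding mv_def by (rule sum.cong[OF refl]) (auto simp: fun_upd_idem)
  then show ?thesis by (simp add: cnt_def)
qed

text \<open>The correction term arises when the second move picks the point that the first one has
  just put into row \<open>r\<close>.\<close>

lemma mv_mv:
  "mv m p q (mv m r t v) s = (\<Sum>k\<in>{k \<in> {1..m}. s k = p}. \<Sum>j\<in>{j \<in> {1..m}. s j = r} - {k}. v (s(k := q, j := t)))
     + (if q = r then mv m p t v s else 0)"
proof -
  have "mv m r t v (s(k := q)) = (\<Sum>j\<in>{j \<in> {1..m}. s j = r} - {k}. v (s(k := q, j := t))) + (if q = r then v (s(k := t)) else 0)"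
    if k: "k \<in> {1..m}" for k
  proof (cases "q = r")
    case True
    have e: "{j \<in> {1..m}. (s(k := q)) j = r} = insert k ({j \<in> {1..m}. s j = r} - {k})" using k True by auto
    have "mv m r t v (s(k := q)) = v (s(k := q, k := t)) + (\<Sum>j\<in>{j \<in> {1..m}. s j = r} - {k}. v (s(k := q, j := t)))"
      unfolding mv_def e by (rule sum.insert) auto
    then show ?thesis using True by (simp add: add.commute)
  next
    case False
    have "{j \<in> {1..m}. (s(k := q)) j = r} = {j \<in> {1..m}. s j = r} - {k}" using False by auto
    then show ?thesis using False by (simp add: mv_def)
  qed
  then have "mv m p q (mv m r t v) s = (\<Sum>k\<in>{k \<in> {1..m}. s k = p}.
      (\<Sum>j\<in>{j \<in> {1..m}. s j = r} - {k}. v (s(k := q, j := t))) + (if q = r then v (s(k := t)) else 0))"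
    unfolding mv_def[of m p q] by (intro sum.cong refl) simp
  then show ?thesis by (simp add: sum.distrib mv_def)
qed

text \<open>The commutator of elementary matrices. Moves of two distinct points commute, so only the
  terms in which one point is moved twice survive.\<close>

lemma mv_comm:
  "mv m p q (mv m r t v) s - mv m r t (mv m p q v) s
     = (if q = r then mv m p t v s else 0) - (if t = p then mv m r q v s else 0)"
proof -
  let ?P = "{k \<in> {1..m}. s k = p}" and ?R = "{j \<in> {1..m}. s j = r}"
  have "(\<Sum>k\<in>?P. \<Sum>j\<in>?R - {k}. v (s(k := q, j := t))) = (\<Sum>k\<in>?P. \<Sum>j\<in>?R. if j ~= k then v (s(k := q, j := t)) else 0)"
    by (rule sum.cong[OF refl], rule sum.mono_neutral_cong_left) auto
  also have "... = (\<Sum>j\<in>?R. \<Sum>k\<in>?P. if j ~= k then v (s(k := q, j := t)) else 0)" by (rule sum.swap)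
  also have "... = (\<Sum>j\<in>?R. \<Sum>k\<in>?P - {j}. v (s(j := t, k := q)))"
    by (rule sum.cong[OF refl], rule sum.mono_neutral_cong_right) (auto simp: fun_upd_twist)
  finally show ?thesis unfolding mv_mv by simp
qed

text \<open>The operators \<open>mv m r (Suc r)\<close> and \<open>mv m (Suc r) r\<close> generate an \<open>sl\<^sub>2\<close>; a vector of negative
  weight killed by the raising operator vanishes.\<close>

lemma raising_inj:
  fixes v :: "(nat => nat) => 'a::field_char_0"
  assumes ab: "a < b" and supp: "\<And>s. v s ~= 0 ==> cnt m s r = a \<and> cnt m s (Suc r) = b"
    and E: "mv m r (Suc r) v = (%s. 0)"
  shows "v = (%s. 0)"
proof -
  define w where "w k = (mv m (Suc r) r ^^ k) v" for k
  have w0: "w 0 = v" and wS: "w (Suc k) = mv m (Suc r) r (w k)" for k by (simp_all add: w_def)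
  \<comment> \<open>Each lowering takes one point out of row \<open>r\<close>. Since
    \<open>v\<close> has \<open>a\<close> points there, the sequence \<open>w\<close> ends after
    \<open>a + 1\<close> steps.\<close>
  have sup: "cnt m s r + k = a \<and> cnt m s (Suc r) = b + k" if "w k s ~= 0" for k s
    using that
  proof (induction k arbitrary: s)
    case (Suc k)
    from Suc.prems obtain i where i: "i \<in> {1..m}" "s i = Suc r" "w k (s(i := r)) ~= 0"
      unfolding wS by (rule mv_nonzeroE)
    have "cnt m s (Suc r) = Suc (cnt m (s(i := r)) (Suc r))" "cnt m (s(i := r)) r = Suc (cnt m s r)"
      using cnt_update(1,2)[of i m s "Suc r" r] i(1,2) by simp_all
    then show ?case using Suc.IH[of "s(i := r)", OF i(3)] by linarith
  qed (use supp w0 in auto)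
  have EF: "mv m r (Suc r) (w (Suc k)) s = mv m (Suc r) r (mv m r (Suc r) (w k)) s
      + (of_int (int a - int b - 2 * int k)) * w k s" for k s
  proof -
    have "mv m r (Suc r) (mv m (Suc r) r (w k)) s - mv m (Suc r) r (mv m r (Suc r) (w k)) s
        = of_nat (cnt m s r) * w k s - of_nat (cnt m s (Suc r)) * w k s"
      unfolding mv_comm by (simp add: mv_self)
    also have "... = (of_int (int a - int b - 2 * int k)) * w k s"
    proof (cases "w k s = 0")
      case False
      have "int (cnt m s r) - int (cnt m s (Suc r)) = int a - int b - 2 * int k" using sup[OF False] by linarith
      then have "(of_nat (cnt m s r) :: 'a) - of_nat (cnt m s (Suc r)) = of_int (int a - int b - 2 * int k)"
        by (metis of_int_diff of_int_of_nat_eq)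
      then show ?thesis by (simp only: left_diff_distrib[symmetric])
    qed simp
    finally show ?thesis unfolding wS by (simp add: algebra_simps)
  qed
  \<comment> \<open>The standard computation \<open>e f^(k+1) v = (k+1)(a-b-k) f^k v\<close>.
    Because \<open>a < b\<close> the factor never vanishes, so the vanishing of
    \<open>w (Suc k)\<close> is inherited by \<open>w k\<close>, down to \<open>v\<close>
    itself.\<close>
  have EW: "mv m r (Suc r) (w (Suc k)) s = of_int (int (Suc k) * (int a - int b - int k)) * w k s" for k s
  proof (induction k arbitrary: s)
    case 0
    show ?case unfolding EF w0 E by simp
  next
    case (Suc k)
    have "mv m r (Suc r) (w (Suc k)) = (%s. of_int (int (Suc k) * (int a - int b - int k)) * w k s)" using Suc.IH by auto
    then have "mv m (Suc r) r (mv m r (Suc r) (w (Suc k))) s = of_int (int (Suc k) * (int a - int b - int k)) * w (Suc k) s"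
      by (simp only: mv_scale wS[symmetric])
    then have "mv m r (Suc r) (w (Suc (Suc k))) s = of_int (int (Suc k) * (int a - int b - int k)) * w (Suc k) s
       + (of_int (int a - int b - 2 * int (Suc k))) * w (Suc k) s"
      unfolding EF[of "Suc k"] by (rule arg_cong)
    also have "... = (of_int (int (Suc k) * (int a - int b - int k) + (int a - int b - 2 * int (Suc k)))) * w (Suc k) s"
      by (simp only: of_int_add distrib_right)
    also have "int (Suc k) * (int a - int b - int k) + (int a - int b - 2 * int (Suc k)) = int (Suc (Suc k)) * (int a - int b - int (Suc k))"
      by (simp add: algebra_simps)
    finally show ?case .
  qed
  have top: "w (Suc a) = (%s. 0)"
  proof
    fix s show "w (Suc a) s = 0" using sup[of "Suc a" s] by auto
  qed
  have "w (a - j) = (%s. 0)" for j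
  proof (induction j)
    have step: "w k = (%s. 0)" if "w (Suc k) = (%s. 0)" for k
    proof
      fix s
      have "of_int (int (Suc k) * (int a - int b - int k)) * w k s = 0" using EW[of k s] that by simp
      moreover have "int (Suc k) * (int a - int b - int k) ~= 0" using ab by simp
      ultimately show "w k s = 0" by (metis mult_eq_0_iff of_int_eq_0_iff)
    qed
    case 0
    show ?case using step[of a] top by simp
    case (Suc j)
    show ?case
    proof (cases "j < a")
      case True
      then have "Suc (a - Suc j) = a - j" by simp
      then show ?thesis using step[of "a - Suc j"] Suc by simp
    next
      case False
      then show ?thesis using Suc by simp
    qed
  qed
  from this[of a] show ?thesis using w0 by simp
qed

lemma update_comp_perm:
  assumes "\<sigma> permutes S"
  shows "s(\<sigma> j := q) \<circ> \<sigma> = (s \<circ> \<sigma>)(j := q)"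
  using permutes_inj[OF assms] by (auto simp: fun_eq_iff inj_eq)

lemma mv_act:
  assumes \<sigma>: "\<sigma> permutes {1..m}"
  shows "mv m p q (%s. v (s \<circ> \<sigma>)) = (%s. mv m p q v (s \<circ> \<sigma>))"
proof
  fix s
  have "bij_betw \<sigma> {k \<in> {1..m}. (s \<circ> \<sigma>) k = p} {k \<in> {1..m}. s k = p}"
    by (rule bij_betw_byWitness[where f' = "inv \<sigma>"])
      (use permutes_inverses[OF \<sigma>] permutes_in_image[OF \<sigma>] permutes_in_image[OF permutes_inv[OF \<sigma>]] in auto)
  then have "mv m p q (%s. v (s \<circ> \<sigma>)) s = (\<Sum>k\<in>{k \<in> {1..m}. (s \<circ> \<sigma>) k = p}. v (s(\<sigma> k := q) \<circ> \<sigma>))"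
    unfolding mv_def by (rule sum.reindex_bij_betw[symmetric])
  then show "mv m p q (%s. v (s \<circ> \<sigma>)) s = mv m p q v (s \<circ> \<sigma>)"
    unfolding update_comp_perm[OF \<sigma>] mv_def .
qed

lemma cnt_comp: "\<sigma> permutes {1..m} ==> cnt m (s \<circ> \<sigma>) r = cnt m s r"
proof -
  assume \<sigma>: "\<sigma> permutes {1..m}"
  have "bij_betw \<sigma> {k \<in> {1..m}. (s \<circ> \<sigma>) k = r} {k \<in> {1..m}. s k = r}"
    by (rule bij_betw_byWitness[where f' = "inv \<sigma>"])
      (use permutes_inverses[OF \<sigma>] permutes_in_image[OF \<sigma>] permutes_in_image[OF permutes_inv[OF \<sigma>]] in auto)
  then show ?thesis unfolding cnt_def by (rule bij_betw_same_card)
qed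

lemma Tab_comp:
  assumes \<sigma>: "\<sigma> permutes {1..m}"
  shows "s \<circ> \<sigma> \<in> Tab m c \<longleftrightarrow> s \<in> Tab m c"
proof -
  have "(\<forall>k. k \<notin> {1..m} --> (s \<circ> \<sigma>) k = 0) \<longleftrightarrow> (\<forall>k. k \<notin> {1..m} --> s k = 0)"
    using permutes_not_in[OF \<sigma>] by auto
  then show ?thesis unfolding Tab_def mem_Collect_eq cnt_comp[OF \<sigma>] by (rule arg_cong)
qed

lemma srep_Fsp: "srep m (Fsp m c)"
  unfolding srep_def using fsub_Fsp Tab_comp unfolding Fsp_def by blast

lemma srep_HW: "srep m (HW m c)"
  unfolding srep_def
proof (intro conjI allI impI)
  show "fsub (HW m c)" by (rule fsub_HW)
  fix \<sigma> and v :: "(nat => nat) => 'a" assume \<sigma>: "\<sigma> permutes {1..m}" and v: "v \<in> HW m c"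
  then show "(%s. v (s \<circ> \<sigma>)) \<in> HW m c"
    using srep_Fsp[where 'a = 'a and m = m and c = c] unfolding HW_def srep_def by (simp add: mv_act[OF \<sigma>])
qed

lemma mv_dlt: "mv m p q (dlt t) = (%s. \<Sum>k\<in>{k \<in> {1..m}. t k = q}. dlt (t(k := p)) s)"
proof
  fix s
  have eq: "(s k = p \<and> s(k := q) = t) \<longleftrightarrow> (t k = q \<and> s = t(k := p))" for k
    by (auto simp: fun_eq_iff)
  have "mv m p q (dlt t) s = (\<Sum>k\<in>{1..m}. if s k = p \<and> s(k := q) = t then 1 else 0)"
    unfolding mv_def dlt_def by (rule sum.mono_neutral_cong_left) auto
  also have "... = (\<Sum>k\<in>{k \<in> {1..m}. t k = q}. dlt (t(k := p)) s)"
    unfolding eq dlt_def by (rule sum.mono_neutral_cong_right) auto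
  finally show "mv m p q (dlt t) s = (\<Sum>k\<in>{k \<in> {1..m}. t k = q}. dlt (t(k := p)) s)" .
qed

text \<open>For the column group of a tableau this signed sum turns the tabloid into the polytabloid
  (see \<open>polytab_kap\<close>).\<close>

definition kap :: "(nat => nat) set => ((nat => nat) => 'a::comm_ring_1) => (nat => nat) => 'a" where
  "kap C v = (%s. \<Sum>\<sigma>\<in>C. of_int (sign \<sigma>) * v (s \<circ> \<sigma>))"

lemma mv_kap:
  assumes "C <= perms m"
  shows "mv m p q (kap C v) = kap C (mv m p q v)"
proof -
  have "mv m p q (kap C v) = (%s. \<Sum>\<sigma>\<in>C. of_int (sign \<sigma>) * mv m p q (%s. v (s \<circ> \<sigma>)) s)"
    unfolding kap_def by (rule mv_lincomb)
  also have "... = kap C (mv m p q v)"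
    unfolding kap_def using assms by (intro ext sum.cong refl) (auto simp: mv_act perms_def)
  finally show ?thesis .
qed

lemma kap_sum: "kap C (%s. \<Sum>k\<in>K. f k s) = (%s. \<Sum>k\<in>K. kap C (f k) s)"
  unfolding kap_def sum_distrib_left by (intro ext) (rule sum.swap)

lemma kap_Fsp: "C <= perms m ==> v \<in> Fsp m c ==> kap C v \<in> Fsp m c"
  unfolding kap_def by (rule fsub_lincomb[OF fsub_Fsp]) (use srep_Fsp[of m c] in \<open>auto simp: srep_def perms_def\<close>)

text \<open>The transposition fixes the tabloid and changes the sign of every summand, so the sum
  equals its own negative.\<close>

lemma kap_dlt_zero:
  assumes tr: "\<And>\<sigma>. \<sigma> \<in> C ==> \<sigma> \<circ> transpose i j \<in> C" and C: "C <= perms m"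
    and ij: "i ~= j" "t i = t j"
  shows "kap C (dlt t) = (%s. 0 :: 'a::field_char_0)"
proof
  fix s
  let ?\<tau> = "transpose i j"
  have bij: "bij_betw (%\<sigma>. \<sigma> \<circ> ?\<tau>) C C"
    by (rule bij_betw_byWitness[where f' = "%\<sigma>. \<sigma> \<circ> ?\<tau>"]) (use tr in \<open>auto simp: o_assoc[symmetric]\<close>)
  have fx: "t \<circ> ?\<tau> = t" using ij by (auto simp: fun_eq_iff transpose_def)
  have "dlt t (u \<circ> ?\<tau>) = (dlt t u :: 'a)" for u
  proof -
    have "u \<circ> ?\<tau> = t \<longleftrightarrow> u = t"
    proof
      assume "u \<circ> ?\<tau> = t"
      then have "u \<circ> ?\<tau> \<circ> ?\<tau> = t \<circ> ?\<tau>" by simp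
      then show "u = t" using fx by (simp add: o_assoc[symmetric])
    qed (use fx in simp)
    then show ?thesis by (simp add: dlt_def)
  qed
  note inv = this
  have sg: "sign (\<sigma> \<circ> ?\<tau>) = - sign \<sigma>" if "\<sigma> \<in> C" for \<sigma>
  proof -
    have "\<sigma> permutes {1..m}" using that C by (auto simp: perms_def)
    then have "permutation \<sigma>" using permutation_permutes by blast
    then show ?thesis using sign_compose[OF _ permutation_swap_id, of \<sigma> i j] ij(1) by (simp add: sign_swap_id)
  qed
  have "(kap C (dlt t) s :: 'a) = (\<Sum>\<sigma>\<in>C. of_int (sign (\<sigma> \<circ> ?\<tau>)) * dlt t (s \<circ> (\<sigma> \<circ> ?\<tau>)))"
    unfolding kap_def by (rule sum.reindex_bij_betw[OF bij, symmetric])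
  also have "... = (\<Sum>\<sigma>\<in>C. - (of_int (sign \<sigma>) * dlt t (s \<circ> \<sigma>)))"
  proof (rule sum.cong[OF refl])
    fix \<sigma> assume "\<sigma> \<in> C"
    then show "of_int (sign (\<sigma> \<circ> ?\<tau>)) * dlt t (s \<circ> (\<sigma> \<circ> ?\<tau>)) = - (of_int (sign \<sigma>) * dlt t (s \<circ> \<sigma>) :: 'a)"
      unfolding o_assoc inv by (simp add: sg)
  qed
  also have "... = - kap C (dlt t) s" unfolding kap_def by (rule sum_negf)
  finally show "kap C (dlt t) s = (0 :: 'a)" by simp
qed

subsection \<open>Partitions and tableaux\<close>

text \<open>Row lengths continued by 0, so that rows beyond the last one need no case
  distinction.\<close>

definition rs :: "nat list => nat => nat" where
  "rs l r = (if r < length l then l ! r else 0)"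

lemma cells_rs: "cells l = {(i, j). j < rs l i}"
  unfolding cells_def rs_def by (auto split: if_splits)

lemma rs_antimono:
  assumes "is_partition l" "i <= j"
  shows "rs l j <= rs l i"
  using assms unfolding is_partition_def rs_def sorted_rev_iff_nth_mono by auto

lemma rs_ge_length [simp]: "length l <= r ==> rs l r = 0"
  by (simp add: rs_def)

lemma rs_inject:
  assumes "is_partition l" "is_partition l'" "rs l = rs l'"
  shows "l = l'"
proof -
  have pos: "r < length k \<longleftrightarrow> rs k r ~= 0" if "is_partition k" for r k
    using that unfolding is_partition_def rs_def by auto
  have "r < length l \<longleftrightarrow> r < length l'" for r using pos assms by metis
  then have "length l = length l'" by (metis linorder_neqE_nat less_irrefl)
  then show ?thesis using assms(3) by (intro nth_equalityI) (auto simp: rs_def fun_eq_iff split: if_splits)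
qed

lemma partition_exists:
  assumes anti: "\<And>i j. i <= j ==> c j <= c i" and N: "c N = (0::nat)"
  shows "\<exists>l. is_partition l \<and> rs l = c"
proof -
  define K where "K = (LEAST n. c n = 0)"
  have K: "c K = 0" unfolding K_def by (rule LeastI[of _ N]) (rule N)
  have pos: "0 < c i" if "i < K" for i using not_less_Least[of i "%n. c n = 0"] that unfolding K_def by simp
  have "is_partition (map c [0..<K])"
    unfolding is_partition_def sorted_rev_iff_nth_mono using anti pos by auto
  moreover have "rs (map c [0..<K]) = c"
  proof
    fix r show "rs (map c [0..<K]) r = c r" using anti[of K r] K by (auto simp: rs_def)
  qed
  ultimately show ?thesis by blast
qed

lemma finite_cells [simp]: "finite (cells l)"
proof -
  have "cells l = Sigma {..<length l} (%i. {..<l ! i})" unfolding cells_def by auto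
  then show ?thesis by simp
qed

lemma card_cells: "card (cells l) = sum_list l"
proof -
  have "cells l = Sigma {..<length l} (%i. {..<l ! i})" unfolding cells_def by auto
  then have "card (cells l) = (\<Sum>i<length l. l ! i)" by simp
  then show ?thesis by (simp add: sum_list_sum_nth atLeast0LessThan)
qed

definition tcell :: "nat list => (nat \<times> nat => nat) => nat => nat \<times> nat" where
  "tcell l T k = inv_into (cells l) T k"

lemma tcell:
  assumes T: "tableau l T"
  shows "k \<in> {1..sum_list l} ==> tcell l T k \<in> cells l" "k \<in> {1..sum_list l} ==> T (tcell l T k) = k"
    "c \<in> cells l ==> tcell l T (T c) = c" "c \<in> cells l ==> T c \<in> {1..sum_list l}"
proof -
  have bij: "bij_betw T (cells l) {1..sum_list l}" using T unfolding tableau_def .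
  then have im: "T ` cells l = {1..sum_list l}" by (rule bij_betw_imp_surj_on)
  show "k \<in> {1..sum_list l} ==> tcell l T k \<in> cells l" "k \<in> {1..sum_list l} ==> T (tcell l T k) = k"
    unfolding tcell_def im[symmetric] by (simp_all add: inv_into_into f_inv_into_f)
  show "c \<in> cells l ==> tcell l T (T c) = c"
    unfolding tcell_def using bij_betw_imp_inj_on[OF bij] by simp
  show "c \<in> cells l ==> T c \<in> {1..sum_list l}" using im by blast
qed

lemma tabloid_eq:
  assumes T: "tableau l T"
  shows "tabloid l T k = (if k \<in> {1..sum_list l} then fst (tcell l T k) else 0)"
proof -
  have im: "T ` cells l = {1..sum_list l}" using T unfolding tableau_def by (rule bij_betw_imp_surj_on)
  have "(THE c. c \<in> cells l \<and> T c = k) = tcell l T k" if "k \<in> {1..sum_list l}"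
    by (rule the_equality) (use tcell[OF T] that in auto)
  then show ?thesis unfolding tabloid_def im by simp
qed

lemma tabloid_Tab:
  assumes T: "tableau l T"
  shows "tabloid l T \<in> Tab (sum_list l) (rs l)"
proof -
  have "cnt (sum_list l) (tabloid l T) r = rs l r" for r
  proof -
    have "bij_betw (%j. T (r, j)) {..<rs l r} {k \<in> {1..sum_list l}. tabloid l T k = r}"
    proof (rule bij_betw_byWitness[where f' = "%k. snd (tcell l T k)"])
      show "\<forall>j\<in>{..<rs l r}. snd (tcell l T (T (r, j))) = j" using tcell(3)[OF T] by (auto simp: cells_rs)
      show "\<forall>k\<in>{k \<in> {1..sum_list l}. tabloid l T k = r}. T (r, snd (tcell l T k)) = k"
        using tcell(2)[OF T] by (auto simp: tabloid_eq[OF T])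
      show "(%j. T (r, j)) ` {..<rs l r} <= {k \<in> {1..sum_list l}. tabloid l T k = r}"
        using tcell(3,4)[OF T] by (auto simp: tabloid_eq[OF T] cells_rs)
      show "(%k. snd (tcell l T k)) ` {k \<in> {1..sum_list l}. tabloid l T k = r} <= {..<rs l r}"
        using tcell(1)[OF T] by (fastforce simp: tabloid_eq[OF T] cells_rs)
    qed
    from bij_betw_same_card[OF this] show ?thesis unfolding cnt_def by simp
  qed
  then show ?thesis unfolding Tab_def by (simp add: tabloid_eq[OF T])
qed

lemma colgrp_iff:
  assumes T: "tableau l T"
  shows "\<sigma> \<in> colgrp l T \<longleftrightarrow> \<sigma> permutes {1..sum_list l} \<and>
     (\<forall>k\<in>{1..sum_list l}. snd (tcell l T (\<sigma> k)) = snd (tcell l T k))"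
proof (cases "\<sigma> permutes {1..sum_list l}")
  case True
  have "(\<exists>c'\<in>cells l. T c' = \<sigma> (T c) \<and> snd c' = snd c) \<longleftrightarrow> snd (tcell l T (\<sigma> (T c))) = snd c"
    if c: "c \<in> cells l" for c
  proof -
    have s: "\<sigma> (T c) \<in> {1..sum_list l}" using permutes_in_image[OF True] tcell(4)[OF T c] by blast
    show ?thesis
    proof
      assume "\<exists>c'\<in>cells l. T c' = \<sigma> (T c) \<and> snd c' = snd c"
      then show "snd (tcell l T (\<sigma> (T c))) = snd c" using tcell(3)[OF T] by metis
    next
      assume "snd (tcell l T (\<sigma> (T c))) = snd c"
      then show "\<exists>c'\<in>cells l. T c' = \<sigma> (T c) \<and> snd c' = snd c" using tcell(1,2)[OF T s] by blast
    qed
  qed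
  then have "(\<forall>c\<in>cells l. \<exists>c'\<in>cells l. T c' = \<sigma> (T c) \<and> snd c' = snd c) \<longleftrightarrow>
      (\<forall>c\<in>cells l. snd (tcell l T (\<sigma> (T c))) = snd c)" by blast
  also have "... \<longleftrightarrow> (\<forall>k\<in>{1..sum_list l}. snd (tcell l T (\<sigma> k)) = snd (tcell l T k))"
    using tcell[OF T] by metis
  finally show ?thesis using True unfolding colgrp_def by simp
qed (simp add: colgrp_def)

lemma colgrp_perms: "colgrp l T <= perms (sum_list l)"
  unfolding colgrp_def perms_def by blast

lemma colgrp_transpose:
  assumes T: "tableau l T" and ij: "i \<in> {1..sum_list l}" "j \<in> {1..sum_list l}"
    and col: "snd (tcell l T i) = snd (tcell l T j)" and \<sigma>: "\<sigma> \<in> colgrp l T"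
  shows "\<sigma> \<circ> transpose i j \<in> colgrp l T"
proof -
  have t: "transpose i j permutes {1..sum_list l}" by (rule permutes_swap_id[OF ij])
  have t': "transpose i j k \<in> {1..sum_list l}" if "k \<in> {1..sum_list l}" for k using permutes_in_image[OF t] that by blast
  have "snd (tcell l T (transpose i j k)) = snd (tcell l T k)" for k
    using col by (auto simp: transpose_def)
  then show ?thesis using \<sigma> t' permutes_compose[OF t] unfolding colgrp_iff[OF T] by simp
qed

lemma polytab_kap:
  assumes T: "tableau l T"
  shows "polytab l T = (kap (colgrp l T) (dlt (tabloid l T)) :: _ => 'a::comm_ring_1)"
proof
  fix s
  have "(s = tabloid l (\<sigma> \<circ> T)) = (s \<circ> \<sigma> = tabloid l T)" if s: "\<sigma> \<in> colgrp l T" for \<sigma>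
  proof -
    have \<sigma>: "\<sigma> permutes {1..sum_list l}" using s unfolding colgrp_def by blast
    have bijT: "bij_betw T (cells l) {1..sum_list l}" using T unfolding tableau_def .
    have T': "tableau l (\<sigma> \<circ> T)" unfolding tableau_def
      using bij_betw_trans[OF bijT permutes_imp_bij[OF \<sigma>]] .
    have tc: "tcell l (\<sigma> \<circ> T) (\<sigma> k) = tcell l T k" if k: "k \<in> {1..sum_list l}" for k
      using tcell(3)[OF T' tcell(1)[OF T k]] tcell(2)[OF T k] by simp
    have "tabloid l (\<sigma> \<circ> T) (\<sigma> k) = tabloid l T k" for k
      unfolding tabloid_eq[OF T] tabloid_eq[OF T'] using permutes_in_image[OF \<sigma>] tc by simp
    then have "tabloid l (\<sigma> \<circ> T) \<circ> \<sigma> = tabloid l T" by auto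
    then show ?thesis using permutes_surj[OF \<sigma>] by (metis (no_types, opaque_lifting) fun.map_comp o_assoc comp_id surj_iff)
  qed
  then show "polytab l T s = (kap (colgrp l T) (dlt (tabloid l T)) s :: 'a)"
    unfolding polytab_def kap_def dlt_def by (intro sum.cong refl) simp
qed

text \<open>Moving a point up by one row puts it beside the point directly above it in its column,
  which exists because \<open>l\<close> is a partition. Two points of one column in one row are
  killed by the signed column sum.\<close>

lemma polytab_HW:
  assumes l: "is_partition l" and T: "tableau l T"
  shows "polytab l T \<in> (HW (sum_list l) (rs l) :: ((nat => nat) => 'a::field_char_0) set)"
proof -
  let ?m = "sum_list l" and ?C = "colgrp l T" and ?t = "tabloid l T"
  have "dlt ?t \<in> (Fsp ?m (rs l) :: (_ => 'a) set)" using tabloid_Tab[OF T] by (auto simp: dlt_def Fsp_def)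
  then have F: "kap ?C (dlt ?t) \<in> (Fsp ?m (rs l) :: (_ => 'a) set)" by (rule kap_Fsp[OF colgrp_perms])
  have "mv ?m r (Suc r) (kap ?C (dlt ?t)) = (%s. 0 :: 'a)" for r
  proof -
    have "kap ?C (dlt (?t(k := r))) = (%s. 0 :: 'a)" if k: "k \<in> {1..?m}" "?t k = Suc r" for k
    proof -
      obtain c where c: "tcell l T k = (Suc r, c)" using k by (metis tabloid_eq[OF T] prod.collapse)
      have cc: "(Suc r, c) \<in> cells l" using tcell(1)[OF T k(1)] c by simp
      then have rc: "(r, c) \<in> cells l" using rs_antimono[OF l, of r "Suc r"] by (simp add: cells_rs)
      define j where "j = T (r, c)"
      have j: "j \<in> {1..?m}" "tcell l T j = (r, c)" using tcell(3,4)[OF T rc] by (simp_all add: j_def)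
      show ?thesis
      proof (rule kap_dlt_zero[OF _ colgrp_perms, where i = k and j = j])
        show "\<sigma> \<circ> transpose k j \<in> ?C" if "\<sigma> \<in> ?C" for \<sigma>
          by (rule colgrp_transpose[OF T k(1) j(1) _ that]) (simp add: c j)
        show "k ~= j" using c j by auto
        show "(?t(k := r)) k = (?t(k := r)) j" using j by (simp add: tabloid_eq[OF T])
      qed
    qed
    then show ?thesis unfolding mv_kap[OF colgrp_perms] mv_dlt kap_sum by (intro ext sum.neutral) simp
  qed
  then show ?thesis unfolding polytab_kap[OF T] HW_def using F by blast
qed

subsection \<open>Specht modules as highest weight spaces\<close>

text \<open>The component of \<open>v\<close> in which the point \<open>m\<close> lies in row
  \<open>r\<close>, read as a function of tabloids on the remaining points. The test
  \<open>s m = 0\<close> respects the convention that tabloids vanish off their points.\<close>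

definition part :: "nat => nat => ((nat => nat) => 'a::comm_ring_1) => (nat => nat) => 'a" where
  "part m r v = (%s. if s m = 0 then v (s(m := r)) else 0)"

lemma part_lin: "part m r (%s. u s + c * v s) = (%s. part m r u s + c * part m r v s)"
  unfolding part_def by auto

lemma part_zero [simp]: "part m r (%s. 0) = (%s. 0)"
  unfolding part_def by auto

lemma cnt_Suc: "cnt (Suc m) (s(Suc m := r)) q = cnt m s q + (if q = r then 1 else 0)"
proof -
  have "{k \<in> {1..Suc m}. (s(Suc m := r)) k = q} = {k \<in> {1..m}. s k = q} \<union> (if q = r then {Suc m} else {})"
    by (auto simp: le_Suc_eq)
  then show ?thesis unfolding cnt_def by simp
qed

lemma part_Fsp:
  assumes v: "v \<in> Fsp (Suc m) c"
  shows "part (Suc m) r v \<in> Fsp m (c(r := c r - 1))" "c r = 0 ==> part (Suc m) r v = (%s. 0)"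
proof -
  have *: "0 < c r \<and> s \<in> Tab m (c(r := c r - 1))" if h: "part (Suc m) r v s ~= 0" for s
  proof -
    have s0: "s (Suc m) = 0" and nz: "v (s(Suc m := r)) ~= 0" using h unfolding part_def by (auto split: if_splits)
    have T: "s(Suc m := r) \<in> Tab (Suc m) c" using v nz unfolding Fsp_def by blast
    have z: "s k = 0" if "k \<notin> {1..m}" for k
    proof (cases "k = Suc m")
      case False
      then have "k \<notin> {1..Suc m}" using that by auto
      then have "(s(Suc m := r)) k = 0" using T unfolding Tab_def mem_Collect_eq by blast
      then show ?thesis using False by simp
    qed (use s0 in simp)
    have cq: "cnt m s q + (if q = r then 1 else 0) = c q" for q
      using T unfolding Tab_def mem_Collect_eq cnt_Suc by blast
    have "cnt m s q = (c(r := c r - 1)) q" for q using cq[of q] cq[of r] by (cases "q = r") auto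
    then show ?thesis using z cq[of r] unfolding Tab_def by auto
  qed
  show "part (Suc m) r v \<in> Fsp m (c(r := c r - 1))" by (rule FspI) (use * in blast)
  show "c r = 0 ==> part (Suc m) r v = (%s. 0)" using * by (auto simp: fun_eq_iff)
qed

text \<open>The additional term is the move of the last point itself.\<close>

lemma mv_part:
  assumes s: "s (Suc m) = 0"
  shows "mv (Suc m) p q v (s(Suc m := r)) = mv m p q (part (Suc m) r v) s + (if r = p then part (Suc m) q v s else 0)"
proof -
  have e: "{k \<in> {1..Suc m}. (s(Suc m := r)) k = p} = {k \<in> {1..m}. s k = p} \<union> (if r = p then {Suc m} else {})"
    by (auto simp: le_Suc_eq)
  have "mv (Suc m) p q v (s(Suc m := r)) = (\<Sum>k\<in>{k \<in> {1..m}. s k = p}. v (s(Suc m := r, k := q)))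
      + (\<Sum>k\<in>(if r = p then {Suc m} else {}). v (s(Suc m := r, k := q)))"
    unfolding mv_def e by (rule sum.union_disjoint) auto
  also have "(\<Sum>k\<in>{k \<in> {1..m}. s k = p}. v (s(Suc m := r, k := q))) = mv m p q (part (Suc m) r v) s"
    unfolding mv_def
  proof (rule sum.cong[OF refl])
    fix k assume "k \<in> {k \<in> {1..m}. s k = p}"
    then have "k ~= Suc m" by auto
    then show "v (s(Suc m := r, k := q)) = part (Suc m) r v (s(k := q))" using s by (simp add: part_def fun_upd_twist)
  qed
  also have "(\<Sum>k\<in>(if r = p then {Suc m} else {}). v (s(Suc m := r, k := q))) = (if r = p then part (Suc m) q v s else 0)"
    using s by (simp add: part_def)
  finally show ?thesis .
qed

text \<open>A raising operator mixes the component of row \<open>r\<close> only with that of row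
  \<open>Suc r\<close>. Once the latter vanishes, the former is again a highest weight
  vector.\<close>

lemma HW_part:
  assumes v: "v \<in> HW (Suc m) c" and z: "part (Suc m) (Suc r) v = (%s. 0)"
  shows "mv m p (Suc p) (part (Suc m) r v) = (%s. 0)"
proof
  fix s
  show "mv m p (Suc p) (part (Suc m) r v) s = 0"
  proof (cases "s (Suc m) = 0")
    case True
    have "mv (Suc m) p (Suc p) v (s(Suc m := r)) = 0" using v unfolding HW_def by simp
    then show ?thesis unfolding mv_part[of s m, OF True] using z by (auto split: if_splits)
  next
    case False
    then show ?thesis unfolding mv_def part_def by (intro sum.neutral) auto
  qed
qed

lemma part_act:
  assumes \<sigma>: "\<sigma> permutes {1..m}"
  shows "part (Suc m) r (%s. v (s \<circ> \<sigma>)) = (%s. part (Suc m) r v (s \<circ> \<sigma>))"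
proof -
  have f: "\<sigma> (Suc m) = Suc m" using permutes_not_in[OF \<sigma>] by simp
  have e: "s(Suc m := r) \<circ> \<sigma> = (s \<circ> \<sigma>)(Suc m := r)" for s :: "nat => nat"
    using update_comp_perm[OF \<sigma>, of s "Suc m" r] unfolding f .
  show ?thesis unfolding part_def by (intro ext) (simp only: e comp_apply f)
qed

definition remrow :: "nat list => nat => nat list => bool" where
  "remrow l r \<alpha> \<longleftrightarrow> is_partition \<alpha> \<and> rs l (Suc r) < rs l r \<and> rs \<alpha> = (rs l)(r := rs l r - 1)"

lemma remrow_cells:
  assumes "remrow l r \<alpha>"
  shows "cells l = insert (r, rs l r - 1) (cells \<alpha>)" "(r, rs l r - 1) \<notin> cells \<alpha>" "sum_list l = Suc (sum_list \<alpha>)"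
proof -
  have r: "0 < rs l r" "rs \<alpha> = (rs l)(r := rs l r - 1)" using assms unfolding remrow_def by auto
  show c: "cells l = insert (r, rs l r - 1) (cells \<alpha>)" unfolding cells_rs r(2) using r(1) by (auto split: if_splits)
  show n: "(r, rs l r - 1) \<notin> cells \<alpha>" unfolding cells_rs r(2) by simp
  show "sum_list l = Suc (sum_list \<alpha>)" using c n unfolding card_cells[symmetric] by simp
qed

lemma boxrem_iff:
  assumes l: "is_partition l"
  shows "boxrem \<alpha> l \<longleftrightarrow> (\<exists>r. remrow l r \<alpha>)"
proof
  assume "\<exists>r. remrow l r \<alpha>"
  then obtain r where r: "remrow l r \<alpha>" by blast
  have "cells \<alpha> = cells l - {(r, rs l r - 1)}" using remrow_cells[OF r] by blast
  moreover have "(r, rs l r - 1) \<in> cells l" using remrow_cells[OF r] by blast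
  ultimately show "boxrem \<alpha> l" unfolding boxrem_def using r l unfolding remrow_def by blast
next
  assume b: "boxrem \<alpha> l"
  then obtain r j where \<alpha>: "is_partition \<alpha>" and c: "j < rs l r" "cells \<alpha> = cells l - {(r, j)}"
    unfolding boxrem_def by (auto simp: cells_rs)
  have mem: "k < rs \<alpha> q \<longleftrightarrow> k < rs l q \<and> \<not> (q = r \<and> k = j)" for q k
    using c(2) unfolding cells_rs by (auto simp: set_eq_iff)
  have other: "rs \<alpha> q = rs l q" if "q ~= r" for q
    using mem[of "rs \<alpha> q" q] mem[of "rs l q" q] that by auto
  have jr: "rs \<alpha> r <= j" using mem[of j r] by simp
  have "\<not> rs \<alpha> r < j" using mem[of "rs \<alpha> r" r] c(1) by auto
  then have j: "rs \<alpha> r = j" using jr by simp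
  have "\<not> Suc j < rs l r" using mem[of "Suc j" r] j by auto
  then have jl: "rs l r = Suc j" using c(1) by simp
  have "rs \<alpha> = (rs l)(r := rs l r - 1)" using other j jl by auto
  moreover have "rs l (Suc r) < rs l r"
    using rs_antimono[OF \<alpha>, of r "Suc r"] other[of "Suc r"] j jl by simp
  ultimately show "\<exists>r. remrow l r \<alpha>" unfolding remrow_def using \<alpha> by blast
qed

lemma remrow_exists:
  assumes l: "is_partition l" and r: "rs l (Suc r) < rs l r"
  shows "\<exists>\<alpha>. remrow l r \<alpha>"
proof -
  let ?c = "(rs l)(r := rs l r - 1)"
  have "?c j <= ?c i" if "i <= j" for i j
  proof (cases "i = r \<and> j ~= r")
    case True
    then have "rs l j <= rs l (Suc r)" using rs_antimono[OF l, of "Suc r" j] that by simp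
    then show ?thesis using True r by simp
  next
    case False
    then show ?thesis using rs_antimono[OF l that] by (cases "j = r") auto
  qed
  moreover have "?c (length l) = 0" by simp
  ultimately show ?thesis using partition_exists[of ?c "length l"] r unfolding remrow_def by blast
qed

lemma remrow_unique: "remrow l r \<alpha> ==> remrow l r' \<alpha> ==> r = r'"
  unfolding remrow_def by (metis diff_less fun_upd_other fun_upd_same less_nat_zero_code not_less_zero zero_less_one bot_nat_0.not_eq_extremum less_irrefl)

text \<open>The point \<open>Suc m\<close> is put into the box that \<open>\<alpha>\<close> lacks.
  That box ends its column, so column permutations can carry the point only to earlier rows, and
  those that keep it in row \<open>r\<close> fix it and form the column group of
  \<open>T\<close>.\<close>

lemma lift_polytab:
  assumes l: "is_partition l" and \<alpha>: "remrow l r \<alpha>" and T: "tableau \<alpha> T" and m: "m = sum_list \<alpha>"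
    and T': "T' = T((r, rs l r - 1) := Suc m)"
  shows "tableau l T'" "part (Suc m) r (polytab l T') = (polytab \<alpha> T :: _ => 'a::field_char_0)"
    "r < q ==> part (Suc m) q (polytab l T') = (%s. 0 :: 'a)"
proof -
  define c0 where "c0 = (r, rs l r - 1)"
  note ce = remrow_cells[OF \<alpha>, folded c0_def]
  have sl: "sum_list l = Suc m" using ce(3) m by simp
  have bij: "bij_betw T (cells \<alpha>) {1..m}" using T unfolding tableau_def m .
  have bij': "bij_betw T' (cells \<alpha>) {1..m}"
    using bij by (subst bij_betw_cong[of _ T' T]) (use ce(2) T' c0_def in auto)
  have c0': "T' c0 = Suc m" unfolding T' c0_def by simp
  have "bij_betw T' (cells \<alpha> \<union> {c0}) ({1..m} \<union> {T' c0})"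
    by (rule notIn_Un_bij_betw[OF ce(2) _ bij']) (simp add: c0')
  moreover have "{1..m} \<union> {T' c0} = {1..Suc m}" unfolding c0' by auto
  ultimately show TT: "tableau l T'" unfolding tableau_def sl ce(1) by simp
  have tc0: "tcell l T' (Suc m) = c0" using tcell(3)[OF TT, of c0] c0' ce(1) by simp
  have tc: "tcell l T' k = tcell \<alpha> T k" if k: "k \<in> {1..m}" for k
  proof -
    have c: "tcell \<alpha> T k \<in> cells \<alpha>" "T (tcell \<alpha> T k) = k" using tcell(1,2)[OF T] k m by auto
    then have "T' (tcell \<alpha> T k) = k" using ce(2) unfolding T' c0_def by auto
    then show ?thesis using tcell(3)[OF TT, of "tcell \<alpha> T k"] c ce(1) by simp
  qed
  define t0 where "t0 = tabloid \<alpha> T"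
  have t0z: "t0 (Suc m) = 0" unfolding t0_def tabloid_eq[OF T] m by simp
  have tab: "tabloid l T' = t0(Suc m := r)"
  proof
    fix k show "tabloid l T' k = (t0(Suc m := r)) k"
      using tc[of k] tc0 unfolding t0_def tabloid_eq[OF T] tabloid_eq[OF TT] sl m[symmetric]
      by (cases "k = Suc m") (auto simp: c0_def le_Suc_eq)
  qed
  have grp: "\<sigma> \<in> colgrp \<alpha> T \<longleftrightarrow> \<sigma> \<in> colgrp l T' \<and> \<sigma> (Suc m) = Suc m" for \<sigma>
  proof
    assume "\<sigma> \<in> colgrp \<alpha> T"
    then have p: "\<sigma> permutes {1..m}" and col: "\<forall>k\<in>{1..m}. snd (tcell \<alpha> T (\<sigma> k)) = snd (tcell \<alpha> T k)"
      unfolding colgrp_iff[OF T] m by auto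
    have p': "\<sigma> permutes {1..Suc m}" using permutes_subset[OF p] by auto
    have f: "\<sigma> (Suc m) = Suc m" using permutes_not_in[OF p] by simp
    have "snd (tcell l T' (\<sigma> k)) = snd (tcell l T' k)" if "k \<in> {1..Suc m}" for k
    proof (cases "k = Suc m")
      case False
      then have k: "k \<in> {1..m}" using that by auto
      then have "\<sigma> k \<in> {1..m}" using permutes_in_image[OF p] by blast
      then show ?thesis using col k tc by simp
    qed (simp add: f)
    then show "\<sigma> \<in> colgrp l T' \<and> \<sigma> (Suc m) = Suc m" unfolding colgrp_iff[OF TT] sl using p' f by blast
  next
    assume h: "\<sigma> \<in> colgrp l T' \<and> \<sigma> (Suc m) = Suc m"
    then have p': "\<sigma> permutes {1..Suc m}" and col: "\<forall>k\<in>{1..Suc m}. snd (tcell l T' (\<sigma> k)) = snd (tcell l T' k)"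
      unfolding colgrp_iff[OF TT] sl by auto
    have p: "\<sigma> permutes {1..m}" by (rule permutes_superset[OF p']) (use h in \<open>auto simp: le_Suc_eq\<close>)
    have "snd (tcell \<alpha> T (\<sigma> k)) = snd (tcell \<alpha> T k)" if k: "k \<in> {1..m}" for k
    proof -
      have "\<sigma> k \<in> {1..m}" using permutes_in_image[OF p] k by blast
      moreover have "k \<in> {1..Suc m}" using k by auto
      ultimately show ?thesis using bspec[OF col, of k] tc[of k] tc[of "\<sigma> k"] k by simp
    qed
    then show "\<sigma> \<in> colgrp \<alpha> T" unfolding colgrp_iff[OF T] m[symmetric] using p by blast
  qed
  \<comment> \<open>\<open>j\<close> lies in the column of the removable box, hence in a row at most
    \<open>r\<close>; in row \<open>r\<close> itself it can only be that box.\<close>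
  have key: "q <= r \<and> (q = r --> \<sigma> (Suc m) = Suc m)"
    if \<sigma>: "\<sigma> \<in> colgrp l T'" and eq: "s(Suc m := q) \<circ> \<sigma> = t0(Suc m := r)" for \<sigma> s q
  proof -
    have p: "\<sigma> permutes {1..Suc m}" and col: "\<forall>k\<in>{1..Suc m}. snd (tcell l T' (\<sigma> k)) = snd (tcell l T' k)"
      using \<sigma> unfolding colgrp_iff[OF TT] sl by auto
    define j where "j = inv \<sigma> (Suc m)"
    have j: "\<sigma> j = Suc m" unfolding j_def using permutes_inverses[OF p] by simp
    have jin: "j \<in> {1..Suc m}" unfolding j_def using permutes_in_image[OF permutes_inv[OF p]] by auto
    have "tabloid l T' j = q" using fun_cong[OF eq, of j] j unfolding tab by simp
    then have row: "fst (tcell l T' j) = q" unfolding tabloid_eq[OF TT] sl using jin by simp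
    have snd: "snd (tcell l T' j) = rs l r - 1" using bspec[OF col jin] unfolding j tc0 c0_def by simp
    have "tcell l T' j \<in> cells l" using tcell(1)[OF TT] jin sl by simp
    then have "rs l r - 1 < rs l q" unfolding cells_rs using row snd by (auto simp: case_prod_beta)
    then have qr: "q <= r" using \<alpha> rs_antimono[OF l, of "Suc r" q] unfolding remrow_def by (cases "Suc r <= q") auto
    have "\<sigma> (Suc m) = Suc m" if "q = r"
    proof -
      have "tcell l T' j = c0" using row snd that unfolding c0_def by (metis prod.collapse)
      then have "j = Suc m" using tcell(2)[OF TT, of j] jin sl c0' by simp
      then show ?thesis using j by simp
    qed
    then show ?thesis using qr by blast
  qed
  have kp: "polytab l T' s = (\<Sum>\<sigma>\<in>colgrp l T'. of_int (sign \<sigma>) * (dlt (t0(Suc m := r)) (s \<circ> \<sigma>) :: 'a))" for s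
    unfolding polytab_kap[OF TT] kap_def tab ..
  show "part (Suc m) q (polytab l T') = (%s. 0 :: 'a)" if q: "r < q"
  proof
    fix s
    have "(polytab l T' (s(Suc m := q)) :: 'a) = 0" unfolding kp
    proof (rule sum.neutral, rule ballI)
      fix \<sigma> assume "\<sigma> \<in> colgrp l T'"
      then have "s(Suc m := q) \<circ> \<sigma> ~= t0(Suc m := r)" using key[of \<sigma> s q] q by auto
      then show "of_int (sign \<sigma>) * (dlt (t0(Suc m := r)) (s(Suc m := q) \<circ> \<sigma>) :: 'a) = 0" by (simp add: dlt_def)
    qed
    then show "part (Suc m) q (polytab l T') s = (0 :: 'a)" by (simp add: part_def)
  qed
  show "part (Suc m) r (polytab l T') = (polytab \<alpha> T :: _ => 'a)"
  proof
    fix s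
    have fixm: "\<sigma> (Suc m) = Suc m" if "\<sigma> \<in> colgrp \<alpha> T" for \<sigma> using grp that by blast
    show "part (Suc m) r (polytab l T') s = (polytab \<alpha> T s :: 'a)"
    proof (cases "s (Suc m) = 0")
      case True
      have "part (Suc m) r (polytab l T') s = (\<Sum>\<sigma>\<in>colgrp l T'. of_int (sign \<sigma>) * (dlt (t0(Suc m := r)) (s(Suc m := r) \<circ> \<sigma>) :: 'a))"
        using True by (simp add: part_def kp)
      also have "... = (\<Sum>\<sigma>\<in>colgrp \<alpha> T. of_int (sign \<sigma>) * (dlt t0 (s \<circ> \<sigma>) :: 'a))"
      proof (rule sum.mono_neutral_cong_right)
        show "finite (colgrp l T')" using finite_subset[OF colgrp_perms] by simp
        show "colgrp \<alpha> T <= colgrp l T'" using grp by blast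
        show "\<forall>\<sigma>\<in>colgrp l T' - colgrp \<alpha> T. of_int (sign \<sigma>) * (dlt (t0(Suc m := r)) (s(Suc m := r) \<circ> \<sigma>) :: 'a) = 0"
        proof
          fix \<sigma> assume "\<sigma> \<in> colgrp l T' - colgrp \<alpha> T"
          then have "s(Suc m := r) \<circ> \<sigma> ~= t0(Suc m := r)" using key[of \<sigma> s r] grp by blast
          then show "of_int (sign \<sigma>) * (dlt (t0(Suc m := r)) (s(Suc m := r) \<circ> \<sigma>) :: 'a) = 0" by (simp add: dlt_def)
        qed
        fix \<sigma> assume s: "\<sigma> \<in> colgrp \<alpha> T"
        have p: "\<sigma> permutes {1..m}" using s unfolding colgrp_iff[OF T] m by blast
        have e: "s(Suc m := r) \<circ> \<sigma> = (s \<circ> \<sigma>)(Suc m := r)"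
          using update_comp_perm[OF p, of s "Suc m" r] unfolding fixm[OF s] .
        have "(s \<circ> \<sigma>)(Suc m := r) = t0(Suc m := r) \<longleftrightarrow> s \<circ> \<sigma> = t0"
        proof
          assume a: "(s \<circ> \<sigma>)(Suc m := r) = t0(Suc m := r)"
          show "s \<circ> \<sigma> = t0"
          proof
            fix k show "(s \<circ> \<sigma>) k = t0 k"
              using fun_cong[OF a, of k] True t0z fixm[OF s] by (cases "k = Suc m") auto
          qed
        qed simp
        then show "of_int (sign \<sigma>) * (dlt (t0(Suc m := r)) (s(Suc m := r) \<circ> \<sigma>) :: 'a) = of_int (sign \<sigma>) * dlt t0 (s \<circ> \<sigma>)"
          unfolding e by (simp add: dlt_def)
      qed
      also have "... = polytab \<alpha> T s" unfolding polytab_kap[OF T] kap_def t0_def ..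
      finally show ?thesis .
    next
      case False
      have "(polytab \<alpha> T s :: 'a) = 0" unfolding polytab_kap[OF T] kap_def
      proof (rule sum.neutral, rule ballI)
        fix \<sigma> assume "\<sigma> \<in> colgrp \<alpha> T"
        then have "\<sigma> (Suc m) = Suc m" by (rule fixm)
        then have "(s \<circ> \<sigma>) (Suc m) ~= t0 (Suc m)" using t0z False by simp
        then have "s \<circ> \<sigma> ~= t0" by auto
        then show "of_int (sign \<sigma>) * (dlt (tabloid \<alpha> T) (s \<circ> \<sigma>) :: 'a) = 0" by (simp add: dlt_def t0_def)
      qed
      then show ?thesis using False by (simp add: part_def)
    qed
  qed
qed

section \<open>The kernel theorem and the pieces of the restriction filtration\<close>

abbreviation sp :: "nat list => ((nat => nat) => 'a::comm_ring_1) set" where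
  "sp l \<equiv> mcarr (spechtmod l)"

lemma sp_def: "sp l = lspan {polytab l T | T. tableau l T}"
  unfolding spechtmod_def by simp

lemma sp_HW: "is_partition l ==> (sp l :: ((nat => nat) => 'a::field_char_0) set) <= HW (sum_list l) (rs l)"
  unfolding sp_def by (rule lspan_least[OF fsub_HW]) (use polytab_HW in blast)

text \<open>Extends the lift of polytabloids to their span. This is the surjectivity onto a piece of
  the filtration by the row of the last point.\<close>

lemma lift_sp:
  assumes l: "is_partition l" and \<alpha>: "remrow l r \<alpha>" and m: "m = sum_list \<alpha>" and u: "u \<in> (sp \<alpha> :: ((nat => nat) => 'a::field_char_0) set)"
  shows "\<exists>w\<in>sp l. part (Suc m) r w = u \<and> (\<forall>q>r. part (Suc m) q w = (%s. 0))"
proof -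
  define K where "K = {u :: (nat => nat) => 'a. \<exists>w\<in>sp l. part (Suc m) r w = u \<and> (\<forall>q>r. part (Suc m) q w = (%s. 0))}"
  have fs: "fsub (sp l :: ((nat => nat) => 'a) set)" unfolding sp_def by (rule fsub_lspan)
  have "fsub K"
  proof -
    have z: "(%s. 0) \<in> K" unfolding K_def using fsubD(1)[OF fs] by (intro CollectI bexI[of _ "%s. 0"]) simp_all
    have lin: "(%s. u s + c * v s) \<in> K" if uv: "u \<in> K" "v \<in> K" for u v c
    proof -
      obtain w w' where w: "w \<in> sp l" "part (Suc m) r w = u" "\<forall>q>r. part (Suc m) q w = (%s. 0)"
        and w': "w' \<in> sp l" "part (Suc m) r w' = v" "\<forall>q>r. part (Suc m) q w' = (%s. 0)"
        using uv unfolding K_def by blast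
      have "(%s. w s + c * w' s) \<in> sp l" using fsubD(2)[OF fs w(1) fsubD(3)[OF fs w'(1)]] .
      then show ?thesis unfolding K_def using w w' by (intro CollectI bexI[of _ "%s. w s + c * w' s"]) (simp_all add: part_lin)
    qed
    show ?thesis unfolding fsub_def
    proof (intro conjI ballI allI)
      show "(%s. u s + v s) \<in> K" if "u \<in> K" "v \<in> K" for u v using lin[OF that, of 1] by simp
      show "(%s. c * v s) \<in> K" if "v \<in> K" for c v using lin[OF z that, of c] by simp
    qed (rule z)
  qed
  moreover have "{polytab \<alpha> T | T. tableau \<alpha> T} <= K"
  proof
    fix f :: "(nat => nat) => 'a" assume "f \<in> {polytab \<alpha> T | T. tableau \<alpha> T}"
    then obtain T where T: "tableau \<alpha> T" "f = polytab \<alpha> T" by blast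
    let ?T' = "T((r, rs l r - 1) := Suc m)"
    note L = lift_polytab[OF l \<alpha> T(1) m refl]
    have "polytab l ?T' \<in> (sp l :: ((nat => nat) => 'a) set)" unfolding sp_def using L(1) by (intro lspan_base) blast
    then show "f \<in> K" unfolding K_def T(2) using L(2,3) by blast
  qed
  ultimately have "sp \<alpha> <= K" unfolding sp_def by (rule lspan_least)
  then show ?thesis using u unfolding K_def by blast
qed

text \<open>If row \<open>r\<close> has no removable box, rows \<open>r\<close> and
  \<open>Suc r\<close> are equally long. Taking a point out of row \<open>r\<close> then makes the
  weight negative, and \<open>raising_inj\<close> kills the component.\<close>

lemma part_image_cases:
  assumes l: "is_partition l" and m: "sum_list l = Suc m" and v: "v \<in> (HW (Suc m) (rs l) :: ((nat => nat) => 'a::field_char_0) set)"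
    and z: "part (Suc m) (Suc r) v = (%s. 0)"
  shows "\<not> rs l (Suc r) < rs l r ==> part (Suc m) r v = (%s. 0)"
    "remrow l r \<alpha> ==> part (Suc m) r v \<in> HW m (rs \<alpha>)"
proof -
  have vF: "v \<in> Fsp (Suc m) (rs l)" using v unfolding HW_def by blast
  note P = part_Fsp[OF vF, of r]
  note E = HW_part[OF v z]
  show "part (Suc m) r v \<in> HW m (rs \<alpha>)" if "remrow l r \<alpha>"
    using that P(1) E unfolding HW_def remrow_def by simp
  assume nr: "\<not> rs l (Suc r) < rs l r"
  then have eq: "rs l (Suc r) = rs l r" using rs_antimono[OF l, of r "Suc r"] by simp
  show "part (Suc m) r v = (%s. 0)"
  proof (cases "rs l r = 0")
    case True
    then show ?thesis by (rule P(2))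
  next
    case False
    show ?thesis
    proof (rule raising_inj[OF _ _ E])
      show "rs l r - 1 < rs l (Suc r)" using False eq by simp
      fix s assume "part (Suc m) r v s ~= 0"
      then have "s \<in> Tab m ((rs l)(r := rs l r - 1))" by (rule FspD[of "part (Suc m) r v", OF P(1)])
      then show "cnt m s r = rs l r - 1 \<and> cnt m s (Suc r) = rs l (Suc r)" unfolding Tab_def by simp
    qed
  qed
qed

lemma parts_zero:
  assumes v: "v \<in> Fsp (Suc m) c" and "\<And>q. part (Suc m) q v = (%s. 0)"
  shows "v = (%s. 0)"
proof
  fix s
  have "part (Suc m) (s (Suc m)) v (s(Suc m := 0)) = 0" using assms(2) by simp
  then show "v s = 0" unfolding part_def by simp
qed

text \<open>Induction on the number of points. A highest weight vector is stripped of its components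
  from the last row upwards: the lowest nonzero component is a highest weight vector for a smaller
  partition, hence lies in its Specht module, hence lifts, and the lift is subtracted.\<close>

theorem HW_eq_sp:
  assumes "is_partition l"
  shows "HW (sum_list l) (rs l) = (sp l :: ((nat => nat) => 'a::field_char_0) set)"
proof -
  have "HW m (rs l) <= (sp l :: ((nat => nat) => 'a) set)" if "is_partition l" "sum_list l = m" for m l
    using that
  proof (induction m arbitrary: l)
    case 0
    have c: "cells l = {}" using 0(2) card_cells[of l] by (metis card_eq_0_iff finite_cells)
    have T: "tableau l (%_. 0)" unfolding tableau_def c 0 by (simp add: bij_betw_def)
    have t: "tabloid l (%_. 0) = (%_. 0)" unfolding tabloid_def c by simp
    have g: "colgrp l (%_. 0) = {id}" unfolding colgrp_def c 0 by simp
    have p: "(polytab l (%_. 0) :: _ => 'a) = dlt (%_. 0)" unfolding polytab_kap[OF T] kap_def g t by simp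
    show ?case
    proof
      fix v :: "(nat => nat) => 'a" assume "v \<in> HW 0 (rs l)"
      then have F: "v \<in> Fsp 0 (rs l)" unfolding HW_def by blast
      have "v s = 0" if "s ~= (%_. 0)" for s
      proof (rule ccontr)
        assume "v s ~= 0"
        then have "s \<in> Tab 0 (rs l)" using F unfolding Fsp_def by blast
        then have "s = (%_. 0)" unfolding Tab_def by (auto simp: fun_eq_iff)
        then show False using that by simp
      qed
      then have "v = (%s. v (%_. 0) * polytab l (%_. 0) s)" unfolding p dlt_def by auto
      moreover have "polytab l (%_. 0) \<in> (sp l :: ((nat => nat) => 'a) set)" unfolding sp_def using T by (intro lspan_base) blast
      then have "(%s. v (%_. 0) * polytab l (%_. 0) s) \<in> sp l" unfolding sp_def by (rule fsubD(3)[OF fsub_lspan])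
      ultimately show "v \<in> sp l" by simp
    qed
  next
    case (Suc m)
    note l = Suc.prems(1)
    have fs: "fsub (sp l :: ((nat => nat) => 'a) set)" unfolding sp_def by (rule fsub_lspan)
    have sub: "(sp l :: ((nat => nat) => 'a) set) <= HW (Suc m) (rs l)" using sp_HW[OF l] Suc.prems(2) by simp
    \<comment> \<open>\<open>N\<close> bounds the rows in which the last point can occur.\<close>
    have *: "v \<in> sp l" if "v \<in> HW (Suc m) (rs l)" "\<And>q. N <= q ==> part (Suc m) q v = (%s. 0)"
      for N and v :: "(nat => nat) => 'a"
      using that
    proof (induction N arbitrary: v)
      case 0
      have "v = (%s. 0)" by (rule parts_zero[of v m "rs l"]) (use 0 in \<open>auto simp: HW_def\<close>)
      then show ?case using fsubD(1)[OF fs] by simp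
    next
      case (Suc N)
      have z: "part (Suc m) (Suc N) v = (%s. 0)" using Suc.prems(2) by simp
      note C = part_image_cases[OF l \<open>sum_list l = Suc m\<close> Suc.prems(1) z]
      show ?case
      proof (cases "rs l (Suc N) < rs l N")
        case False
        have "part (Suc m) q v = (%s. 0)" if "N <= q" for q
          using C(1)[OF False] Suc.prems(2)[of q] that by (cases "q = N") auto
        then show ?thesis using Suc.IH[OF Suc.prems(1)] by blast
      next
        case True
        then obtain \<alpha> where \<alpha>: "remrow l N \<alpha>" using remrow_exists[OF l] by blast
        have m\<alpha>: "m = sum_list \<alpha>" using remrow_cells(3)[OF \<alpha>] \<open>sum_list l = Suc m\<close> by simp
        have "part (Suc m) N v \<in> sp \<alpha>"
          using C(2)[OF \<alpha>] \<open>\<And>l. is_partition l ==> sum_list l = m ==> HW m (rs l) <= sp l\<close>[of \<alpha>] m\<alpha> \<alpha>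
          unfolding remrow_def by blast
        then obtain w where w: "w \<in> sp l" "part (Suc m) N w = part (Suc m) N v" "\<forall>q>N. part (Suc m) q w = (%s. 0)"
          using lift_sp[OF l \<alpha> m\<alpha>] by blast
        define v' where "v' = (%s. v s + (-1) * w s)"
        have "v' \<in> HW (Suc m) (rs l)" unfolding v'_def
          using fsubD(2)[OF fsub_HW Suc.prems(1) fsubD(3)[OF fsub_HW subsetD[OF sub w(1)]]] .
        moreover have "part (Suc m) q v' = (%s. 0)" if "N <= q" for q
          unfolding v'_def part_lin using w Suc.prems(2)[of q] that by (cases "q = N") auto
        ultimately have "v' \<in> sp l" using Suc.IH by blast
        from fsubD(2)[OF fs this w(1)] show ?thesis unfolding v'_def by simp
      qed
    qed
    show ?case
    proof
      fix v :: "(nat => nat) => 'a" assume v: "v \<in> HW (Suc m) (rs l)"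
      show "v \<in> sp l"
      proof (rule *[OF v, of "length l"])
        fix q assume "length l <= q"
        then show "part (Suc m) q v = (%s. 0)" using part_Fsp(2)[of v m "rs l" q] v unfolding HW_def by simp
      qed
    qed
  qed
  then show ?thesis using sp_HW[OF assms] assms by blast
qed

lemma srep_sp: "is_partition l ==> srep (sum_list l) (sp l :: ((nat => nat) => 'a::field_char_0) set)"
  using srep_HW[of "sum_list l" "rs l"] HW_eq_sp[of l] by metis

lemma part_image:
  assumes l: "is_partition l" and m: "sum_list l = Suc m"
  shows "remrow l r \<alpha> ==> part (Suc m) r ` {v \<in> sp l. \<forall>q>r. part (Suc m) q v = (%s. 0)} = (sp \<alpha> :: ((nat => nat) => 'a::field_char_0) set)"
    "\<not> rs l (Suc r) < rs l r ==> part (Suc m) r ` {v \<in> sp l. \<forall>q>r. part (Suc m) q v = (%s. 0)} = {%s. 0 :: 'a}"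
proof -
  have H: "HW (Suc m) (rs l) = (sp l :: ((nat => nat) => 'a) set)" using HW_eq_sp[OF l] m by simp
  note C = part_image_cases[where 'a = 'a, OF l m, unfolded H]
  show "part (Suc m) r ` {v \<in> sp l. \<forall>q>r. part (Suc m) q v = (%s. 0)} = (sp \<alpha> :: ((nat => nat) => 'a) set)" if \<alpha>: "remrow l r \<alpha>"
  proof
    have m\<alpha>: "m = sum_list \<alpha>" using remrow_cells(3)[OF \<alpha>] m by simp
    have "HW m (rs \<alpha>) = (sp \<alpha> :: ((nat => nat) => 'a) set)" using HW_eq_sp[of \<alpha>] \<alpha> m\<alpha> unfolding remrow_def by simp
    then show "part (Suc m) r ` {v \<in> sp l. \<forall>q>r. part (Suc m) q v = (%s. 0)} <= (sp \<alpha> :: ((nat => nat) => 'a) set)"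
      using C(2)[OF _ _ \<alpha>] by auto
    show "(sp \<alpha> :: ((nat => nat) => 'a) set) <= part (Suc m) r ` {v \<in> sp l. \<forall>q>r. part (Suc m) q v = (%s. 0)}"
    proof
      fix u :: "(nat => nat) => 'a" assume "u \<in> sp \<alpha>"
      from lift_sp[OF l \<alpha> m\<alpha> this] show "u \<in> part (Suc m) r ` {v \<in> sp l. \<forall>q>r. part (Suc m) q v = (%s. 0)}" by auto
    qed
  qed
  show "part (Suc m) r ` {v \<in> sp l. \<forall>q>r. part (Suc m) q v = (%s. 0)} = {%s. 0 :: 'a}" if "\<not> rs l (Suc r) < rs l r"
  proof -
    have "(%s. 0 :: 'a) \<in> sp l" unfolding sp_def by (rule fsubD(1)[OF fsub_lspan])
    then have "(%s. 0 :: 'a) \<in> part (Suc m) r ` {v \<in> sp l. \<forall>q>r. part (Suc m) q v = (%s. 0)}"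
      by (intro image_eqI[of _ _ "%s. 0"]) simp_all
    then show ?thesis using C(1)[OF _ _ that] by auto
  qed
qed

subsection \<open>Induced Specht modules\<close>

text \<open>The module induced from \<open>sp l\<close> is realised inside the functions on tabloids with one extra
  row of length one, in position \<open>Suc (length l)\<close>, which carries the coset.\<close>

definition indX :: "nat list => ((nat => nat) => 'a::comm_ring_1) set" where
  "indX l = {v \<in> Fsp (Suc (sum_list l)) ((rs l)(Suc (length l) := 1)).
     \<forall>r<length l. mv (Suc (sum_list l)) r (Suc r) v = (%s. 0)}"

lemma srep_indX: "srep (Suc (sum_list l)) (indX l :: ((nat => nat) => 'a::comm_ring_1) set)"
proof -
  let ?m = "Suc (sum_list l)" and ?c = "(rs l)(Suc (length l) := 1)"
  note F = srep_Fsp[where 'a = 'a and m = ?m and c = ?c, unfolded srep_def]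
  have a: "mv ?m p q (%s. u s + v s) = (%s. mv ?m p q u s + mv ?m p q v s)" for p q and u v :: "(nat => nat) => 'a"
    using mv_lin[where u = u and c = 1 and v = v] by simp
  have "fsub (indX l :: ((nat => nat) => 'a) set)"
    unfolding fsub_def indX_def using fsubD[OF conjunct1[OF F]] by (simp add: a mv_scale)
  moreover have "(%s. v (s \<circ> \<sigma>)) \<in> indX l" if "\<sigma> permutes {1..?m}" "v \<in> indX l" for \<sigma> and v :: "(nat => nat) => 'a"
    using that conjunct2[OF F] unfolding indX_def by (simp add: mv_act[OF that(1)])
  ultimately show ?thesis unfolding srep_def by blast
qed

lemma addrow_exists:
  assumes l: "is_partition l" and r: "r = 0 \<or> rs l r < rs l (r - 1)"
  shows "\<exists>\<beta>. is_partition \<beta> \<and> remrow \<beta> r l"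
proof -
  let ?c = "(rs l)(r := Suc (rs l r))"
  have "?c j <= ?c i" if "i <= j" for i j
  proof (cases "j = r \<and> i ~= r")
    case True
    then have "i <= r - 1" using that by linarith
    then have "rs l (r - 1) <= rs l i" by (rule rs_antimono[OF l])
    then show ?thesis using True r that by auto
  next
    case False
    then show ?thesis using rs_antimono[OF l that] by auto
  qed
  moreover have "?c (Suc (length l) + r) = 0" by simp
  ultimately obtain \<beta> where \<beta>: "is_partition \<beta>" "rs \<beta> = ?c" using partition_exists[of ?c "Suc (length l) + r"] by blast
  have "rs l = (rs \<beta>)(r := rs \<beta> r - 1)" "rs \<beta> (Suc r) < rs \<beta> r"
    using \<beta>(2) rs_antimono[OF l, of r "Suc r"] by auto
  then show ?thesis using \<beta>(1) l unfolding remrow_def by blast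
qed

lemma remrow_rs:
  assumes \<beta>: "is_partition \<beta>" and r: "remrow \<beta> r l"
  shows "rs \<beta> = (rs l)(r := Suc (rs l r))" "r <= length l"
proof -
  have *: "rs l = (rs \<beta>)(r := rs \<beta> r - 1)" "0 < rs \<beta> r" using r unfolding remrow_def by auto
  show e: "rs \<beta> = (rs l)(r := Suc (rs l r))" using * by auto
  show "r <= length l"
  proof (rule ccontr)
    assume "\<not> r <= length l"
    then have "rs \<beta> (length l) = 0" "length l <= r" using e by auto
    then show False using rs_antimono[OF \<beta>, of "length l" r] *(2) by simp
  qed
qed

text \<open>The operator puts the point of the extra row into row \<open>r\<close>. Its commutator
  with the raising operator out of row \<open>r\<close> is the analogous operator for row
  \<open>r - 1\<close>, so the image becomes a highest weight vector exactly where the earlier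
  operators vanish.\<close>

lemma ind_raise:
  fixes v :: "(nat => nat) => 'a::comm_ring_1"
  assumes v: "v \<in> indX l" and z: "\<And>q. q < r ==> mv (Suc (sum_list l)) q (Suc (length l)) v = (%s. 0)" and r: "r <= length l"
  shows "mv (Suc (sum_list l)) r (Suc (length l)) v \<in> HW (Suc (sum_list l)) ((rs l)(r := Suc (rs l r)))"
proof -
  let ?m = "Suc (sum_list l)" and ?L = "Suc (length l)"
  define u where "u = mv ?m r ?L v"
  have vF: "v \<in> Fsp ?m ((rs l)(?L := 1))" and vE: "\<And>p. p < length l ==> mv ?m p (Suc p) v = (%s. 0)"
    using v unfolding indX_def by blast+
  have cs: "((rs l)(?L := 1))(r := Suc (((rs l)(?L := 1)) r), ?L := ((rs l)(?L := 1)) ?L - 1) = (rs l)(r := Suc (rs l r))"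
    using r by (auto simp: fun_eq_iff)
  have "r ~= ?L" using r by simp
  from mv_Fsp(1)[OF vF this] have uF: "u \<in> Fsp ?m ((rs l)(r := Suc (rs l r)))" unfolding u_def cs .
  have "mv ?m p (Suc p) u = (%s. 0)" for p
  proof (cases "p < length l")
    case True
    show ?thesis
    proof
      fix s
      have "mv ?m p (Suc p) u s = mv ?m r ?L (mv ?m p (Suc p) v) s
          + ((if Suc p = r then mv ?m p ?L v s else 0) - (if ?L = p then mv ?m r (Suc p) v s else 0))"
        using mv_comm[of ?m p "Suc p" r ?L v s] unfolding u_def by (simp add: algebra_simps)
      also have "... = 0" using vE[OF True] True z[of p] by auto
      finally show "mv ?m p (Suc p) u s = 0" .
    qed
  next
    case False
    have "((rs l)(r := Suc (rs l r))) (Suc p) = 0" using False r by auto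
    then show ?thesis by (rule mv_Fsp(2)[OF uF, rotated]) simp
  qed
  then show ?thesis unfolding HW_def u_def[symmetric] using uF by blast
qed

text \<open>The preimage exiles the point of the added box to the extra row before the signed column
  sum is taken. Moving it back to row \<open>r\<close> restores the tabloid; moving it to an earlier
  row makes it meet a point of its own column.\<close>

lemma ind_lift_polytab:
  assumes l: "is_partition l" and \<beta>: "is_partition \<beta>" and r: "remrow \<beta> r l" and T: "tableau \<beta> T"
  shows "\<exists>w\<in>indX l. mv (Suc (sum_list l)) r (Suc (length l)) w = (polytab \<beta> T :: _ => 'a::field_char_0)
    \<and> (\<forall>q<r. mv (Suc (sum_list l)) q (Suc (length l)) w = (%s. 0))"
proof -
  let ?m = "Suc (sum_list l)" and ?L = "Suc (length l)"
  note rb = remrow_rs[OF \<beta> r]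
  have sb: "sum_list \<beta> = ?m" using remrow_cells(3)[OF r] .
  define C where "C = colgrp \<beta> T"
  have Cp: "C <= perms ?m" unfolding C_def using colgrp_perms[of \<beta> T] sb by simp
  define t0 where "t0 = tabloid \<beta> T"
  define y where "y = T (r, rs l r)"
  have yc: "(r, rs l r) \<in> cells \<beta>" unfolding cells_rs rb(1) by simp
  have y: "y \<in> {1..?m}" "tcell \<beta> T y = (r, rs l r)" using tcell(3,4)[OF T yc] sb by (simp_all add: y_def)
  have t0: "t0 k = (if k \<in> {1..?m} then fst (tcell \<beta> T k) else 0)" for k
    unfolding t0_def tabloid_eq[OF T] sb ..
  have t0T: "t0 \<in> Tab ?m (rs \<beta>)" unfolding t0_def using tabloid_Tab[OF T] sb by simp
  have t0y: "t0 y = r" using y t0 by simp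
  have t0L: "t0 k <= length l" for k
  proof (cases "k \<in> {1..?m}")
    case True
    then have "tcell \<beta> T k \<in> cells \<beta>" using tcell(1)[OF T] sb by simp
    then have "0 < rs \<beta> (t0 k)" unfolding t0 using True by (auto simp: cells_rs case_prod_beta)
    then show ?thesis using rb by (cases "t0 k <= length l") (auto split: if_splits)
  next
    case False
    then have "t0 k = 0" using t0[of k] by (simp only: if_False)
    then show ?thesis by simp
  qed
  have zero: "kap C (dlt t) = (%s. 0 :: 'a)" if ij: "i \<in> {1..?m}" "j \<in> {1..?m}" "i ~= j" "t i = t j"
    "snd (tcell \<beta> T i) = snd (tcell \<beta> T j)" for t i j
  proof (rule kap_dlt_zero[OF _ Cp ij(3,4)])
    fix \<sigma> assume "\<sigma> \<in> C"
    then show "\<sigma> \<circ> transpose i j \<in> C" unfolding C_def using colgrp_transpose[OF T _ _ ij(5)] ij(1,2) sb by simp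
  qed
  define t where "t = t0(y := ?L)"
  define w where "w = (kap C (dlt t) :: _ => 'a)"
  have rL: "r ~= ?L" using rb(2) by simp
  have tT: "t \<in> Tab ?m ((rs l)(?L := 1))"
  proof -
    have z: "t k = 0" if "k \<notin> {1..?m}" for k
    proof -
      have "k ~= y" using y(1) that by blast
      then show ?thesis using t0[of k] that by (auto simp: t_def)
    qed
    have c: "cnt ?m t0 q = rs \<beta> q" for q using t0T unfolding Tab_def by blast
    note u = cnt_update[of y ?m t0 r ?L, OF y(1) t0y rL, folded t_def]
    have "cnt ?m t q = ((rs l)(?L := 1)) q" for q
    proof (cases "q = r")
      case True
      then show ?thesis using u(1) c[of r] rL unfolding rb(1) by simp
    next
      case False
      then show ?thesis using u(2) u(3)[of q] c[of q] c[of ?L] rL unfolding rb(1) by (cases "q = ?L") auto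
    qed
    then show ?thesis unfolding Tab_def using z by blast
  qed
  have wF: "w \<in> Fsp ?m ((rs l)(?L := 1))" unfolding w_def
    by (rule kap_Fsp[OF Cp]) (use tT in \<open>auto simp: Fsp_def dlt_def\<close>)
  have E: "mv ?m p (Suc p) w = (%s. 0)" if p: "p < length l" for p
  proof -
    have "kap C (dlt (t(k := p))) = (%s. 0 :: 'a)" if k: "k \<in> {1..?m}" "t k = Suc p" for k
    proof -
      have ky: "k ~= y" using k(2) p unfolding t_def by auto
      then have "t0 k = Suc p" using k(2) by (simp add: t_def)
      then have f: "fst (tcell \<beta> T k) = Suc p" using t0 k(1) by simp
      define c where "c = snd (tcell \<beta> T k)"
      have tk: "tcell \<beta> T k = (Suc p, c)" using f unfolding c_def by (metis prod.collapse)
      have cc: "(Suc p, c) \<in> cells \<beta>" using tcell(1)[OF T] k(1) sb tk by metis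
      then have pc: "(p, c) \<in> cells \<beta>" using rs_antimono[OF \<beta>, of p "Suc p"] by (simp add: cells_rs)
      define j where "j = T (p, c)"
      have j: "j \<in> {1..?m}" "tcell \<beta> T j = (p, c)" using tcell(3,4)[OF T pc] sb by (simp_all add: j_def)
      \<comment> \<open>\<open>y\<close> has left its box, so it must not be the point above
        \<open>k\<close>. If it were, row \<open>Suc r\<close> of \<open>l\<close> would be longer
        than row \<open>r\<close>.\<close>
      have jy: "j ~= y"
      proof
        assume "j = y"
        then have "p = r" "c = rs l r" using j(2) y(2) by auto
        then have "rs l r < rs l (Suc r)" using cc unfolding cells_rs rb(1) by simp
        then show False using rs_antimono[OF l, of r "Suc r"] by simp
      qed
      show ?thesis
      proof (rule zero[OF k(1) j(1)])
        show "k ~= j" using tk j(2) by auto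
        have "t j = p" using jy t0[of j] j by (simp add: t_def)
        then show "(t(k := p)) k = (t(k := p)) j" by simp
        show "snd (tcell \<beta> T k) = snd (tcell \<beta> T j)" using tk j by simp
      qed
    qed
    then show ?thesis unfolding w_def mv_kap[OF Cp] mv_dlt kap_sum by (intro ext sum.neutral) simp
  qed
  have A: "mv ?m q ?L w = kap C (dlt (t0(y := q)))" for q
  proof -
    have "{k \<in> {1..?m}. t k = ?L} = {y}"
    proof -
      have "t k ~= ?L" if "k ~= y" for k using t0L[of k] that by (simp add: t_def)
      then show ?thesis using y(1) by (auto simp: t_def)
    qed
    then show ?thesis unfolding w_def mv_kap[OF Cp] mv_dlt by (simp add: t_def)
  qed
  have "mv ?m q ?L w = (%s. 0)" if q: "q < r" for q
  proof -
    have "rs \<beta> r <= rs \<beta> q" using rs_antimono[OF \<beta>, of q r] q by simp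
    then have qc: "(q, rs l r) \<in> cells \<beta>" unfolding cells_rs rb(1) using q by simp
    define j where "j = T (q, rs l r)"
    have j: "j \<in> {1..?m}" "tcell \<beta> T j = (q, rs l r)" using tcell(3,4)[OF T qc] sb by (simp_all add: j_def)
    have jy: "y ~= j" using j(2) y(2) q by auto
    show ?thesis unfolding A
    proof (rule zero[OF y(1) j(1) jy])
      show "(t0(y := q)) y = (t0(y := q)) j" using jy t0[of j] j by simp
    qed (simp add: y j)
  qed
  moreover have "mv ?m r ?L w = polytab \<beta> T"
    unfolding A polytab_kap[OF T] using t0y by (simp add: fun_upd_idem C_def t0_def)
  moreover have "w \<in> indX l" unfolding indX_def using wF E by blast
  ultimately show ?thesis by blast
qed

text \<open>Where no box can be added, rows \<open>r - 1\<close> and \<open>r\<close> of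
  \<open>l\<close> are equally long, so a highest weight vector with one more point in row
  \<open>r\<close> has negative weight for these rows and vanishes.\<close>

lemma ind_image:
  assumes l: "is_partition l"
  shows "is_partition \<beta> ==> remrow \<beta> r l ==> mv (Suc (sum_list l)) r (Suc (length l)) `
      {v \<in> indX l. \<forall>q<r. mv (Suc (sum_list l)) q (Suc (length l)) v = (%s. 0)} = (sp \<beta> :: ((nat => nat) => 'a::field_char_0) set)"
    "r <= length l ==> \<not> (r = 0 \<or> rs l r < rs l (r - 1)) ==> mv (Suc (sum_list l)) r (Suc (length l)) `
      {v \<in> indX l. \<forall>q<r. mv (Suc (sum_list l)) q (Suc (length l)) v = (%s. 0)} = {%s. 0 :: 'a}"
proof -
  let ?A = "%q. mv (Suc (sum_list l)) q (Suc (length l)) :: ((nat => nat) => 'a) => _"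
  define X where "X = {v \<in> indX l. \<forall>q<r. ?A q v = (%s. 0)}"
  have fI: "fsub (indX l :: ((nat => nat) => 'a) set)" using srep_indX[of l] unfolding srep_def by blast
  have X0: "(%s. 0) \<in> X" unfolding X_def using fsubD(1)[OF fI] by simp
  have Xlin: "(%s. u s + c * v s) \<in> X" if "u \<in> X" "v \<in> X" for u v c
  proof -
    have "(%s. u s + c * v s) \<in> indX l" using fsubD(2)[OF fI _ fsubD(3)[OF fI]] that unfolding X_def by blast
    then show ?thesis using that unfolding X_def by (simp add: mv_lin)
  qed
  show "?A r ` X = (sp \<beta> :: ((nat => nat) => 'a) set)" if \<beta>: "is_partition \<beta>" and r: "remrow \<beta> r l"
  proof
    note rb = remrow_rs[OF \<beta> r]
    have sb: "sum_list \<beta> = Suc (sum_list l)" using remrow_cells(3)[OF r] .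
    have H: "HW (Suc (sum_list l)) ((rs l)(r := Suc (rs l r))) = (sp \<beta> :: ((nat => nat) => 'a) set)"
      using HW_eq_sp[OF \<beta>, where 'a = 'a] unfolding rb(1) sb .
    show "?A r ` X <= sp \<beta>"
    proof
      fix u assume "u \<in> ?A r ` X"
      then obtain v where v: "u = ?A r v" "v \<in> indX l" "\<And>q. q < r ==> ?A q v = (%s. 0)" unfolding X_def by blast
      show "u \<in> sp \<beta>" using ind_raise[OF v(2,3) rb(2)] unfolding v(1) H by simp
    qed
    have "fsub (?A r ` X)"
      unfolding fsub_def
    proof (intro conjI ballI allI)
      show "(%s. 0) \<in> ?A r ` X" using X0 by (intro image_eqI[of _ _ "%s. 0"]) simp_all
      fix u v assume "u \<in> ?A r ` X" "v \<in> ?A r ` X"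
      then obtain u' v' where "u = ?A r u'" "u' \<in> X" "v = ?A r v'" "v' \<in> X" by blast
      then show "(%s. u s + v s) \<in> ?A r ` X"
        using Xlin[of u' v' 1] by (intro image_eqI[of _ _ "%s. u' s + 1 * v' s"]) (simp_all only: mv_lin, simp)
    next
      fix c v assume "v \<in> ?A r ` X"
      then obtain v' where "v = ?A r v'" "v' \<in> X" by blast
      then show "(%s. c * v s) \<in> ?A r ` X"
        using Xlin[OF X0, of v' c] by (intro image_eqI[of _ _ "%s. c * v' s"]) (simp_all add: mv_scale)
    qed
    moreover have "{polytab \<beta> T | T. tableau \<beta> T} <= ?A r ` X"
    proof
      fix f :: "(nat => nat) => 'a" assume "f \<in> {polytab \<beta> T | T. tableau \<beta> T}"
      then obtain T where T: "tableau \<beta> T" "f = polytab \<beta> T" by blast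
      from ind_lift_polytab[OF l \<beta> r T(1), where 'a = 'a] obtain w where
        "w \<in> indX l" "?A r w = polytab \<beta> T" "\<forall>q<r. ?A q w = (%s. 0)" by blast
      then show "f \<in> ?A r ` X" unfolding X_def T(2) by (intro image_eqI[of _ _ w]) simp_all
    qed
    ultimately show "sp \<beta> <= ?A r ` X" unfolding sp_def by (rule lspan_least)
  qed
  show "?A r ` X = {%s. 0}" if r: "r <= length l" and nr: "\<not> (r = 0 \<or> rs l r < rs l (r - 1))"
  proof -
    obtain r' where r': "r = Suc r'" using nr by (cases r) auto
    have eq: "rs l r' = rs l r" using nr rs_antimono[OF l, of r' r] r' by simp
    have "?A r v = (%s. 0)" if v: "v \<in> X" for v
    proof -
      have H: "?A r v \<in> HW (Suc (sum_list l)) ((rs l)(r := Suc (rs l r)))"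
        by (rule ind_raise[OF _ _ r]) (use v in \<open>auto simp: X_def\<close>)
      show ?thesis
      proof (rule raising_inj[where r = r' and m = "Suc (sum_list l)"])
        show "rs l r' < Suc (rs l r)" using eq by simp
        show "mv (Suc (sum_list l)) r' (Suc r') (?A r v) = (%s. 0)" using H unfolding HW_def by blast
        fix s assume "?A r v s ~= 0"
        then have "s \<in> Tab (Suc (sum_list l)) ((rs l)(r := Suc (rs l r)))" using H unfolding HW_def Fsp_def by blast
        then show "cnt (Suc (sum_list l)) s r' = rs l r' \<and> cnt (Suc (sum_list l)) s (Suc r') = Suc (rs l r)"
          unfolding Tab_def r' by simp
      qed
    qed
    then show ?thesis using X0 by auto
  qed
qed

subsection \<open>Splitting filtrations\<close>

text \<open>Some linear projection of the space of all functions onto \<open>L\<close> exists, and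
  averaging it over the group makes it equivariant. Projecting from all functions lets the same
  statement serve every step of a filtration.\<close>

lemma maschke_projection:
  fixes L :: "((nat => nat) => 'a::field_char_0) set"
  assumes L: "srep m L"
  shows "\<exists>P. (\<forall>u v c. P (%s. u s + c * v s) = (%s. P u s + c * P v s)) \<and> (\<forall>v. P v \<in> L) \<and> (\<forall>v\<in>L. P v = v) \<and>
    (\<forall>\<sigma> v. \<sigma> permutes {1..m} --> P (%s. v (s \<circ> \<sigma>)) = (%s. P v (s \<circ> \<sigma>)))"
proof -
  let ?sc = "%(c::'a) (f::(nat => nat) => 'a) s. c * f s"
  interpret vector_space_pair ?sc ?sc
    by unfold_locales (auto simp: fun_eq_iff algebra_simps)
  have "vs1.subspace L" using L unfolding vs1.subspace_def srep_def fsub_def by (simp add: plus_fun_def zero_fun_def)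
  moreover have "Vector_Spaces.linear ?sc ?sc id" unfolding linear_iff by (simp add: vs1.vector_space_axioms)
  ultimately obtain g where g: "range g <= L" "Vector_Spaces.linear ?sc ?sc g" "\<forall>v\<in>L. g (id v) = v"
    using linear_exists_left_inverse_on[of id L] by auto
  have gL: "g v \<in> L" for v using g(1) by blast
  have glin: "g (%s. u s + c * v s) = (%s. g u s + c * g v s)" for u v c
  proof -
    have "g (u + ?sc c v) = g u + ?sc c (g v)" using g(2) unfolding linear_iff by simp
    then show ?thesis by (simp add: plus_fun_def)
  qed
  define P where "P v = (%s. \<Sum>\<sigma>\<in>perms m. inverse (fact m) * g (%s. v (s \<circ> inv \<sigma>)) (s \<circ> \<sigma>))" for v
  have fL: "fsub L" using L unfolding srep_def by blast
  have "P v \<in> L" for v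
    unfolding P_def by (rule fsub_lincomb[OF fL]) (use L gL in \<open>auto simp: srep_def perms_def\<close>)
  moreover have "P (%s. u s + c * v s) = (%s. P u s + c * P v s)" for u v c
    unfolding P_def glin by (simp add: sum.distrib distrib_left sum_distrib_left mult_ac)
  moreover have "P v = v" if v: "v \<in> L" for v
  proof
    fix s
    have "P v s = (\<Sum>\<sigma>\<in>perms m. inverse (fact m) * v s)" unfolding P_def
    proof (rule sum.cong[OF refl])
      fix \<sigma> assume "\<sigma> \<in> perms m"
      then have \<sigma>: "\<sigma> permutes {1..m}" by (simp add: perms_def)
      have "(%s. v (s \<circ> inv \<sigma>)) \<in> L" using L v permutes_inv[OF \<sigma>] unfolding srep_def by blast
      then have "g (%s. v (s \<circ> inv \<sigma>)) = (%s. v (s \<circ> inv \<sigma>))" using g(3) by simp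
      then show "inverse (fact m) * g (%s. v (s \<circ> inv \<sigma>)) (s \<circ> \<sigma>) = inverse (fact m) * v s"
        by (simp add: o_assoc[symmetric] permutes_inv_o[OF \<sigma>])
    qed
    then show "P v s = v s" by (simp add: card_perms)
  qed
  moreover have "P (%s. v (s \<circ> \<tau>)) = (%s. P v (s \<circ> \<tau>))" if \<tau>: "\<tau> permutes {1..m}" for \<tau> v
  proof
    fix s
    have "P (%s. v (s \<circ> \<tau>)) s = (\<Sum>\<sigma>\<in>perms m. inverse (fact m) * g (%s. v (s \<circ> inv (\<tau> \<circ> \<sigma>) \<circ> \<tau>)) (s \<circ> (\<tau> \<circ> \<sigma>)))"
      unfolding P_def by (rule sum.reindex_bij_betw[OF perms_left[OF \<tau>], symmetric])
    also have "... = P v (s \<circ> \<tau>)" unfolding P_def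
    proof (rule sum.cong[OF refl])
      fix \<sigma> assume "\<sigma> \<in> perms m"
      then have \<sigma>: "\<sigma> permutes {1..m}" by (simp add: perms_def)
      have "inv (\<tau> \<circ> \<sigma>) = inv \<sigma> \<circ> inv \<tau>"
        by (rule o_inv_distrib) (use \<sigma> \<tau> permutes_bij in blast)+
      then have "u \<circ> inv (\<tau> \<circ> \<sigma>) \<circ> \<tau> = u \<circ> inv \<sigma>" for u :: "nat => nat"
        by (simp add: o_assoc[symmetric] permutes_inv_o[OF \<tau>])
      then show "inverse (fact m) * g (%s. v (s \<circ> inv (\<tau> \<circ> \<sigma>) \<circ> \<tau>)) (s \<circ> (\<tau> \<circ> \<sigma>))
          = inverse (fact m) * g (%s. v (s \<circ> inv \<sigma>)) (s \<circ> \<tau> \<circ> \<sigma>)" by (simp add: o_assoc)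
    qed
    finally show "P (%s. v (s \<circ> \<tau>)) s = P v (s \<circ> \<tau>)" .
  qed
  ultimately show ?thesis by (intro exI[of _ P]) blast
qed

text \<open>An equivariant isomorphism from \<open>X\<close> to the direct sum of the
  \<open>Y i\<close>, given by its components; the last clause is bijectivity.\<close>

definition decomp :: "nat => ((nat => nat) => 'a::comm_ring_1) set => 'i set => ('i => ((nat => nat) => 'a) set)
    => ('i => ((nat => nat) => 'a) => (nat => nat) => 'a) => bool" where
  "decomp m X I Y b \<longleftrightarrow>
     (\<forall>i\<in>I. \<forall>u\<in>X. \<forall>v\<in>X. \<forall>c. b i (%s. u s + c * v s) = (%s. b i u s + c * b i v s)) \<and>
     (\<forall>i\<in>I. \<forall>v\<in>X. b i v \<in> Y i) \<and>
     (\<forall>i\<in>I. \<forall>\<sigma>. \<forall>v\<in>X. \<sigma> permutes {1..m} --> b i (%s. v (s \<circ> \<sigma>)) = (%s. b i v (s \<circ> \<sigma>))) \<and>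
     (\<forall>y. (\<forall>i\<in>I. y i \<in> Y i) --> (\<exists>!v. v \<in> X \<and> (\<forall>i\<in>I. b i v = y i)))"

text \<open>The image of \<open>a i\<close> is controlled only on the step of the filtration where
  the earlier maps vanish. Composing with an equivariant projection onto that step gives a map on
  all of \<open>X\<close>, and the resulting system of components is triangular.\<close>

lemma filtration_decomp:
  fixes X :: "((nat => nat) => 'a::field_char_0) set" and N :: nat
  assumes X: "srep m X"
    and lin: "\<And>i u v c. i < N ==> u \<in> X ==> v \<in> X ==> a i (%s. u s + c * v s) = (%s. a i u s + c * a i v s)"
    and eqv: "\<And>i \<sigma> v. i < N ==> v \<in> X ==> \<sigma> permutes {1..m} ==> a i (%s. v (s \<circ> \<sigma>)) = (%s. a i v (s \<circ> \<sigma>))"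
    and inj: "\<And>v. v \<in> X ==> (\<And>i. i < N ==> a i v = (%s. 0)) ==> v = (%s. 0)"
    and im: "\<And>i. i < N ==> a i ` {v \<in> X. \<forall>j<i. a j v = (%s. 0)} = Y i"
  shows "\<exists>b. decomp m X {..<N} Y b"
proof -
  define L where "L i = {v \<in> X. \<forall>j<i. a j v = (%s. 0)}" for i
  have fX: "fsub X" using X unfolding srep_def by blast
  have Xl: "(%s. u s + c * v s) \<in> X" if "u \<in> X" "v \<in> X" for u v c
    using fsubD(2)[OF fX that(1) fsubD(3)[OF fX that(2)]] .
  have a0: "a i (%s. 0) = (%s. 0)" if "i < N" for i
    using lin[OF that fsubD(1)[OF fX] fsubD(1)[OF fX], of "-1"] by simp
  have Ll: "(%s. u s + c * v s) \<in> L i" if "u \<in> L i" "v \<in> L i" "i <= N" for u v c i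
  proof -
    have u: "u \<in> X" "v \<in> X" "\<And>j. j < i ==> a j u = (%s. 0)" "\<And>j. j < i ==> a j v = (%s. 0)"
      using that unfolding L_def by auto
    have "a j (%s. u s + c * v s) = (%s. 0)" if "j < i" for j
      using lin[of j u v c, OF order_less_le_trans[OF that \<open>i <= N\<close>] u(1,2)] u(3,4)[OF that] by simp
    then show ?thesis using Xl[OF u(1,2), of c] unfolding L_def by blast
  qed
  have L0: "(%s. 0) \<in> L i" if "i <= N" for i using fsubD(1)[OF fX] a0 that unfolding L_def by auto
  have Ls: "srep m (L i)" if i: "i <= N" for i
    unfolding srep_def fsub_def
  proof (intro conjI ballI allI impI)
    show "(%s. 0) \<in> L i" by (rule L0[OF i])
    show "(%s. u s + v s) \<in> L i" if "u \<in> L i" "v \<in> L i" for u v using Ll[OF that i, of 1] by simp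
    show "(%s. c * v s) \<in> L i" if "v \<in> L i" for c v using Ll[OF L0[OF i] that i, of c] by simp
    fix \<sigma> v assume s: "\<sigma> permutes {1..m}" and v: "v \<in> L i"
    then have "(%s. v (s \<circ> \<sigma>)) \<in> X" using X unfolding srep_def L_def by blast
    moreover have "a j (%s. v (s \<circ> \<sigma>)) = (%s. 0)" if "j < i" for j
      using eqv[of j v \<sigma>, OF order_less_le_trans[OF that i] _ s] v that unfolding L_def by simp
    ultimately show "(%s. v (s \<circ> \<sigma>)) \<in> L i" unfolding L_def by blast
  qed
  define Q where "Q i P \<longleftrightarrow> (\<forall>u v c. P (%s. u s + c * v s) = (%s. P u s + c * P v s)) \<and> (\<forall>v. P v \<in> L i) \<and> (\<forall>v\<in>L i. P v = v) \<and>
    (\<forall>\<sigma> v. \<sigma> permutes {1..m} --> P (%s. v (s \<circ> \<sigma>)) = (%s. P v (s \<circ> \<sigma>)))" for i P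
  define P where "P i = (SOME P. Q i P)" for i
  have "Q i (P i)" if "i <= N" for i
  proof -
    have "\<exists>P. Q i P" unfolding Q_def by (rule maschke_projection[OF Ls[OF that]])
    then show ?thesis unfolding P_def by (rule someI_ex)
  qed
  note P = this[unfolded Q_def]
  have PL: "P i v \<in> L i" "P i v \<in> X" "v \<in> L i ==> P i v = v" if "i < N" for i v
    using P[of i] that unfolding L_def by auto
  define b where "b i v = a i (P i v)" for i v
  have blin: "b i (%s. u s + c * v s) = (%s. b i u s + c * b i v s)" if "i < N" for i u v c
    unfolding b_def using P[of i] that lin[OF that PL(2)[OF that] PL(2)[OF that]] by simp
  have bY: "b i v \<in> Y i" if "i < N" for i v
    unfolding b_def im[OF that, symmetric] using PL(1)[OF that, of v] unfolding L_def by blast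
  have bL: "b i v = a i v" if "i < N" "v \<in> L i" for i v unfolding b_def using PL(3)[OF that] by simp
  have Yl: "(%s. u s + c * v s) \<in> Y i" if that: "i < N" "u \<in> Y i" "v \<in> Y i" for u v c i
  proof -
    obtain u' where u: "u' \<in> L i" "u = a i u'"
      by (rule imageE[OF \<open>u \<in> Y i\<close>[folded im[OF \<open>i < N\<close>], folded L_def]])
    obtain v' where v: "v' \<in> L i" "v = a i v'"
      by (rule imageE[OF \<open>v \<in> Y i\<close>[folded im[OF \<open>i < N\<close>], folded L_def]])
    note uv = u v
    have "u' \<in> X" "v' \<in> X" using uv unfolding L_def by auto
    then have e: "(%s. u s + c * v s) = a i (%s. u' s + c * v' s)" using lin[OF that(1)] uv by simp
    have "(%s. u' s + c * v' s) \<in> L i" using Ll uv that(1) by simp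
    from imageI[OF this, of "a i"] show ?thesis unfolding e im[OF that(1), folded L_def] .
  qed
  \<comment> \<open>Solved from \<open>i = 0\<close> upwards: a correction taken from
    \<open>L k\<close> leaves the components below \<open>k\<close> unchanged.\<close>
  have ex: "\<exists>v\<in>X. \<forall>i<k. b i v = y i" if kN: "k <= N" and yY: "\<And>i. i < N ==> y i \<in> Y i" for k y
    using kN
  proof (induction k)
    case 0
    then show ?case using fsubD(1)[OF fX] by auto
  next
    case (Suc k)
    then obtain v where v: "v \<in> X" "\<forall>i<k. b i v = y i" by auto
    have k: "k < N" using Suc by simp
    have "(%s. y k s + (-1) * b k v s) \<in> Y k" by (rule Yl[OF k yY[OF k] bY[OF k]])
    then obtain w where w0: "w \<in> L k" "(%s. y k s + (-1) * b k v s) = a k w"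
      unfolding im[OF k, symmetric, folded L_def] by (rule imageE)
    note w = w0(1) w0(2)[symmetric]
    have wX: "w \<in> X" using w unfolding L_def by blast
    have "b i w = (%s. 0)" if "i < k" for i
    proof -
      have "w \<in> L i" using w(1) that unfolding L_def by auto
      then show ?thesis using bL[of i w] w(1) that k unfolding L_def by auto
    qed
    moreover have "b k w = (%s. y k s + (-1) * b k v s)" using bL[OF k w(1)] w(2) by simp
    ultimately have "b i (%s. v s + 1 * w s) = y i" if "i < Suc k" for i
      unfolding blin[of i v 1 w, OF order_less_le_trans[OF that Suc.prems]] using v(2) that by (cases "i = k") auto
    then show ?case using Xl[OF v(1) wX, of 1] by blast
  qed
  have un: "v = v'" if v: "v \<in> X" "v' \<in> X" "\<And>i. i < N ==> b i v = b i v'" for v v'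
  proof -
    define d where "d = (%s. v s + (-1) * v' s)"
    have d: "d \<in> X" unfolding d_def by (rule Xl[OF v(1,2)])
    have bd: "b i d = (%s. 0)" if "i < N" for i unfolding d_def blin[OF that] using v(3)[OF that] by simp
    have "d \<in> L i" if "i <= N" for i
      using that
    proof (induction i)
      case 0
      then show ?case using d unfolding L_def by simp
    next
      case (Suc i)
      then have dL: "d \<in> L i" "i < N" by auto
      then have "a i d = (%s. 0)" using bL[OF dL(2,1)] bd by simp
      then show ?case using dL(1) unfolding L_def by (auto simp: less_Suc_eq)
    qed
    from this[of N] have "d = (%s. 0)" using inj[OF d] unfolding L_def by blast
    then show "v = v'" unfolding d_def by (auto simp: fun_eq_iff)
  qed
  have beqv: "b i (%s. v (s \<circ> \<sigma>)) = (%s. b i v (s \<circ> \<sigma>))" if "i < N" "\<sigma> permutes {1..m}" for i \<sigma> v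
    unfolding b_def using P[of i] that eqv[OF that(1) PL(2)[OF that(1)] that(2)] by simp
  have "decomp m X {..<N} Y b"
    unfolding decomp_def
  proof (intro conjI ballI allI impI)
    fix y assume y: "\<forall>i\<in>{..<N}. y i \<in> Y i"
    from ex[of N y] y obtain v where "v \<in> X" "\<forall>i<N. b i v = y i" by auto
    then show "\<exists>!v. v \<in> X \<and> (\<forall>i\<in>{..<N}. b i v = y i)" using un by (intro ex1I[of _ v]) auto
  qed (use blin bY beqv in auto)
  then show ?thesis by blast
qed

text \<open>Rows without a removable or addable box contribute zero pieces. These are dropped, and
  the remaining rows are replaced by the partitions they produce.\<close>

lemma decomp_reindex:
  assumes d: "decomp m X I Y b" and f: "inj_on f J" "f ` J <= I" and Y': "\<And>j. j \<in> J ==> Y' j = Y (f j)"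
    and Y0: "\<And>i. i \<in> I - f ` J ==> Y i = {%s. 0}"
  shows "decomp m X J Y' (%j. b (f j))"
  unfolding decomp_def
proof (intro conjI ballI allI impI)
  fix y assume y: "\<forall>j\<in>J. y j \<in> Y' j"
  define y' where "y' i = (if i \<in> f ` J then y (inv_into J f i) else (%s. 0))" for i
  have y'f: "y' (f j) = y j" if "j \<in> J" for j using that f(1) by (simp add: y'_def)
  have "\<forall>i\<in>I. y' i \<in> Y i"
  proof
    fix i assume i: "i \<in> I"
    show "y' i \<in> Y i"
    proof (cases "i \<in> f ` J")
      case True
      then obtain j where "j \<in> J" "i = f j" by blast
      then show ?thesis using y'f y Y' by auto
    next
      case False
      then show ?thesis using Y0[of i] i by (simp add: y'_def)
    qed
  qed
  then have "\<exists>!v. v \<in> X \<and> (\<forall>i\<in>I. b i v = y' i)" using d unfolding decomp_def by blast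
  moreover have "(v \<in> X \<and> (\<forall>i\<in>I. b i v = y' i)) \<longleftrightarrow> (v \<in> X \<and> (\<forall>j\<in>J. b (f j) v = y j))" for v
  proof (cases "v \<in> X")
    case v: True
    have "(\<forall>i\<in>I. b i v = y' i) \<longleftrightarrow> (\<forall>i\<in>f ` J. b i v = y' i)"
    proof -
      have "b i v = y' i" if "i \<in> I - f ` J" for i
      proof -
        have "b i v \<in> Y i" using d v that unfolding decomp_def by blast
        then show ?thesis using Y0[OF that] that by (simp add: y'_def)
      qed
      then show ?thesis using f(2) by blast
    qed
    then show ?thesis using v y'f by simp
  qed simp
  ultimately show "\<exists>!v. v \<in> X \<and> (\<forall>j\<in>J. b (f j) v = y j)" by simp
qed (use d f Y' in \<open>auto simp: decomp_def\<close>)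

text \<open>A component is understood only when those of all later rows vanish, so the filtration
  starts with the last row; hence the reversed index \<open>N - 1 - i\<close>.\<close>

theorem specht_restriction:
  assumes l: "is_partition l" and m: "sum_list l = Suc m"
  shows "\<exists>b. decomp m (sp l :: ((nat => nat) => 'a::field_char_0) set) {\<alpha>. boxrem \<alpha> l} sp b"
proof -
  define N where "N = length l"
  define X where "X = (sp l :: ((nat => nat) => 'a) set)"
  define a where "a i = (part (Suc m) (N - 1 - i) :: ((nat => nat) => 'a) => _)" for i
  define Y where "Y i = a i ` {v \<in> X. \<forall>j<i. a j v = (%s. 0)}" for i
  have sX: "srep (Suc m) X" unfolding X_def using srep_sp[OF l, where 'a = 'a] m by simp
  have sX': "srep m X" using sX permutes_subset[of _ "{1..m}" "{1..Suc m}"] unfolding srep_def by auto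
  have XH: "v \<in> HW (Suc m) (rs l)" if "v \<in> X" for v using that sp_HW[OF l, where 'a = 'a] m unfolding X_def by auto
  have high: "part (Suc m) q v = (%s. 0)" if "v \<in> X" "N <= q" for v q
    using part_Fsp(2)[of v m "rs l" q] XH[OF that(1)] that(2) unfolding HW_def N_def by simp
  have low: "{v \<in> X. \<forall>j<i. a j v = (%s. 0)} = {v \<in> X. \<forall>q>N - 1 - i. part (Suc m) q v = (%s. 0)}" if i: "i < N" for i
  proof -
    have "(\<forall>j<i. a j v = (%s. 0)) \<longleftrightarrow> (\<forall>q>N - 1 - i. part (Suc m) q v = (%s. 0))" if v: "v \<in> X" for v
    proof
      assume A: "\<forall>j<i. a j v = (%s. 0)"
      show "\<forall>q>N - 1 - i. part (Suc m) q v = (%s. 0)"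
      proof (intro allI impI)
        fix q assume q: "N - 1 - i < q"
        show "part (Suc m) q v = (%s. 0)"
        proof (cases "N <= q")
          case False
          then have "N - 1 - (N - 1 - q) = q" "N - 1 - q < i" using q i by auto
          then show ?thesis using A[rule_format, of "N - 1 - q"] unfolding a_def by simp
        qed (rule high[OF v])
      qed
    next
      assume "\<forall>q>N - 1 - i. part (Suc m) q v = (%s. 0)"
      then show "\<forall>j<i. a j v = (%s. 0)" unfolding a_def using i by auto
    qed
    then show ?thesis by blast
  qed
  have "\<exists>b. decomp m X {..<N} Y b"
  proof (rule filtration_decomp[OF sX', where a = a])
    show "a i (%s. u s + c * v s) = (%s. a i u s + c * a i v s)" for i u v c unfolding a_def by (rule part_lin)
    show "a i (%s. v (s \<circ> \<sigma>)) = (%s. a i v (s \<circ> \<sigma>))" if "\<sigma> permutes {1..m}" for i \<sigma> v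
      unfolding a_def by (rule part_act[OF that])
    show "v = (%s. 0)" if v: "v \<in> X" and z: "\<And>i. i < N ==> a i v = (%s. 0)" for v
    proof (rule parts_zero[of v m "rs l"])
      show "v \<in> Fsp (Suc m) (rs l)" using XH[OF v] unfolding HW_def by blast
      fix q
      show "part (Suc m) q v = (%s. 0)"
      proof (cases "N <= q")
        case False
        then have "N - 1 - (N - 1 - q) = q" "N - 1 - q < N" by auto
        then show ?thesis using z[of "N - 1 - q"] unfolding a_def by simp
      qed (rule high[OF v])
    qed
  qed (simp add: Y_def)
  then obtain b where b: "decomp m X {..<N} Y b" by blast
  define row where "row \<alpha> = (THE r. remrow l r \<alpha>)" for \<alpha>
  have row: "remrow l (row \<alpha>) \<alpha>" if h: "boxrem \<alpha> l" for \<alpha>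
  proof -
    obtain r where r: "remrow l r \<alpha>" using h boxrem_iff[OF l] by blast
    then show ?thesis unfolding row_def using remrow_unique by (metis theI)
  qed
  have rowN: "row \<alpha> < N" if "boxrem \<alpha> l" for \<alpha>
  proof (rule ccontr)
    assume "\<not> row \<alpha> < N"
    then have "rs l (row \<alpha>) = 0" unfolding N_def by simp
    then show False using row[OF that] unfolding remrow_def by simp
  qed
  let ?f = "%\<alpha>. N - 1 - row \<alpha>"
  have "decomp m X {\<alpha>. boxrem \<alpha> l} sp (%\<alpha>. b (?f \<alpha>))"
  proof (rule decomp_reindex[OF b])
    show "inj_on ?f {\<alpha>. boxrem \<alpha> l}"
    proof (rule inj_onI)
      fix \<alpha> \<alpha>' assume h: "\<alpha> \<in> {\<alpha>. boxrem \<alpha> l}" "\<alpha>' \<in> {\<alpha>. boxrem \<alpha> l}" "?f \<alpha> = ?f \<alpha>'"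
      then have "row \<alpha> = row \<alpha>'" using rowN[of \<alpha>] rowN[of \<alpha>'] by simp
      then show "\<alpha> = \<alpha>'" using row[of \<alpha>] row[of \<alpha>'] h rs_inject unfolding remrow_def by simp
    qed
    show "?f ` {\<alpha>. boxrem \<alpha> l} <= {..<N}" using rowN by fastforce
    show "sp \<alpha> = Y (?f \<alpha>)" if "\<alpha> \<in> {\<alpha>. boxrem \<alpha> l}" for \<alpha>
    proof -
      have r: "row \<alpha> < N" "remrow l (row \<alpha>) \<alpha>" using rowN row that by auto
      then have e: "N - 1 - ?f \<alpha> = row \<alpha>" "?f \<alpha> < N" by auto
      show ?thesis unfolding Y_def low[OF e(2)] unfolding a_def e(1) X_def by (rule part_image(1)[OF l m r(2), symmetric])
    qed
    show "Y i = {%s. 0}" if i: "i \<in> {..<N} - ?f ` {\<alpha>. boxrem \<alpha> l}" for i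
    proof -
      have iN: "i < N" using i by simp
      have nr: "\<not> rs l (Suc (N - 1 - i)) < rs l (N - 1 - i)"
      proof
        assume "rs l (Suc (N - 1 - i)) < rs l (N - 1 - i)"
        then obtain \<alpha> where \<alpha>: "remrow l (N - 1 - i) \<alpha>" using remrow_exists[OF l] by blast
        then have bx: "boxrem \<alpha> l" using boxrem_iff[OF l] by blast
        then have "row \<alpha> = N - 1 - i" using row[OF bx] \<alpha> remrow_unique by blast
        then have "i = ?f \<alpha>" using i by auto
        then show False using i bx by blast
      qed
      show ?thesis unfolding Y_def low[OF iN] unfolding a_def X_def by (rule part_image(2)[OF l m nr])
    qed
  qed
  then show ?thesis unfolding X_def by blast
qed

theorem specht_induction:
  assumes l: "is_partition l"
  shows "\<exists>b. decomp (Suc (sum_list l)) (indX l :: ((nat => nat) => 'a::field_char_0) set) {\<beta>. boxrem l \<beta>} sp b"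
proof -
  let ?m = "Suc (sum_list l)" and ?L = "Suc (length l)"
  define X where "X = (indX l :: ((nat => nat) => 'a) set)"
  define a where "a i = (mv ?m i ?L :: ((nat => nat) => 'a) => _)" for i
  define Y where "Y i = a i ` {v \<in> X. \<forall>j<i. a j v = (%s. 0)}" for i
  have "\<exists>b. decomp ?m X {..<?L} Y b"
  proof (rule filtration_decomp[where a = a])
    show "srep ?m X" unfolding X_def by (rule srep_indX)
    show "a i (%s. u s + c * v s) = (%s. a i u s + c * a i v s)" for i u v c unfolding a_def by (rule mv_lin)
    show "a i (%s. v (s \<circ> \<sigma>)) = (%s. a i v (s \<circ> \<sigma>))" if "\<sigma> permutes {1..?m}" for i \<sigma> v
      unfolding a_def by (rule mv_act[OF that])
    show "v = (%s. 0)" if v: "v \<in> X" and z: "\<And>i. i < ?L ==> a i v = (%s. 0)" for v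
    proof
      fix s
      show "v s = 0"
      proof (rule ccontr)
        assume nz: "v s ~= 0"
        have "s \<in> Tab ?m ((rs l)(?L := 1))" using v nz unfolding X_def indX_def Fsp_def by blast
        then have c: "cnt ?m s ?L = 1" "cnt ?m s (length l) = 0" unfolding Tab_def by auto
        obtain k where k: "{j \<in> {1..?m}. s j = ?L} = {k}" by (rule card_1_singletonE[OF c(1)[unfolded cnt_def]])
        then have kin: "k \<in> {1..?m}" "s k = ?L" by auto
        \<comment> \<open>Row \<open>length l\<close> is empty on the support of \<open>v\<close>,
          so moving the only point of the extra row there loses nothing. The extra row has index
          \<open>Suc (length l)\<close> so that this row stays free for a new row of
          \<open>\<beta>\<close>.\<close>
        define s' where "s' = s(k := length l)"
        have n: "{j \<in> {1..?m}. s j = length l} = {}" using c(2) unfolding cnt_def by simp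
        have "{j \<in> {1..?m}. s' j = length l} = {k}" using n kin unfolding s'_def by auto
        moreover have "s'(k := ?L) = s" unfolding s'_def using kin(2) by auto
        ultimately have "a (length l) v s' = v s" unfolding a_def mv_def by simp
        then show False using z[of "length l"] nz by simp
      qed
    qed
  qed (simp add: Y_def)
  then obtain b where b: "decomp ?m X {..<?L} Y b" by blast
  define row where "row \<beta> = (THE r. remrow \<beta> r l)" for \<beta>
  have bx: "boxrem l \<beta> \<longleftrightarrow> is_partition \<beta> \<and> (\<exists>r. remrow \<beta> r l)" for \<beta>
    using boxrem_iff[of \<beta> l] unfolding boxrem_def by blast
  have row: "remrow \<beta> (row \<beta>) l" "is_partition \<beta>" if h: "boxrem l \<beta>" for \<beta>
  proof -
    obtain r where r: "remrow \<beta> r l" using h bx by blast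
    then show "remrow \<beta> (row \<beta>) l" unfolding row_def using remrow_unique by (metis theI)
    show "is_partition \<beta>" using that bx by blast
  qed
  have "decomp ?m X {\<beta>. boxrem l \<beta>} sp (%\<beta>. b (row \<beta>))"
  proof (rule decomp_reindex[OF b])
    show "inj_on row {\<beta>. boxrem l \<beta>}"
    proof (rule inj_onI)
      fix \<beta> \<beta>' assume h: "\<beta> \<in> {\<beta>. boxrem l \<beta>}" "\<beta>' \<in> {\<beta>. boxrem l \<beta>}" "row \<beta> = row \<beta>'"
      have "rs \<beta> = rs \<beta>'" using remrow_rs(1)[OF row(2,1)[of \<beta>]] remrow_rs(1)[OF row(2,1)[of \<beta>']] h by simp
      then show "\<beta> = \<beta>'" using rs_inject row(2) h by simp
    qed
    show "row ` {\<beta>. boxrem l \<beta>} <= {..<?L}" using remrow_rs(2)[OF row(2,1)] by fastforce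
    show "sp \<beta> = Y (row \<beta>)" if "\<beta> \<in> {\<beta>. boxrem l \<beta>}" for \<beta>
      unfolding Y_def a_def X_def using ind_image(1)[OF l row(2,1), where 'a = 'a, of \<beta>] that by simp
    show "Y i = {%s. 0}" if i: "i \<in> {..<?L} - row ` {\<beta>. boxrem l \<beta>}" for i
    proof -
      have "\<not> (i = 0 \<or> rs l i < rs l (i - 1))"
      proof
        assume "i = 0 \<or> rs l i < rs l (i - 1)"
        then obtain \<beta> where \<beta>: "is_partition \<beta>" "remrow \<beta> i l" using addrow_exists[OF l] by blast
        then have b': "boxrem l \<beta>" using bx by blast
        then have "row \<beta> = i" using row(1)[OF b'] \<beta> remrow_unique by blast
        then show False using i b' by blast
      qed
      then show ?thesis unfolding Y_def a_def X_def using ind_image(2)[OF l, where 'a = 'a, of i] i by simp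
    qed
  qed
  then show ?thesis unfolding X_def by blast
qed

section \<open>Half diagrams sorted by the arc at the last top vertex\<close>

lemma Dg_sub: "d \<in> Dg n ==> d' <= d ==> d' \<in> Dg n"
  unfolding Dg_iff by (meson subset_iff)

lemma Dg_lower:
  assumes d: "d \<in> Dg (Suc N)" and iso: "\<And>v. {Top (Suc N), v} \<notin> d" "\<And>v. {Bot (Suc N), v} \<notin> d"
  shows "d \<in> Dg N"
proof (rule DgI)
  fix e assume e: "e \<in> d"
  obtain u v where uv: "e = {u, v}" "u ~= v" "u \<in> verts (Suc N)" "v \<in> verts (Suc N)" by (rule Dg_edgeE[OF d e])
  have h: "{u, v} \<in> d" "{v, u} \<in> d" using e uv by (simp_all add: insert_commute)
  have w: "w \<in> verts N" if "w \<in> verts (Suc N)" "{w, z} \<in> d" for w z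
    using that iso by (cases w) (auto simp: le_Suc_eq)
  show "\<exists>u v. u ~= v \<and> e = {u, v} \<and> u \<in> verts N \<and> v \<in> verts N"
    using uv w[OF uv(3) h(1)] w[OF uv(4) h(2)] by blast
next
  fix u v w assume "{u, v} \<in> d" "{u, w} \<in> d"
  then show "v = w" by (rule Dg_partner[OF d])
qed

lemma Hd_cases:
  assumes d: "d \<in> Hd (Suc N) m" and m: "m <= N"
  obtains "d \<in> Hd N m" | j where "{Top (Suc N), Top j} \<in> d" | k where "k \<in> {1..m}" "{Top (Suc N), Bot k} \<in> d"
proof (cases "\<exists>v. {Top (Suc N), v} \<in> d")
  case False
  have "d \<in> Dg N" by (rule Dg_lower[OF HdD(1)[OF d]]) (use False HdD(3)[OF d] m in auto)
  then have "d \<in> Hd N m" using HdD(2,3)[OF d] by (intro HdI) auto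
  then show ?thesis using that(1) by blast
next
  case True
  then obtain v where v: "{Top (Suc N), v} \<in> d" by blast
  show ?thesis
  proof (cases v)
    case (Top j)
    then show ?thesis using v that(2) by blast
  next
    case (Bot k)
    have "\<not> m < k" using HdD(3)[OF d, of k "Top (Suc N)"] v Bot by (auto simp: insert_commute)
    moreover have "1 <= k" using Dg_edgeD(3)[OF HdD(1)[OF d] v] Bot by simp
    ultimately show ?thesis using v Bot that(3)[of k] by simp
  qed
qed

text \<open>Trades the vertical arc at bottom \<open>Suc m\<close> for a horizontal arc at the new
  top vertex. Together with \<open>Hd_unbend\<close> this is a bijection onto the half diagrams with
  such a horizontal arc.\<close>

lemma Hd_bend:
  assumes h: "h \<in> Hd N (Suc m)" and m: "Suc m <= N"
  shows "bend (Suc m) (Suc N) h \<in> Hd (Suc N) m" "\<exists>j. {Top (Suc N), Top j} \<in> bend (Suc m) (Suc N) h"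
proof -
  note hD = HdD(1)[OF h]
  have up: "{Top j, Bot i} \<in> bend (Suc m) (Suc N) h" if "{Top j, Bot i} \<in> h" "i ~= Suc m" for i j
    using vmap_edgeI[OF that(1), of "%v. if v = Bot (Suc m) then Top (Suc N) else v"] that(2) unfolding bend_def by simp
  show "bend (Suc m) (Suc N) h \<in> Hd (Suc N) m"
  proof (rule HdI[OF bend_Dg[OF hD]])
    fix i assume i: "i \<in> {1..m}"
    then obtain j where "{Top j, Bot i} \<in> h" using HdD(2)[OF h, of i] by auto
    then show "\<exists>j. {Top j, Bot i} \<in> bend (Suc m) (Suc N) h" using up[of j i] i by auto
  next
    fix i v assume i: "m < i"
    show "{Bot i, v} \<notin> bend (Suc m) (Suc N) h"
    proof (cases "i = Suc m")
      case True
      then show ?thesis using bend_isolated[OF hD] by simp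
    next
      case False
      show ?thesis
      proof
        assume "{Bot i, v} \<in> bend (Suc m) (Suc N) h"
        then obtain p q where "{p, q} \<in> h" "Bot i = (if p = Bot (Suc m) then Top (Suc N) else p)"
          unfolding bend_def by (rule vmap_edgeE[OF hD])
        then have "{Bot i, q} \<in> h" by (auto split: if_splits)
        then show False using HdD(3)[OF h, of i q] i False by auto
      qed
    qed
  qed
  obtain j where "{Top j, Bot (Suc m)} \<in> h" using HdD(2)[OF h, of "Suc m"] by auto
  from vmap_edgeI[OF this, of "%v. if v = Bot (Suc m) then Top (Suc N) else v"]
  show "\<exists>j. {Top (Suc N), Top j} \<in> bend (Suc m) (Suc N) h" unfolding bend_def by (auto simp: insert_commute)
qed

lemma Hd_unbend:
  assumes d: "d \<in> Hd (Suc N) m" and j: "{Top (Suc N), Top j} \<in> d" and m: "Suc m <= N"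
  shows "unbend (Suc m) (Suc N) d \<in> Hd N (Suc m)" "bend (Suc m) (Suc N) (unbend (Suc m) (Suc N) d) = d"
proof -
  note dD = HdD(1)[OF d]
  have U: "unbend (Suc m) (Suc N) d \<in> Dg N"
    by (rule unbend_Dg[OF dD]) (use m HdD(3)[OF d] in auto)
  have jN: "j ~= Suc N" using Dg_edgeD(1)[OF dD j] by auto
  show "unbend (Suc m) (Suc N) d \<in> Hd N (Suc m)"
  proof (rule HdI[OF U])
    fix i assume i: "i \<in> {1..Suc m}"
    show "\<exists>j. {Top j, Bot i} \<in> unbend (Suc m) (Suc N) d"
    proof (cases "i = Suc m")
      case True
      show ?thesis using vmap_edgeI[OF j, of "%v. if v = Top (Suc N) then Bot (Suc m) else v"] jN True
        unfolding unbend_def by (auto simp: insert_commute intro!: exI[of _ j])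
    next
      case False
      then obtain l where l: "{Top l, Bot i} \<in> d" using HdD(2)[OF d, of i] i by auto
      have "l ~= Suc N" using Dg_partner[OF dD j, of "Bot i"] l by auto
      then show ?thesis using vmap_edgeI[OF l, of "%v. if v = Top (Suc N) then Bot (Suc m) else v"]
        unfolding unbend_def by (auto intro!: exI[of _ l])
    qed
  next
    fix i v assume i: "Suc m < i"
    show "{Bot i, v} \<notin> unbend (Suc m) (Suc N) d"
    proof
      assume "{Bot i, v} \<in> unbend (Suc m) (Suc N) d"
      then obtain p q where "{p, q} \<in> d" "Bot i = (if p = Top (Suc N) then Bot (Suc m) else p)"
        unfolding unbend_def by (rule vmap_edgeE[OF dD])
      then have "{Bot i, q} \<in> d" using i by (auto split: if_splits)
      then show False using HdD(3)[OF d, of i q] i by auto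
    qed
  qed
  show "bend (Suc m) (Suc N) (unbend (Suc m) (Suc N) d) = d"
    by (rule bend_unbend[OF dD]) (use HdD(3)[OF d] in auto)
qed

text \<open>The permutation has to fix \<open>Suc m\<close>, whose arc leaves the bottom row. This
  is why bending links representations of \<open>S_m\<close> with induced ones of
  \<open>S_(m+1)\<close>.\<close>

lemma bend_rt:
  assumes \<rho>: "\<rho> permutes {1..m}"
  shows "bend (Suc m) q (rt \<rho> h) = rt \<rho> (bend (Suc m) q h)"
proof -
  have i: "inv \<rho> i = Suc m \<longleftrightarrow> i = Suc m" for i
    using permutes_inv_eq[OF \<rho>] permutes_not_in[OF \<rho>, of "Suc m"] by auto
  have "(%v. if v = Bot (Suc m) then Top q else v) \<circ> (%v. case v of Top i => Top i | Bot i => Bot (inv \<rho> i))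
     = (%v. case v of Top i => Top i | Bot i => Bot (inv \<rho> i)) \<circ> (%v. if v = Bot (Suc m) then Top q else v)"
    by (rule ext) (auto split: vtx.splits simp: i)
  then show ?thesis unfolding bend_def rt_def vmap_vmap by simp
qed

abbreviation ins :: "nat => nat => diag => diag" where
  "ins N k d \<equiv> insert {Top (Suc N), Bot k} d"

lemma Hd_ins:
  assumes h: "h \<in> Hd N m" and m: "Suc m <= N"
  shows "ins N (Suc m) h \<in> Hd (Suc N) (Suc m)"
proof (rule HdI)
  show "ins N (Suc m) h \<in> Dg (Suc N)"
    by (rule Dg_insert[OF Dg_Suc[OF HdD(1)[OF h]]]) (use m Dg_vertex_gt(1)[OF HdD(1)[OF h]] HdD(3)[OF h] in auto)
  fix i
  show "\<exists>j. {Top j, Bot i} \<in> ins N (Suc m) h" if "i \<in> {1..Suc m}"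
    using HdD(2)[OF h, of i] that by (cases "i = Suc m") auto
  show "{Bot i, v} \<notin> ins N (Suc m) h" if "Suc m < i" for v
    using HdD(3)[OF h, of i v] that by (auto simp: doubleton_eq_iff)
qed

lemma Dg_del:
  assumes d: "d \<in> Hd (Suc N) m" and m: "m <= N" and e: "{Top (Suc N), Bot k} \<in> d"
  shows "d - {{Top (Suc N), Bot k}} \<in> Dg N" "\<And>v. {Bot k, v} \<notin> d - {{Top (Suc N), Bot k}}"
    "d = ins N k (d - {{Top (Suc N), Bot k}})"
proof -
  note dD = HdD(1)[OF d]
  show "\<And>v. {Bot k, v} \<notin> d - {{Top (Suc N), Bot k}}"
    using Dg_disjoint[OF dD e] by blast
  show "d = ins N k (d - {{Top (Suc N), Bot k}})" using e by blast
  show "d - {{Top (Suc N), Bot k}} \<in> Dg N"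
    by (rule Dg_lower[OF Dg_sub[OF dD]]) (use Dg_disjoint[OF dD e] HdD(3)[OF d] m in auto)
qed

lemma Hd_del:
  assumes d: "d \<in> Hd (Suc N) (Suc m)" and m: "Suc m <= N" and e: "{Top (Suc N), Bot (Suc m)} \<in> d"
  shows "d - {{Top (Suc N), Bot (Suc m)}} \<in> Hd N m"
proof (rule HdI[OF Dg_del(1)[OF d m e]])
  fix i
  show "\<exists>j. {Top j, Bot i} \<in> d - {{Top (Suc N), Bot (Suc m)}}" if "i \<in> {1..m}"
    using HdD(2)[OF d, of i] that by (auto simp: doubleton_eq_iff)
  show "{Bot i, v} \<notin> d - {{Top (Suc N), Bot (Suc m)}}" if "m < i" for v
    using HdD(3)[OF d, of i v] that Dg_del(2)[OF d m e, of v] by (cases "i = Suc m") auto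
qed

lemma ins_rt:
  assumes \<rho>: "\<rho> permutes {1..m}"
  shows "rt \<rho> (ins N (Suc m) h) = ins N (Suc m) (rt \<rho> h)"
proof -
  have "inv \<rho> (Suc m) = Suc m" using permutes_not_in[OF permutes_inv[OF \<rho>], of "Suc m"] by simp
  then show ?thesis unfolding rt_def vmap_def by simp
qed

lemma Hd_low_top: "h \<in> Hd N m ==> {Top (Suc N), v} \<notin> h"
  using Dg_vertex_gt(1)[OF HdD(1)] by blast

text \<open>The action at \<open>\<beta> h\<close> may involve diagrams outside the image of
  \<open>\<beta>\<close>. The hypothesis \<open>pre\<close> says that none of them contributes, and
  then the two sums agree term by term.\<close>

lemma dact_transport:
  fixes \<phi> :: "diag => 'z => 'a::comm_ring_1"
  assumes inj: "inj_on \<beta> (Hd N k)" and sub: "\<And>d. d \<in> Hd N k ==> \<beta> d \<in> Hd M m" and h: "h \<in> Hd N k"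
    and pre: "\<And>d. d \<in> Hd M m ==> Gp M a d = \<beta> h ==> \<phi> d s ~= 0 ==> d \<in> \<beta> ` Hd N k"
    and Gp: "\<And>d. d \<in> Hd N k ==> (Gp M a (\<beta> d) = \<beta> h \<longleftrightarrow> Gp N b d = h) \<and> ell M a (\<beta> d) = ell N b d"
  shows "dact M m x a \<phi> (\<beta> h) s = dact N k x b (%d. \<phi> (\<beta> d)) h s"
proof -
  have "dact M m x a \<phi> (\<beta> h) s = (\<Sum>d\<in>Hd M m. if Gp M a d = \<beta> h then x ^ ell M a d * \<phi> d s else 0)"
    unfolding dact_def using sub[OF h] by simp
  also have "... = (\<Sum>d\<in>\<beta> ` Hd N k. if Gp M a d = \<beta> h then x ^ ell M a d * \<phi> d s else 0)"
  proof (rule sum.mono_neutral_right[OF finite_Hd])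
    show "\<beta> ` Hd N k <= Hd M m" using sub by blast
    show "\<forall>d\<in>Hd M m - \<beta> ` Hd N k. (if Gp M a d = \<beta> h then x ^ ell M a d * \<phi> d s else 0) = 0"
    proof
      fix d assume "d \<in> Hd M m - \<beta> ` Hd N k"
      then have "Gp M a d = \<beta> h ==> \<phi> d s = 0" using pre[of d] by blast
      then show "(if Gp M a d = \<beta> h then x ^ ell M a d * \<phi> d s else 0) = 0" by simp
    qed
  qed
  also have "... = (\<Sum>d\<in>Hd N k. if Gp N b d = h then x ^ ell N b d * \<phi> (\<beta> d) s else 0)"
    unfolding sum.reindex[OF inj] using Gp by (intro sum.cong) auto
  finally show ?thesis unfolding dact_def using h by simp
qed

lemma hact_transport:
  assumes "\<And>a. a \<in> Dg N ==> dact (Suc N) m x (hat N a) \<phi> (\<beta> h) s = dact N k x a (%d. \<phi> (\<beta> d)) h s"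
  shows "hact (Suc N) m x (eps N b) \<phi> (\<beta> h) s = hact N k x b (%d. \<phi> (\<beta> d)) h s"
  unfolding hact_eps unfolding hact_def using assms by simp

text \<open>The strand of \<open>hat N b\<close> prolongs the arc, so a vertical arc at the last top
  vertex survives multiplication.\<close>

lemma Gp_hat_bot:
  assumes d: "d \<in> Hd (Suc N) m" and m: "m <= N" and k: "k \<in> {1..m}" and e: "{Top (Suc N), Bot k} \<in> d" and b: "b \<in> Dg N"
  shows "{Top (Suc N), Bot k} \<in> Gp (Suc N) (hat N b) d"
proof -
  note D = Dg_del[OF d m e]
  have "k \<in> {1..N}" using k m by simp
  from Gp_hat_insert[OF b D(1) this D(2)] show ?thesis unfolding D(3)[symmetric] by simp
qed

text \<open>Nothing is assumed of \<open>\<phi>\<close>: multiplication by \<open>hat N a\<close>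
  keeps the last top vertex isolated or on a vertical arc if it was so, hence a horizontal arc there
  can only come from a horizontal arc. This makes the horizontal case a quotient.\<close>

lemma hact_bend:
  assumes h: "h \<in> Hd N (Suc m)" and m: "Suc m <= N"
  shows "hact (Suc N) m x (eps N b) \<phi> (bend (Suc m) (Suc N) h) s = hact N (Suc m) x b (%d. \<phi> (bend (Suc m) (Suc N) d)) h s"
proof (rule hact_transport, rule dact_transport)
  have u: "unbend (Suc m) (Suc N) (bend (Suc m) (Suc N) d) = d" if "d \<in> Dg N" for d
    by (rule unbend_bend[OF that]) simp
  show "inj_on (bend (Suc m) (Suc N)) (Hd N (Suc m))" by (rule inj_onI) (metis u HdD(1))
  show "bend (Suc m) (Suc N) d \<in> Hd (Suc N) m" if "d \<in> Hd N (Suc m)" for d by (rule Hd_bend(1)[OF that m])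
  show "h \<in> Hd N (Suc m)" by (rule h)
  fix a d assume a: "a \<in> Dg N"
  show "(Gp (Suc N) (hat N a) (bend (Suc m) (Suc N) d) = bend (Suc m) (Suc N) h \<longleftrightarrow> Gp N a d = h) \<and>
      ell (Suc N) (hat N a) (bend (Suc m) (Suc N) d) = ell N a d" if "d \<in> Hd N (Suc m)"
  proof -
    have "Suc m \<in> {1..N}" using m by simp
    note G = Gp_hat_bend[OF a HdD(1)[OF that] this]
    show ?thesis using G u[OF HdD(1)[OF h]] u[OF Gp_Dg[OF a HdD(1)[OF that]]] by metis
  qed
  show "d \<in> bend (Suc m) (Suc N) ` Hd N (Suc m)" if d: "d \<in> Hd (Suc N) m" and G: "Gp (Suc N) (hat N a) d = bend (Suc m) (Suc N) h"
  proof (rule Hd_cases[OF d])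
    show "m <= N" using m by simp
    obtain j where j: "{Top (Suc N), Top j} \<in> bend (Suc m) (Suc N) h" using Hd_bend(2)[OF h m] by blast
    {
      assume "d \<in> Hd N m"
      then have "Gp (Suc N) (hat N a) d \<in> Dg N" using Gp_hat_low[OF a HdD(1)] Gp_Dg[OF a HdD(1)] by metis
      then show ?thesis using j G Dg_vertex_gt(1)[of _ N "Suc N"] by auto
    next
      fix j assume "{Top (Suc N), Top j} \<in> d"
      then show ?thesis using Hd_unbend[OF d _ m] by (metis imageI)
    next
      fix k assume "k \<in> {1..m}" "{Top (Suc N), Bot k} \<in> d"
      then have "{Top (Suc N), Bot k} \<in> bend (Suc m) (Suc N) h" using Gp_hat_bot[OF d _ _ _ a] m G by simp
      then show ?thesis using Dg_partner[OF HdD(1)[OF Hd_bend(1)[OF h m]] j] by auto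
    }
  qed
qed

text \<open>Here the horizontal case must be excluded by hypothesis: the other end of a horizontal
  arc may meet an isolated bottom vertex of \<open>a\<close>, which leaves the last top vertex
  isolated.\<close>

lemma hact_low:
  assumes h: "h \<in> Hd N m" and m: "m <= N" and \<phi>: "\<And>d j. {Top (Suc N), Top j} \<in> d ==> \<phi> d s = 0"
  shows "hact (Suc N) m x (eps N b) \<phi> h s = hact N m x b \<phi> h s"
proof (rule hact_transport[where \<beta> = "%h. h"], rule dact_transport[where \<beta> = "%h. h"])
  show "inj_on (%h. h) (Hd N m)" by simp
  show "d \<in> Hd (Suc N) m" if "d \<in> Hd N m" for d using that Hd_mono[of N "Suc N" m] by auto
  show "h \<in> Hd N m" by (rule h)
  fix a d assume a: "a \<in> Dg N"
  show "(Gp (Suc N) (hat N a) d = h \<longleftrightarrow> Gp N a d = h) \<and> ell (Suc N) (hat N a) d = ell N a d" if "d \<in> Hd N m"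
    using Gp_hat_low[OF a HdD(1)[OF that]] by simp
  show "d \<in> (%h. h) ` Hd N m" if d: "d \<in> Hd (Suc N) m" and G: "Gp (Suc N) (hat N a) d = h" and nz: "\<phi> d s ~= 0"
  proof (rule Hd_cases[OF d m])
    fix k assume "k \<in> {1..m}" "{Top (Suc N), Bot k} \<in> d"
    then have "{Top (Suc N), Bot k} \<in> h" using Gp_hat_bot[OF d m _ _ a] G by simp
    then show ?thesis using Hd_low_top[OF h] by blast
  qed (use \<phi> nz in auto)
qed

text \<open>A horizontal arc at the last top vertex can also become vertical, by way of an arc in
  the bottom row of \<open>a\<close>; the hypothesis on \<open>\<phi>\<close> excludes this
  source.\<close>

lemma hact_ins:
  assumes h: "h \<in> Hd N m" and m: "Suc m <= N" and \<phi>: "\<And>d j. {Top (Suc N), Top j} \<in> d ==> \<phi> d s = 0"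
  shows "hact (Suc N) (Suc m) x (eps N b) \<phi> (ins N (Suc m) h) s = hact N m x b (%d. \<phi> (ins N (Suc m) d)) h s"
proof (rule hact_transport[where \<beta> = "ins N (Suc m)"], rule dact_transport[where \<beta> = "ins N (Suc m)"])
  have u: "ins N (Suc m) d - {{Top (Suc N), Bot (Suc m)}} = d" if "d \<in> Dg N" for d
    using Dg_vertex_gt(1)[OF that, of "Suc N"] by auto
  show "inj_on (ins N (Suc m)) (Hd N m)" by (rule inj_onI) (metis u HdD(1))
  show "ins N (Suc m) d \<in> Hd (Suc N) (Suc m)" if "d \<in> Hd N m" for d by (rule Hd_ins[OF that m])
  show "h \<in> Hd N m" by (rule h)
  fix a d assume a: "a \<in> Dg N"
  show "(Gp (Suc N) (hat N a) (ins N (Suc m) d) = ins N (Suc m) h \<longleftrightarrow> Gp N a d = h) \<and>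
      ell (Suc N) (hat N a) (ins N (Suc m) d) = ell N a d" if "d \<in> Hd N m"
  proof -
    have "Suc m \<in> {1..N}" using m by simp
    note G = Gp_hat_insert[OF a HdD(1)[OF that] this HdD(3)[OF that]]
    show ?thesis using G u[OF HdD(1)[OF h]] u[OF Gp_Dg[OF a HdD(1)[OF that]]] by (metis lessI)
  qed
  show "d \<in> ins N (Suc m) ` Hd N m" if d: "d \<in> Hd (Suc N) (Suc m)" and G: "Gp (Suc N) (hat N a) d = ins N (Suc m) h" and nz: "\<phi> d s ~= 0"
  proof (rule Hd_cases[OF d m])
    assume "d \<in> Hd N (Suc m)"
    then have "Gp (Suc N) (hat N a) d \<in> Dg N" using Gp_hat_low[OF a HdD(1)] Gp_Dg[OF a HdD(1)] by metis
    then show ?thesis using G Dg_vertex_gt(1)[of _ N "Suc N" "Bot (Suc m)"] by auto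
  next
    fix k assume k: "k \<in> {1..Suc m}" "{Top (Suc N), Bot k} \<in> d"
    then have e: "{Top (Suc N), Bot k} \<in> ins N (Suc m) h" using Gp_hat_bot[OF d m _ _ a] G by simp
    have "k = Suc m" using Dg_partner[OF HdD(1)[OF Hd_ins[OF h m]] e, of "Bot (Suc m)"] by simp
    then show ?thesis using Hd_del[OF d m] Dg_del(3)[OF d m] k by (metis imageI)
  qed (use \<phi> nz in auto)
qed

text \<open>Permutations with the same value at \<open>Suc m\<close> lie in one coset of the
  stabiliser \<open>S_m\<close>. Both extension lemmas below use this to show independence of
  choices.\<close>

lemma permutes_Suc_split:
  assumes \<sigma>: "\<sigma> permutes {1..Suc m}" "\<sigma>' permutes {1..Suc m}" and e: "\<sigma> (Suc m) = \<sigma>' (Suc m)"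
  shows "(inv \<sigma> \<circ> \<sigma>') permutes {1..m}" "\<sigma>' = \<sigma> \<circ> (inv \<sigma> \<circ> \<sigma>')"
proof -
  have p: "(inv \<sigma> \<circ> \<sigma>') permutes {1..Suc m}" by (rule permutes_compose[OF \<sigma>(2) permutes_inv[OF \<sigma>(1)]])
  have "(inv \<sigma> \<circ> \<sigma>') (Suc m) = Suc m" using e permutes_inverses(2)[OF \<sigma>(1), of "Suc m"] by simp
  then show "(inv \<sigma> \<circ> \<sigma>') permutes {1..m}" by (intro permutes_superset[OF p]) (auto simp: le_Suc_eq)
  show "\<sigma>' = \<sigma> \<circ> (inv \<sigma> \<circ> \<sigma>')" by (simp add: o_assoc permutes_inv_o[OF \<sigma>(1)])
qed

lemma permutes_Suc_I: "\<rho> permutes {1..m} ==> \<rho> permutes {1..Suc m}"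
  by (rule permutes_subset) auto

lemma Ehd_rt_eq:
  assumes \<phi>: "\<phi> \<in> Ehd n m V" and \<sigma>: "\<sigma> permutes {1..m}" and h: "h \<in> Hd n m"
  shows "\<phi> (rt \<sigma> h) = (%s. \<phi> h (s \<circ> inv \<sigma>))" "\<phi> h = (%s. \<phi> (rt \<sigma> h) (s \<circ> \<sigma>))"
proof -
  show "\<phi> (rt \<sigma> h) = (%s. \<phi> h (s \<circ> inv \<sigma>))"
  proof
    fix s :: "nat => nat"
    have "(s \<circ> inv \<sigma>) \<circ> \<sigma> = s" by (simp add: o_assoc[symmetric] permutes_inv_o[OF \<sigma>])
    then show "\<phi> (rt \<sigma> h) s = \<phi> h (s \<circ> inv \<sigma>)" using EhdD(3)[OF \<phi> \<sigma> h, of "s \<circ> inv \<sigma>"] by simp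
  qed
  show "\<phi> h = (%s. \<phi> (rt \<sigma> h) (s \<circ> \<sigma>))" using EhdD(3)[OF \<phi> \<sigma> h] by (simp add: fun_eq_iff)
qed

lemma Ehd_eqI:
  assumes "\<phi> \<in> Ehd n m V" "\<psi> \<in> Ehd n m W" "\<And>h. h \<in> Hd n m ==> \<phi> h = \<psi> h"
  shows "\<phi> = \<psi>"
proof (intro ext)
  fix h s
  show "\<phi> h s = \<psi> h s" using EhdD(1)[OF assms(1)] EhdD(1)[OF assms(2)] assms(3) by (cases "h \<in> Hd n m") auto
qed

text \<open>Written with a scalar kernel, the action visibly commutes with any linear map applied to
  the values.\<close>

lemma hact_kernel:
  assumes "h \<in> Hd n m"
  shows "hact n m x b \<phi> h s = (\<Sum>d\<in>Hd n m. (\<Sum>a\<in>Dg n. b a * (if Gp n a d = h then x ^ ell n a d else 0)) * \<phi> d s)"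
proof -
  have "hact n m x b \<phi> h s = (\<Sum>a\<in>Dg n. \<Sum>d\<in>Hd n m. b a * (if Gp n a d = h then x ^ ell n a d else 0) * \<phi> d s)"
    unfolding hact_def dact_def using assms by (auto simp: sum_distrib_left intro!: sum.cong)
  also have "... = (\<Sum>d\<in>Hd n m. \<Sum>a\<in>Dg n. b a * (if Gp n a d = h then x ^ ell n a d else 0) * \<phi> d s)" by (rule sum.swap)
  finally show ?thesis by (simp add: sum_distrib_right)
qed

section \<open>Lifting a decomposition of the coefficients to equivariant functions\<close>

context
  fixes X :: "((nat => nat) => 'a::comm_ring_1) set" and m :: nat and I :: "'i set" and Y b
  assumes X: "srep m X" and dc: "decomp m X I Y b"
begin

lemma decompD:
  assumes "i \<in> I"
  shows "u \<in> X ==> v \<in> X ==> b i (%s. u s + c * v s) = (%s. b i u s + c * b i v s)" "v \<in> X ==> b i v \<in> Y i"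
    "v \<in> X ==> \<sigma> permutes {1..m} ==> b i (%s. v (s \<circ> \<sigma>)) = (%s. b i v (s \<circ> \<sigma>))"
  using dc assms unfolding decomp_def by blast+

lemma decomp_ex1: "(\<And>i. i \<in> I ==> y i \<in> Y i) ==> \<exists>!v. v \<in> X \<and> (\<forall>i\<in>I. b i v = y i)"
  using dc unfolding decomp_def by blast

lemma decomp_fsub: "fsub X"
  using X unfolding srep_def by blast

lemma decomp_zero: "i \<in> I ==> b i (%s. 0) = (%s. 0)"
  using decompD(1)[OF _ fsubD(1)[OF decomp_fsub] fsubD(1)[OF decomp_fsub], of i "-1"] by simp

lemma decomp_lincomb:
  assumes i: "i \<in> I" and "finite D" and "\<And>d. d \<in> D ==> f d \<in> X"
  shows "b i (%s. \<Sum>d\<in>D. k d * f d s) = (%s. \<Sum>d\<in>D. k d * b i (f d) s)"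
  using assms(2,3)
proof (induction D)
  case empty
  then show ?case using decomp_zero[OF i] by simp
next
  case (insert d D)
  have w: "(%s. \<Sum>d\<in>D. k d * f d s) \<in> X" by (rule fsub_lincomb[OF decomp_fsub]) (use insert in auto)
  have "b i (%s. (\<Sum>d\<in>D. k d * f d s) + k d * f d s) = (%s. b i (%s. \<Sum>d\<in>D. k d * f d s) s + k d * b i (f d) s)"
    by (rule decompD(1)[OF i w]) (use insert in auto)
  then show ?case using insert by (simp add: add.commute)
qed

lemma decomp_hact:
  assumes i: "i \<in> I" and \<phi>: "\<phi> \<in> Ehd n m X" and m: "m <= n"
  shows "(%h. b i (hact n m x a \<phi> h)) = hact n m x a (%h. b i (\<phi> h))"
proof
  fix h
  show "b i (hact n m x a \<phi> h) = hact n m x a (%h. b i (\<phi> h)) h"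
  proof (cases "h \<in> Hd n m")
    case True
    have e: "hact n m x a \<psi> h = (%s. \<Sum>d\<in>Hd n m. (\<Sum>e\<in>Dg n. a e * (if Gp n e d = h then x ^ ell n e d else 0)) * \<psi> d s)"
      for \<psi> :: "diag => (nat => nat) => 'a"
      by (rule ext) (rule hact_kernel[OF True])
    show ?thesis unfolding e by (rule decomp_lincomb[OF i finite_Hd]) (rule EhdD(2)[OF \<phi>])
  next
    case False
    have e: "hact n m x a \<psi> h = (%s. 0)" for \<psi> :: "diag => (nat => nat) => 'a" unfolding hact_def dact_def using False by simp
    show ?thesis unfolding e by (rule decomp_zero[OF i])
  qed
qed

lemma decomp_Ehd:
  assumes i: "i \<in> I" and \<phi>: "\<phi> \<in> Ehd n m X" and m: "m <= n"
  shows "(%h. b i (\<phi> h)) \<in> Ehd n m (Y i)"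
proof (rule EhdI)
  fix h s
  show "b i (\<phi> h) s = 0" if "h \<notin> Hd n m"
  proof -
    have "\<phi> h = (%s. 0)" using EhdD(1)[OF \<phi> that] by (simp add: fun_eq_iff)
    then show ?thesis using decomp_zero[OF i] by simp
  qed
next
  fix h assume "h \<in> Hd n m"
  then show "b i (\<phi> h) \<in> Y i" by (rule decompD(2)[OF i EhdD(2)[OF \<phi>]])
next
  fix \<sigma> h and s :: "nat => nat" assume \<sigma>: "\<sigma> permutes {1..m}" and h: "h \<in> Hd n m"
  have e: "(s \<circ> \<sigma>) \<circ> inv \<sigma> = s" by (simp add: o_assoc[symmetric] permutes_inv_o[OF \<sigma>])
  show "b i (\<phi> (rt \<sigma> h)) (s \<circ> \<sigma>) = b i (\<phi> h) s"
    unfolding Ehd_rt_eq(1)[OF \<phi> \<sigma> h] decompD(3)[OF i EhdD(2)[OF \<phi> h] permutes_inv[OF \<sigma>]] e by simp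
qed

lemma decomp_Ehd_inj:
  assumes \<phi>: "\<phi> \<in> Ehd n m X" and z: "\<And>i h. i \<in> I ==> b i (\<phi> h) = (%s. 0)" and Y: "\<And>i. i \<in> I ==> fsub (Y i)"
  shows "\<phi> = (%h s. 0)"
proof (rule Ehd_eqI[OF \<phi> Ehd_zero[OF decomp_fsub]])
  fix h assume h: "h \<in> Hd n m"
  have "\<exists>!v. v \<in> X \<and> (\<forall>i\<in>I. b i v = (%s. 0))" by (rule decomp_ex1) (rule fsubD(1)[OF Y])
  moreover have "\<phi> h \<in> X \<and> (\<forall>i\<in>I. b i (\<phi> h) = (%s. 0))" using EhdD(2)[OF \<phi> h] z by blast
  moreover have "(%s. 0) \<in> X \<and> (\<forall>i\<in>I. b i (%s. 0) = (%s. 0))" using fsubD(1)[OF decomp_fsub] decomp_zero by blast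
  ultimately show "\<phi> h = (%s. 0)" by (elim ex1E) metis
qed

text \<open>The preimage is chosen pointwise. Equivariance comes for free: the translated values
  solve the same system, whose solution is unique.\<close>

lemma decomp_Ehd_surj:
  assumes y: "\<And>i. i \<in> I ==> y i \<in> Ehd n m (Y i)" and m: "m <= n"
  shows "\<exists>\<chi>. \<chi> \<in> Ehd n m X \<and> (\<forall>i\<in>I. (%h. b i (\<chi> h)) = y i)"
proof -
  define \<chi> where "\<chi> h = (if h \<in> Hd n m then THE v. v \<in> X \<and> (\<forall>i\<in>I. b i v = y i h) else (%s. 0))" for h
  have U: "\<exists>!v. v \<in> X \<and> (\<forall>i\<in>I. b i v = y i h)" if "h \<in> Hd n m" for h
    by (rule decomp_ex1) (rule EhdD(2)[OF y that])
  have C: "\<chi> h \<in> X \<and> (\<forall>i\<in>I. b i (\<chi> h) = y i h)" if "h \<in> Hd n m" for h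
    using theI'[OF U[OF that]] that unfolding \<chi>_def by simp
  have \<chi>: "\<chi> \<in> Ehd n m X"
  proof (rule EhdI)
    fix \<sigma> h s assume \<sigma>: "\<sigma> permutes {1..m}" and h: "h \<in> Hd n m"
    note h' = Hd_rt[OF \<sigma> m h]
    have "(%s. \<chi> (rt \<sigma> h) (s \<circ> \<sigma>)) \<in> X" using X C[OF h'] \<sigma> unfolding srep_def by blast
    moreover have "b i (%s. \<chi> (rt \<sigma> h) (s \<circ> \<sigma>)) = y i h" if i: "i \<in> I" for i
      using decompD(3)[OF i conjunct1[OF C[OF h']] \<sigma>] C[OF h'] i Ehd_rt_eq(2)[OF y[OF i] \<sigma> h] by simp
    ultimately have "(%s. \<chi> (rt \<sigma> h) (s \<circ> \<sigma>)) = \<chi> h" using U[OF h] C[OF h] by (elim ex1E) metis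
    then show "\<chi> (rt \<sigma> h) (s \<circ> \<sigma>) = \<chi> h s" by (rule fun_cong)
  qed (use C in \<open>auto simp: \<chi>_def\<close>)
  have "(%h. b i (\<chi> h)) = y i" if i: "i \<in> I" for i
    by (rule Ehd_eqI[OF decomp_Ehd[OF i \<chi> m] y[OF i]]) (use C i in blast)
  then show ?thesis using \<chi> by blast
qed

end

text \<open>An equivariant function may be prescribed freely on the diagrams whose last top vertex
  is joined to bottom \<open>Suc m\<close>, with equivariance under \<open>S_m\<close> only.
  Permutations carry every other diagram with a vertical arc at that vertex to one of these.\<close>

lemma ins_extension:
  fixes V :: "((nat => nat) => 'a::comm_ring_1) set"
  assumes V: "srep (Suc m) V" and m: "Suc m <= N" and \<chi>: "\<chi> \<in> Ehd N m V"
  shows "\<exists>\<phi> \<in> Ehd (Suc N) (Suc m) V. (\<forall>h\<in>Hd N m. \<phi> (ins N (Suc m) h) = \<chi> h) \<and>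
     (\<forall>d s. \<phi> d s ~= 0 --> (\<exists>k. {Top (Suc N), Bot k} \<in> d))"
proof -
  let ?e = "{Top (Suc N), Bot (Suc m)}"
  have fV: "fsub V" using V unfolding srep_def by blast
  define val where "val d s \<sigma> = \<chi> (rt \<sigma> d - {?e}) (s \<circ> \<sigma>)" for d :: diag and s \<sigma>
  \<comment> \<open>\<open>\<sigma>\<close> brings the arc of the last top vertex to bottom
    \<open>Suc m\<close>. All such \<open>\<sigma>\<close> lie in one coset of \<open>S_m\<close>,
    so the value does not depend on the choice.\<close>
  define ok where "ok d \<sigma> \<longleftrightarrow> \<sigma> permutes {1..Suc m} \<and> {Top (Suc N), Bot (\<sigma> (Suc m))} \<in> d" for d \<sigma>
  define \<phi> where "\<phi> d s = (if d \<in> Hd (Suc N) (Suc m) \<and> (\<exists>\<sigma>. ok d \<sigma>) then val d s (SOME \<sigma>. ok d \<sigma>) else 0)" for d s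
  have okH: "rt \<sigma> d - {?e} \<in> Hd N m" "rt \<sigma> d = ins N (Suc m) (rt \<sigma> d - {?e})" if "d \<in> Hd (Suc N) (Suc m)" "ok d \<sigma>" for d \<sigma>
  proof -
    have p1: "\<sigma> permutes {1..Suc m}" using that(2) unfolding ok_def by blast
    have p2: "?e \<in> rt \<sigma> d" unfolding rt_edge(1)[OF p1] using that(2) unfolding ok_def by blast
    note p = p1 p2
    have d': "rt \<sigma> d \<in> Hd (Suc N) (Suc m)" by (rule Hd_rt[OF p(1) _ that(1)]) (use m in simp)
    show "rt \<sigma> d - {?e} \<in> Hd N m" by (rule Hd_del[OF d' m p(2)])
    show "rt \<sigma> d = ins N (Suc m) (rt \<sigma> d - {?e})" by (rule Dg_del(3)[OF d' m p(2)])
  qed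
  have ind: "val d s \<sigma> = val d s \<sigma>'" if d: "d \<in> Hd (Suc N) (Suc m)" and o: "ok d \<sigma>" "ok d \<sigma>'" for d s \<sigma> \<sigma>'
  proof -
    have p: "\<sigma> permutes {1..Suc m}" "\<sigma>' permutes {1..Suc m}" using o unfolding ok_def by auto
    have "Bot (\<sigma> (Suc m)) = Bot (\<sigma>' (Suc m))" by (rule Dg_partner[OF HdD(1)[OF d], of "Top (Suc N)"]) (use o in \<open>simp_all add: ok_def\<close>)
    then have q: "\<sigma> (Suc m) = \<sigma>' (Suc m)" by simp
    note R = permutes_Suc_split[OF p q]
    let ?\<rho> = "inv \<sigma> \<circ> \<sigma>'"
    have "rt \<sigma>' d = rt ?\<rho> (rt \<sigma> d)" by (simp only: rt_comp[OF p(1) permutes_Suc_I[OF R(1)]] R(2)[symmetric])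
    also have "... = ins N (Suc m) (rt ?\<rho> (rt \<sigma> d - {?e}))"
      by (subst okH(2)[OF d o(1)]) (rule ins_rt[OF R(1)])
    finally have "rt \<sigma>' d - {?e} = rt ?\<rho> (rt \<sigma> d - {?e})"
      using Hd_low_top[OF Hd_rt[OF R(1) _ okH(1)[OF d o(1)]]] m by auto
    moreover have "s \<circ> \<sigma>' = (s \<circ> \<sigma>) \<circ> ?\<rho>" using arg_cong[OF R(2), of "(\<circ>) s"] by (simp only: o_assoc)
    ultimately show ?thesis unfolding val_def using EhdD(3)[OF \<chi> R(1) okH(1)[OF d o(1)]] by simp
  qed
  have v: "\<phi> d s = val d s \<sigma>" if "d \<in> Hd (Suc N) (Suc m)" "ok d \<sigma>" for d s \<sigma>
    using ind[OF that(1) someI[of "ok d", OF that(2)] that(2)] that unfolding \<phi>_def by auto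
  have n: "\<phi> d s = 0" if "\<nexists>\<sigma>. ok d \<sigma>" for d s using that unfolding \<phi>_def by auto
  have "\<phi> \<in> Ehd (Suc N) (Suc m) V"
  proof (rule EhdI)
    show "\<phi> h s = 0" if "h \<notin> Hd (Suc N) (Suc m)" for h s using that unfolding \<phi>_def by simp
    show "\<phi> h \<in> V" if h: "h \<in> Hd (Suc N) (Suc m)" for h
    proof (cases "\<exists>\<sigma>. ok h \<sigma>")
      case True
      then obtain \<sigma> where o: "ok h \<sigma>" by blast
      have "\<phi> h = (%s. \<chi> (rt \<sigma> h - {?e}) (s \<circ> \<sigma>))" using v[OF h o] unfolding val_def by (simp add: fun_eq_iff)
      moreover have "\<sigma> permutes {1..Suc m}" using o unfolding ok_def by blast
      ultimately show ?thesis using V EhdD(2)[OF \<chi> okH(1)[OF h o]] unfolding srep_def by simp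
    next
      case False
      then have "\<phi> h = (%s. 0)" using n[of h] by (simp add: fun_eq_iff)
      then show ?thesis using fsubD(1)[OF fV] by simp
    qed
    fix \<pi> h s assume \<pi>: "\<pi> permutes {1..Suc m}" and h: "h \<in> Hd (Suc N) (Suc m)"
    have h': "rt \<pi> h \<in> Hd (Suc N) (Suc m)" by (rule Hd_rt[OF \<pi> _ h]) (use m in simp)
    have k: "ok (rt \<pi> h) \<sigma> \<longleftrightarrow> ok h (\<pi> \<circ> \<sigma>)" if "\<sigma> permutes {1..Suc m}" for \<sigma>
      using that permutes_compose[OF that \<pi>] rt_edge(1)[OF \<pi>] unfolding ok_def by simp
    show "\<phi> (rt \<pi> h) (s \<circ> \<pi>) = \<phi> h s"
    proof (cases "\<exists>\<sigma>. ok (rt \<pi> h) \<sigma>")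
      case True
      then obtain \<sigma> where o: "ok (rt \<pi> h) \<sigma>" by blast
      then have p: "\<sigma> permutes {1..Suc m}" unfolding ok_def by blast
      have "\<phi> h s = val h s (\<pi> \<circ> \<sigma>)" by (rule v[OF h]) (use k[OF p] o in simp)
      also have "... = val (rt \<pi> h) (s \<circ> \<pi>) \<sigma>" unfolding val_def rt_comp[OF \<pi> p] by (simp add: o_assoc)
      finally show ?thesis using v[OF h' o] by simp
    next
      case False
      have "\<nexists>\<sigma>. ok h \<sigma>"
      proof
        assume "\<exists>\<sigma>. ok h \<sigma>"
        then obtain \<sigma> where o: "ok h \<sigma>" by blast
        then have "\<sigma> permutes {1..Suc m}" unfolding ok_def by blast
        then have "ok (rt \<pi> h) (inv \<pi> \<circ> \<sigma>)"
          using k[OF permutes_compose[OF _ permutes_inv[OF \<pi>]]] o by (simp add: o_assoc permutes_inv_o[OF \<pi>])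
        then show False using False by blast
      qed
      then show ?thesis using n[OF False] n by simp
    qed
  qed
  moreover have "\<phi> (ins N (Suc m) h) = \<chi> h" if h: "h \<in> Hd N m" for h
  proof
    fix s
    have o: "ok (ins N (Suc m) h) id" unfolding ok_def by (simp add: permutes_id)
    have "ins N (Suc m) h - {?e} = h" using Hd_low_top[OF h] by auto
    then show "\<phi> (ins N (Suc m) h) s = \<chi> h s" using v[OF Hd_ins[OF h m] o, of s] unfolding val_def by simp
  qed
  moreover have "\<exists>k. {Top (Suc N), Bot k} \<in> d" if nz: "\<phi> d s ~= 0" for d s
  proof -
    obtain \<sigma> where "ok d \<sigma>" using n[of d s] nz by auto
    then show ?thesis unfolding ok_def by (intro exI[of _ "\<sigma> (Suc m)"]) simp
  qed
  ultimately show ?thesis by blast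
qed

lemma transpose_Suc:
  assumes "k \<in> {1..Suc m}"
  shows "transpose k (Suc m) permutes {1..Suc m}" "transpose k (Suc m) (Suc m) = k"
  using assms by (auto intro: permutes_swap_id)

lemma ins_determines:
  assumes m: "Suc m <= N" and \<phi>: "\<phi> \<in> Ehd (Suc N) (Suc m) V"
    and z: "\<And>h. h \<in> Hd N m ==> \<phi> (ins N (Suc m) h) = (%s. 0)"
    and d: "d \<in> Hd (Suc N) (Suc m)" and k: "k \<in> {1..Suc m}" "{Top (Suc N), Bot k} \<in> d"
  shows "\<phi> d = (%s. 0)"
proof -
  let ?\<tau> = "transpose k (Suc m)"
  note t = transpose_Suc[OF k(1)]
  have d': "rt ?\<tau> d \<in> Hd (Suc N) (Suc m)" by (rule Hd_rt[OF t(1) _ d]) (use m in simp)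
  have e: "{Top (Suc N), Bot (Suc m)} \<in> rt ?\<tau> d" using k(2) rt_edge(1)[OF t(1)] t(2) by simp
  have "\<phi> (rt ?\<tau> d) = (%s. 0)" using z[OF Hd_del[OF d' m e]] Dg_del(3)[OF d' m e] by simp
  then show ?thesis using Ehd_rt_eq(2)[OF \<phi> t(1) d] by simp
qed

lemma Fsp_absent:
  assumes "v \<in> Fsp m c" "c L = 0" "j \<in> {1..m}" "s j = L"
  shows "v s = 0"
proof -
  have "s \<notin> Tab m c"
  proof
    assume "s \<in> Tab m c"
    then have "card {k \<in> {1..m}. s k = L} = 0" using assms(2) unfolding Tab_def cnt_def by simp
    then show False using assms(3,4) by auto
  qed
  then show ?thesis using assms(1) unfolding Fsp_def by blast
qed

lemma Tab_Suc_update: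
  assumes t: "t(Suc m := 0) \<in> Tab m c" and L: "t (Suc m) = L" and c: "c L = 0"
  shows "t \<in> Tab (Suc m) (c(L := 1))"
proof -
  have e: "(t(Suc m := 0))(Suc m := L) = t" using L by auto
  have "cnt (Suc m) t q = (c(L := 1)) q" for q
    using cnt_Suc[of m "t(Suc m := 0)" L q] t c unfolding e Tab_def by simp
  moreover have "t k = 0" if "k \<notin> {1..Suc m}" for k
  proof -
    have "k ~= Suc m" "k \<notin> {1..m}" using that by auto
    then show ?thesis using t unfolding Tab_def by fastforce
  qed
  ultimately show ?thesis unfolding Tab_def by blast
qed

text \<open>A vector of \<^const>\<open>indX\<close> is determined by its values on the tabloids whose extra row consists
  of the last point; this identifies it with the module induced from the Specht module of \<open>l\<close>.\<close>

context
  fixes l :: "nat list" and m L N :: nat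
  assumes l: "is_partition l" and ml: "m = sum_list l" and Ll: "L = Suc (length l)" and mN: "Suc m <= N"
begin

lemma cL: "rs l L = 0" using Ll by simp

lemma sp_eq_HW: "(sp l :: ((nat => nat) => 'a::field_char_0) set) = HW m (rs l)"
  unfolding ml by (rule HW_eq_sp[OF l, symmetric])

lemma sp_Fsp: "v \<in> (sp l :: ((nat => nat) => 'a::field_char_0) set) ==> v \<in> Fsp m (rs l)"
  unfolding sp_eq_HW HW_def by blast

lemma indX_iff: "(w :: (nat => nat) => 'a::field_char_0) \<in> indX l \<longleftrightarrow> w \<in> Fsp (Suc m) ((rs l)(L := 1)) \<and>
    (\<forall>r<length l. mv (Suc m) r (Suc r) w = (%s. 0))"
  unfolding indX_def ml Ll by blast

text \<open>The raising operators below \<open>length l\<close> do not touch the extra row, so they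
  commute with deleting its point; for larger \<open>r\<close> the row \<open>Suc r\<close> is empty
  after the deletion.\<close>

lemma part_indX:
  assumes w: "w \<in> (indX l :: ((nat => nat) => 'a::field_char_0) set)"
  shows "part (Suc m) L w \<in> sp l"
  unfolding sp_eq_HW HW_def mem_Collect_eq
proof (intro conjI allI)
  have e: "((rs l)(L := 1))(L := ((rs l)(L := 1)) L - 1) = rs l" using cL by auto
  show F: "part (Suc m) L w \<in> Fsp m (rs l)"
    using part_Fsp(1)[of w m "(rs l)(L := 1)" L] w unfolding e indX_iff by blast
  fix r
  show "mv m r (Suc r) (part (Suc m) L w) = (%s. 0)"
  proof
    fix s
    show "mv m r (Suc r) (part (Suc m) L w) s = 0"
    proof (cases "r < length l")
      case True
      show ?thesis
      proof (cases "s (Suc m) = 0")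
        case s: True
        have "mv (Suc m) r (Suc r) w (s(Suc m := L)) = 0" using w True unfolding indX_iff by simp
        then show ?thesis using mv_part[of s m r "Suc r" w L, OF s] True Ll by simp
      next
        case False
        then have "part (Suc m) L w (s(k := Suc r)) = 0" if "k \<in> {1..m}" for k using that unfolding part_def by auto
        then show ?thesis unfolding mv_def by (intro sum.neutral) auto
      qed
    next
      case False
      then have "part (Suc m) L w (s(k := Suc r)) = 0" if "k \<in> {1..m}" for k
        using Fsp_absent[OF F, of "Suc r" k "s(k := Suc r)"] that by simp
      then show ?thesis unfolding mv_def by (intro sum.neutral) auto
    qed
  qed
qed

text \<open>Values are prescribed on tabloids whose extra row holds the last point, and are spread
  by equivariance. The permutation is chosen from the tabloid and not from the diagram, which is how
  functions on cosets become functions on tabloids with an extra row.\<close>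

lemma bend_extension:
  fixes \<phi> :: "diag => (nat => nat) => 'a::field_char_0"
  assumes \<phi>: "\<phi> \<in> Ehd (Suc N) m (sp l)"
  shows "\<exists>\<Phi> \<in> Ehd N (Suc m) (indX l). \<forall>h\<in>Hd N (Suc m). part (Suc m) L (\<Phi> h) = \<phi> (bend (Suc m) (Suc N) h)"
proof -
  let ?b = "bend (Suc m) (Suc N)"
  define val where "val h s \<sigma> = \<phi> (?b (rt \<sigma> h)) ((s \<circ> \<sigma>)(Suc m := 0))" for h and s :: "nat => nat" and \<sigma>
  define ok where "ok s \<sigma> \<longleftrightarrow> \<sigma> permutes {1..Suc m} \<and> s (\<sigma> (Suc m)) = L" for s \<sigma>
  define \<Phi> where "\<Phi> h s = (if h \<in> Hd N (Suc m) \<and> (\<exists>\<sigma>. ok s \<sigma>) then val h s (SOME \<sigma>. ok s \<sigma>) else 0)" for h s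
  have bF: "\<phi> (?b (rt \<sigma> h)) \<in> Fsp m (rs l)" "\<phi> (?b (rt \<sigma> h)) \<in> sp l" if "h \<in> Hd N (Suc m)" "\<sigma> permutes {1..Suc m}" for h \<sigma>
    using sp_Fsp EhdD(2)[OF \<phi> Hd_bend(1)[OF Hd_rt[OF that(2) mN that(1)] mN]] by blast+
  \<comment> \<open>If the extra row holds two points, the possible \<open>\<sigma>\<close> do not
    lie in one coset. Each of them then gives 0, since a point remains in a row that is empty for
    \<open>l\<close>.\<close>
  have amb: "val h s \<sigma> = 0" if h: "h \<in> Hd N (Suc m)" and o: "ok s \<sigma>" and k: "k \<in> {1..Suc m}" "s k = L" "k ~= \<sigma> (Suc m)" for h s \<sigma> k
  proof -
    have p: "\<sigma> permutes {1..Suc m}" using o unfolding ok_def by blast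
    define j where "j = inv \<sigma> k"
    have sj: "\<sigma> j = k" unfolding j_def by (rule permutes_inverses(1)[OF p])
    have "j \<in> {1..Suc m}" unfolding j_def using permutes_in_image[OF permutes_inv[OF p]] k(1) by blast
    moreover have "j ~= Suc m" using sj k(3) by blast
    ultimately have "j \<in> {1..m}" by auto
    then show ?thesis unfolding val_def
      by (intro Fsp_absent[OF bF(1)[OF h p] cL, of j]) (use sj k(2) \<open>j ~= Suc m\<close> in auto)
  qed
  have ind: "val h s \<sigma> = val h s \<sigma>'" if h: "h \<in> Hd N (Suc m)" and o: "ok s \<sigma>" "ok s \<sigma>'" for h s \<sigma> \<sigma>'
  proof -
    have p: "\<sigma> permutes {1..Suc m}" "\<sigma>' permutes {1..Suc m}" and L: "s (\<sigma> (Suc m)) = L" "s (\<sigma>' (Suc m)) = L"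
      using o unfolding ok_def by auto
    have i: "\<sigma> (Suc m) \<in> {1..Suc m}" "\<sigma>' (Suc m) \<in> {1..Suc m}"
      using permutes_in_image[OF p(1), of "Suc m"] permutes_in_image[OF p(2), of "Suc m"] by auto
    show ?thesis
    proof (cases "\<sigma> (Suc m) = \<sigma>' (Suc m)")
      case False
      then show ?thesis using amb[OF h o(1) i(2) L(2)] amb[OF h o(2) i(1) L(1)] by auto
    next
      case True
      note R = permutes_Suc_split[OF p True]
      let ?\<rho> = "inv \<sigma> \<circ> \<sigma>'"
      have "rt \<sigma>' h = rt ?\<rho> (rt \<sigma> h)" by (simp only: rt_comp[OF p(1) permutes_Suc_I[OF R(1)]] R(2)[symmetric])
      then have "?b (rt \<sigma>' h) = rt ?\<rho> (?b (rt \<sigma> h))" using bend_rt[OF R(1)] by simp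
      moreover have "(s \<circ> \<sigma>')(Suc m := 0) = (s \<circ> \<sigma>)(Suc m := 0) \<circ> ?\<rho>"
      proof -
        have r: "?\<rho> (Suc m) = Suc m" using permutes_not_in[OF R(1), of "Suc m"] by simp
        have "(s \<circ> \<sigma>)(?\<rho> (Suc m) := 0) \<circ> ?\<rho> = ((s \<circ> \<sigma>) \<circ> ?\<rho>)(Suc m := 0)" by (rule update_comp_perm[OF R(1)])
        moreover have "s \<circ> \<sigma>' = (s \<circ> \<sigma>) \<circ> ?\<rho>" using arg_cong[OF R(2), of "(\<circ>) s"] by (simp only: o_assoc)
        ultimately show ?thesis unfolding r by simp
      qed
      ultimately show ?thesis unfolding val_def
        using EhdD(3)[OF \<phi> R(1) Hd_bend(1)[OF Hd_rt[OF p(1) mN h] mN]] by simp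
    qed
  qed
  have v: "\<Phi> h s = val h s \<sigma>" if "h \<in> Hd N (Suc m)" "ok s \<sigma>" for h s \<sigma>
    using ind[OF that(1) someI[of "ok s", OF that(2)] that(2)] that unfolding \<Phi>_def by auto
  have n: "\<Phi> h s = 0" if "\<nexists>\<sigma>. ok s \<sigma>" for h s using that unfolding \<Phi>_def by auto
  have eqv: "\<Phi> (rt \<pi> h) (s \<circ> \<pi>) = \<Phi> h s" if \<pi>: "\<pi> permutes {1..Suc m}" and h: "h \<in> Hd N (Suc m)" for \<pi> h s
  proof -
    have h': "rt \<pi> h \<in> Hd N (Suc m)" by (rule Hd_rt[OF \<pi> mN h])
    have k: "ok (s \<circ> \<pi>) \<sigma> \<longleftrightarrow> ok s (\<pi> \<circ> \<sigma>)" if "\<sigma> permutes {1..Suc m}" for \<sigma>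
      using that permutes_compose[OF that \<pi>] unfolding ok_def by simp
    show ?thesis
    proof (cases "\<exists>\<sigma>. ok (s \<circ> \<pi>) \<sigma>")
      case True
      then obtain \<sigma> where o: "ok (s \<circ> \<pi>) \<sigma>" by blast
      then have p: "\<sigma> permutes {1..Suc m}" unfolding ok_def by blast
      have "\<Phi> h s = val h s (\<pi> \<circ> \<sigma>)" by (rule v[OF h]) (use k[OF p] o in simp)
      also have "... = val (rt \<pi> h) (s \<circ> \<pi>) \<sigma>" unfolding val_def rt_comp[OF \<pi> p] by (simp add: o_assoc)
      finally show ?thesis using v[OF h' o] by simp
    next
      case False
      have "\<nexists>\<sigma>. ok s \<sigma>"
      proof
        assume "\<exists>\<sigma>. ok s \<sigma>"
        then obtain \<sigma> where o: "ok s \<sigma>" by blast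
        then have "\<sigma> permutes {1..Suc m}" unfolding ok_def by blast
        then have "ok (s \<circ> \<pi>) (inv \<pi> \<circ> \<sigma>)"
          using k[OF permutes_compose[OF _ permutes_inv[OF \<pi>]]] o by (simp add: o_assoc permutes_inv_o[OF \<pi>])
        then show False using False by blast
      qed
      then show ?thesis using n[OF False] n by simp
    qed
  qed
  have lst: "\<Phi> h s = \<phi> (?b h) (s(Suc m := 0))" if "h \<in> Hd N (Suc m)" "s (Suc m) = L" for h s
  proof -
    have "ok s id" using that(2) unfolding ok_def by (simp add: permutes_id)
    from v[OF that(1) this] show ?thesis unfolding val_def by simp
  qed
  have pt: "part (Suc m) L (\<Phi> h) = \<phi> (?b h)" if h: "h \<in> Hd N (Suc m)" for h
  proof
    fix s
    have F: "\<phi> (?b h) \<in> Fsp m (rs l)" using bF(1)[OF h permutes_id] by simp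
    show "part (Suc m) L (\<Phi> h) s = \<phi> (?b h) s"
    proof (cases "s (Suc m) = 0")
      case True
      then have "s(Suc m := 0) = s" by auto
      then show ?thesis using lst[OF h, of "s(Suc m := L)"] True unfolding part_def by simp
    next
      case False
      then have "s \<notin> Tab m (rs l)" unfolding Tab_def by (auto intro!: exI[of _ "Suc m"])
      then show ?thesis using F False unfolding Fsp_def part_def by simp
    qed
  qed
  have "\<Phi> \<in> Ehd N (Suc m) (indX l)"
  proof (rule EhdI)
    show "\<Phi> h s = 0" if "h \<notin> Hd N (Suc m)" for h s using that unfolding \<Phi>_def by simp
    show "\<Phi> (rt \<pi> h) (s \<circ> \<pi>) = \<Phi> h s" if "\<pi> permutes {1..Suc m}" "h \<in> Hd N (Suc m)" for \<pi> h s
      by (rule eqv[OF that])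
    fix h assume h: "h \<in> Hd N (Suc m)"
    show "\<Phi> h \<in> indX l" unfolding indX_iff
    proof (intro conjI allI impI)
      show "\<Phi> h \<in> Fsp (Suc m) ((rs l)(L := 1))" unfolding Fsp_def mem_Collect_eq
      proof (intro allI impI)
        fix s assume s: "s \<notin> Tab (Suc m) ((rs l)(L := 1))"
        show "\<Phi> h s = 0"
        proof (cases "\<exists>\<sigma>. ok s \<sigma>")
          case True
          then obtain \<sigma> where o: "ok s \<sigma>" by blast
          then have p: "\<sigma> permutes {1..Suc m}" and L: "(s \<circ> \<sigma>) (Suc m) = L" unfolding ok_def by auto
          have "s \<circ> \<sigma> \<notin> Tab (Suc m) ((rs l)(L := 1))" using s Tab_comp[OF p] by blast
          then have "(s \<circ> \<sigma>)(Suc m := 0) \<notin> Tab m (rs l)" using Tab_Suc_update[of "s \<circ> \<sigma>" m "rs l" L, OF _ L cL] by blast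
          then show ?thesis using v[OF h o] bF(1)[OF h p] unfolding val_def Fsp_def by simp
        qed (use n in blast)
      qed
      fix r assume r: "r < length l"
      have key: "mv (Suc m) r (Suc r) (\<Phi> h') s = 0" if h': "h' \<in> Hd N (Suc m)" and s: "s (Suc m) = L" for h' s
      proof -
        have e: "s = (s(Suc m := 0))(Suc m := L)" using s by auto
        have "mv (Suc m) r (Suc r) (\<Phi> h') s = mv m r (Suc r) (\<phi> (?b h')) (s(Suc m := 0))"
          using mv_part[of "s(Suc m := 0)" m r "Suc r" "\<Phi> h'" L] r Ll pt[OF h'] unfolding e[symmetric] by simp
        moreover have "\<phi> (?b h') \<in> HW m (rs l)" using bF(2)[OF h' permutes_id] unfolding sp_eq_HW by simp
        ultimately show ?thesis unfolding HW_def by simp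
      qed
      show "mv (Suc m) r (Suc r) (\<Phi> h) = (%s. 0)"
      proof
        fix s
        show "mv (Suc m) r (Suc r) (\<Phi> h) s = 0"
        proof (cases "\<exists>\<sigma>. ok s \<sigma>")
          case True
          then obtain \<sigma> where o: "ok s \<sigma>" by blast
          then have p: "\<sigma> permutes {1..Suc m}" and L: "(s \<circ> \<sigma>) (Suc m) = L" unfolding ok_def by auto
          have "\<Phi> h = (%s. \<Phi> (rt \<sigma> h) (s \<circ> \<sigma>))" using eqv[OF p h] by (simp add: fun_eq_iff)
          then have "mv (Suc m) r (Suc r) (\<Phi> h) s = mv (Suc m) r (Suc r) (\<Phi> (rt \<sigma> h)) (s \<circ> \<sigma>)"
            using mv_act[OF p, of r "Suc r" "\<Phi> (rt \<sigma> h)"] by simp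
          then show ?thesis using key[of "rt \<sigma> h" "s \<circ> \<sigma>", OF Hd_rt[OF p mN h] L] by simp
        next
          case False
          have "\<Phi> h (s(k := Suc r)) = 0" for k
          proof (rule n, rule notI)
            assume "\<exists>\<sigma>. ok (s(k := Suc r)) \<sigma>"
            then obtain \<sigma> where "ok (s(k := Suc r)) \<sigma>" by blast
            then have "ok s \<sigma>" using r Ll unfolding ok_def by (auto split: if_splits)
            then show False using False by blast
          qed
          then show ?thesis unfolding mv_def by simp
        qed
      qed
    qed
  qed
  then show ?thesis using pt by blast
qed

text \<open>A transposition carries the point of the extra row to the last position, where the
  component is known.\<close>

lemma part_determines:
  fixes \<Phi> :: "diag => (nat => nat) => 'a::field_char_0"
  assumes P: "\<Phi> \<in> Ehd N (Suc m) (indX l)" "\<Psi> \<in> Ehd N (Suc m) (indX l)"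
    and e: "\<And>h. h \<in> Hd N (Suc m) ==> part (Suc m) L (\<Phi> h) = part (Suc m) L (\<Psi> h)"
  shows "\<Phi> = \<Psi>"
proof (rule Ehd_eqI[OF P])
  fix h assume h: "h \<in> Hd N (Suc m)"
  have F: "\<Phi> h \<in> Fsp (Suc m) ((rs l)(L := 1))" "\<Psi> h \<in> Fsp (Suc m) ((rs l)(L := 1))"
    using EhdD(2)[OF P(1) h] EhdD(2)[OF P(2) h] unfolding indX_iff by auto
  show "\<Phi> h = \<Psi> h"
  proof
    fix s
    show "\<Phi> h s = \<Psi> h s"
    proof (cases "s \<in> Tab (Suc m) ((rs l)(L := 1))")
      case False
      then show ?thesis using F unfolding Fsp_def by simp
    next
      case True
      then have "cnt (Suc m) s L = 1" unfolding Tab_def by simp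
      then have "{k \<in> {1..Suc m}. s k = L} ~= {}" unfolding cnt_def by (metis card.empty zero_neq_one)
      then obtain k where k: "k \<in> {1..Suc m}" "s k = L" by blast
      let ?\<tau> = "transpose k (Suc m)"
      note t = transpose_Suc[OF k(1)]
      have u: "((s \<circ> ?\<tau>)(Suc m := 0))(Suc m := L) = s \<circ> ?\<tau>" using t(2) k(2) by auto
      have T: "\<Theta> (rt ?\<tau> h) (s \<circ> ?\<tau>) = part (Suc m) L (\<Theta> (rt ?\<tau> h)) ((s \<circ> ?\<tau>)(Suc m := 0))" for \<Theta> :: "diag => (nat => nat) => 'a"
        unfolding part_def u by simp
      have "\<Phi> (rt ?\<tau> h) (s \<circ> ?\<tau>) = \<Psi> (rt ?\<tau> h) (s \<circ> ?\<tau>)" by (simp only: T[of \<Phi>] T[of \<Psi>] e[OF Hd_rt[OF t(1) mN h]])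
      then show ?thesis using EhdD(3)[OF P(1) t(1) h] EhdD(3)[OF P(2) t(1) h] by simp
    qed
  qed
qed

lemma part_perm:
  assumes "\<rho> permutes {1..m}"
  shows "part (Suc m) r v (s \<circ> \<rho>) = part (Suc m) r (%s. v (s \<circ> \<rho>)) s"
proof -
  have e: "\<rho> (Suc m) = Suc m" using permutes_not_in[OF assms, of "Suc m"] by simp
  have "s(Suc m := r) \<circ> \<rho> = (s \<circ> \<rho>)(Suc m := r)" using update_comp_perm[OF assms, of s "Suc m" r] e by simp
  then show ?thesis unfolding part_def using e by simp
qed

text \<open>The converse of \<open>bend_extension\<close>, used for surjectivity:
  \<open>\<phi>\<close> is read off on the diagrams with a horizontal arc at the last top vertex and
  set to 0 on all others.\<close>

lemma bend_section:
  fixes \<Phi> :: "diag => (nat => nat) => 'a::field_char_0"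
  assumes P: "\<Phi> \<in> Ehd N (Suc m) (indX l)"
  shows "\<exists>\<phi> \<in> Ehd (Suc N) m (sp l). \<forall>h\<in>Hd N (Suc m). part (Suc m) L (\<Phi> h) = \<phi> (bend (Suc m) (Suc N) h)"
proof -
  let ?b = "bend (Suc m) (Suc N)" and ?u = "unbend (Suc m) (Suc N)"
  define cap where "cap d \<longleftrightarrow> d \<in> Hd (Suc N) m \<and> (\<exists>j. {Top (Suc N), Top j} \<in> d)" for d
  define \<phi> where "\<phi> d = (if cap d then part (Suc m) L (\<Phi> (?u d)) else (%s. 0))" for d
  have ub: "?u (?b h) = h" if "h \<in> Hd N (Suc m)" for h using unbend_bend[OF HdD(1)[OF that], of "Suc N" "Suc m"] by simp
  have cu: "?u d \<in> Hd N (Suc m)" "?b (?u d) = d" if "cap d" for d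
    using that Hd_unbend[OF _ _ mN] unfolding cap_def by blast+
  have V: "srep m (sp l :: ((nat => nat) => 'a) set)" unfolding ml by (rule srep_sp[OF l])
  then have fV: "fsub (sp l :: ((nat => nat) => 'a) set)" unfolding srep_def by blast
  have "\<phi> \<in> Ehd (Suc N) m (sp l)"
  proof (rule EhdI)
    show "\<phi> h s = 0" if "h \<notin> Hd (Suc N) m" for h s using that unfolding \<phi>_def cap_def by simp
    show "\<phi> h \<in> sp l" for h
      using part_indX[OF EhdD(2)[OF P cu(1)]] fsubD(1)[OF fV] unfolding \<phi>_def by simp
    fix \<rho> h s assume \<rho>: "\<rho> permutes {1..m}" and h: "h \<in> Hd (Suc N) m"
    have mN': "m <= Suc N" using mN by simp
    have c: "cap (rt \<rho> h) \<longleftrightarrow> cap h" unfolding cap_def rt_edge(2)[OF \<rho>] Hd_rt_iff[OF \<rho> mN'] by simp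
    show "\<phi> (rt \<rho> h) (s \<circ> \<rho>) = \<phi> h s"
    proof (cases "cap h")
      case True
      note h' = cu(1)[OF True]
      have "rt \<rho> h = ?b (rt \<rho> (?u h))" using bend_rt[OF \<rho>, of "Suc N" "?u h"] cu(2)[OF True] by simp
      then have "?u (rt \<rho> h) = rt \<rho> (?u h)" using ub[OF Hd_rt[OF permutes_Suc_I[OF \<rho>] mN h']] by simp
      then show ?thesis using c True part_perm[OF \<rho>, of L _ s] Ehd_rt_eq(2)[OF P permutes_Suc_I[OF \<rho>] h'] unfolding \<phi>_def by simp
    next
      case False
      then show ?thesis using c unfolding \<phi>_def by simp
    qed
  qed
  moreover have "part (Suc m) L (\<Phi> h) = \<phi> (?b h)" if "h \<in> Hd N (Suc m)" for h
    using Hd_bend[OF that mN] ub[OF that] unfolding \<phi>_def cap_def by simp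
  ultimately show ?thesis by blast
qed

end

section \<open>Submodule and quotient of the restricted module\<close>

lemma boxremD:
  assumes "boxrem \<alpha> l"
  shows "is_partition \<alpha>" "is_partition l" "sum_list l = Suc (sum_list \<alpha>)"
proof -
  show p: "is_partition \<alpha>" "is_partition l" using assms unfolding boxrem_def by auto
  show "sum_list l = Suc (sum_list \<alpha>)" using assms boxrem_iff[OF p(2)] remrow_cells(3) by blast
qed

lemma fsub_sp: "fsub (sp l :: ((nat => nat) => 'a::comm_ring_1) set)"
  unfolding spechtmod_def by (simp add: fsub_lspan)

abbreviation capfree :: "nat => (diag => (nat => nat) => 'a::zero) => bool" where
  "capfree N \<phi> \<equiv> \<forall>d j. {Top (Suc N), Top j} \<in> d --> \<phi> d = (%s. 0)"

text \<open>The quotient of the exact sequence sees the diagrams in which the last top vertex lies on a horizontal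
  arc: bending that arc down to the bottom row turns them into diagrams with one more vertical arc.\<close>

lemma cap_quotient:
  fixes x :: "'a::field_char_0"
  assumes l: "is_partition l" and ml: "m = sum_list l" and mN: "Suc m <= N"
  shows "\<exists>G. (\<forall>\<beta>\<in>{\<beta>. boxrem l \<beta>}. \<forall>\<phi>\<in>Ehd (Suc N) m (sp l). G \<beta> \<phi> \<in> Ehd N (Suc m) (sp \<beta>) \<and>
        (\<forall>\<psi>\<in>Ehd (Suc N) m (sp l). \<forall>c. G \<beta> (%h s. \<phi> h s + c * \<psi> h s) = (%h s. G \<beta> \<phi> h s + c * G \<beta> \<psi> h s)) \<and>
        (\<forall>b. G \<beta> (hact (Suc N) m x (eps N b) \<phi>) = hact N (Suc m) x b (G \<beta> \<phi>))) \<and>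
     (\<forall>y. (\<forall>\<beta>\<in>{\<beta>. boxrem l \<beta>}. y \<beta> \<in> Ehd N (Suc m) (sp \<beta>)) -->
        (\<exists>\<phi>\<in>Ehd (Suc N) m (sp l). \<forall>\<beta>\<in>{\<beta>. boxrem l \<beta>}. G \<beta> \<phi> = y \<beta>)) \<and>
     (\<forall>\<phi>\<in>Ehd (Suc N) m (sp l). (\<forall>\<beta>\<in>{\<beta>. boxrem l \<beta>}. G \<beta> \<phi> = (%h s. 0)) \<longleftrightarrow> capfree N \<phi>)"
proof -
  let ?E = "Ehd (Suc N) m (sp l :: ((nat => nat) => 'a) set)" and ?X = "Ehd N (Suc m) (indX l :: ((nat => nat) => 'a) set)"
  let ?J = "{\<beta>. boxrem l \<beta>}"
  define L where "L = Suc (length l)"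
  obtain b where b: "decomp (Suc m) (indX l :: ((nat => nat) => 'a) set) ?J sp b"
    using specht_induction[OF l] unfolding ml by blast
  have X: "srep (Suc m) (indX l :: ((nat => nat) => 'a) set)" unfolding ml by (rule srep_indX)
  then have fX: "fsub (indX l :: ((nat => nat) => 'a) set)" unfolding srep_def by blast
  \<comment> \<open>The correspondence between functions on bent diagrams and functions with induced
    coefficients. The two lemmas on extension and uniqueness turn it into a map \<open>P\<close>,
    and uniqueness also yields its linearity and compatibility with the action.\<close>
  define rel where "rel \<phi> \<Phi> \<longleftrightarrow> \<Phi> \<in> ?X \<and> (\<forall>h\<in>Hd N (Suc m). part (Suc m) L (\<Phi> h) = \<phi> (bend (Suc m) (Suc N) h))" for \<phi> \<Phi>
  define P where "P \<phi> = (SOME \<Phi>. rel \<phi> \<Phi>)" for \<phi>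
  have Pr: "rel \<phi> (P \<phi>)" if "\<phi> \<in> ?E" for \<phi>
  proof -
    have "\<exists>\<Phi>. rel \<phi> \<Phi>" using bend_extension[OF l ml L_def mN that] unfolding rel_def by blast
    then show ?thesis unfolding P_def by (rule someI_ex)
  qed
  have Pu: "P \<phi> = \<Phi>" if "\<phi> \<in> ?E" "rel \<phi> \<Phi>" for \<phi> \<Phi>
    by (rule part_determines[OF l ml L_def mN]) (use that Pr[OF that(1)] in \<open>auto simp: rel_def\<close>)
  have PX: "P \<phi> \<in> ?X" if "\<phi> \<in> ?E" for \<phi> using Pr[OF that] unfolding rel_def by blast
  have fV: "fsub (sp l :: ((nat => nat) => 'a) set)" by (rule fsub_sp)
  have El: "(%h s. \<phi> h s + c * \<psi> h s) \<in> ?E" if "\<phi> \<in> ?E" "\<psi> \<in> ?E" for \<phi> \<psi> c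
    by (rule Ehd_add[OF fV that(1) Ehd_scale[OF fV that(2)]])
  have Pl: "P (%h s. \<phi> h s + c * \<psi> h s) = (%h s. P \<phi> h s + c * P \<psi> h s)" if "\<phi> \<in> ?E" "\<psi> \<in> ?E" for \<phi> \<psi> c
  proof (rule Pu[OF El[OF that]])
    have "(%h s. P \<phi> h s + c * P \<psi> h s) \<in> ?X" by (rule Ehd_add[OF fX PX[OF that(1)] Ehd_scale[OF fX PX[OF that(2)]]])
    moreover have "part (Suc m) L (%s. P \<phi> h s + c * P \<psi> h s) = (%s. part (Suc m) L (P \<phi> h) s + c * part (Suc m) L (P \<psi> h) s)" for h
      unfolding part_def by auto
    ultimately show "rel (%h s. \<phi> h s + c * \<psi> h s) (%h s. P \<phi> h s + c * P \<psi> h s)"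
      using Pr[OF that(1)] Pr[OF that(2)] unfolding rel_def by simp
  qed
  have Ph: "P (hact (Suc N) m x (eps N a) \<phi>) = hact N (Suc m) x a (P \<phi>)" if p: "\<phi> \<in> ?E" for \<phi> a
  proof (rule Pu)
    have mN': "m <= Suc N" using mN by simp
    show "hact (Suc N) m x (eps N a) \<phi> \<in> ?E" by (rule hact_Ehd[OF fV mN' p])
    have "part (Suc m) L (hact N (Suc m) x a (P \<phi>) h) s = hact (Suc N) m x (eps N a) \<phi> (bend (Suc m) (Suc N) h) s"
      if h: "h \<in> Hd N (Suc m)" for h s
    proof -
      have "part (Suc m) L (hact N (Suc m) x a (P \<phi>) h) s = hact N (Suc m) x a (%d. part (Suc m) L (P \<phi> d)) h s"
        unfolding hact_kernel[OF h] part_def by auto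
      also have "... = hact N (Suc m) x a (%d. \<phi> (bend (Suc m) (Suc N) d)) h s"
        unfolding hact_kernel[OF h] using Pr[OF p] unfolding rel_def by simp
      finally show ?thesis unfolding hact_bend[OF h mN] .
    qed
    then show "rel (hact (Suc N) m x (eps N a) \<phi>) (hact N (Suc m) x a (P \<phi>))"
      unfolding rel_def using hact_Ehd[OF fX mN PX[OF p]] by (auto simp: fun_eq_iff)
  qed
  define G where "G \<beta> \<phi> = (%h. b \<beta> (P \<phi> h))" for \<beta> \<phi>
  have G1: "G \<beta> \<phi> \<in> Ehd N (Suc m) (sp \<beta>)" if "\<beta> \<in> ?J" "\<phi> \<in> ?E" for \<beta> \<phi>
    unfolding G_def by (rule decomp_Ehd[OF X b that(1) PX[OF that(2)] mN])
  have G2: "G \<beta> (%h s. \<phi> h s + c * \<psi> h s) = (%h s. G \<beta> \<phi> h s + c * G \<beta> \<psi> h s)" if \<beta>: "\<beta> \<in> ?J" and p: "\<phi> \<in> ?E" "\<psi> \<in> ?E" for \<beta> \<phi> \<psi> c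
  proof
    fix h
    have i: "P \<phi> h \<in> indX l" if "\<phi> \<in> ?E" for \<phi>
    proof (cases "h \<in> Hd N (Suc m)")
      case True
      then show ?thesis using EhdD(2)[OF PX[OF that]] by blast
    next
      case False
      then have "P \<phi> h = (%s. 0)" using EhdD(1)[OF PX[OF that]] by (simp add: fun_eq_iff)
      then show ?thesis using fsubD(1)[OF fX] by simp
    qed
    show "G \<beta> (%h s. \<phi> h s + c * \<psi> h s) h = (%s. G \<beta> \<phi> h s + c * G \<beta> \<psi> h s)"
      unfolding G_def Pl[OF p] by (rule decompD(1)[OF X b \<beta> i[OF p(1)] i[OF p(2)]])
  qed
  have G3: "G \<beta> (hact (Suc N) m x (eps N a) \<phi>) = hact N (Suc m) x a (G \<beta> \<phi>)" if "\<beta> \<in> ?J" "\<phi> \<in> ?E" for \<beta> \<phi> a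
    unfolding G_def Ph[OF that(2)] by (rule decomp_hact[OF X b that(1) PX[OF that(2)] mN])
  have G4: "\<exists>\<phi>\<in>?E. \<forall>\<beta>\<in>?J. G \<beta> \<phi> = y \<beta>" if y: "\<forall>\<beta>\<in>?J. y \<beta> \<in> Ehd N (Suc m) (sp \<beta>)" for y
  proof -
    obtain \<Phi> where F: "\<Phi> \<in> ?X" "\<forall>\<beta>\<in>?J. (%h. b \<beta> (\<Phi> h)) = y \<beta>"
      using decomp_Ehd_surj[OF X b bspec[OF y] mN] by blast
    obtain \<phi> where p: "\<phi> \<in> ?E" "\<forall>h\<in>Hd N (Suc m). part (Suc m) L (\<Phi> h) = \<phi> (bend (Suc m) (Suc N) h)"
      using bend_section[OF l ml L_def mN F(1)] by blast
    have "P \<phi> = \<Phi>" by (rule Pu[OF p(1)]) (use F p in \<open>simp add: rel_def\<close>)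
    then show ?thesis using p(1) F(2) unfolding G_def by blast
  qed
  have G5: "(\<forall>\<beta>\<in>?J. G \<beta> \<phi> = (%h s. 0)) \<longleftrightarrow> capfree N \<phi>" if p: "\<phi> \<in> ?E" for \<phi>
  proof
    assume z: "\<forall>\<beta>\<in>?J. G \<beta> \<phi> = (%h s. 0)"
    have "P \<phi> = (%h s. 0)"
      by (rule decomp_Ehd_inj[OF X b PX[OF p] _ fsub_sp]) (use z in \<open>auto simp: G_def fun_eq_iff\<close>)
    then have pz: "part (Suc m) L (P \<phi> h) = (%s. 0)" for h by (simp add: part_def)
    have bz: "\<phi> (bend (Suc m) (Suc N) h) = (%s. 0)" if "h \<in> Hd N (Suc m)" for h
      using Pr[OF p] that unfolding rel_def pz by simp
    show "capfree N \<phi>"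
    proof (intro allI impI)
      fix d j assume j: "{Top (Suc N), Top j} \<in> d"
      show "\<phi> d = (%s. 0)"
      proof (cases "d \<in> Hd (Suc N) m")
        case True
        then show ?thesis using bz[OF Hd_unbend(1)[OF True j mN]] Hd_unbend(2)[OF True j mN] by simp
      next
        case False
        then show ?thesis using EhdD(1)[OF p False] by (simp add: fun_eq_iff)
      qed
    qed
  next
    assume c: "capfree N \<phi>"
    have "P \<phi> = (%h s. 0)"
    proof (rule Pu[OF p])
      have "\<phi> (bend (Suc m) (Suc N) h) = (%s. 0)" if "h \<in> Hd N (Suc m)" for h
        using Hd_bend(2)[OF that mN] c by blast
      then show "rel \<phi> (%h s. 0)" unfolding rel_def using Ehd_zero[OF fX] by (simp add: part_def)
    qed
    then show "\<forall>\<beta>\<in>?J. G \<beta> \<phi> = (%h s. 0)" unfolding G_def using decomp_zero[OF X b] by simp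
  qed
  show ?thesis
  proof (intro exI[of _ G] conjI ballI allI impI)
    show "G \<beta> \<phi> \<in> Ehd N (Suc m) (sp \<beta>)" if "\<beta> \<in> ?J" "\<phi> \<in> ?E" for \<beta> \<phi> by (rule G1[OF that])
    show "G \<beta> (%h s. \<phi> h s + c * \<psi> h s) = (%h s. G \<beta> \<phi> h s + c * G \<beta> \<psi> h s)" if "\<beta> \<in> ?J" "\<phi> \<in> ?E" "\<psi> \<in> ?E" for \<beta> \<phi> \<psi> c
      by (rule G2[OF that])
    show "G \<beta> (hact (Suc N) m x (eps N a) \<phi>) = hact N (Suc m) x a (G \<beta> \<phi>)" if "\<beta> \<in> ?J" "\<phi> \<in> ?E" for \<beta> \<phi> a
      by (rule G3[OF that])
    show "\<exists>\<phi>\<in>?E. \<forall>\<beta>\<in>?J. G \<beta> \<phi> = y \<beta>" if "\<forall>\<beta>\<in>?J. y \<beta> \<in> Ehd N (Suc m) (sp \<beta>)" for y by (rule G4[OF that])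
    show "(\<forall>\<beta>\<in>?J. G \<beta> \<phi> = (%h s. 0)) \<longleftrightarrow> capfree N \<phi>" if "\<phi> \<in> ?E" for \<phi> by (rule G5[OF that])
  qed
qed

text \<open>\<open>F\<close> looks at the diagrams with a vertical arc at the last top vertex. By
  equivariance that arc may be taken to end at the last used bottom vertex; deleting it leaves
  coefficients in the Specht module restricted by one point, which \<open>specht_restriction\<close>
  decomposes.\<close>

lemma through_part:
  fixes x :: "'a::field_char_0"
  assumes l: "is_partition l" and ml: "m = sum_list l" and mN: "m <= N"
  defines "K \<equiv> {\<phi> \<in> Ehd (Suc N) m (sp l :: ((nat => nat) => 'a) set). capfree N \<phi>}"
  shows "\<exists>F. (\<forall>\<alpha>\<in>{\<alpha>. boxrem \<alpha> l}. \<forall>\<phi>\<in>K. F \<alpha> \<phi> \<in> Ehd N (sum_list \<alpha>) (sp \<alpha>) \<and>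
        (\<forall>\<psi>\<in>K. \<forall>c. F \<alpha> (%h s. \<phi> h s + c * \<psi> h s) = (%h s. F \<alpha> \<phi> h s + c * F \<alpha> \<psi> h s)) \<and>
        (\<forall>b. F \<alpha> (hact (Suc N) m x (eps N b) \<phi>) = hact N (sum_list \<alpha>) x b (F \<alpha> \<phi>))) \<and>
     (\<forall>y. (\<forall>\<alpha>\<in>{\<alpha>. boxrem \<alpha> l}. y \<alpha> \<in> Ehd N (sum_list \<alpha>) (sp \<alpha>)) -->
        (\<exists>\<phi>\<in>K. (\<forall>h\<in>Hd N m. \<phi> h = (%s. 0)) \<and> (\<forall>\<alpha>\<in>{\<alpha>. boxrem \<alpha> l}. F \<alpha> \<phi> = y \<alpha>))) \<and>
     (\<forall>\<phi>\<in>K. (\<forall>h\<in>Hd N m. \<phi> h = (%s. 0)) --> (\<forall>\<alpha>\<in>{\<alpha>. boxrem \<alpha> l}. F \<alpha> \<phi> = (%h s. 0)) --> \<phi> = (%h s. 0))"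
proof (cases m)
  case 0
  \<comment> \<open>Without vertical arcs there is no diagram to look at, and no box that could be
    removed.\<close>
  have n: "\<not> boxrem \<alpha> l" for \<alpha> using boxremD(3)[of \<alpha> l] 0 ml by auto
  have fV: "fsub (sp l :: ((nat => nat) => 'a) set)" by (rule fsub_sp)
  have z: "(%h s. 0) \<in> K" unfolding K_def using Ehd_zero[OF fV] by simp
  have "\<phi> = (%h s. 0)" if p: "\<phi> \<in> K" "\<forall>h\<in>Hd N m. \<phi> h = (%s. 0)" for \<phi>
  proof (rule Ehd_eqI[OF _ Ehd_zero[OF fV]])
    show "\<phi> \<in> Ehd (Suc N) m (sp l)" using p unfolding K_def by blast
    fix h assume h: "h \<in> Hd (Suc N) m"
    show "\<phi> h = (%s. 0)" by (rule Hd_cases[OF h mN]) (use p 0 in \<open>auto simp: K_def\<close>)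
  qed
  then show ?thesis using n z by auto
next
  case (Suc k)
  let ?I = "{\<alpha>. boxrem \<alpha> l}" and ?V = "sp l :: ((nat => nat) => 'a) set"
  have sk: "sum_list \<alpha> = k" if "\<alpha> \<in> ?I" for \<alpha> using boxremD(3)[of \<alpha> l] that Suc ml by simp
  have kN: "Suc k <= N" using mN Suc by simp
  have kN': "k <= N" using kN by simp
  obtain b where b: "decomp k ?V ?I sp b" using specht_restriction[OF l, of k] ml Suc by auto
  have V: "srep m ?V" unfolding ml by (rule srep_sp[OF l])
  then have fV: "fsub ?V" unfolding srep_def by blast
  have Vk: "srep k ?V" using V permutes_Suc_I unfolding srep_def Suc by blast
  define R where "R \<phi> h = (if h \<in> Hd N k then \<phi> (ins N (Suc k) h) else (%s. 0))" for \<phi> :: "diag => (nat => nat) => 'a" and h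
  have KE: "\<phi> \<in> Ehd (Suc N) (Suc k) ?V" "capfree N \<phi>" if "\<phi> \<in> K" for \<phi> using that Suc unfolding K_def by auto
  have RE: "R \<phi> \<in> Ehd N k ?V" if p: "\<phi> \<in> K" for \<phi>
  proof (rule EhdI)
    show "R \<phi> h s = 0" if "h \<notin> Hd N k" for h s using that unfolding R_def by simp
    show "R \<phi> h \<in> ?V" if "h \<in> Hd N k" for h using EhdD(2)[OF KE(1)[OF p] Hd_ins[OF that kN]] that unfolding R_def by simp
    fix \<rho> h s assume r: "\<rho> permutes {1..k}" and h: "h \<in> Hd N k"
    show "R \<phi> (rt \<rho> h) (s \<circ> \<rho>) = R \<phi> h s"
      using EhdD(3)[OF KE(1)[OF p] permutes_Suc_I[OF r] Hd_ins[OF h kN]] Hd_rt[OF r kN' h] h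
      unfolding R_def ins_rt[OF r] by simp
  qed
  have RV: "R \<phi> h \<in> ?V" if "\<phi> \<in> K" for \<phi> h
    using EhdD(2)[OF RE[OF that]] fsubD(1)[OF fV] by (cases "h \<in> Hd N k") (auto simp: R_def)
  define F where "F \<alpha> \<phi> = (%h. b \<alpha> (R \<phi> h))" for \<alpha> \<phi>
  have F1: "F \<alpha> \<phi> \<in> Ehd N k (sp \<alpha>)" if "\<alpha> \<in> ?I" "\<phi> \<in> K" for \<alpha> \<phi>
    unfolding F_def by (rule decomp_Ehd[OF Vk b that(1) RE[OF that(2)] kN'])
  have F2: "F \<alpha> (%h s. \<phi> h s + c * \<psi> h s) = (%h s. F \<alpha> \<phi> h s + c * F \<alpha> \<psi> h s)" if a: "\<alpha> \<in> ?I" and p: "\<phi> \<in> K" "\<psi> \<in> K" for \<alpha> \<phi> \<psi> c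
  proof
    fix h
    have "R (%h s. \<phi> h s + c * \<psi> h s) h = (%s. R \<phi> h s + c * R \<psi> h s)" unfolding R_def by auto
    then show "F \<alpha> (%h s. \<phi> h s + c * \<psi> h s) h = (%s. F \<alpha> \<phi> h s + c * F \<alpha> \<psi> h s)"
      unfolding F_def using decompD(1)[OF Vk b a RV[OF p(1)] RV[OF p(2)]] by simp
  qed
  have F3: "F \<alpha> (hact (Suc N) (Suc k) x (eps N a) \<phi>) = hact N k x a (F \<alpha> \<phi>)" if i: "\<alpha> \<in> ?I" and p: "\<phi> \<in> K" for \<alpha> \<phi> a
  proof -
    have "R (hact (Suc N) (Suc k) x (eps N a) \<phi>) h s = hact N k x a (R \<phi>) h s" for h s
    proof (cases "h \<in> Hd N k")
      case True
      have "R (hact (Suc N) (Suc k) x (eps N a) \<phi>) h s = hact N k x a (%d. \<phi> (ins N (Suc k) d)) h s"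
        unfolding R_def using True hact_ins[OF True kN, of \<phi> s x a] KE(2)[OF p] by simp
      also have "... = hact N k x a (R \<phi>) h s" unfolding hact_kernel[OF True] R_def by simp
      finally show ?thesis .
    next
      case False
      then show ?thesis unfolding R_def hact_def dact_def by simp
    qed
    then have "R (hact (Suc N) (Suc k) x (eps N a) \<phi>) = hact N k x a (R \<phi>)" by (intro ext)
    then show ?thesis unfolding F_def using decomp_hact[OF Vk b i RE[OF p] kN', of x a] by simp
  qed
  have F4: "\<exists>\<phi>\<in>K. (\<forall>h\<in>Hd N (Suc k). \<phi> h = (%s. 0)) \<and> (\<forall>\<alpha>\<in>?I. F \<alpha> \<phi> = y \<alpha>)" if y: "\<forall>\<alpha>\<in>?I. y \<alpha> \<in> Ehd N k (sp \<alpha>)" for y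
  proof -
    obtain \<chi> where X: "\<chi> \<in> Ehd N k ?V" "\<forall>\<alpha>\<in>?I. (%h. b \<alpha> (\<chi> h)) = y \<alpha>"
      using decomp_Ehd_surj[OF Vk b bspec[OF y] kN'] by blast
    obtain \<phi> where p: "\<phi> \<in> Ehd (Suc N) (Suc k) ?V" "\<forall>h\<in>Hd N k. \<phi> (ins N (Suc k) h) = \<chi> h"
      and nz: "\<forall>d s. \<phi> d s ~= 0 --> (\<exists>k. {Top (Suc N), Bot k} \<in> d)"
      using ins_extension[OF V[unfolded Suc] kN X(1)] by blast
    have z: "\<phi> d = (%s. 0)" if "\<nexists>k. {Top (Suc N), Bot k} \<in> d" for d using nz that by (auto simp: fun_eq_iff)
    have "capfree N \<phi>"
    proof (intro allI impI)
      fix d j assume j: "{Top (Suc N), Top j} \<in> d"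
      show "\<phi> d = (%s. 0)"
      proof (cases "d \<in> Hd (Suc N) (Suc k)")
        case True
        show ?thesis by (rule z) (use Dg_partner[OF HdD(1)[OF True] j] in auto)
      next
        case False
        then show ?thesis using EhdD(1)[OF p(1) False] by (simp add: fun_eq_iff)
      qed
    qed
    then have pK: "\<phi> \<in> K" using p(1) Suc unfolding K_def by simp
    have "\<phi> h = (%s. 0)" if "h \<in> Hd N (Suc k)" for h by (rule z) (use Hd_low_top[OF that] in blast)
    moreover have "R \<phi> = \<chi>" by (rule Ehd_eqI[OF RE[OF pK] X(1)]) (use p(2) in \<open>simp add: R_def\<close>)
    ultimately show ?thesis using pK X(2) unfolding F_def by blast
  qed
  have F5: "\<phi> = (%h s. 0)" if p: "\<phi> \<in> K" and low: "\<forall>h\<in>Hd N (Suc k). \<phi> h = (%s. 0)" and z: "\<forall>\<alpha>\<in>?I. F \<alpha> \<phi> = (%h s. 0)" for \<phi>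
  proof (rule Ehd_eqI[OF KE(1)[OF p] Ehd_zero[OF fV]])
    have R0: "R \<phi> = (%h s. 0)"
      by (rule decomp_Ehd_inj[OF Vk b RE[OF p] _ fsub_sp]) (use z in \<open>auto simp: F_def fun_eq_iff\<close>)
    have r: "\<phi> (ins N (Suc k) h) = (%s. 0)" if "h \<in> Hd N k" for h using fun_cong[OF R0, of h] that unfolding R_def by simp
    fix d assume d: "d \<in> Hd (Suc N) (Suc k)"
    show "\<phi> d = (%s. 0)"
    proof (rule Hd_cases[OF d kN])
      show ?thesis if "j \<in> {1..Suc k}" "{Top (Suc N), Bot j} \<in> d" for j
        by (rule ins_determines[OF kN KE(1)[OF p] r d that])
    qed (use low KE(2)[OF p] in auto)
  qed
  show ?thesis unfolding Suc
  proof (intro exI[of _ F] conjI ballI allI impI)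
    show "F \<alpha> \<phi> \<in> Ehd N (sum_list \<alpha>) (sp \<alpha>)" if "\<alpha> \<in> ?I" "\<phi> \<in> K" for \<alpha> \<phi> using F1[OF that] sk[OF that(1)] by simp
    show "F \<alpha> (%h s. \<phi> h s + c * \<psi> h s) = (%h s. F \<alpha> \<phi> h s + c * F \<alpha> \<psi> h s)" if "\<alpha> \<in> ?I" "\<phi> \<in> K" "\<psi> \<in> K" for \<alpha> \<phi> \<psi> c
      by (rule F2[OF that])
    show "F \<alpha> (hact (Suc N) (Suc k) x (eps N a) \<phi>) = hact N (sum_list \<alpha>) x a (F \<alpha> \<phi>)" if "\<alpha> \<in> ?I" "\<phi> \<in> K" for \<alpha> \<phi> a
      using F3[OF that] sk[OF that(1)] by simp
    show "\<exists>\<phi>\<in>K. (\<forall>h\<in>Hd N (Suc k). \<phi> h = (%s. 0)) \<and> (\<forall>\<alpha>\<in>?I. F \<alpha> \<phi> = y \<alpha>)"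
      if y: "\<forall>\<alpha>\<in>?I. y \<alpha> \<in> Ehd N (sum_list \<alpha>) (sp \<alpha>)" for y
      by (rule F4) (use y sk in simp)
    show "\<phi> = (%h s. 0)" if "\<phi> \<in> K" "\<forall>h\<in>Hd N (Suc k). \<phi> h = (%s. 0)" "\<forall>\<alpha>\<in>?I. F \<alpha> \<phi> = (%h s. 0)" for \<phi>
      by (rule F5[OF that])
  qed
qed

section \<open>Inverses, direct sums and transport of exact sequences\<close>

lemma is_homD:
  assumes "is_hom R M N f"
  shows "v \<in> mcarr M ==> f v \<in> mcarr N" "u \<in> mcarr M ==> v \<in> mcarr M ==> f (madd M u v) = madd N (f u) (f v)"
    "v \<in> mcarr M ==> f (msmul M c v) = msmul N c (f v)" "r \<in> R ==> v \<in> mcarr M ==> f (mact M r v) = mact N r (f v)"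
  using assms unfolding is_hom_def by blast+

lemma is_hom_comp: "is_hom R A B f ==> is_hom R B C g ==> is_hom R A C (g \<circ> f)"
  unfolding is_hom_def by simp

lemma misoD:
  assumes "miso R M N F"
  shows "is_hom R M N F" "bij_betw F (mcarr M) (mcarr N)" "F (mzero M) = mzero N" "mzero M \<in> mcarr M"
    "u \<in> mcarr M ==> v \<in> mcarr M ==> madd M u v \<in> mcarr M" "v \<in> mcarr M ==> msmul M c v \<in> mcarr M"
    "r \<in> R ==> v \<in> mcarr M ==> mact M r v \<in> mcarr M"
  using assms unfolding miso_def mclosed_def by blast+

text \<open>Closure of \<open>M\<close> is part of \<open>miso\<close> because the records have no
  axioms: the inverse is additive only if the sum of two preimages is again in the carrier.\<close>

lemma miso_inv_hom:
  assumes F: "miso R M N F"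
  shows "is_hom R N M (inv_into (mcarr M) F)"
proof -
  let ?G = "inv_into (mcarr M) F"
  note h = is_homD[OF misoD(1)[OF F]] and b = misoD(2)[OF F]
  have G: "?G v \<in> mcarr M" "F (?G v) = v" if "v \<in> mcarr N" for v
    using that b bij_betw_imp_surj_on[OF b] inv_into_into[of v F "mcarr M"] f_inv_into_f[of v F "mcarr M"] by auto
  have inv: "?G (F u) = u" if "u \<in> mcarr M" for u using inv_into_f_f[OF bij_betw_imp_inj_on[OF b] that] .
  show ?thesis unfolding is_hom_def
  proof (intro conjI ballI allI)
    fix u v assume u: "u \<in> mcarr N" and v: "v \<in> mcarr N"
    show "?G (madd N u v) = madd M (?G u) (?G v)"
      using inv[OF misoD(5)[OF F G(1)[OF u] G(1)[OF v]]] h(2)[OF G(1)[OF u] G(1)[OF v]] G(2)[OF u] G(2)[OF v] by simp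
  next
    fix c v assume v: "v \<in> mcarr N"
    show "?G (msmul N c v) = msmul M c (?G v)"
      using inv[OF misoD(6)[OF F G(1)[OF v], of c]] h(3)[OF G(1)[OF v], of c] G(2)[OF v] by simp
  next
    fix r v assume r: "r \<in> R" and v: "v \<in> mcarr N"
    show "?G (mact N r v) = mact M r (?G v)"
      using inv[OF misoD(7)[OF F r G(1)[OF v]]] h(4)[OF r G(1)[OF v]] G(2)[OF v] by simp
  qed (rule G(1))
qed

lemma dsum_miso:
  assumes F: "\<And>i. i \<in> I ==> miso R (M i) (N i) (F i)"
  shows "miso R (dsum I M) (dsum I N) (%f i. if i \<in> I then F i (f i) else undefined)"
  unfolding miso_def
proof (intro conjI)
  note m = misoD[OF F]
  show "is_hom R (dsum I M) (dsum I N) (%f i. if i \<in> I then F i (f i) else undefined)"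
    unfolding is_hom_def dsum_def using is_homD[OF m(1)] by (auto simp: fun_eq_iff)
  show "(%i. if i \<in> I then F i (mzero (dsum I M) i) else undefined) = mzero (dsum I N)"
    unfolding dsum_def using m(3) by (auto simp: fun_eq_iff)
  show "mclosed R (dsum I M)" unfolding mclosed_def dsum_def using m(4-7) by auto
  show "bij_betw (%f i. if i \<in> I then F i (f i) else undefined) (mcarr (dsum I M)) (mcarr (dsum I N))"
  proof (rule bij_betw_byWitness[where f' = "%f i. if i \<in> I then inv_into (mcarr (M i)) (F i) (f i) else undefined"])
    note b = m(2)
    show "\<forall>f\<in>mcarr (dsum I M). (%i. if i \<in> I then inv_into (mcarr (M i)) (F i) (if i \<in> I then F i (f i) else undefined) else undefined) = f"
      unfolding dsum_def using inv_into_f_f[OF bij_betw_imp_inj_on[OF b]] by (auto simp: fun_eq_iff)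
    show "\<forall>f\<in>mcarr (dsum I N). (%i. if i \<in> I then F i (if i \<in> I then inv_into (mcarr (M i)) (F i) (f i) else undefined) else undefined) = f"
      unfolding dsum_def using bij_betw_inv_into_right[OF b] by (auto simp: fun_eq_iff)
    show "(%f i. if i \<in> I then F i (f i) else undefined) ` mcarr (dsum I M) <= mcarr (dsum I N)"
      unfolding dsum_def using is_homD(1)[OF m(1)] by auto
    show "(%f i. if i \<in> I then inv_into (mcarr (M i)) (F i) (f i) else undefined) ` mcarr (dsum I N) <= mcarr (dsum I M)"
      unfolding dsum_def using is_homD(1)[OF miso_inv_hom[OF F]] by auto
  qed
qed

text \<open>Both maps are conjugated by the isomorphisms. Exactness in the middle is stated with
  \<open>mzero\<close>, so the isomorphism of \<open>C\<close> must respect zero explicitly.\<close>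

lemma short_exact_transfer:
  assumes a: "miso R A A' a" and b: "miso R B B' b" and c: "miso R C C' c" and ex: "short_exact R A' B' C' f g"
  shows "short_exact R A B C (inv_into (mcarr B) b \<circ> f \<circ> a) (inv_into (mcarr C) c \<circ> g \<circ> b)"
proof -
  let ?b = "inv_into (mcarr B) b" and ?c = "inv_into (mcarr C) c"
  have f: "is_hom R A' B' f" and g: "is_hom R B' C' g" and fi: "inj_on f (mcarr A')" and gs: "g ` mcarr B' = mcarr C'"
    and k: "f ` mcarr A' = {y \<in> mcarr B'. g y = mzero C'}" using ex unfolding short_exact_def by auto
  note ab = misoD(2)[OF a] and bb = misoD(2)[OF b] and cb = misoD(2)[OF c]
  note bi = bij_betw_inv_into[OF bb] and ci = bij_betw_inv_into[OF cb]
  have a': "a ` mcarr A = mcarr A'" and b': "b ` mcarr B = mcarr B'" "?b ` mcarr B' = mcarr B" and c': "?c ` mcarr C' = mcarr C"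
    using ab bb bi ci by (simp_all add: bij_betw_def)
  have "is_hom R A B (?b \<circ> f \<circ> a)" "is_hom R B C (?c \<circ> g \<circ> b)"
    by (intro is_hom_comp[OF misoD(1)[OF a]] is_hom_comp[OF f] is_hom_comp[OF misoD(1)[OF b]] is_hom_comp[OF g]
        miso_inv_hom[OF b] miso_inv_hom[OF c] | simp only: o_assoc[symmetric])+
  moreover have "inj_on (?b \<circ> f \<circ> a) (mcarr A)"
  proof (rule comp_inj_on)
    show "inj_on a (mcarr A)" by (rule bij_betw_imp_inj_on[OF ab])
    show "inj_on (?b \<circ> f) (a ` mcarr A)" unfolding a'
      by (rule comp_inj_on[OF fi inj_on_subset[OF bij_betw_imp_inj_on[OF bi]]]) (use k in auto)
  qed
  moreover have "(?c \<circ> g \<circ> b) ` mcarr B = mcarr C" unfolding image_comp[symmetric] b' gs c' ..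
  moreover have "(?b \<circ> f \<circ> a) ` mcarr A = {z \<in> mcarr B. (?c \<circ> g \<circ> b) z = mzero C}"
  proof -
    have z: "?c (g (b z)) = mzero C \<longleftrightarrow> g (b z) = mzero C'" if "z \<in> mcarr B" for z
    proof -
      have "g (b z) \<in> mcarr C'" using is_homD(1)[OF g is_homD(1)[OF misoD(1)[OF b] that]] .
      then have e: "c (?c (g (b z))) = g (b z)" by (rule bij_betw_inv_into_right[OF cb])
      have "?c (mzero C') = mzero C" using bij_betw_inv_into_left[OF cb misoD(4)[OF c]] misoD(3)[OF c] by simp
      then show ?thesis using e misoD(3)[OF c] by metis
    qed
    have "?b ` {y \<in> mcarr B'. g y = mzero C'} = {z \<in> mcarr B. g (b z) = mzero C'}"
      using b' bij_betw_inv_into_left[OF bb] bij_betw_inv_into_right[OF bb] by (auto 0 3 simp: image_iff)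
    then show ?thesis unfolding image_comp[symmetric] a' k using z by auto
  qed
  ultimately show ?thesis unfolding short_exact_def by blast
qed

lemma resmod_miso:
  fixes M :: "('a::comm_ring_1, diag => 'a, 'v) amod"
  assumes "miso (freesp (Dg (Suc k))) M N F"
  shows "miso (freesp (Dg k)) (resmod k M) (resmod k N) F"
proof -
  note m = misoD[OF assms] and h = is_homD[OF misoD(1)[OF assms]]
  have "is_hom (freesp (Dg k)) (resmod k M) (resmod k N) F"
    unfolding is_hom_def resmod_def using h(1-3) h(4)[OF eps_freesp] by simp
  moreover have "mclosed (freesp (Dg k)) (resmod k M)"
    unfolding mclosed_def resmod_def using m(4-6) m(7)[OF eps_freesp] by simp
  ultimately show ?thesis unfolding miso_def using m(2,3) by (simp add: resmod_def)
qed

lemma Emod_short_exact: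
  fixes x :: "'a::field_char_0"
  assumes l: "is_partition l" and ml: "m = sum_list l" and mN: "Suc m <= N"
  shows "\<exists>f g. short_exact (freesp (Dg N)) (dsum {\<alpha>. boxrem_eq \<alpha> l} (%\<alpha>. Emod N (sum_list \<alpha>) x (sp \<alpha>)))
     (resmod N (Emod (Suc N) m x (sp l))) (dsum {\<beta>. boxrem l \<beta>} (%\<beta>. Emod N (sum_list \<beta>) x (sp \<beta>))) f g"
proof -
  let ?E = "Ehd (Suc N) m (sp l :: ((nat => nat) => 'a) set)" and ?I = "{\<alpha>. boxrem \<alpha> l}" and ?J = "{\<beta>. boxrem l \<beta>}"
  let ?B = "resmod N (Emod (Suc N) m x (sp l :: ((nat => nat) => 'a) set))" and ?R = "freesp (Dg N) :: (diag => 'a) set"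
  let ?A = "dsum {\<alpha>. boxrem_eq \<alpha> l} (%\<alpha>. Emod N (sum_list \<alpha>) x (sp \<alpha> :: ((nat => nat) => 'a) set))"
  let ?C = "dsum ?J (%\<beta>. Emod N (sum_list \<beta>) x (sp \<beta> :: ((nat => nat) => 'a) set))"
  have mN': "m <= N" "m <= Suc N" using mN by auto
  have fV: "fsub (sp l :: ((nat => nat) => 'a) set)" by (rule fsub_sp)
  have sJ: "sum_list \<beta> = Suc m" if "\<beta> \<in> ?J" for \<beta> using boxremD(3)[of l \<beta>] that ml by simp
  have nl: "\<not> boxrem l l" using boxremD(3)[of l l] by auto
  obtain G where G0: "(\<forall>\<beta>\<in>?J. \<forall>\<phi>\<in>?E. G \<beta> \<phi> \<in> Ehd N (Suc m) (sp \<beta>) \<and>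
        (\<forall>\<psi>\<in>?E. \<forall>c. G \<beta> (%h s. \<phi> h s + c * \<psi> h s) = (%h s. G \<beta> \<phi> h s + c * G \<beta> \<psi> h s)) \<and>
        (\<forall>b. G \<beta> (hact (Suc N) m x (eps N b) \<phi>) = hact N (Suc m) x b (G \<beta> \<phi>))) \<and>
     (\<forall>y. (\<forall>\<beta>\<in>?J. y \<beta> \<in> Ehd N (Suc m) (sp \<beta>)) --> (\<exists>\<phi>\<in>?E. \<forall>\<beta>\<in>?J. G \<beta> \<phi> = y \<beta>)) \<and>
     (\<forall>\<phi>\<in>?E. (\<forall>\<beta>\<in>?J. G \<beta> \<phi> = (%h s. 0)) \<longleftrightarrow> capfree N \<phi>)"
    using cap_quotient[OF l ml mN, of x] by (elim exE) (rule that)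
  have G1: "G \<beta> \<phi> \<in> Ehd N (Suc m) (sp \<beta>)"
    and G2: "\<psi> \<in> ?E ==> G \<beta> (%h s. \<phi> h s + c * \<psi> h s) = (%h s. G \<beta> \<phi> h s + c * G \<beta> \<psi> h s)"
    and G3: "G \<beta> (hact (Suc N) m x (eps N b) \<phi>) = hact N (Suc m) x b (G \<beta> \<phi>)"
    if "\<beta> \<in> ?J" "\<phi> \<in> ?E" for \<beta> \<phi> \<psi> c b
    using bspec[OF bspec[OF conjunct1[OF G0] that(1)] that(2)] by simp_all
  note G4 = spec[OF conjunct1[OF conjunct2[OF G0]], THEN mp] and G5 = bspec[OF conjunct2[OF conjunct2[OF G0]]]
  define K where "K = {\<phi> \<in> ?E. capfree N \<phi>}"
  obtain F where F0: "(\<forall>\<alpha>\<in>?I. \<forall>\<phi>\<in>K. F \<alpha> \<phi> \<in> Ehd N (sum_list \<alpha>) (sp \<alpha>) \<and>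
        (\<forall>\<psi>\<in>K. \<forall>c. F \<alpha> (%h s. \<phi> h s + c * \<psi> h s) = (%h s. F \<alpha> \<phi> h s + c * F \<alpha> \<psi> h s)) \<and>
        (\<forall>b. F \<alpha> (hact (Suc N) m x (eps N b) \<phi>) = hact N (sum_list \<alpha>) x b (F \<alpha> \<phi>))) \<and>
     (\<forall>y. (\<forall>\<alpha>\<in>?I. y \<alpha> \<in> Ehd N (sum_list \<alpha>) (sp \<alpha>)) -->
        (\<exists>\<phi>\<in>K. (\<forall>h\<in>Hd N m. \<phi> h = (%s. 0)) \<and> (\<forall>\<alpha>\<in>?I. F \<alpha> \<phi> = y \<alpha>))) \<and>
     (\<forall>\<phi>\<in>K. (\<forall>h\<in>Hd N m. \<phi> h = (%s. 0)) --> (\<forall>\<alpha>\<in>?I. F \<alpha> \<phi> = (%h s. 0)) --> \<phi> = (%h s. 0))"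
    using through_part[OF l ml mN'(1), of x, folded K_def] by (elim exE) (rule that)
  have F1: "F \<alpha> \<phi> \<in> Ehd N (sum_list \<alpha>) (sp \<alpha>)"
    and F2: "\<psi> \<in> K ==> F \<alpha> (%h s. \<phi> h s + c * \<psi> h s) = (%h s. F \<alpha> \<phi> h s + c * F \<alpha> \<psi> h s)"
    and F3: "F \<alpha> (hact (Suc N) m x (eps N b) \<phi>) = hact N (sum_list \<alpha>) x b (F \<alpha> \<phi>)"
    if "\<alpha> \<in> ?I" "\<phi> \<in> K" for \<alpha> \<phi> \<psi> c b
    using bspec[OF bspec[OF conjunct1[OF F0] that(1)] that(2)] by simp_all
  note F4 = spec[OF conjunct1[OF conjunct2[OF F0]], THEN mp] and F5 = bspec[OF conjunct2[OF conjunct2[OF F0]], THEN mp, THEN mp]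
  have KE: "\<phi> \<in> ?E" "capfree N \<phi>" if "\<phi> \<in> K" for \<phi> using that unfolding K_def by auto
  have Kl: "(%h s. \<phi> h s + c * \<psi> h s) \<in> K" if "\<phi> \<in> K" "\<psi> \<in> K" for \<phi> \<psi> c
    unfolding K_def using Ehd_add[OF fV KE(1)[OF that(1)] Ehd_scale[OF fV KE(1)[OF that(2)]]] KE(2)[OF that(1)] KE(2)[OF that(2)] by simp
  have h0: "hact n k x b (%h s. 0) = (%h (s :: nat => nat). 0)" for n k and b :: "diag => 'a"
    using hact_lin[of n k x b "%h s. 0" "-1" "%h s. 0"] by simp
  \<comment> \<open>Closure under the action is read off from \<open>G\<close>: it commutes with the
    action, and \<open>K\<close> is its kernel.\<close>
  have Kh: "hact (Suc N) m x (eps N b) \<phi> \<in> K" if "\<phi> \<in> K" for \<phi> b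
  proof -
    have e: "hact (Suc N) m x (eps N b) \<phi> \<in> ?E" by (rule hact_Ehd[OF fV mN'(2) KE(1)[OF that]])
    have "\<forall>\<beta>\<in>?J. G \<beta> \<phi> = (%h s. 0)" using G5[OF KE(1)[OF that]] KE(2)[OF that] by blast
    then have "\<forall>\<beta>\<in>?J. G \<beta> (hact (Suc N) m x (eps N b) \<phi>) = (%h s. 0)"
      using G3[OF _ KE(1)[OF that]] h0 by simp
    then show ?thesis using G5[OF e] e unfolding K_def by blast
  qed
  have K0: "(%h s. 0) \<in> K" unfolding K_def using Ehd_zero[OF fV] by simp
  define low where "low \<phi> = (%h. if h \<in> Hd N m then \<phi> h else (%s. 0))" for \<phi> :: "diag => (nat => nat) => 'a"
  have low1: "low \<phi> \<in> Ehd N m (sp l)" if p: "\<phi> \<in> K" for \<phi>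
  proof (rule EhdI)
    have s: "h \<in> Hd (Suc N) m" if "h \<in> Hd N m" for h using that Hd_mono[of N "Suc N" m] by auto
    show "low \<phi> h \<in> sp l" if "h \<in> Hd N m" for h using EhdD(2)[OF KE(1)[OF p] s[OF that]] that unfolding low_def by simp
    show "low \<phi> (rt \<sigma> h) (s \<circ> \<sigma>) = low \<phi> h s" if "\<sigma> permutes {1..m}" "h \<in> Hd N m" for \<sigma> h s
      using EhdD(3)[OF KE(1)[OF p] that(1) s[OF that(2)]] Hd_rt[OF that(1) mN'(1) that(2)] that(2) unfolding low_def by simp
  qed (simp add: low_def)
  have low2: "low (%h s. \<phi> h s + c * \<psi> h s) = (%h s. low \<phi> h s + c * low \<psi> h s)" for \<phi> \<psi> c
    unfolding low_def by (auto simp: fun_eq_iff)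
  have low3: "low (hact (Suc N) m x (eps N b) \<phi>) = hact N m x b (low \<phi>)" if p: "\<phi> \<in> K" for \<phi> b
  proof (intro ext)
    fix h s
    show "low (hact (Suc N) m x (eps N b) \<phi>) h s = hact N m x b (low \<phi>) h s"
    proof (cases "h \<in> Hd N m")
      case True
      have "low (hact (Suc N) m x (eps N b) \<phi>) h s = hact N m x b \<phi> h s"
        unfolding low_def using True hact_low[OF True mN'(1), of \<phi> s x b] KE(2)[OF p] by simp
      also have "... = hact N m x b (low \<phi>) h s" unfolding hact_kernel[OF True] low_def by simp
      finally show ?thesis .
    next
      case False
      then show ?thesis unfolding low_def hact_def dact_def by simp
    qed
  qed
  \<comment> \<open>The component of \<open>l\<close> comes from the diagrams with isolated last top
    vertex, those of the smaller partitions from the diagrams with a vertical arc there.\<close>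
  define H where "H \<alpha> = (if \<alpha> = l then low else F \<alpha>)" for \<alpha>
  let ?I' = "{\<alpha>. boxrem_eq \<alpha> l}"
  have I': "\<alpha> = l \<or> \<alpha> \<in> ?I" if "\<alpha> \<in> ?I'" for \<alpha> using that unfolding boxrem_eq_def by auto
  have H1: "H \<alpha> \<phi> \<in> Ehd N (sum_list \<alpha>) (sp \<alpha>)" if "\<alpha> \<in> ?I'" "\<phi> \<in> K" for \<alpha> \<phi>
    using I'[OF that(1)] F1[OF _ that(2)] low1[OF that(2)] ml unfolding H_def by auto
  have H2: "H \<alpha> (%h s. \<phi> h s + c * \<psi> h s) = (%h s. H \<alpha> \<phi> h s + c * H \<alpha> \<psi> h s)" if "\<alpha> \<in> ?I'" "\<phi> \<in> K" "\<psi> \<in> K" for \<alpha> \<phi> \<psi> c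
    using I'[OF that(1)] F2[OF _ that(2,3)] low2 unfolding H_def by auto
  have H3: "H \<alpha> (hact (Suc N) m x (eps N b) \<phi>) = hact N (sum_list \<alpha>) x b (H \<alpha> \<phi>)" if "\<alpha> \<in> ?I'" "\<phi> \<in> K" for \<alpha> \<phi> b
    using I'[OF that(1)] F3[OF _ that(2)] low3[OF that(2)] ml unfolding H_def by auto
  have Ha: "H \<alpha> (%h s. \<phi> h s + \<psi> h s) = (%h s. H \<alpha> \<phi> h s + H \<alpha> \<psi> h s)" if "\<alpha> \<in> ?I'" "\<phi> \<in> K" "\<psi> \<in> K" for \<alpha> \<phi> \<psi>
    using H2[OF that, of 1] by simp
  have Hs: "H \<alpha> (%h s. c * \<phi> h s) = (%h s. c * H \<alpha> \<phi> h s)" if "\<alpha> \<in> ?I'" "\<phi> \<in> K" for \<alpha> \<phi> c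
    using H2[OF that that(2), of "c - 1"] by (simp add: algebra_simps)
  have H0: "H \<alpha> (%h s. 0) = (%h s. 0)" if "\<alpha> \<in> ?I'" for \<alpha> using Hs[OF that K0, of 0] by simp
  have lI: "l \<in> ?I'" unfolding boxrem_eq_def by simp
  define Hf where "Hf \<phi> = (%\<alpha>. if \<alpha> \<in> ?I' then H \<alpha> \<phi> else undefined)" for \<phi>
  have A: "mcarr ?A = {f. (\<forall>i\<in>?I'. f i \<in> Ehd N (sum_list i) (sp i)) \<and> (\<forall>i. i \<notin> ?I' --> f i = undefined)}"
    unfolding dsum_def by (simp add: Emod_def)
  have C: "mcarr ?C = {f. (\<forall>i\<in>?J. f i \<in> Ehd N (sum_list i) (sp i)) \<and> (\<forall>i. i \<notin> ?J --> f i = undefined)}"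
    unfolding dsum_def by (simp add: Emod_def)
  have B: "mcarr ?B = ?E" unfolding resmod_def Emod_def by simp
  define Km where "Km = ?B\<lparr>mcarr := K\<rparr>"
  have Km: "mcarr Km = K" "mzero Km = (%h s. 0)" "madd Km = (%f g h s. f h s + g h s)" "msmul Km = (%c f h s. c * f h s)"
      "mact Km = (%b. hact (Suc N) m x (eps N b))"
    unfolding Km_def resmod_def Emod_def by simp_all
  have M: "miso ?R Km ?A Hf"
    unfolding miso_def
  proof (intro conjI)
    show "is_hom ?R Km ?A Hf" unfolding is_hom_def
    proof (intro conjI ballI allI)
      show "Hf \<phi> \<in> mcarr ?A" if "\<phi> \<in> mcarr Km" for \<phi> using H1[of _ \<phi>] that unfolding A Hf_def Km by simp
      show "Hf (madd Km \<phi> \<psi>) = madd ?A (Hf \<phi>) (Hf \<psi>)" if "\<phi> \<in> mcarr Km" "\<psi> \<in> mcarr Km" for \<phi> \<psi>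
        using Ha[of _ \<phi> \<psi>] that unfolding Hf_def Km by (simp add: dsum_def Emod_def fun_eq_iff)
      show "Hf (msmul Km c \<phi>) = msmul ?A c (Hf \<phi>)" if "\<phi> \<in> mcarr Km" for c \<phi>
        using Hs[of _ \<phi> c] that unfolding Hf_def Km by (simp add: dsum_def Emod_def fun_eq_iff)
      show "Hf (mact Km r \<phi>) = mact ?A r (Hf \<phi>)" if "\<phi> \<in> mcarr Km" for r \<phi>
        using H3[of _ \<phi> r] that unfolding Hf_def Km by (simp add: dsum_def Emod_def fun_eq_iff)
    qed
    show "Hf (mzero Km) = mzero ?A" using H0 unfolding Hf_def Km by (simp add: dsum_def Emod_def fun_eq_iff)
    show "mclosed ?R Km" unfolding mclosed_def Km
    proof (intro conjI ballI allI)
      show "(%h s. \<phi> h s + \<psi> h s) \<in> K" if "\<phi> \<in> K" "\<psi> \<in> K" for \<phi> \<psi> using Kl[OF that, of 1] by simp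
      show "(%h s. c * \<phi> h s) \<in> K" if "\<phi> \<in> K" for c \<phi> using Kl[OF K0 that, of c] by simp
    qed (use K0 Kh in auto)
    show "bij_betw Hf (mcarr Km) (mcarr ?A)" unfolding Km
    proof (rule bij_betwI')
      fix \<phi> \<psi> assume p: "\<phi> \<in> K" "\<psi> \<in> K"
      show "Hf \<phi> = Hf \<psi> \<longleftrightarrow> \<phi> = \<psi>"
      proof
        assume e: "Hf \<phi> = Hf \<psi>"
        have "H \<alpha> \<phi> = H \<alpha> \<psi>" if "\<alpha> \<in> ?I'" for \<alpha> using fun_cong[OF e, of \<alpha>] that unfolding Hf_def by simp
        then have z: "H \<alpha> (%h s. \<phi> h s + (-1) * \<psi> h s) = (%h s. 0)" if "\<alpha> \<in> ?I'" for \<alpha>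
          using H2[OF that p, of "-1"] that by simp
        have "(%h s. \<phi> h s + (-1) * \<psi> h s) = (%h s. 0)"
        proof (rule F5[OF Kl[OF p]])
          have "low (%h s. \<phi> h s + (-1) * \<psi> h s) = (%h s. 0)" using z[OF lI] unfolding H_def by simp
          from fun_cong[OF this] show "\<forall>h\<in>Hd N m. (%s. \<phi> h s + (-1) * \<psi> h s) = (%s. 0)" unfolding low_def by meson
          show "\<forall>\<alpha>\<in>?I. F \<alpha> (%h s. \<phi> h s + (-1) * \<psi> h s) = (%h s. 0)"
          proof
            fix \<alpha> assume a: "\<alpha> \<in> ?I"
            then have "\<alpha> \<in> ?I'" "\<alpha> ~= l" using nl unfolding boxrem_eq_def by auto
            then show "F \<alpha> (%h s. \<phi> h s + (-1) * \<psi> h s) = (%h s. 0)" using z[of \<alpha>] unfolding H_def by simp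
          qed
        qed
        then show "\<phi> = \<psi>" by (simp add: fun_eq_iff)
      qed simp
    next
      fix \<phi> assume "\<phi> \<in> K"
      then show "Hf \<phi> \<in> mcarr ?A" using H1 unfolding A Hf_def by simp
    next
      fix y assume y: "y \<in> mcarr ?A"
      \<comment> \<open>The datum for \<open>l\<close> is extended by 0 to the larger size. Its
        components under \<open>F\<close> are subtracted from the remaining data before these are
        realised, so that the sum has the prescribed components.\<close>
      have yl: "y l \<in> Ehd N m (sp l)" using y lI ml unfolding A by auto
      have yz: "y l h = (%s. 0)" if "h \<notin> Hd N m" for h using EhdD(1)[OF yl that] by (simp add: fun_eq_iff)
      have "y l d = (%s. 0)" if "{Top (Suc N), Top j} \<in> d" for d j
        by (rule yz) (use Hd_low_top[of d N m "Top j"] that in blast)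
      then have "capfree N (y l)" by (intro allI impI)
      then have yK: "y l \<in> K" unfolding K_def using Ehd_mono[OF fV mN'(1) _ yl, of "Suc N"] by simp
      have "\<forall>\<alpha>\<in>?I. (%h s. y \<alpha> h s + (-1) * F \<alpha> (y l) h s) \<in> Ehd N (sum_list \<alpha>) (sp \<alpha>)"
      proof
        fix \<alpha> assume a: "\<alpha> \<in> ?I"
        then have "\<alpha> \<in> ?I'" unfolding boxrem_eq_def by simp
        then have "y \<alpha> \<in> Ehd N (sum_list \<alpha>) (sp \<alpha>)" using y unfolding A by blast
        then show "(%h s. y \<alpha> h s + (-1) * F \<alpha> (y l) h s) \<in> Ehd N (sum_list \<alpha>) (sp \<alpha>)"
          by (rule Ehd_add[OF fsub_sp _ Ehd_scale[OF fsub_sp F1[OF a yK]]])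
      qed
      from F4[OF this] obtain \<phi> where p: "\<phi> \<in> K" "\<forall>h\<in>Hd N m. \<phi> h = (%s. 0)"
        and pF: "\<forall>\<alpha>\<in>?I. F \<alpha> \<phi> = (%h s. y \<alpha> h s + (-1) * F \<alpha> (y l) h s)" by blast
      let ?\<psi> = "%h s. \<phi> h s + 1 * y l h s"
      have "Hf ?\<psi> \<alpha> = y \<alpha>" for \<alpha>
      proof (cases "\<alpha> \<in> ?I'")
        case False
        then show ?thesis using y unfolding A Hf_def by simp
      next
        case True
        show ?thesis
        proof (cases "\<alpha> = l")
          case l': True
          have "low ?\<psi> = y l" using p(2) yz unfolding low_def by (auto simp: fun_eq_iff)
          then show ?thesis using True l' unfolding Hf_def H_def by simp
        next
          case False
          then have a: "\<alpha> \<in> ?I" using I'[OF True] by simp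
          show ?thesis using True False F2[OF a p(1) yK, of 1] bspec[OF pF a] unfolding Hf_def H_def by simp
        qed
      qed
      then show "\<exists>\<phi>\<in>K. y = Hf \<phi>" using Kl[OF p(1) yK, of 1] by (intro bexI[of _ ?\<psi>]) (auto simp: fun_eq_iff)
    qed
  qed
  \<comment> \<open>The first map of the sequence is the inverse of the isomorphism from
    \<open>K\<close> to the direct sum.\<close>
  let ?f = "inv_into K Hf"
  define g where "g \<phi> = (%\<beta>. if \<beta> \<in> ?J then G \<beta> \<phi> else undefined)" for \<phi>
  have bij: "bij_betw Hf K (mcarr ?A)" using misoD(2)[OF M] unfolding Km .
  have "is_hom ?R ?A Km ?f" using miso_inv_hom[OF M] unfolding Km .
  then have hf: "is_hom ?R ?A ?B ?f" unfolding is_hom_def Km B using KE(1) by (simp add: resmod_def Emod_def)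
  have Ga: "G \<beta> (%h s. \<phi> h s + \<psi> h s) = (%h s. G \<beta> \<phi> h s + G \<beta> \<psi> h s)" if "\<beta> \<in> ?J" "\<phi> \<in> ?E" "\<psi> \<in> ?E" for \<beta> \<phi> \<psi>
    using G2[OF that, of 1] by simp
  have Gs: "G \<beta> (%h s. c * \<phi> h s) = (%h s. c * G \<beta> \<phi> h s)" if "\<beta> \<in> ?J" "\<phi> \<in> ?E" for \<beta> \<phi> c
    using G2[OF that that(2), of "c - 1"] by (simp add: algebra_simps)
  have hg: "is_hom ?R ?B ?C g" unfolding is_hom_def B
  proof (intro conjI ballI allI)
    show "g \<phi> \<in> mcarr ?C" if "\<phi> \<in> ?E" for \<phi> using G1[OF _ that] sJ unfolding C g_def by simp
    show "g (madd ?B \<phi> \<psi>) = madd ?C (g \<phi>) (g \<psi>)" if "\<phi> \<in> ?E" "\<psi> \<in> ?E" for \<phi> \<psi>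
      using Ga[OF _ that] unfolding g_def by (simp add: dsum_def resmod_def Emod_def fun_eq_iff)
    show "g (msmul ?B c \<phi>) = msmul ?C c (g \<phi>)" if "\<phi> \<in> ?E" for c \<phi>
      using Gs[OF _ that] unfolding g_def by (simp add: dsum_def resmod_def Emod_def fun_eq_iff)
    show "g (mact ?B r \<phi>) = mact ?C r (g \<phi>)" if "\<phi> \<in> ?E" for r \<phi>
      using G3[OF _ that] sJ unfolding g_def by (simp add: dsum_def resmod_def Emod_def fun_eq_iff)
  qed
  have gs: "g ` ?E = mcarr ?C"
  proof
    show "g ` ?E <= mcarr ?C" using is_homD(1)[OF hg] unfolding B by blast
    show "mcarr ?C <= g ` ?E"
    proof
      fix y assume y: "y \<in> mcarr ?C"
      then have "\<forall>\<beta>\<in>?J. y \<beta> \<in> Ehd N (Suc m) (sp \<beta>)" using sJ unfolding C by auto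
      then obtain \<phi> where p: "\<phi> \<in> ?E" "\<forall>\<beta>\<in>?J. G \<beta> \<phi> = y \<beta>" using G4[of y] by blast
      have "g \<phi> = y" using p(2) y unfolding C g_def by (auto simp: fun_eq_iff)
      then show "y \<in> g ` ?E" using p(1) by blast
    qed
  qed
  have "g \<phi> = mzero ?C \<longleftrightarrow> capfree N \<phi>" if "\<phi> \<in> ?E" for \<phi>
  proof -
    have "g \<phi> = mzero ?C \<longleftrightarrow> (\<forall>\<beta>\<in>?J. G \<beta> \<phi> = (%h s. 0))"
      unfolding g_def dsum_def by (auto simp: Emod_def fun_eq_iff)
    then show ?thesis using G5[OF that] by simp
  qed
  then have "?f ` mcarr ?A = {\<phi> \<in> ?E. g \<phi> = mzero ?C}"
    using bij_betw_inv_into[OF bij] unfolding bij_betw_def K_def by auto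
  moreover have "inj_on ?f (mcarr ?A)" using bij_betw_inv_into[OF bij] unfolding bij_betw_def by blast
  ultimately have "short_exact ?R ?A ?B ?C ?f g" unfolding short_exact_def B using hf hg gs by blast
  then show ?thesis by blast
qed

theorem theorem3p4:
  fixes x :: "'a::field_char_0" and n t :: nat and lam :: "nat list"
  assumes "x \<noteq> 0" and "1 \<le> t" and "t \<le> n"
    and "is_partition lam" and "sum_list lam = n - t"
  shows "mod_iso (freesp (Dg (n + 1)))
           (indmod n x (Mmod n x lam)) (resmod (n + 1) (Mmod (n + 2) x lam))
       \<and> (\<exists>f g. short_exact (freesp (Dg (n + 1)))
           (dsum {\<alpha>. boxrem_eq \<alpha> lam} (\<lambda>\<alpha>. Mmod (n + 1) x \<alpha>))
           (indmod n x (Mmod n x lam))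
           (dsum {\<beta>. boxrem lam \<beta>} (\<lambda>\<beta>. Mmod (n + 1) x \<beta>)) f g)"
  proof -
  let ?m = "sum_list lam" and ?V = "sp lam :: ((nat => nat) => 'a) set" and ?R = "freesp (Dg (Suc n)) :: (diag => 'a) set"
  note lam = assms(4)
  have m: "?m <= n" "?m <= Suc (Suc n)" "Suc ?m <= Suc n" using assms(5) by auto
  have V: "srep ?m ?V" by (rule srep_sp[OF lam])
  have sm: "sum_list \<alpha> <= Suc n \<and> is_partition \<alpha>" if "boxrem_eq \<alpha> lam \<or> boxrem lam \<alpha>" for \<alpha>
    using that boxremD[of \<alpha> lam] boxremD[of lam \<alpha>] lam m unfolding boxrem_eq_def by auto
  have ME: "\<exists>\<Phi>. miso ?R (Mmod (Suc n) x \<alpha>) (Emod (Suc n) (sum_list \<alpha>) x (sp \<alpha>)) \<Phi>"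
    if "boxrem_eq \<alpha> lam \<or> boxrem lam \<alpha>" for \<alpha>
    using Mmod_miso[OF assms(1) refl conjunct1[OF sm[OF that]] srep_sp[OF conjunct2[OF sm[OF that]]]] .
  obtain \<Phi> where "miso (freesp (Dg n)) (Mmod n x lam) (Emod n ?m x ?V) \<Phi>"
    using Mmod_miso[OF assms(1) refl m(1) V] by blast
  from indmod_miso[OF assms(1) m(1) V this]
  obtain \<Psi> where ind: "miso ?R (indmod n x (Mmod n x lam)) (resmod (Suc n) (Emod (Suc (Suc n)) ?m x ?V)) \<Psi>" by blast
  obtain \<Theta> where "miso (freesp (Dg (Suc (Suc n)))) (Mmod (Suc (Suc n)) x lam) (Emod (Suc (Suc n)) ?m x ?V) \<Theta>"
    using Mmod_miso[OF assms(1) refl m(2) V] by blast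
  from resmod_miso[OF this]
  have res: "miso ?R (resmod (Suc n) (Mmod (Suc (Suc n)) x lam)) (resmod (Suc n) (Emod (Suc (Suc n)) ?m x ?V)) \<Theta>" .
  \<comment> \<open>The induced and the restricted module are both isomorphic to the same restricted
    module of functions, so one isomorphism is composed with the inverse of the other.\<close>
  have "mod_iso ?R (indmod n x (Mmod n x lam)) (resmod (Suc n) (Mmod (Suc (Suc n)) x lam))"
    unfolding mod_iso_def
    using is_hom_comp[OF misoD(1)[OF ind] miso_inv_hom[OF res]]
      bij_betw_trans[OF misoD(2)[OF ind] bij_betw_inv_into[OF misoD(2)[OF res]]] by blast
  moreover have "\<exists>f g. short_exact ?R (dsum {\<alpha>. boxrem_eq \<alpha> lam} (%\<alpha>. Mmod (Suc n) x \<alpha>))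
      (indmod n x (Mmod n x lam)) (dsum {\<beta>. boxrem lam \<beta>} (%\<beta>. Mmod (Suc n) x \<beta>)) f g"
  proof -
    have "\<forall>\<alpha>\<in>{\<alpha>. boxrem_eq \<alpha> lam}. \<exists>\<Phi>. miso ?R (Mmod (Suc n) x \<alpha>) (Emod (Suc n) (sum_list \<alpha>) x (sp \<alpha>)) \<Phi>"
      using ME by blast
    from bchoice[OF this] obtain A
      where A: "\<forall>\<alpha>\<in>{\<alpha>. boxrem_eq \<alpha> lam}. miso ?R (Mmod (Suc n) x \<alpha>) (Emod (Suc n) (sum_list \<alpha>) x (sp \<alpha>)) (A \<alpha>)" by blast
    have "\<forall>\<beta>\<in>{\<beta>. boxrem lam \<beta>}. \<exists>\<Phi>. miso ?R (Mmod (Suc n) x \<beta>) (Emod (Suc n) (sum_list \<beta>) x (sp \<beta>)) \<Phi>"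
      using ME by blast
    from bchoice[OF this] obtain C
      where C: "\<forall>\<beta>\<in>{\<beta>. boxrem lam \<beta>}. miso ?R (Mmod (Suc n) x \<beta>) (Emod (Suc n) (sum_list \<beta>) x (sp \<beta>)) (C \<beta>)" by blast
    obtain f g where "short_exact ?R (dsum {\<alpha>. boxrem_eq \<alpha> lam} (%\<alpha>. Emod (Suc n) (sum_list \<alpha>) x (sp \<alpha>)))
        (resmod (Suc n) (Emod (Suc (Suc n)) ?m x ?V)) (dsum {\<beta>. boxrem lam \<beta>} (%\<beta>. Emod (Suc n) (sum_list \<beta>) x (sp \<beta>))) f g"
      using Emod_short_exact[OF lam refl m(3), of x] by blast
    from short_exact_transfer[OF dsum_miso[OF bspec[OF A]] ind dsum_miso[OF bspec[OF C]] this] show ?thesis by blast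
  qed
  ultimately show ?thesis by (simp add: One_nat_def)
qed

end
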